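(* Let $T=\mathbb{C}/(\mathbb{Z}\omega_1+\mathbb{Z}\omega_2)$ be a flat torus with Green function $G$. The mean field equation $$\triangle u+\rho e^u=\rho\,\delta_0\quad\text{on }T,\qquad \rho=8\pi,$$ has a solution if and only if $G$ has critical points other than the three half period points $\frac12\omega_1,\frac12\omega_2,\frac12(\omega_1+\omega_2)$. Moreover, each extra pair $\{z_0,-z_0\}$ of critical points of $G$ (i.e. with $z_0$ not a half period point) corresponds to a one parameter scaling family of solutions.
   Context: $\omega_1,\omega_2\in\mathbb{C}$ are linearly independent over $\mathbb{R}$. The Green function of $T$ is $G(z)=G(z,0)$, where $G(z,w)$ is the unique function on $T\times T$ with $-\triangle_z G(z,w)=\delta_w(z)-\frac1{|T|}$ and $\int_T G(z,w)\,dA=0$; it is even and smooth away from $0$, so its critical points other than the half period points come in pairs $\pm z_0$. $\delta_0$ is the Dirac measure at $0\in T$. The half period points of $T$ are the three nonzero points $p$ with $2p=0$ in $T$. A one parameter scaling family of solutions is a family of solutions of the form $$u_\lambda(z)=c_1+\log\frac{e^{2\lambda}|f'(z)|^2}{(1+e^{2\lambda}|f(z)|^2)^2},\qquad \lambda\in\mathbb{R},$$ where $f$ is a fixed non-constant meromorphic function on $\mathbb{C}$ (a developing map), $c_1$ is a constant depending only on $\rho$ (determined by $\rho e^{c_1}=8$), and every $u_\lambda$ is doubly periodic with periods $\omega_1,\omega_2$ and solves the equation on $T$. The family corresponding to an extra pair $\pm z_0$ is the one with developing map $$f(z)=\exp\left(\int_0^z\frac{\wp'(z_0)}{\wp(\xi)-\wp(z_0)}\,d\xi\right),$$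 where $\wp$ is the Weierstrass function of the lattice $\mathbb{Z}\omega_1+\mathbb{Z}\omega_2$ (replacing $z_0$ by $-z_0$ replaces $f$ by $1/f$, giving the same family). *)

theory Defs
  imports "HOL-Complex_Analysis.Complex_Analysis"
begin

section \<open>Flat tori and functions on them\<close>

text \<open>
  A function on the torus $T$ is a doubly periodic function on the plane, a point of $T$ is
  represented by any of its preimages in the plane, and integrals over $T$ are Lebesgue integrals
  over a fundamental parallelogram.
\<close>

definition lattice :: "complex \<Rightarrow> complex \<Rightarrow> complex set" where
  "lattice \<omega>\<^sub>1 \<omega>\<^sub>2 = {of_int m * \<omega>\<^sub>1 + of_int n * \<omega>\<^sub>2 | m n. True}"

definition parallelogram :: "complex \<Rightarrow> complex \<Rightarrow> complex set" where
  "parallelogram \<omega>\<^sub>1 \<omega>\<^sub>2 =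
     {of_real s * \<omega>\<^sub>1 + of_real t * \<omega>\<^sub>2 | s t. 0 \<le> s \<and> s < 1 \<and> 0 \<le> t \<and> t < 1}"

definition torus_area :: "complex \<Rightarrow> complex \<Rightarrow> real" where
  "torus_area \<omega>\<^sub>1 \<omega>\<^sub>2 = measure lborel (parallelogram \<omega>\<^sub>1 \<omega>\<^sub>2)"

definition torus_integrable :: "complex \<Rightarrow> complex \<Rightarrow> (complex \<Rightarrow> real) \<Rightarrow> bool" where
  "torus_integrable \<omega>\<^sub>1 \<omega>\<^sub>2 f \<longleftrightarrow> set_integrable lborel (parallelogram \<omega>\<^sub>1 \<omega>\<^sub>2) f"

definition torus_integral :: "complex \<Rightarrow> complex \<Rightarrow> (complex \<Rightarrow> real) \<Rightarrow> real" where
  "torus_integral \<omega>\<^sub>1 \<omega>\<^sub>2 f = set_lebesgue_integral lborel (parallelogram \<omega>\<^sub>1 \<omega>\<^sub>2) f"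

definition doubly_periodic :: "complex \<Rightarrow> complex \<Rightarrow> (complex \<Rightarrow> 'a) \<Rightarrow> bool" where
  "doubly_periodic \<omega>\<^sub>1 \<omega>\<^sub>2 f \<longleftrightarrow> (\<forall>z. f (z + \<omega>\<^sub>1) = f z \<and> f (z + \<omega>\<^sub>2) = f z)"

definition half_period_point :: "complex \<Rightarrow> complex \<Rightarrow> complex \<Rightarrow> bool" where
  "half_period_point \<omega>\<^sub>1 \<omega>\<^sub>2 z \<longleftrightarrow>
     (\<exists>p\<in>{\<omega>\<^sub>1 / 2, \<omega>\<^sub>2 / 2, (\<omega>\<^sub>1 + \<omega>\<^sub>2) / 2}. z - p \<in> lattice \<omega>\<^sub>1 \<omega>\<^sub>2)"

section \<open>Real differentiability in the plane\<close>

definition dir_deriv :: "complex \<Rightarrow> (complex \<Rightarrow> real) \<Rightarrow> complex \<Rightarrow> real" where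
  "dir_deriv v f z = frechet_derivative f (at z) v"

text \<open>Continuous differentiability to order \<open>k\<close>; meant for open sets \<open>S\<close> only.\<close>

primrec Ck_on :: "nat \<Rightarrow> (complex \<Rightarrow> real) \<Rightarrow> complex set \<Rightarrow> bool" where
  "Ck_on 0 f S \<longleftrightarrow> continuous_on S f"
| "Ck_on (Suc k) f S \<longleftrightarrow>
     (\<forall>z\<in>S. f differentiable (at z)) \<and> Ck_on k (dir_deriv 1 f) S \<and> Ck_on k (dir_deriv \<i> f) S"

definition smooth_fun_on :: "(complex \<Rightarrow> real) \<Rightarrow> complex set \<Rightarrow> bool" where
  "smooth_fun_on f S \<longleftrightarrow> (\<forall>k. Ck_on k f S)"

definition laplacian :: "(complex \<Rightarrow> real) \<Rightarrow> complex \<Rightarrow> real" where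
  "laplacian f z = dir_deriv 1 (dir_deriv 1 f) z + dir_deriv \<i> (dir_deriv \<i> f) z"

text \<open>
  The equation $\triangle u = c\,\delta_w + h$ in the sense of distributions on $T$, for
  integrable \<open>u\<close> and \<open>h\<close>. Test functions are the smooth functions on $T$.
\<close>

definition weak_laplacian ::
  "complex \<Rightarrow> complex \<Rightarrow> (complex \<Rightarrow> real) \<Rightarrow> real \<Rightarrow> complex \<Rightarrow> (complex \<Rightarrow> real) \<Rightarrow> bool" where
  "weak_laplacian \<omega>\<^sub>1 \<omega>\<^sub>2 u c w h \<longleftrightarrow>
     torus_integrable \<omega>\<^sub>1 \<omega>\<^sub>2 u \<and> torus_integrable \<omega>\<^sub>1 \<omega>\<^sub>2 h \<and>
     (\<forall>\<phi>. doubly_periodic \<omega>\<^sub>1 \<omega>\<^sub>2 \<phi> \<and> smooth_fun_on \<phi> UNIV \<longrightarrow>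
        torus_integral \<omega>\<^sub>1 \<omega>\<^sub>2 (\<lambda>z. u z * laplacian \<phi> z) =
        c * \<phi> w + torus_integral \<omega>\<^sub>1 \<omega>\<^sub>2 (\<lambda>z. h z * \<phi> z))"

section \<open>The Green function and the mean field equation\<close>

text \<open>
  $-\triangle_z \Gamma(z,w) = \delta_w - 1/|T|$ with mean zero, in the representative that is smooth
  off the diagonal of $T \times T$. The value on the diagonal, where the Green function is infinite,
  is an arbitrary real number.
\<close>

definition green_function :: "complex \<Rightarrow> complex \<Rightarrow> (complex \<Rightarrow> complex \<Rightarrow> real) \<Rightarrow> bool" where
  "green_function \<omega>\<^sub>1 \<omega>\<^sub>2 \<Gamma> \<longleftrightarrow>
     doubly_periodic \<omega>\<^sub>1 \<omega>\<^sub>2 \<Gamma> \<and>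
     (\<forall>w. doubly_periodic \<omega>\<^sub>1 \<omega>\<^sub>2 (\<Gamma> w)) \<and>
     (\<forall>w. smooth_fun_on (\<lambda>z. \<Gamma> z w) {z. z - w \<notin> lattice \<omega>\<^sub>1 \<omega>\<^sub>2}) \<and>
     (\<forall>w. weak_laplacian \<omega>\<^sub>1 \<omega>\<^sub>2 (\<lambda>z. \<Gamma> z w) (- 1) w (\<lambda>_. 1 / torus_area \<omega>\<^sub>1 \<omega>\<^sub>2)) \<and>
     (\<forall>w. torus_integral \<omega>\<^sub>1 \<omega>\<^sub>2 (\<lambda>z. \<Gamma> z w) = 0)"

definition critical_point :: "complex \<Rightarrow> complex \<Rightarrow> (complex \<Rightarrow> real) \<Rightarrow> complex \<Rightarrow> bool" where
  "critical_point \<omega>\<^sub>1 \<omega>\<^sub>2 G z \<longleftrightarrow>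
     z \<notin> lattice \<omega>\<^sub>1 \<omega>\<^sub>2 \<and> (G has_derivative (\<lambda>_. 0)) (at z)"

definition extra_critical_point ::
  "complex \<Rightarrow> complex \<Rightarrow> (complex \<Rightarrow> real) \<Rightarrow> complex \<Rightarrow> bool" where
  "extra_critical_point \<omega>\<^sub>1 \<omega>\<^sub>2 G z \<longleftrightarrow>
     critical_point \<omega>\<^sub>1 \<omega>\<^sub>2 G z \<and> \<not> half_period_point \<omega>\<^sub>1 \<omega>\<^sub>2 z"

text \<open>
  Solutions of $\triangle u + \rho e^u = \rho\,\delta_0$ on $T$: the equation holds in the sense of
  distributions on $T$, with $u$ and $e^u$ integrable, and $u$ is twice continuously differentiable
  away from $0$. The value of $u$ at lattice points, where $u$ tends to minus infinity, is irrelevant.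
\<close>

definition mean_field_solution :: "complex \<Rightarrow> complex \<Rightarrow> real \<Rightarrow> (complex \<Rightarrow> real) \<Rightarrow> bool" where
  "mean_field_solution \<omega>\<^sub>1 \<omega>\<^sub>2 \<rho> u \<longleftrightarrow>
     doubly_periodic \<omega>\<^sub>1 \<omega>\<^sub>2 u \<and>
     Ck_on 2 u (- lattice \<omega>\<^sub>1 \<omega>\<^sub>2) \<and>
     weak_laplacian \<omega>\<^sub>1 \<omega>\<^sub>2 u \<rho> 0 (\<lambda>z. - \<rho> * exp (u z))"

section \<open>Scaling families and their developing maps\<close>

text \<open>
  The formula for $u_\lambda$ is imposed outside the lattice at the points where \<open>f\<close> is analytic.
  At the remaining points outside the lattice (poles of \<open>f\<close>, or isolated points where the value of
  \<open>f\<close> is not the right one) it determines \<open>u \<lambda>\<close> by continuity.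
\<close>

definition scaling_family ::
  "complex \<Rightarrow> complex \<Rightarrow> real \<Rightarrow> (complex \<Rightarrow> complex) \<Rightarrow> (real \<Rightarrow> complex \<Rightarrow> real) \<Rightarrow> bool" where
  "scaling_family \<omega>\<^sub>1 \<omega>\<^sub>2 \<rho> f u \<longleftrightarrow>
     f meromorphic_on UNIV \<and>
     \<not> (\<exists>c. \<forall>z. f analytic_on {z} \<longrightarrow> f z = c) \<and>
     (\<exists>c\<^sub>1. \<rho> * exp c\<^sub>1 = 8 \<and>
        (\<forall>l. mean_field_solution \<omega>\<^sub>1 \<omega>\<^sub>2 \<rho> (u l) \<and>
             (\<forall>z. z \<notin> lattice \<omega>\<^sub>1 \<omega>\<^sub>2 \<and> f analytic_on {z} \<longrightarrow>
                u l z = c\<^sub>1 + ln (exp (2 * l) * (cmod (deriv f z))\<^sup>2 /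
                                   (1 + exp (2 * l) * (cmod (f z))\<^sup>2)\<^sup>2))))"

definition weierstrass_p :: "complex \<Rightarrow> complex \<Rightarrow> complex \<Rightarrow> complex" where
  "weierstrass_p \<omega>\<^sub>1 \<omega>\<^sub>2 z =
     1 / z\<^sup>2 + infsum (\<lambda>\<omega>. 1 / (z - \<omega>)\<^sup>2 - 1 / \<omega>\<^sup>2) (lattice \<omega>\<^sub>1 \<omega>\<^sub>2 - {0})"

text \<open>
  The integral from $0$ to $z$ is taken along any path avoiding the poles of the integrand, which are
  the points congruent to $z_0$ or $-z_0$. The residues there are $1$ and $-1$, so the exponential
  does not depend on the path. At lattice points the integrand has a removable singularity, and the
  value it takes there does not affect the integral. At the points congruent to $\pm z_0$ themselves
  no path is available and the value is meaningless; the meromorphic function meant here is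
  determined by the other points.
\<close>

definition developing_map :: "complex \<Rightarrow> complex \<Rightarrow> complex \<Rightarrow> complex \<Rightarrow> complex" where
  "developing_map \<omega>\<^sub>1 \<omega>\<^sub>2 z\<^sub>0 z =
     exp (contour_integral
       (SOME \<gamma>. valid_path \<gamma> \<and> pathstart \<gamma> = 0 \<and> pathfinish \<gamma> = z \<and>
          (\<forall>\<xi>\<in>path_image \<gamma>. \<xi> - z\<^sub>0 \<notin> lattice \<omega>\<^sub>1 \<omega>\<^sub>2 \<and> \<xi> + z\<^sub>0 \<notin> lattice \<omega>\<^sub>1 \<omega>\<^sub>2))
       (\<lambda>\<xi>. deriv (weierstrass_p \<omega>\<^sub>1 \<omega>\<^sub>2) z\<^sub>0 /
             (weierstrass_p \<omega>\<^sub>1 \<omega>\<^sub>2 \<xi> - weierstrass_p \<omega>\<^sub>1 \<omega>\<^sub>2 z\<^sub>0)))"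

end

(*
 The Green function satisfies G = - ln |sigma| / (2 pi) + |z|^2 / (4 |T|) + Re (c z^2) + const, so that its
 critical points a are the solutions of zeta a = pi cnj a / |T| + 4 pi c a, and zeta is compared with the
 quasi-periods eta.  If a is an extra critical point, exp (zeta a * z) sigma (z - a) and
 exp (- zeta a * z) sigma (z + a) have unimodular multipliers relative to sigma, and Liouville's formula
 applied to their quotient gives a family of doubly periodic solutions.

 Conversely let u be a solution.  A Brezis-Merle argument shows that u - 4 ln |z| is bounded near 0; on the
 cylinder Z = ln z this forces the Schwarzian u_zz - u_z^2 / 2, which is holomorphic off the lattice, to be
 - 4 wp + const.  Hence E = exp (- u / 2) solves the Lame equation y'' = (2 wp + wp a) y for some a, and
 also its conjugate.  The coefficient of E with respect to a quasi-periodic solution y and its conjugate is a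
 positive constant, so the multipliers of y are unimodular, which is the critical point equation for a.
 If a were a half period, the second, logarithmic solution would produce eta w = - wp a * w on the lattice,
 contradicting the non-holomorphic term in G.
*)

theory Submission
 imports Defs
begin

text \<open>The obstacle is the point 0, in the direction from solutions to critical points: there
  \<open>u\<close> and exp u are merely integrable. Testing the weak equation with a truncated,
  regularised logarithm gives 2 pi u = 8 pi ln |z| minus a potential, up to a bounded error. Because
  exp u has little mass near 0, a first estimate puts exp u into L^2 and a second one bounds the
  potential. This bounds V = u - 4 ln |z|, but none of its derivatives. In the coordinate ln z there
  are discs whose radius is proportional to ln (1/|z|), and averaging over them shows that z^2 times
  the Schwarzian tends to -4. A simple pole of the Schwarzian plus 4 wp is still possible at this
  stage; it is excluded because the quasi-periods eta are not complex linear on the lattice, the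
  same fact that excludes half periods at the end. Integration by parts comes from translation
  invariance of integrals, on the plane and on the torus alike.\<close>

abbreviation sint :: "complex set => (complex => 'b) => 'b::{banach,second_countable_topology}" where
 "sint \<equiv> set_lebesgue_integral lborel"

section \<open>Wirtinger derivatives\<close>

text \<open>\<open>a\<close> and \<open>b\<close> are the Wirtinger derivatives f_z and f_zbar of a
  real differentiable map. \<open>b\<close> vanishes for holomorphic functions and f_{z zbar} is a
  quarter of the Laplacian, so complex analysis and the differential equation share one
  calculus.\<close>

definition has_wirt :: "(complex => complex) => complex => complex => complex => bool" where
 "has_wirt f a b z \<longleftrightarrow> (f has_derivative (%h. a * h + b * cnj h)) (at z)"

lemma wirt_eq_rhs: "has_wirt f a b z ==> a = a' ==> b = b' ==> has_wirt f a' b' z"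
 by simp

lemma wirt_unique:
 assumes "has_wirt f a b z" "has_wirt f a' b' z"
 shows "a = a'" "b = b'"
proof -
 have "(%h. a * h + b * cnj h) = (%h. a' * h + b' * cnj h)"
  using assms has_derivative_unique unfolding has_wirt_def by blast
 from fun_cong[OF this, of 1] fun_cong[OF this, of \<i>]
 have 1: "a + b = a' + b'" and 2: "a * \<i> - b * \<i> = a' * \<i> - b' * \<i>" by auto
 from 2 have "(a - b) * \<i> = (a' - b') * \<i>" by (simp add: algebra_simps)
 then have "a - b = a' - b'" by simp
 then have "(a + b) + (a - b) = (a' + b') + (a' - b')" using 1 by simp
 then have "2 * a = 2 * a'" by (simp add: algebra_simps)
 then show "a = a'" by simp
 then show "b = b'" using 1 by simp
qed

lemma wirt_const [simp]: "has_wirt (%z. c) 0 0 z"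
 by (simp add: has_wirt_def)

lemma wirt_holo: "(f has_field_derivative d) (at z) ==> has_wirt f d 0 z"
 by (simp add: has_wirt_def has_field_derivative_def)

lemma wirt_zero_imp_DERIV: "has_wirt f a 0 z ==> (f has_field_derivative a) (at z)"
 by (simp add: has_wirt_def has_field_derivative_def)

lemma wirt_cnj: "has_wirt f a b z ==> has_wirt (%z. cnj (f z)) (cnj b) (cnj a) z"
 unfolding has_wirt_def by (drule has_derivative_cnj) (simp add: algebra_simps)

lemma wirt_add: "has_wirt f a b z ==> has_wirt g c d z ==> has_wirt (%z. f z + g z) (a + c) (b + d) z"
 unfolding has_wirt_def by (drule (1) has_derivative_add) (simp add: algebra_simps)

lemma wirt_diff: "has_wirt f a b z ==> has_wirt g c d z ==> has_wirt (%z. f z - g z) (a - c) (b - d) z"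
 unfolding has_wirt_def by (drule (1) has_derivative_diff) (simp add: algebra_simps)

lemma wirt_mult: "has_wirt f a b z ==> has_wirt g c d z ==>
  has_wirt (%z. f z * g z) (f z * c + a * g z) (f z * d + b * g z) z"
 unfolding has_wirt_def by (drule (1) has_derivative_mult) (simp add: algebra_simps)

lemma wirt_cmult: "has_wirt f a b z ==> has_wirt (%z. c * f z) (c * a) (c * b) z"
 using wirt_mult[OF wirt_const[of c z]] by fastforce

lemma wirt_comp_holo:
 assumes "has_wirt f a b z" "(g has_field_derivative d) (at (f z))"
 shows "has_wirt (%z. g (f z)) (d * a) (d * b) z"
 using has_derivative_compose[of f "%h. a * h + b * cnj h" z UNIV g "(*) d"] assms
 unfolding has_wirt_def has_field_derivative_def by (simp add: ring_distribs mult.assoc)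

lemma wirt_holo_comp:
 assumes "(g has_field_derivative d) (at z)" "has_wirt f a b (g z)"
 shows "has_wirt (%z. f (g z)) (a * d) (b * cnj d) z"
 using has_derivative_compose[of g "(*) d" z UNIV f "%h. a * h + b * cnj h"] assms
 unfolding has_wirt_def has_field_derivative_def by (simp add: mult.assoc)

lemma wirt_inverse:
 assumes "has_wirt f a b z" "f z ~= 0"
 shows "has_wirt (%z. inverse (f z)) (- a / (f z)\<^sup>2) (- b / (f z)\<^sup>2) z"
proof -
 have "(inverse has_field_derivative (- (inverse (f z) ^ Suc (Suc 0)))) (at (f z))"
  using assms(2) by (rule DERIV_inverse)
 from wirt_comp_holo[OF assms(1) this] show ?thesis
  by (rule wirt_eq_rhs) (auto simp: field_simps power2_eq_square)
qed

lemma wirt_divide: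
 assumes "has_wirt f a b z" "has_wirt g c d z" "g z ~= 0"
 shows "has_wirt (%z. f z / g z) ((a * g z - f z * c) / (g z)\<^sup>2) ((b * g z - f z * d) / (g z)\<^sup>2) z"
 unfolding divide_inverse[of "f _"]
 by (rule wirt_eq_rhs[OF wirt_mult[OF assms(1) wirt_inverse[OF assms(2,3)]]])
  (use assms(3) in \<open>auto simp: field_simps power2_eq_square\<close>)

text \<open>The derivative of a real-valued function takes real values, as one sees by
  differentiating its vanishing imaginary part; after that the chain rule for a real
  \<open>g\<close> applies.\<close>

lemma wirt_of_real_comp:
 assumes "has_wirt (%z. of_real (\<phi> z)) a b z" "(g has_real_derivative d) (at (\<phi> z))"
 shows "has_wirt (%z. of_real (g (\<phi> z))) (of_real d * a) (of_real d * b) z"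
proof -
 have "((%z. Re (of_real (\<phi> z))) has_derivative (%h. Re (a * h + b * cnj h))) (at z)"
  using assms(1) unfolding has_wirt_def by (rule has_derivative_Re)
 then have 1: "(\<phi> has_derivative (%h. Re (a * h + b * cnj h))) (at z)" by simp
 have im: "((%z. Im (of_real (\<phi> z))) has_derivative (%h. Im (a * h + b * cnj h))) (at z)"
  using assms(1) unfolding has_wirt_def by (rule has_derivative_Im)
 have "(%h. Im (a * h + b * cnj h)) = (%h. 0)"
  using im by (intro has_derivative_unique[OF im]) simp
 then have im0: "Im (a * h + b * cnj h) = 0" for h by meson
 have "((%z. g (\<phi> z)) has_derivative (%h. d * Re (a * h + b * cnj h))) (at z)"
  using has_derivative_compose[OF 1, of g "%h. d * h"] assms(2)
  by (simp add: has_field_derivative_def)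
 from has_derivative_of_real[OF this, where 'a = complex]
 have "((%z. complex_of_real (g (\<phi> z))) has_derivative (%h. of_real (d * Re (a * h + b * cnj h)))) (at z)" .
 moreover have "complex_of_real (d * Re (a * h + b * cnj h)) = of_real d * a * h + of_real d * b * cnj h" for h
 proof -
  have "complex_of_real (Re (a * h + b * cnj h)) = a * h + b * cnj h"
   using im0[of h] by (simp add: complex_eq_iff)
  then show ?thesis by (simp only: of_real_mult) (simp add: algebra_simps)
 qed
 ultimately show ?thesis unfolding has_wirt_def by simp
qed

lemma wirt_of_real_iff:
 "has_wirt (%z. of_real (\<phi> z)) a (cnj a) z \<longleftrightarrow> (\<phi> has_derivative (%h. 2 * Re (a * h))) (at z)"
proof
 assume "has_wirt (%z. of_real (\<phi> z)) a (cnj a) z"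
 then have "((%z. Re (of_real (\<phi> z))) has_derivative (%h. Re (a * h + cnj a * cnj h))) (at z)"
  unfolding has_wirt_def by (rule has_derivative_Re)
 then show "(\<phi> has_derivative (%h. 2 * Re (a * h))) (at z)" by (simp add: algebra_simps)
next
 assume "(\<phi> has_derivative (%h. 2 * Re (a * h))) (at z)"
 from has_derivative_of_real[OF this, where 'a = complex]
 have "((%z. complex_of_real (\<phi> z)) has_derivative (%h. of_real (2 * Re (a * h)))) (at z)" .
 moreover have "complex_of_real (2 * Re (a * h)) = a * h + cnj a * cnj h" for h
  by (simp add: complex_eq_iff)
 ultimately show "has_wirt (%z. of_real (\<phi> z)) a (cnj a) z" unfolding has_wirt_def by simp
qed

lemma wirt_of_real_cnj:
 assumes "has_wirt (%z. of_real (\<phi> z)) a b z" shows "b = cnj a"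
 using wirt_unique(2)[OF wirt_cnj[OF assms]] assms by simp

lemma wirt_transform:
 assumes "has_wirt f a b z" "open S" "z \<in> S" "!!w. w \<in> S ==> f w = g w"
 shows "has_wirt g a b z"
 using has_derivative_transform_within_open[of f _ z UNIV S g] assms unfolding has_wirt_def by auto

lemma wirt_imp_isCont: "has_wirt f a b z ==> isCont f z"
 unfolding has_wirt_def by (rule has_derivative_continuous)

lemma wirt_imp_continuous_on:
 "(!!z. z \<in> S ==> has_wirt f (a z) (b z) z) ==> continuous_on S f"
 by (intro continuous_at_imp_continuous_on ballI) (blast intro: wirt_imp_isCont)

lemma wirt_zero_const:
 assumes "open S" "connected S" "!!z. z \<in> S ==> has_wirt f 0 0 z" "x \<in> S" "y \<in> S"
 shows "f x = f y"
 by (rule has_derivative_zero_unique_connected[OF assms(1,2) _ assms(4,5)])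
  (use assms(3) in \<open>auto simp: has_wirt_def\<close>)

lemma wirt_cmod2: "has_wirt (%z. of_real ((cmod (z - c))\<^sup>2)) (cnj (z - c)) (z - c) z"
proof -
 have "has_wirt (%z. (z - c) * cnj (z - c)) (cnj (z - c)) (z - c) z"
  by (rule wirt_eq_rhs[OF wirt_mult[OF wirt_holo wirt_cnj[OF wirt_holo]]])
   (auto intro!: derivative_eq_intros)
 then show ?thesis by (simp only: complex_norm_square)
qed

lemma wirt_radial:
 assumes "(q has_real_derivative d) (at ((cmod (z - c))\<^sup>2))"
 shows "has_wirt (%z. of_real (q ((cmod (z - c))\<^sup>2))) (of_real d * cnj (z - c)) (of_real d * (z - c)) z"
 by (rule wirt_of_real_comp[OF wirt_cmod2 assms])

section \<open>Twice continuously differentiable functions in Wirtinger form\<close>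

lemma Ck_2_iff: "Ck_on 2 f S \<longleftrightarrow>
 (\<forall>z\<in>S. f differentiable (at z)) \<and> (\<forall>v\<in>{1,\<i>}. (\<forall>z\<in>S. dir_deriv v f differentiable (at z)) \<and>
   (\<forall>w\<in>{1,\<i>}. continuous_on S (dir_deriv w (dir_deriv v f))))"
 by (auto simp: numeral_2_eq_2)

lemma dir_deriv_eq: "(f has_derivative D) (at z) ==> dir_deriv v f z = D v"
 unfolding dir_deriv_def using frechet_derivative_at by metis

text \<open>\<open>a\<close> is the z-derivative of \<open>\<phi>\<close> and \<open>\<beta>\<close>
  the zbar-derivative of \<open>a\<close>. Nothing says that \<open>\<beta>\<close> is real, hence
  the real part in the Laplacian.\<close>

lemma Ck2_laplacian_I:
 assumes S: "open S"
  and 1: "!!z. z \<in> S ==> has_wirt (%z. of_real (\<phi> z)) (a z) (cnj (a z)) z"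
  and 2: "!!z. z \<in> S ==> has_wirt a (\<alpha> z) (\<beta> z) z"
  and c: "continuous_on S \<alpha>" "continuous_on S \<beta>"
 shows "Ck_on 2 \<phi> S" "!!z. z \<in> S ==> laplacian \<phi> z = 4 * Re (\<beta> z)"
  "!!z v. z \<in> S ==> dir_deriv v \<phi> z = 2 * Re (v * a z)"
  "!!z v. z \<in> S ==> (dir_deriv v \<phi> has_derivative (%h. 2 * Re (v * (\<alpha> z * h + \<beta> z * cnj h)))) (at z)"
proof -
 have d1: "(\<phi> has_derivative (%h. 2 * Re (a z * h))) (at z)" if "z \<in> S" for z
  using 1[OF that] wirt_of_real_iff by blast
 show e1: "dir_deriv v \<phi> z = 2 * Re (v * a z)" if "z \<in> S" for z v
  using dir_deriv_eq[OF d1[OF that]] by (simp add: algebra_simps)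
 show d2: "(dir_deriv v \<phi> has_derivative (%h. 2 * Re (v * (\<alpha> z * h + \<beta> z * cnj h)))) (at z)" if "z \<in> S" for z v
 proof -
  have "((%z. 2 * Re (v * a z)) has_derivative (%h. 2 * Re (v * (\<alpha> z * h + \<beta> z * cnj h)))) (at z)"
   using 2[OF that] unfolding has_wirt_def by (intro derivative_intros)
  then show ?thesis
   by (rule has_derivative_transform_within_open[OF _ S that]) (simp add: e1)
 qed
 have e2: "dir_deriv w (dir_deriv v \<phi>) z = 2 * Re (v * (\<alpha> z * w + \<beta> z * cnj w))" if "z \<in> S" for z v w
  using dir_deriv_eq[OF d2[OF that]] by simp
 have "continuous_on S (%z. dir_deriv w (dir_deriv v \<phi>) z)" for v w
  by (subst continuous_on_cong[OF refl e2]) (auto intro!: continuous_intros c)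
 then show "Ck_on 2 \<phi> S" unfolding Ck_2_iff
  using d1 d2 unfolding differentiable_def by blast
 show "laplacian \<phi> z = 4 * Re (\<beta> z)" if "z \<in> S" for z
  unfolding laplacian_def using e2[OF that] by simp
qed

lemma Ck2_wirt:
 assumes S: "open S" and C: "Ck_on 2 \<phi> S"
 obtains a \<alpha> \<beta> where "!!z. z \<in> S ==> has_wirt (%z. of_real (\<phi> z)) (a z) (cnj (a z)) z"
  "!!z. z \<in> S ==> has_wirt a (\<alpha> z) (\<beta> z) z" "continuous_on S \<alpha>" "continuous_on S \<beta>"
  "!!z. z \<in> S ==> laplacian \<phi> z = 4 * Re (\<beta> z)"
  "!!z. z \<in> S ==> a z = (of_real (dir_deriv 1 \<phi> z) - \<i> * of_real (dir_deriv \<i> \<phi> z)) / 2"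
proof -
 define p where "p = dir_deriv 1 \<phi>"
 define q where "q = dir_deriv \<i> \<phi>"
 define a where "a z = (of_real (p z) - \<i> * of_real (q z)) / 2" for z
 note C' = C[unfolded Ck_2_iff]
 have lin: "D h = Re h * D 1 + Im h * D \<i>" if "bounded_linear D" for D :: "complex => real" and h
 proof -
  interpret bounded_linear D by fact
  have "h = Re h *\<^sub>R 1 + Im h *\<^sub>R \<i>" by (simp add: complex_eq_iff)
  then have "D h = D (Re h *\<^sub>R 1 + Im h *\<^sub>R \<i>)" by simp
  also have "\<dots> = Re h * D 1 + Im h * D \<i>" by (simp add: add scaleR)
  finally show ?thesis .
 qed
 have der: "(f has_derivative (%h. Re h * dir_deriv 1 f z + Im h * dir_deriv \<i> f z)) (at z)"
  if "f differentiable (at z)" for f :: "complex => real" and z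
 proof -
  from that have *: "(f has_derivative frechet_derivative f (at z)) (at z)"
   by (simp add: frechet_derivative_works)
  have "frechet_derivative f (at z) = (%h. Re h * dir_deriv 1 f z + Im h * dir_deriv \<i> f z)"
   unfolding dir_deriv_def using lin[OF has_derivative_bounded_linear[OF *]] by (intro ext)
  with * show ?thesis by simp
 qed
 \<comment> \<open>The coefficients of h and cnj h in the derivative of (p - i q) / 2, after Re h
   and Im h are written through h and cnj h.\<close>
 define \<alpha> where "\<alpha> z = (of_real (dir_deriv 1 p z) - \<i> * of_real (dir_deriv \<i> p z)
   - \<i> * of_real (dir_deriv 1 q z) - of_real (dir_deriv \<i> q z)) / 4" for z
 define \<beta> where "\<beta> z = (of_real (dir_deriv 1 p z) + \<i> * of_real (dir_deriv \<i> p z)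
   - \<i> * of_real (dir_deriv 1 q z) + of_real (dir_deriv \<i> q z)) / 4" for z
 show thesis
 proof
  fix z assume z: "z \<in> S"
  have "(\<phi> has_derivative (%h. Re h * p z + Im h * q z)) (at z)"
   unfolding p_def q_def using C' z by (intro der) auto
  moreover have "(%h. Re h * p z + Im h * q z) = (%h. 2 * Re (a z * h))"
   by (auto simp: a_def algebra_simps)
  ultimately show "has_wirt (%z. of_real (\<phi> z)) (a z) (cnj (a z)) z"
   using wirt_of_real_iff by simp
  have p: "(p has_derivative (%h. Re h * dir_deriv 1 p z + Im h * dir_deriv \<i> p z)) (at z)"
   and q: "(q has_derivative (%h. Re h * dir_deriv 1 q z + Im h * dir_deriv \<i> q z)) (at z)"
   unfolding p_def q_def using C' z by (intro der; auto)+
  have "(a has_derivative (%h. (of_real (Re h * dir_deriv 1 p z + Im h * dir_deriv \<i> p z)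
   - \<i> * of_real (Re h * dir_deriv 1 q z + Im h * dir_deriv \<i> q z)) / 2)) (at z)"
   unfolding a_def
   unfolding divide_inverse
   by (intro has_derivative_mult_left has_derivative_diff has_derivative_mult_right has_derivative_of_real p q)
  moreover have "(%h. (of_real (Re h * dir_deriv 1 p z + Im h * dir_deriv \<i> p z)
   - \<i> * of_real (Re h * dir_deriv 1 q z + Im h * dir_deriv \<i> q z)) / 2) = (%h. \<alpha> z * h + \<beta> z * cnj h)"
   by (rule ext) (auto simp: \<alpha>_def \<beta>_def complex_eq_iff field_simps)
  ultimately show "has_wirt a (\<alpha> z) (\<beta> z) z" unfolding has_wirt_def by simp
  show "laplacian \<phi> z = 4 * Re (\<beta> z)" by (simp add: laplacian_def \<beta>_def p_def q_def)
  show "a z = (of_real (dir_deriv 1 \<phi> z) - \<i> * of_real (dir_deriv \<i> \<phi> z)) / 2" by (simp add: a_def p_def q_def)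
 next
  show "continuous_on S \<alpha>" "continuous_on S \<beta>"
   unfolding \<alpha>_def \<beta>_def p_def q_def using C' by (auto intro!: continuous_intros)
 qed
qed

text \<open>The integral of a derivative vanishes as soon as the integral is invariant under translations:
 the difference quotients have integral zero.\<close>

lemma stokes_abstract:
 fixes \<Psi> :: "complex => complex" and wt :: "complex => real"
 assumes W: "!!z. has_wirt \<Psi> (a z) (b z) z"
  and int: "!!h. integrable lborel (%z. wt z *\<^sub>R \<Psi> (z + h))"
  and inv: "!!h. (LINT z|lborel. wt z *\<^sub>R \<Psi> (z + h)) = (LINT z|lborel. wt z *\<^sub>R \<Psi> z)"
  and g: "integrable lborel g"
  and dom: "!!z t. 0 < t ==> t <= 1 ==> norm (wt z *\<^sub>R (\<Psi> (z + of_real t * v) - \<Psi> z)) <= t * g z"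
  and meas: "(%z. wt z *\<^sub>R (a z * v + b z * cnj v)) \<in> borel_measurable lborel"
 shows "(LINT z|lborel. wt z *\<^sub>R (a z * v + b z * cnj v)) = 0"
proof -
 define t where "t n = 1 / real (Suc n)" for n
 have t: "0 < t n" "t n <= 1" for n by (auto simp: t_def)
 have t0: "t \<longlonglongrightarrow> 0" unfolding t_def using LIMSEQ_inverse_real_of_nat by (simp add: inverse_eq_divide)
 define s where "s n z = wt z *\<^sub>R ((\<Psi> (z + of_real (t n) * v) - \<Psi> z) /\<^sub>R t n)" for n z
 have s_alt: "s n z = (wt z *\<^sub>R \<Psi> (z + of_real (t n) * v) - wt z *\<^sub>R \<Psi> (z + 0)) /\<^sub>R t n" for n z
  by (simp add: s_def algebra_simps)
 have i: "integrable lborel (s n)" for n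
  unfolding s_alt[abs_def] by (intro integrable_scaleR_right Bochner_Integration.integrable_diff int)
 have z: "integral\<^sup>L lborel (s n) = 0" for n
  unfolding s_alt[abs_def] using int
  by (simp only: Bochner_Integration.integral_diff Bochner_Integration.integral_scaleR_right inv) simp
 have lim: "(%n. s n z) \<longlonglongrightarrow> wt z *\<^sub>R (a z * v + b z * cnj v)" for z
 proof -
  have "((%x. z + of_real x * v) has_vector_derivative v) (at 0)"
   by (auto intro!: derivative_eq_intros simp: has_vector_derivative_def scaleR_conv_of_real)
  then have 1: "((%x. z + of_real x * v) has_derivative (%x. x *\<^sub>R v)) (at 0)"
   by (simp add: has_vector_derivative_def)
  have 2: "(\<Psi> has_derivative (%h. a z * h + b z * cnj h)) (at (z + of_real 0 * v))"
   using W[of z] by (simp add: has_wirt_def)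
  define F where "F x = \<Psi> (z + of_real x * v)" for x :: real
  define D where "D = a z * v + b z * cnj v"
  have "(F has_derivative (%x. a z * (x *\<^sub>R v) + b z * cnj (x *\<^sub>R v))) (at 0)"
   unfolding F_def by (rule has_derivative_compose[OF 1 2])
  moreover have "(%x. a z * (x *\<^sub>R v) + b z * cnj (x *\<^sub>R v)) = (%x. x *\<^sub>R D)"
   by (auto simp: D_def scaleR_conv_of_real algebra_simps)
  ultimately have "(F has_derivative (%x. x *\<^sub>R D)) (at 0)" by metis
  then have "(%h. norm (F (0 + h) - F 0 - h *\<^sub>R D) / norm h) \<midarrow>0\<rightarrow> 0"
   unfolding has_derivative_at by blast
  moreover have "norm (F (0 + h) - F 0 - h *\<^sub>R D) / norm h = norm ((F h - F 0) /\<^sub>R h - D)" if "h ~= 0" for h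
  proof -
   have "F h - F 0 - h *\<^sub>R D = h *\<^sub>R ((F h - F 0) /\<^sub>R h - D)"
    using that by (simp add: scaleR_diff_right)
   then show ?thesis using that by simp
  qed
  ultimately have "(%h. norm ((F h - F 0) /\<^sub>R h - D)) \<midarrow>0\<rightarrow> 0"
   by (auto intro: Lim_transform_eventually simp: eventually_at_filter)
  then have "((%x::real. (\<Psi> (z + of_real x * v) - \<Psi> z) /\<^sub>R x) \<longlongrightarrow> a z * v + b z * cnj v) (at 0)"
  proof -
   assume "(%h. norm ((F h - F 0) /\<^sub>R h - D)) \<midarrow>0\<rightarrow> 0"
   then have "(%h. (F h - F 0) /\<^sub>R h - D) \<midarrow>0\<rightarrow> 0" by (rule tendsto_norm_zero_cancel)
   then have "(%h. (F h - F 0) /\<^sub>R h) \<midarrow>0\<rightarrow> D" by (rule LIM_zero_cancel)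
   then show ?thesis by (simp add: F_def D_def)
  qed
  have "filterlim t (at 0) sequentially"
   unfolding filterlim_at using t0 t(1) by (auto simp: less_imp_neq[symmetric] intro!: always_eventually)
  then have "(%n. (\<Psi> (z + of_real (t n) * v) - \<Psi> z) /\<^sub>R t n) \<longlonglongrightarrow> a z * v + b z * cnj v"
   by (rule filterlim_compose[OF \<open>((%x::real. (\<Psi> (z + of_real x * v) - \<Psi> z) /\<^sub>R x) \<longlongrightarrow> a z * v + b z * cnj v) (at 0)\<close>])
  then show ?thesis unfolding s_def by (intro tendsto_intros)
 qed
 have "(%n. integral\<^sup>L lborel (s n)) \<longlonglongrightarrow> (LINT z|lborel. wt z *\<^sub>R (a z * v + b z * cnj v))"
 proof (rule integral_dominated_convergence[where w = g])
  show "AE x in lborel. norm (s n x) <= g x" for n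
  proof (rule AE_I2)
   fix x
   have "norm (s n x) = norm (wt x *\<^sub>R (\<Psi> (x + of_real (t n) * v) - \<Psi> x)) / t n"
    using t(1)[of n] by (simp add: s_def divide_inverse abs_mult)
   also have "\<dots> <= t n * g x / t n"
    using dom[OF t[of n]] t(1)[of n] by (intro divide_right_mono) auto
   finally show "norm (s n x) <= g x" using t(1)[of n] by simp
  qed
 qed (use i meas lim g in \<open>auto\<close>)
 then show ?thesis using z by (simp add: LIMSEQ_const_iff)
qed

lemma wirt_lipschitz:
 assumes W: "!!z. has_wirt f (a z) (b z) z" and B: "!!z. cmod (a z) <= K" "!!z. cmod (b z) <= K"
 shows "cmod (f x - f y) <= 2 * K * cmod (x - y)"
proof (rule differentiable_bound[of UNIV f "%z h. a z * h + b z * cnj h"])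
 show "onorm (%h. a x * h + b x * cnj h) <= 2 * K" for x
 proof (rule onorm_le)
  fix h
  have "cmod (a x * h + b x * cnj h) <= cmod (a x) * cmod h + cmod (b x) * cmod h"
   by (metis norm_triangle_ineq norm_mult complex_mod_cnj)
  also have "\<dots> <= K * cmod h + K * cmod h" by (intro add_mono mult_right_mono B) auto
  finally show "cmod (a x * h + b x * cnj h) <= 2 * K * cmod h" by simp
 qed
qed (use W in \<open>auto simp: has_wirt_def\<close>)

text \<open>\<open>stokes_abstract\<close> works in one direction at a time; the directions 1 and i
  separate the two Wirtinger parts.\<close>

lemma zero_from_two: "a * 1 + b * cnj 1 = 0 ==> a * \<i> + b * cnj \<i> = 0 ==> a = 0 \<and> b = (0::complex)"
proof -
 assume 1: "a * 1 + b * cnj 1 = 0" and 2: "a * \<i> + b * cnj \<i> = 0"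
 from 2 have "(a - b) * \<i> = 0" by (simp add: algebra_simps)
 then have "a = b" by simp
 with 1 show ?thesis by simp
qed

lemma integrable_compact_support:
 fixes f :: "complex => 'b::euclidean_space"
 assumes "continuous_on (cball c r) f" "!!z. z \<notin> cball c r ==> f z = 0"
 shows "integrable lborel f"
proof -
 have "integrable lborel (%x. indicator (cball c r) x *\<^sub>R f x)"
  by (rule borel_integrable_compact) (use assms in auto)
 also have "(%x. indicator (cball c r) x *\<^sub>R f x) = f"
  using assms(2) by (auto simp: indicator_def fun_eq_iff)
 finally show ?thesis .
qed

lemma lborel_translate:
 fixes f :: "complex => 'b::euclidean_space"
 shows "integrable lborel f ==> integrable lborel (%z. f (z + h))"
  and "f \<in> borel_measurable borel ==> (LINT z|lborel. f (z + h)) = (LINT z|lborel. f z)"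
proof -
 have L: "lborel = distr lborel borel (%z. z + h)"
 proof -
  have "(+) h = (%z. z + h)" by (auto simp: add.commute)
  then show ?thesis using lborel_distr_plus[of h] by simp
 qed
 show "integrable lborel (%z. f (z + h))" if "integrable lborel f"
  using that integrable_distr[of "%z. z + h" lborel borel f] L by simp
 show "(LINT z|lborel. f (z + h)) = (LINT z|lborel. f z)" if "f \<in> borel_measurable borel"
  by (subst (2) L, subst integral_distr) (use that in auto)
qed

lemma stokes_compact:
 fixes \<Psi> :: "complex => complex"
 assumes W: "!!z. has_wirt \<Psi> (a z) (b z) z"
  and c: "continuous_on UNIV a" "continuous_on UNIV b"
  and supp: "!!z. z \<notin> cball c r ==> \<Psi> z = 0"
 shows "(LINT z|lborel. a z) = 0" "(LINT z|lborel. b z) = 0" "integrable lborel a" "integrable lborel b"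
proof -
 have z: "a z = 0 \<and> b z = 0" if "z \<notin> cball c r" for z
 proof -
  have "has_wirt (%z. 0) (a z) (b z) z"
   by (rule wirt_transform[OF W, of "- cball c r"]) (use that supp in auto)
  from wirt_unique[OF this wirt_const] show ?thesis by simp
 qed
 have ca: "continuous_on A a" "continuous_on A b" for A
  using c continuous_on_subset by blast+
 show ia: "integrable lborel a" and ib: "integrable lborel b"
  using integrable_compact_support[OF ca(1)[of "cball c r"]] integrable_compact_support[OF ca(2)[of "cball c r"]] z
  by auto
 obtain K1 where K1: "!!z. z \<in> cball c r ==> cmod (a z) <= K1"
  using compact_imp_bounded[OF compact_continuous_image[OF ca(1) compact_cball[of c r]]]
  unfolding bounded_iff by blast
 obtain K2 where K2: "!!z. z \<in> cball c r ==> cmod (b z) <= K2"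
  using compact_imp_bounded[OF compact_continuous_image[OF ca(2) compact_cball[of c r]]]
  unfolding bounded_iff by blast
 define K where "K = max 0 (max K1 K2)"
 have K: "cmod (a z) <= K" "cmod (b z) <= K" for z
 proof -
  have "cmod (a z) <= K \<and> cmod (b z) <= K"
  proof (cases "z \<in> cball c r")
   case True
   from K1[OF True] K2[OF True] show ?thesis unfolding K_def by linarith
  next
   case False
   with z show ?thesis by (simp add: K_def)
  qed
  then show "cmod (a z) <= K" "cmod (b z) <= K" by auto
 qed
 have c\<Psi>: "continuous_on A \<Psi>" for A using wirt_imp_continuous_on W by blast
 have i\<Psi>: "integrable lborel \<Psi>" by (rule integrable_compact_support[OF c\<Psi> supp])
 have m: "\<Psi> \<in> borel_measurable borel" "a \<in> borel_measurable borel" "b \<in> borel_measurable borel"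
  using c c\<Psi> by (auto intro: borel_measurable_continuous_onI)
 have main: "(LINT z|lborel. 1 *\<^sub>R (a z * v + b z * cnj v)) = 0" if v: "cmod v = 1" for v
 \<comment> \<open>A shift by at most 1 keeps the support inside the ball of radius r + 1; the
   Lipschitz bound on this ball dominates the difference quotients.\<close>
 proof (rule stokes_abstract[where wt = "%_. 1" and \<Psi> = \<Psi> and a = a and b = b and g = "%z. 2 * K * indicator (cball c (r + 1)) z"])
  show "integrable lborel (%z. 2 * K * indicator (cball c (r + 1)) z)"
   using borel_integrable_compact[of "cball c (r+1)" "%_. 2 * K"] by (simp add: mult.commute)
  show "norm (1 *\<^sub>R (\<Psi> (z + of_real t * v) - \<Psi> z)) <= t * (2 * K * indicator (cball c (r + 1)) z)"
   if t: "0 < t" "t <= 1" for z t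
  proof (cases "z \<in> cball c (r + 1)")
   case True
   have "norm (\<Psi> (z + of_real t * v) - \<Psi> z) <= 2 * K * cmod (z + of_real t * v - z)"
    by (rule wirt_lipschitz[OF W K])
   with True t v show ?thesis by (simp add: norm_mult mult_ac)
  next
   case False
   have "z \<notin> cball c r" using False by (auto simp: dist_norm)
   moreover have "z + of_real t * v \<notin> cball c r"
   proof
    assume "z + of_real t * v \<in> cball c r"
    then have "cmod (c - z - of_real t * v) <= r" by (simp add: dist_norm algebra_simps)
    moreover have "cmod (c - z) <= cmod (c - z - of_real t * v) + cmod (of_real t * v)"
     by (metis add.commute diff_add_cancel norm_triangle_ineq)
    ultimately show False using False t v by (simp add: dist_norm norm_mult)
   qed
   ultimately show ?thesis using supp False by simp
  qed
  show "(%z. 1 *\<^sub>R (a z * v + b z * cnj v)) \<in> borel_measurable lborel"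
   using m by simp
  show "integrable lborel (%z. 1 *\<^sub>R \<Psi> (z + h))" for h
   using lborel_translate(1)[OF i\<Psi>] by simp
  show "(LINT z|lborel. 1 *\<^sub>R \<Psi> (z + h)) = (LINT z|lborel. 1 *\<^sub>R \<Psi> z)" for h
   using lborel_translate(2)[OF m(1)] by simp
 qed (rule W)
 have *: "(LINT z|lborel. a z) * v + (LINT z|lborel. b z) * cnj v = 0" if "cmod v = 1" for v
 proof -
  have "(LINT z|lborel. a z * v + b z * cnj v) = (LINT z|lborel. a z * v) + (LINT z|lborel. b z * cnj v)"
   by (intro Bochner_Integration.integral_add integrable_mult_left ia ib)
  then show ?thesis using main[OF that] by simp
 qed
 have "(LINT z|lborel. a z) = 0 \<and> (LINT z|lborel. b z) = 0"
  by (rule zero_from_two; rule *) simp_all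
 then
 show "(LINT z|lborel. a z) = 0" "(LINT z|lborel. b z) = 0" by auto
qed

text \<open>The form p dz + q dzbar is closed, since \<open>p2\<close> is both p_zbar and q_z. The
  primitive is its integral along the segment from the centre.\<close>

lemma poincare_wirt:
 assumes p: "!!z. z \<in> ball c r ==> has_wirt p (p1 z) (p2 z) z"
  and q: "!!z. z \<in> ball c r ==> has_wirt q (p2 z) (q2 z) z"
  and cont: "continuous_on (ball c r) p1" "continuous_on (ball c r) p2" "continuous_on (ball c r) q2"
 obtains \<nu> where "!!z. z \<in> ball c r ==> has_wirt \<nu> (p z) (q z) z"
proof -
 define \<zeta> where "\<zeta> x t = c + of_real t * (x - c)" for x :: complex and t :: real
 have \<zeta>_in: "\<zeta> x t \<in> ball c r" if "x \<in> ball c r" "t \<in> cbox 0 1" for x t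
 proof -
  have "norm (of_real t * (x - c)) <= 1 * norm (x - c)"
   unfolding norm_mult using that(2) by (intro mult_right_mono) auto
  then show ?thesis using that(1) by (simp add: \<zeta>_def dist_norm norm_minus_commute)
 qed
 have cp: "continuous_on (ball c r) p" "continuous_on (ball c r) q"
  using wirt_imp_continuous_on p q by blast+
 define f where "f x t = p (\<zeta> x t) * (x - c) + q (\<zeta> x t) * cnj (x - c)" for x t
 define A where "A x t = p (\<zeta> x t) + of_real t * (p1 (\<zeta> x t) * (x - c) + p2 (\<zeta> x t) * cnj (x - c))" for x t
 define B where "B x t = q (\<zeta> x t) + of_real t * (p2 (\<zeta> x t) * (x - c) + q2 (\<zeta> x t) * cnj (x - c))" for x t
 define fx where "fx x t = blinfun_mult_right (A x t) + (blinfun_mult_right (B x t) o\<^sub>L Blinfun cnj)" for x t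
 have fx_app: "blinfun_apply (fx x t) h = A x t * h + B x t * cnj h" for x t h
  by (simp add: fx_def blinfun.add_left bounded_linear_Blinfun_apply bounded_linear_cnj)
 have \<zeta>_cont: "continuous_on S (%y. \<zeta> (fst y) (snd y))" for S
  unfolding \<zeta>_def by (intro continuous_intros)
 have cc: "continuous_on (ball c r \<times> cbox 0 1) (%y. g (\<zeta> (fst y) (snd y)))" if "continuous_on (ball c r) g" for g :: "complex => complex"
  by (rule continuous_on_compose2[OF that \<zeta>_cont]) (use \<zeta>_in in auto)
 have Acont: "continuous_on (ball c r \<times> cbox 0 1) (%y. A (fst y) (snd y))"
  and Bcont: "continuous_on (ball c r \<times> cbox 0 1) (%y. B (fst y) (snd y))"
  unfolding A_def B_def by (intro continuous_intros cc cp cont)+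
 have fxcont: "continuous_on (ball c r \<times> cbox 0 1) (%(x, t). fx x t)"
  unfolding fx_def split_beta
  by (intro continuous_intros bounded_linear.continuous_on[OF bounded_linear_blinfun_mult_right] Acont Bcont)
 have slice: "continuous_on (cbox 0 1) (%t. g x t)" if "continuous_on (ball c r \<times> cbox 0 1) (%y. g (fst y) (snd y))" "x \<in> ball c r"
  for g :: "complex => real => complex" and x
 proof -
  have "continuous_on (cbox 0 1) (%t. (%y. g (fst y) (snd y)) (x, t))"
   by (rule continuous_on_compose2[OF that(1)]) (use that(2) in \<open>auto intro!: continuous_intros\<close>)
  then show ?thesis by simp
 qed
 have dzx: "((%x. \<zeta> x t) has_field_derivative of_real t) (at x)" for x t
  unfolding \<zeta>_def by (auto intro!: derivative_eq_intros)
 have dfx: "((%x. f x t) has_derivative blinfun_apply (fx x t)) (at x within ball c r)"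
  if x: "x \<in> ball c r" and t: "t \<in> cbox 0 1" for x t
 proof -
  note z = \<zeta>_in[OF x t]
  have id: "has_wirt (%x. x - c) 1 0 x"
   by (rule wirt_holo) (auto intro!: derivative_eq_intros)
  have "has_wirt (%x. f x t) (A x t) (B x t) x"
   unfolding f_def
   by (rule wirt_eq_rhs[OF wirt_add[OF wirt_mult[OF wirt_holo_comp[OF dzx p[OF z]] id]
     wirt_mult[OF wirt_holo_comp[OF dzx q[OF z]] wirt_cnj[OF id]]]])
    (simp_all add: A_def B_def algebra_simps)
  then show ?thesis unfolding has_wirt_def fx_app[abs_def, symmetric]
   by (rule has_derivative_at_withinI)
 qed
 have fint: "f x integrable_on cbox 0 1" if "x \<in> ball c r" for x
 proof (rule integrable_continuous)
  have "continuous_on (ball c r \<times> cbox 0 1) (%y. f (fst y) (snd y))"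
   unfolding f_def by (intro continuous_intros cc cp)
  from slice[OF this that] show "continuous_on (cbox 0 1) (f x)" .
 qed
 \<comment> \<open>Differentiating under the integral leaves the t-derivative of t (p h + q cnj h)
   along the segment, so only the value at t = 1 remains.\<close>
 have key: "blinfun_apply (integral (cbox 0 1) (fx x)) h = p x * h + q x * cnj h" if x: "x \<in> ball c r" for x h
 proof -
  have c1: "continuous_on (cbox 0 1) (fx x)"
   unfolding fx_def
   by (intro continuous_intros bounded_linear.continuous_on[OF bounded_linear_blinfun_mult_right] slice[OF Acont x] slice[OF Bcont x])
  have "blinfun_apply (integral (cbox 0 1) (fx x)) h = integral (cbox 0 1) (%t. A x t * h + B x t * cnj h)"
   by (subst blinfun_apply_integral[OF integrable_continuous[OF c1]]) (simp add: fx_app)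
  also have "((%t. A x t * h + B x t * cnj h) has_integral
    (of_real 1 * (p (\<zeta> x 1) * h + q (\<zeta> x 1) * cnj h) - of_real 0 * (p (\<zeta> x 0) * h + q (\<zeta> x 0) * cnj h))) {0..1}"
  proof (rule fundamental_theorem_of_calculus)
   fix t :: real assume t: "t \<in> {0..1}"
   then have z: "\<zeta> x t \<in> ball c r" using \<zeta>_in[OF x] by auto
   have dz: "((%t. \<zeta> x t) has_derivative (%s. of_real s * (x - c))) (at t)"
    unfolding \<zeta>_def by (auto intro!: derivative_eq_intros)
   have P: "((%t. p (\<zeta> x t)) has_vector_derivative (p1 (\<zeta> x t) * (x - c) + p2 (\<zeta> x t) * cnj (x - c))) (at t)"
    using has_derivative_compose[OF dz p[OF z, unfolded has_wirt_def]]
    by (simp add: has_vector_derivative_def scaleR_conv_of_real algebra_simps)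
   have Q: "((%t. q (\<zeta> x t)) has_vector_derivative (p2 (\<zeta> x t) * (x - c) + q2 (\<zeta> x t) * cnj (x - c))) (at t)"
    using has_derivative_compose[OF dz q[OF z, unfolded has_wirt_def]]
    by (simp add: has_vector_derivative_def scaleR_conv_of_real algebra_simps)
   have T: "((%t. complex_of_real t) has_vector_derivative 1) (at t)"
    by (auto intro!: derivative_eq_intros simp: has_vector_derivative_def scaleR_conv_of_real)
   have "((%t. of_real t * (p (\<zeta> x t) * h + q (\<zeta> x t) * cnj h)) has_vector_derivative
     (of_real t * ((p1 (\<zeta> x t) * (x - c) + p2 (\<zeta> x t) * cnj (x - c)) * h
      + (p2 (\<zeta> x t) * (x - c) + q2 (\<zeta> x t) * cnj (x - c)) * cnj h)
     + 1 * (p (\<zeta> x t) * h + q (\<zeta> x t) * cnj h))) (at t)"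
    by (intro has_vector_derivative_mult T has_vector_derivative_add has_vector_derivative_mult_left P Q)
   then have "((%t. of_real t * (p (\<zeta> x t) * h + q (\<zeta> x t) * cnj h)) has_vector_derivative
     (A x t * h + B x t * cnj h)) (at t)"
    by (simp add: A_def B_def algebra_simps)
   then show "((%t. of_real t * (p (\<zeta> x t) * h + q (\<zeta> x t) * cnj h)) has_vector_derivative
     (A x t * h + B x t * cnj h)) (at t within {0..1})"
    by (rule has_vector_derivative_at_within)
  qed simp
  then have "integral (cbox 0 1) (%t. A x t * h + B x t * cnj h) = p (\<zeta> x 1) * h + q (\<zeta> x 1) * cnj h"
   by (simp add: integral_unique)
  finally show ?thesis by (simp add: \<zeta>_def)
 qed
 show thesis
 proof (rule that)
  fix x assume x: "x \<in> ball c r"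
  have "((%x. integral (cbox 0 1) (f x)) has_derivative blinfun_apply (integral (cbox 0 1) (fx x))) (at x within ball c r)"
   by (rule leibniz_rule[OF dfx fint fxcont x convex_ball])
  moreover have "blinfun_apply (integral (cbox 0 1) (fx x)) = (%h. p x * h + q x * cnj h)"
   using key[OF x] by auto
  ultimately show "has_wirt (%x. integral (cbox 0 1) (f x)) (p x) (q x) x"
   unfolding has_wirt_def using at_within_open[OF x open_ball] by simp
 qed
qed

text \<open>A disc of squared radius s has area pi s, linear in s, so |z - c|^2 carries planar
  Lebesgue measure to pi times Lebesgue measure on the half line. This is why radial functions are
  written in the squared radius throughout.\<close>

lemma nn_integral_radial:
 fixes F :: "real => ennreal"
 assumes [measurable]: "F \<in> borel_measurable borel"
 shows "(\<integral>\<^sup>+z. F ((cmod (z - c))\<^sup>2) \<partial>lborel) = ennreal pi * (\<integral>\<^sup>+t. F t * indicator {0..} t \<partial>lborel)"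
proof -
 have eq: "distr lborel borel (%z. (cmod (z - c))\<^sup>2) = density lborel (%t. ennreal pi * indicator {0..} t)"
 proof (rule measure_eqI_generator_eq[where E = "range atMost" and \<Omega> = UNIV and A = "%n. {..real n}"])
  show "Int_stable (range (atMost :: real => _))" by (auto simp: Int_stable_def)
  have bs: "sets borel = sigma_sets UNIV (range (atMost :: real => _))"
   by (subst borel_eq_atMost) simp
  then show "sets (distr lborel borel (%z. (cmod (z - c))\<^sup>2)) = sigma_sets UNIV (range atMost)"
   "sets (density lborel (%t. ennreal pi * indicator {0..} t)) = sigma_sets UNIV (range (atMost :: real => _))"
   by simp_all
  have em: "emeasure (distr lborel borel (%z. (cmod (z - c))\<^sup>2)) {..s} = ennreal (pi * max 0 s)" for s
  proof -
   have "emeasure (distr lborel borel (%z. (cmod (z - c))\<^sup>2)) {..s} = emeasure lborel {z. (cmod (z - c))\<^sup>2 <= s}"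
    by (subst emeasure_distr) (auto simp: vimage_def)
   also have "\<dots> = ennreal (pi * max 0 s)"
   proof (cases "s \<ge> 0")
    case True
    then have "{z. (cmod (z - c))\<^sup>2 <= s} = cball c (sqrt s)"
     by (auto simp: dist_norm norm_minus_commute intro: real_le_rsqrt) (metis True norm_ge_zero real_sqrt_pow2 power2_le_iff_abs_le abs_norm_cancel real_sqrt_ge_zero)
    then show ?thesis using True by (simp add: emeasure_cball unit_ball_vol_2)
   next
    case False
    then have "{z. (cmod (z - c))\<^sup>2 <= s} = {}" by (auto simp: not_le intro: less_le_trans)
    then show ?thesis using False by simp
   qed
   finally show ?thesis .
  qed
  show "emeasure (distr lborel borel (%z. (cmod (z - c))\<^sup>2)) {..real n} ~= \<infinity>" for n
   unfolding em by simp
  fix X :: "real set" assume "X \<in> range atMost"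
  then obtain s where X: "X = {..s}" by auto
  have "emeasure (density lborel (%t. ennreal pi * indicator {0..} t)) {..s}
    = (\<integral>\<^sup>+t. ennreal pi * indicator {0..s} t \<partial>lborel)"
   by (subst emeasure_density) (auto intro!: nn_integral_cong simp: indicator_def)
  also have "\<dots> = ennreal pi * ennreal (max 0 s)"
   by (subst nn_integral_cmult_indicator) (auto simp: max_def)
  also have "\<dots> = ennreal (pi * max 0 s)" by (simp add: ennreal_mult)
  finally show "emeasure (distr lborel borel (%z. (cmod (z - c))\<^sup>2)) X = emeasure (density lborel (%t. ennreal pi * indicator {0..} t)) X"
   by (simp add: X em)
 qed (auto intro: real_arch_simple)
 have "(\<integral>\<^sup>+z. F ((cmod (z - c))\<^sup>2) \<partial>lborel) = (\<integral>\<^sup>+t. F t \<partial>distr lborel borel (%z. (cmod (z - c))\<^sup>2))"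
  by (subst nn_integral_distr) auto
 also have "\<dots> = (\<integral>\<^sup>+t. ennreal pi * (F t * indicator {0..} t) \<partial>lborel)"
  unfolding eq by (subst nn_integral_density) (auto simp: mult_ac)
 also have "\<dots> = ennreal pi * (\<integral>\<^sup>+t. F t * indicator {0..} t \<partial>lborel)"
  by (rule nn_integral_cmult) auto
 finally show ?thesis .
qed

section \<open>Period lattices\<close>

locale torus_lattice =
 fixes \<omega>\<^sub>1 \<omega>\<^sub>2 :: complex
 assumes neq: "\<omega>\<^sub>1 ~= \<omega>\<^sub>2" and indep: "independent {\<omega>\<^sub>1, \<omega>\<^sub>2}"
begin

abbreviation "\<Lambda> \<equiv> lattice \<omega>\<^sub>1 \<omega>\<^sub>2"
abbreviation "P \<equiv> parallelogram \<omega>\<^sub>1 \<omega>\<^sub>2"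
abbreviation "periodic \<equiv> doubly_periodic \<omega>\<^sub>1 \<omega>\<^sub>2"

text \<open>\<open>dt\<close> is the signed area of the period parallelogram; \<open>cs\<close> and
  \<open>ct\<close> are the real coordinates with respect to the two periods, by Cramer's
  rule.\<close>

definition dt :: real where "dt = Im (cnj \<omega>\<^sub>1 * \<omega>\<^sub>2)"
definition cs :: "complex => real" where "cs z = - Im (cnj \<omega>\<^sub>2 * z) / dt"
definition ct :: "complex => real" where "ct z = Im (cnj \<omega>\<^sub>1 * z) / dt"

lemma omega_nz: "\<omega>\<^sub>1 ~= 0" "\<omega>\<^sub>2 ~= 0"
 using indep dependent_zero[of "{\<omega>\<^sub>1,\<omega>\<^sub>2}"] by auto

lemma dt_nz: "dt ~= 0"
proof
 assume "dt = 0"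
 then have im: "Im (cnj \<omega>\<^sub>1 * \<omega>\<^sub>2) = 0" by (simp add: dt_def)
 define k where "k = Re (cnj \<omega>\<^sub>1 * \<omega>\<^sub>2) / (cmod \<omega>\<^sub>1)\<^sup>2"
 have "cnj \<omega>\<^sub>1 * \<omega>\<^sub>2 = of_real (Re (cnj \<omega>\<^sub>1 * \<omega>\<^sub>2))" using im by (simp add: complex_eq_iff)
 moreover have "\<omega>\<^sub>1 * (cnj \<omega>\<^sub>1 * \<omega>\<^sub>2) = of_real ((cmod \<omega>\<^sub>1)\<^sup>2) * \<omega>\<^sub>2"
  by (simp only: complex_norm_square mult.assoc)
 ultimately have "\<omega>\<^sub>1 * of_real (Re (cnj \<omega>\<^sub>1 * \<omega>\<^sub>2)) = of_real ((cmod \<omega>\<^sub>1)\<^sup>2) * \<omega>\<^sub>2" by metis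
 then have "\<omega>\<^sub>2 = k *\<^sub>R \<omega>\<^sub>1" using omega_nz
  by (simp add: k_def scaleR_conv_of_real field_simps)
 then have "\<omega>\<^sub>2 \<in> span {\<omega>\<^sub>1}" by (simp add: span_base span_scale)
 moreover have "insert \<omega>\<^sub>2 {\<omega>\<^sub>1} = {\<omega>\<^sub>1, \<omega>\<^sub>2}" by auto
 ultimately show False using independent_insert[of \<omega>\<^sub>2 "{\<omega>\<^sub>1}"] indep neq by auto
qed

lemma coords: "of_real (cs z) * \<omega>\<^sub>1 + of_real (ct z) * \<omega>\<^sub>2 = z"
proof -
 have "of_real (- Im (cnj \<omega>\<^sub>2 * z)) * \<omega>\<^sub>1 + of_real (Im (cnj \<omega>\<^sub>1 * z)) * \<omega>\<^sub>2 = of_real dt * z"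
  by (simp add: complex_eq_iff dt_def algebra_simps)
 then have "(of_real (- Im (cnj \<omega>\<^sub>2 * z)) * \<omega>\<^sub>1 + of_real (Im (cnj \<omega>\<^sub>1 * z)) * \<omega>\<^sub>2) / of_real dt = z"
  using dt_nz by simp
 then show ?thesis by (simp add: cs_def ct_def add_divide_distrib)
qed

lemma cs_simps: "cs (z + w) = cs z + cs w" "cs (z - w) = cs z - cs w" "cs (- z) = - cs z"
 "cs (of_real a * z) = a * cs z" "cs (of_int n * z) = of_int n * cs z" "cs \<omega>\<^sub>1 = 1" "cs \<omega>\<^sub>2 = 0" "cs 0 = 0"
 and ct_simps: "ct (z + w) = ct z + ct w" "ct (z - w) = ct z - ct w" "ct (- z) = - ct z"
 "ct (of_real a * z) = a * ct z" "ct (of_int n * z) = of_int n * ct z" "ct \<omega>\<^sub>1 = 0" "ct \<omega>\<^sub>2 = 1" "ct 0 = 0"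
 using dt_nz by (auto simp: cs_def ct_def field_simps) (auto simp: dt_def algebra_simps)

lemma cs_cont [continuous_intros]: "continuous_on S f ==> continuous_on S (%x. cs (f x))"
 and ct_cont [continuous_intros]: "continuous_on S f ==> continuous_on S (%x. ct (f x))"
 unfolding cs_def ct_def by (intro continuous_intros; use dt_nz in simp)+

lemma lattice_iff: "z \<in> \<Lambda> \<longleftrightarrow> cs z \<in> \<int> \<and> ct z \<in> \<int>"
proof
 assume "z \<in> \<Lambda>" then show "cs z \<in> \<int> \<and> ct z \<in> \<int>" by (auto simp: lattice_def cs_simps ct_simps)
next
 assume "cs z \<in> \<int> \<and> ct z \<in> \<int>"
 then obtain m n where "cs z = of_int m" "ct z = of_int n" by (auto elim!: Ints_cases)
 with coords[of z] have "z = of_int m * \<omega>\<^sub>1 + of_int n * \<omega>\<^sub>2" by simp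
 then show "z \<in> \<Lambda>" by (auto simp: lattice_def)
qed

lemma parallelogram_iff: "z \<in> P \<longleftrightarrow> 0 <= cs z \<and> cs z < 1 \<and> 0 <= ct z \<and> ct z < 1"
proof
 assume "z \<in> P" then show "0 <= cs z \<and> cs z < 1 \<and> 0 <= ct z \<and> ct z < 1"
  by (auto simp: parallelogram_def cs_simps ct_simps)
next
 assume "0 <= cs z \<and> cs z < 1 \<and> 0 <= ct z \<and> ct z < 1"
 with coords[of z] show "z \<in> P" unfolding parallelogram_def by force
qed

lemma lattice_0 [simp]: "0 \<in> \<Lambda>" by (simp add: lattice_iff cs_simps ct_simps)
lemma lattice_add: "x \<in> \<Lambda> ==> y \<in> \<Lambda> ==> x + y \<in> \<Lambda>" by (simp add: lattice_iff cs_simps ct_simps)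
lemma lattice_minus: "x \<in> \<Lambda> ==> - x \<in> \<Lambda>" by (simp add: lattice_iff cs_simps ct_simps)
lemma lattice_minus_iff: "- x \<in> \<Lambda> \<longleftrightarrow> x \<in> \<Lambda>" using lattice_minus[of x] lattice_minus[of "-x"] by auto
lemma lattice_diff: "x \<in> \<Lambda> ==> y \<in> \<Lambda> ==> x - y \<in> \<Lambda>" by (simp add: lattice_iff cs_simps ct_simps)
lemma lattice_add_iff: "y \<in> \<Lambda> ==> x + y \<in> \<Lambda> \<longleftrightarrow> x \<in> \<Lambda>"
 using lattice_diff[of "x + y" y] lattice_add by auto
lemma lattice_basis: "\<omega>\<^sub>1 \<in> \<Lambda>" "\<omega>\<^sub>2 \<in> \<Lambda>" by (simp_all add: lattice_iff cs_simps ct_simps)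

lemma countable_lattice: "countable \<Lambda>"
proof -
 have "\<Lambda> = (%(m, n). of_int m * \<omega>\<^sub>1 + of_int n * \<omega>\<^sub>2) ` (UNIV :: (int \<times> int) set)"
  by (auto simp: lattice_def)
 then show ?thesis by simp
qed

lemma closed_lattice: "closed \<Lambda>"
proof -
 have "\<Lambda> = (UNIV \<inter> cs -` \<int>) \<inter> (UNIV \<inter> ct -` \<int>)" by (auto simp: lattice_iff)
 moreover have "closed (UNIV \<inter> cs -` \<int>)"
  by (rule continuous_closed_preimage) (auto intro!: continuous_intros)
 moreover have "closed (UNIV \<inter> ct -` \<int>)"
  by (rule continuous_closed_preimage) (auto intro!: continuous_intros)
 ultimately show ?thesis by auto
qed

text \<open>Chosen so that both coordinates of z are at most |z| / rmin. A nonzero lattice point has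
  a coordinate of absolute value at least 1, hence length at least \<open>rmin\<close>.\<close>

definition rmin :: real where "rmin = \<bar>dt\<bar> / max (cmod \<omega>\<^sub>1) (cmod \<omega>\<^sub>2)"

lemma rmin_pos: "rmin > 0" using dt_nz omega_nz by (auto simp: rmin_def less_max_iff_disj intro!: divide_pos_pos)

lemma coord_bound: "\<bar>cs z\<bar> <= cmod z / rmin" "\<bar>ct z\<bar> <= cmod z / rmin"
proof -
 let ?m = "max (cmod \<omega>\<^sub>1) (cmod \<omega>\<^sub>2)"
 have "\<bar>Im (cnj \<omega>\<^sub>2 * z)\<bar> <= ?m * cmod z" "\<bar>Im (cnj \<omega>\<^sub>1 * z)\<bar> <= ?m * cmod z"
  by (rule order_trans[OF abs_Im_le_cmod], simp only: norm_mult complex_mod_cnj, rule mult_right_mono; simp)+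
 then show "\<bar>cs z\<bar> <= cmod z / rmin" "\<bar>ct z\<bar> <= cmod z / rmin"
  unfolding cs_def ct_def rmin_def using dt_nz by (auto simp: field_simps abs_divide divide_right_mono)
qed

lemma lattice_norm_ge: assumes "w \<in> \<Lambda>" "w ~= 0" shows "cmod w \<ge> rmin"
proof -
 obtain m n where mn: "cs w = of_int m" "ct w = of_int n" using assms(1) by (auto simp: lattice_iff elim!: Ints_cases)
 have "m ~= 0 \<or> n ~= 0" using coords[of w] assms(2) mn by auto
 then have "1 <= \<bar>cs w\<bar> \<or> 1 <= \<bar>ct w\<bar>" using mn by auto
 then have "1 <= cmod w / rmin" using coord_bound[of w] by linarith
 then show ?thesis using rmin_pos by (simp add: field_simps)
qed

lemma lattice_dist: "x \<in> \<Lambda> ==> y \<in> \<Lambda> ==> x ~= y ==> rmin <= cmod (x - y)"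
 using lattice_norm_ge[OF lattice_diff] by simp

lemma uniform_discrete_translates:
 "(+) a ` \<Lambda> sparse_in UNIV" "closed ((+) a ` \<Lambda>)" "countable ((+) a ` \<Lambda>)"
proof -
 show cl: "closed ((+) a ` \<Lambda>)" using closed_translation[OF closed_lattice] .
 show "countable ((+) a ` \<Lambda>)" using countable_lattice by simp
 have "\<not> x islimpt ((+) a ` \<Lambda>)" for x
 proof (rule discrete_imp_not_islimpt[of rmin])
  show "0 < rmin" by (rule rmin_pos)
  fix x y assume "x \<in> (+) a ` \<Lambda>" "y \<in> (+) a ` \<Lambda>" "dist y x < rmin"
  then obtain u v where "x = a + u" "y = a + v" "u \<in> \<Lambda>" "v \<in> \<Lambda>" by auto
  then show "y = x" using lattice_dist[of v u] \<open>dist y x < rmin\<close> by (force simp: dist_norm)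
 qed
 then show "(+) a ` \<Lambda> sparse_in UNIV" unfolding sparse_in_def by (intro ballI exI[of _ UNIV]) auto
qed

lemma sparse_lattice: "\<Lambda> sparse_in UNIV" using uniform_discrete_translates(1)[of 0] by simp

lemma open_compl_lattice: "open (- \<Lambda>)" using closed_lattice by auto

lemma connected_compl_countable: "countable S ==> connected (- S :: complex set)"
 using connected_open_diff_countable[of "UNIV::complex set" S] connected_UNIV[where 'a = complex]
 by (simp add: Compl_eq_Diff_UNIV)

lemma periodic_lattice: assumes "periodic f" "w \<in> \<Lambda>" shows "f (z + w) = f z"
proof -
 have nat: "f (z + of_nat n * \<omega>) = f z" if "!!z. f (z + \<omega>) = f z" for n z \<omega>
  by (induction n arbitrary: z) (auto simp: algebra_simps that, metis add.assoc that)
 have int: "f (z + of_int n * \<omega>) = f z" if "!!z. f (z + \<omega>) = f z" for n z \<omega>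
 proof (cases "n \<ge> 0")
  case True then show ?thesis using nat[OF that, of z "nat n"] by simp
 next
  case False
  then show ?thesis using nat[OF that, of "z + of_int n * \<omega>" "nat (- n)"] by (simp add: algebra_simps)
 qed
 obtain m n where w: "w = of_int m * \<omega>\<^sub>1 + of_int n * \<omega>\<^sub>2" using assms(2) by (auto simp: lattice_def)
 have p: "!!z. f (z + \<omega>\<^sub>1) = f z" "!!z. f (z + \<omega>\<^sub>2) = f z" using assms(1) by (auto simp: doubly_periodic_def)
 show ?thesis unfolding w using int[OF p(1)] int[OF p(2)] by (metis add.assoc)
qed

lemma periodicI: "(!!z w. w \<in> \<Lambda> ==> f (z + w) = f z) ==> periodic f"
 using lattice_basis by (auto simp: doubly_periodic_def)

lemma lattice_reduce: obtains w where "w \<in> \<Lambda>" "z - w \<in> P"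
proof
 let ?w = "of_int \<lfloor>cs z\<rfloor> * \<omega>\<^sub>1 + of_int \<lfloor>ct z\<rfloor> * \<omega>\<^sub>2"
 show "?w \<in> \<Lambda>" by (auto simp: lattice_def)
 show "z - ?w \<in> P" unfolding parallelogram_iff cs_simps ct_simps by simp linarith
qed

definition cell :: "complex set" where "cell = {z. 0 <= cs z \<and> cs z <= 1 \<and> 0 <= ct z \<and> ct z <= 1}"

lemma P_subset_cell: "P \<subseteq> cell" by (auto simp: parallelogram_iff cell_def)

lemma compact_cell: "compact cell"
proof (rule compact_eq_bounded_closed[THEN iffD2], rule conjI)
 show "bounded cell" unfolding bounded_iff
 proof (intro exI ballI)
  fix z assume "z \<in> cell"
  then have "cmod (of_real (cs z) * \<omega>\<^sub>1) <= 1 * cmod \<omega>\<^sub>1" "cmod (of_real (ct z) * \<omega>\<^sub>2) <= 1 * cmod \<omega>\<^sub>2"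
   unfolding norm_mult by (intro mult_right_mono; auto simp: cell_def)+
  then have "cmod (of_real (cs z) * \<omega>\<^sub>1 + of_real (ct z) * \<omega>\<^sub>2) <= cmod \<omega>\<^sub>1 + cmod \<omega>\<^sub>2"
   using norm_triangle_ineq[of "of_real (cs z) * \<omega>\<^sub>1" "of_real (ct z) * \<omega>\<^sub>2"] by linarith
  then show "cmod z <= cmod \<omega>\<^sub>1 + cmod \<omega>\<^sub>2" unfolding coords .
 qed
 show "closed cell" unfolding cell_def
  by (intro closed_Collect_conj closed_Collect_le continuous_intros)
qed

lemma P_borel [measurable]: "P \<in> sets borel"
proof -
 have "P = {z. 0 <= cs z} \<inter> {z. cs z < 1} \<inter> {z. 0 <= ct z} \<inter> {z. ct z < 1}"
  by (auto simp: parallelogram_iff)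
 moreover have "closed {z. 0 <= cs z}" "open {z. cs z < 1}" "closed {z. 0 <= ct z}" "open {z. ct z < 1}"
  by (intro closed_Collect_le open_Collect_less continuous_intros)+
 ultimately show ?thesis by auto
qed

lemma emeasure_P_finite: "emeasure lborel P < \<infinity>"
 using emeasure_mono[OF P_subset_cell] emeasure_compact_finite[OF compact_cell] compact_cell
 by (metis borel_compact order_le_less_trans sets_lborel)

lemma torus_area_pos: "torus_area \<omega>\<^sub>1 \<omega>\<^sub>2 > 0"
proof -
 let ?O = "{z. 0 < cs z} \<inter> {z. cs z < 1} \<inter> {z. 0 < ct z} \<inter> {z. ct z < 1}"
 have "open ?O" by (intro open_Int open_Collect_less continuous_intros)
 moreover have "(\<omega>\<^sub>1 + \<omega>\<^sub>2) / 2 \<in> ?O"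
  using cs_simps(4)[of "1/2" "\<omega>\<^sub>1 + \<omega>\<^sub>2"] ct_simps(4)[of "1/2" "\<omega>\<^sub>1 + \<omega>\<^sub>2"] by (simp add: cs_simps ct_simps)
 ultimately obtain e where e: "e > 0" "ball ((\<omega>\<^sub>1 + \<omega>\<^sub>2) / 2) e \<subseteq> ?O" unfolding open_contains_ball by blast
 have "0 < emeasure lborel (ball ((\<omega>\<^sub>1 + \<omega>\<^sub>2) / 2) e)"
  using e by (simp add: emeasure_ball unit_ball_vol_2)
 also have "\<dots> <= emeasure lborel P"
 proof (rule emeasure_mono)
  have "?O \<subseteq> P" by (auto simp: parallelogram_iff)
  with e show "ball ((\<omega>\<^sub>1 + \<omega>\<^sub>2) / 2) e \<subseteq> P" by blast
 qed simp
 finally show ?thesis using emeasure_P_finite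
  by (simp add: torus_area_def measure_def enn2real_positive_iff)
qed

lemma continuous_periodic_bounded:
 fixes f :: "complex => 'b::real_normed_vector"
 assumes "periodic f" "continuous_on UNIV f"
 obtains K where "!!z. norm (f z) <= K" "0 <= K"
proof -
 have "bounded (f ` cell)"
  by (intro compact_imp_bounded compact_continuous_image compact_cell continuous_on_subset[OF assms(2)]) auto
 then obtain K where K: "!!z. z \<in> cell ==> norm (f z) <= K" unfolding bounded_iff by blast
 have "norm (f z) <= K" for z
 proof -
  obtain w where w: "w \<in> \<Lambda>" "z - w \<in> P" by (rule lattice_reduce)
  have "f z = f (z - w)" using periodic_lattice[OF assms(1) w(1), of "z - w"] by simp
  then show ?thesis using K P_subset_cell w by auto
 qed
 moreover from this[of 0] have "0 <= K" using norm_ge_zero order_trans by blast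
 ultimately show thesis using that by blast
qed

end

text \<open>Shifting by t v carries the part c < 1 - t of the half-open strip to the part t <= c.
  The rest would leave the strip and is brought back by the period, that is, shifted by (t - 1) v.
  One coordinate moves at a time while the constraint \<open>Q\<close> on the other is
  invariant.\<close>

lemma shift_step:
 fixes F :: "complex => 'b::euclidean_space" and c :: "complex => real" and v :: complex
  and Q :: "complex => bool"
 defines "A \<equiv> {z. 0 <= c z \<and> c z < 1 \<and> Q z}"
 assumes c: "!!z t. c (z + of_real t * v) = c z + t" and Q: "!!z t. Q (z + of_real t * v) = Q z"
  and mc [measurable]: "c \<in> borel_measurable borel" and mQ [measurable]: "Measurable.pred borel Q"
  and per: "!!z. F (z + v) = F z"
  and int: "set_integrable lborel A F" and t: "0 <= t" "t < 1"
 shows "set_integrable lborel A (%z. F (z + of_real t * v))"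
  and "sint A (%z. F (z + of_real t * v)) = sint A F"
proof -
 define A1 where "A1 = {z. 0 <= c z \<and> c z < 1 - t \<and> Q z}"
 define A2 where "A2 = {z. 1 - t <= c z \<and> c z < 1 \<and> Q z}"
 define B1 where "B1 = {z. t <= c z \<and> c z < 1 \<and> Q z}"
 define B2 where "B2 = {z. 0 <= c z \<and> c z < t \<and> Q z}"
 have mA [measurable]: "A \<in> sets borel" "A1 \<in> sets borel" "A2 \<in> sets borel" "B1 \<in> sets borel" "B2 \<in> sets borel"
  unfolding A_def A1_def A2_def B1_def B2_def by measurable
 have A: "A = A1 \<union> A2" "A1 \<inter> A2 = {}" "A = B1 \<union> B2" "B1 \<inter> B2 = {}"
  using t by (auto simp: A_def A1_def A2_def B1_def B2_def)
 have per': "F (z - v) = F z" for z using per[of "z - v"] by simp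
 have iB: "set_integrable lborel B1 F" "set_integrable lborel B2 F"
  by (rule set_integrable_subset[OF int]; use A in auto)+
 have tr1: "integrable lborel (%z. indicator C (z + h) *\<^sub>R F (z + h))"
   "(LINT z|lborel. indicator C (z + h) *\<^sub>R F (z + h)) = sint C F"
  if "set_integrable lborel C F" for C h
  using lborel_translate[of "%z. indicator C z *\<^sub>R F z" h] that
  by (auto simp: set_integrable_def set_lebesgue_integral_def dest: borel_measurable_integrable)
 have e1: "indicator B1 (z + of_real t * v) *\<^sub>R F (z + of_real t * v) = indicator A1 z *\<^sub>R F (z + of_real t * v)" for z
  using c[of z t] Q[of z t] by (auto simp: indicator_def A1_def B1_def)
 have e2: "indicator B2 (z + of_real (t - 1) * v) *\<^sub>R F (z + of_real (t - 1) * v) = indicator A2 z *\<^sub>R F (z + of_real t * v)" for z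
  using c[of z "t - 1"] Q[of z "t - 1"] per'[of "z + of_real t * v"]
  by (auto simp: indicator_def A2_def B2_def algebra_simps)
 have i: "set_integrable lborel A1 (%z. F (z + of_real t * v))" "set_integrable lborel A2 (%z. F (z + of_real t * v))"
  using tr1(1)[OF iB(1), of "of_real t * v"] tr1(1)[OF iB(2), of "of_real (t - 1) * v"]
  unfolding e1 e2 set_integrable_def by auto
 show "set_integrable lborel A (%z. F (z + of_real t * v))"
  unfolding A(1) by (intro set_integrable_Un i) auto
 have "sint A (%z. F (z + of_real t * v)) =
  sint A1 (%z. F (z + of_real t * v)) + sint A2 (%z. F (z + of_real t * v))"
  unfolding A(1) by (intro set_integral_Un i A)
 also have "\<dots> = sint B1 F + sint B2 F"
  using tr1(2)[OF iB(1), of "of_real t * v"] tr1(2)[OF iB(2), of "of_real (t - 1) * v"]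
  unfolding e1 e2 by (simp add: set_lebesgue_integral_def)
 also have "\<dots> = sint A F"
  unfolding A(3) by (intro set_integral_Un[symmetric] iB A)
 finally show "sint A (%z. F (z + of_real t * v)) = sint A F" .
qed

section \<open>Translation invariance and integration by parts on the torus\<close>

context torus_lattice
begin

lemma P_alt: "P = {z. 0 <= cs z \<and> cs z < 1 \<and> (0 <= ct z \<and> ct z < 1)}"
 "P = {z. 0 <= ct z \<and> ct z < 1 \<and> (0 <= cs z \<and> cs z < 1)}"
 by (auto simp: parallelogram_iff)

lemma coord_borel [measurable]: "cs \<in> borel_measurable borel" "ct \<in> borel_measurable borel"
 by (intro borel_measurable_continuous_onI continuous_intros)+

lemma torus_shift:
 fixes F :: "complex => 'b::euclidean_space"
 assumes per: "periodic F" and int: "set_integrable lborel P F"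
 shows "set_integrable lborel P (%z. F (z + h))"
  "sint P (%z. F (z + h)) = sint P F"
proof -
 \<comment> \<open>By periodicity only the fractional parts of the coordinates of \<open>h\<close>
   matter; each is handled by one use of \<open>shift_step\<close>.\<close>
 define s where "s = frac (cs h)"
 define t where "t = frac (ct h)"
 have st: "0 <= s" "s < 1" "0 <= t" "t < 1" by (simp_all add: s_def t_def frac_lt_1)
 define h' where "h' = of_real s * \<omega>\<^sub>1 + of_real t * \<omega>\<^sub>2"
 have "h = h' + (of_int \<lfloor>cs h\<rfloor> * \<omega>\<^sub>1 + of_int \<lfloor>ct h\<rfloor> * \<omega>\<^sub>2)"
  using coords[of h] by (simp add: h'_def s_def t_def frac_def algebra_simps)
 moreover have "of_int \<lfloor>cs h\<rfloor> * \<omega>\<^sub>1 + of_int \<lfloor>ct h\<rfloor> * \<omega>\<^sub>2 \<in> \<Lambda>" by (auto simp: lattice_def)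
 ultimately have eq: "(%z. F (z + h)) = (%z. F (z + h'))"
  using periodic_lattice[OF per] by (metis add.assoc)
 have p1: "F (z + \<omega>\<^sub>1) = F z" "F (z + \<omega>\<^sub>2) = F z" for z using per by (auto simp: doubly_periodic_def)
 note S1 = shift_step[of cs \<omega>\<^sub>1 "%z. 0 <= ct z \<and> ct z < 1" F s, folded P_alt(1)]
 note S2 = shift_step[of ct \<omega>\<^sub>2 "%z. 0 <= cs z \<and> cs z < 1" "%z. F (z + of_real s * \<omega>\<^sub>1)" t, folded P_alt(2)]
 have 1: "set_integrable lborel P (%z. F (z + of_real s * \<omega>\<^sub>1))"
  "sint P (%z. F (z + of_real s * \<omega>\<^sub>1)) = sint P F"
  by (rule S1; use st p1 int in \<open>simp add: cs_simps ct_simps\<close>)+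
 have p2: "F (z + \<omega>\<^sub>2 + of_real s * \<omega>\<^sub>1) = F (z + of_real s * \<omega>\<^sub>1)" for z
  using p1(2)[of "z + of_real s * \<omega>\<^sub>1"] by (simp add: algebra_simps)
 have 2: "set_integrable lborel P (%z. F (z + of_real t * \<omega>\<^sub>2 + of_real s * \<omega>\<^sub>1))"
  "sint P (%z. F (z + of_real t * \<omega>\<^sub>2 + of_real s * \<omega>\<^sub>1)) = sint P (%z. F (z + of_real s * \<omega>\<^sub>1))"
  by (rule S2; use st p2 1 in \<open>simp add: cs_simps ct_simps\<close>)+
 have "(%z. F (z + h')) = (%z. F (z + of_real t * \<omega>\<^sub>2 + of_real s * \<omega>\<^sub>1))"
  by (simp add: h'_def algebra_simps)
 then show "set_integrable lborel P (%z. F (z + h))"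
  "sint P (%z. F (z + h)) = sint P F"
  unfolding eq using 1 2 by simp_all
qed

lemma continuous_set_integrable_P:
 fixes F :: "complex => 'b::euclidean_space"
 assumes "continuous_on UNIV F"
 shows "set_integrable lborel P F"
proof -
 have "integrable lborel (%x. indicator cell x *\<^sub>R F x)"
  by (rule borel_integrable_compact[OF compact_cell continuous_on_subset[OF assms]]) auto
 then have "set_integrable lborel cell F" unfolding set_integrable_def .
 then show ?thesis by (rule set_integrable_subset) (use P_subset_cell in auto)
qed

lemma wirt_periodic:
 assumes "periodic \<Psi>" "!!z. z \<in> S ==> has_wirt \<Psi> (a z) (b z) z" "w \<in> \<Lambda>" "z \<in> S" "z + w \<in> S"
 shows "a (z + w) = a z" "b (z + w) = b z"
proof -
 have "has_wirt (%z. \<Psi> (z + w)) (a (z + w) * 1) (b (z + w) * cnj 1) z"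
  by (rule wirt_holo_comp[of "%z. z + w"]) (auto intro!: derivative_eq_intros assms)
 moreover have "(%z. \<Psi> (z + w)) = \<Psi>" using periodic_lattice[OF assms(1,3)] by auto
 ultimately have "has_wirt \<Psi> (a (z + w)) (b (z + w)) z" by simp
 from wirt_unique[OF this assms(2)[OF assms(4)]] show "a (z + w) = a z" "b (z + w) = b z" .
qed

text \<open>Translation invariance takes the place of cancelling opposite sides of the
  parallelogram. Periodicity bounds the derivatives, which yields the dominating function.\<close>

lemma stokes_torus:
 assumes W: "!!z. has_wirt \<Psi> (a z) (b z) z"
  and c: "continuous_on UNIV a" "continuous_on UNIV b" and per: "periodic \<Psi>"
 shows "sint P a = 0" "sint P b = 0"
proof -
 have pa: "periodic a" "periodic b"
  using wirt_periodic[OF per, of UNIV a b] W by (auto intro!: periodicI)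
 obtain K1 where K1: "!!z. cmod (a z) <= K1" using continuous_periodic_bounded[OF pa(1) c(1)] by blast
 obtain K2 where K2: "!!z. cmod (b z) <= K2" using continuous_periodic_bounded[OF pa(2) c(2)] by blast
 define K where "K = max K1 K2"
 have K: "cmod (a z) <= K" "cmod (b z) <= K" for z using K1[of z] K2[of z] by (auto simp: K_def)
 have c\<Psi>: "continuous_on UNIV \<Psi>" using wirt_imp_continuous_on W by blast
 have ia: "set_integrable lborel P a" "set_integrable lborel P b" "set_integrable lborel P \<Psi>"
  by (intro continuous_set_integrable_P c c\<Psi>)+
 have m: "a \<in> borel_measurable borel" "b \<in> borel_measurable borel"
  using c by (auto intro: borel_measurable_continuous_onI)
 have main: "(LINT z|lborel. indicator P z *\<^sub>R (a z * v + b z * cnj v)) = 0" if v: "cmod v = 1" for v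
 proof (rule stokes_abstract[where wt = "indicator P" and \<Psi> = \<Psi> and a = a and b = b and g = "%z. 2 * K * indicator P z"])
  show "integrable lborel (%z. 2 * K * indicator P z)"
   using continuous_set_integrable_P[of "%_. 2 * K"] by (simp add: set_integrable_def mult.commute)
  show "norm (indicator P z *\<^sub>R (\<Psi> (z + of_real t * v) - \<Psi> z)) <= t * (2 * K * indicator P z)"
   if t: "0 < t" "t <= 1" for z t
  proof -
   have "norm (\<Psi> (z + of_real t * v) - \<Psi> z) <= 2 * K * cmod (z + of_real t * v - z)"
    by (rule wirt_lipschitz[OF W K])
   then show ?thesis using t v by (simp add: norm_mult mult_ac indicator_def)
  qed
  show "(%z. indicator P z *\<^sub>R (a z * v + b z * cnj v)) \<in> borel_measurable lborel"
   using m by simp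
  show "integrable lborel (%z. indicator P z *\<^sub>R \<Psi> (z + h))" for h
   using torus_shift(1)[OF per ia(3)] by (simp add: set_integrable_def)
  show "(LINT z|lborel. indicator P z *\<^sub>R \<Psi> (z + h)) = (LINT z|lborel. indicator P z *\<^sub>R \<Psi> z)" for h
   using torus_shift(2)[OF per ia(3)] by (simp add: set_lebesgue_integral_def)
 qed (rule W)
 have *: "sint P a * v + sint P b * cnj v = 0" if "cmod v = 1" for v
 proof -
  have "sint P (%z. a z * v + b z * cnj v) =
   sint P (%z. a z * v) + sint P (%z. b z * cnj v)"
   by (intro set_integral_add set_integrable_mult_left ia)
  then show ?thesis using main[OF that] by (simp add: set_lebesgue_integral_def)
 qed
 have "sint P a = 0 \<and> sint P b = 0"
  by (rule zero_from_two; rule *) simp_all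
 then show "sint P a = 0" "sint P b = 0" by auto
qed

end

section \<open>Test functions\<close>

text \<open>\<open>f\<close> lives on \<open>U\<close> only, but \<open>g\<close> is supported in a
  ball inside \<open>U\<close>, so all products extend by zero and \<open>stokes_compact\<close>
  applies to f g.\<close>

lemma stokes_product:
 assumes U: "open U" "cball c r \<subseteq> U"
  and f: "!!z. z \<in> U ==> has_wirt f (a z) (b z) z" "continuous_on U a" "continuous_on U b"
  and g: "!!z. has_wirt g (ga z) (gb z) z" "continuous_on UNIV ga" "continuous_on UNIV gb"
  and supp: "!!z. z \<notin> cball c r ==> g z = 0"
 shows "integrable lborel (%z. a z * g z)" "integrable lborel (%z. b z * g z)"
  "integrable lborel (%z. f z * ga z)" "integrable lborel (%z. f z * gb z)"
  "(LINT z|lborel. f z * ga z) = - (LINT z|lborel. a z * g z)"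
  "(LINT z|lborel. f z * gb z) = - (LINT z|lborel. b z * g z)"
proof -
 have z: "ga z = 0 \<and> gb z = 0" if "z \<notin> cball c r" for z
 proof -
  have "has_wirt (%z. 0) (ga z) (gb z) z"
   by (rule wirt_transform[OF g(1), of "- cball c r"]) (use that supp in auto)
  from wirt_unique[OF this wirt_const] show ?thesis by simp
 qed
 have cf: "continuous_on U f" using f(1) wirt_imp_continuous_on by blast
 have cg: "continuous_on UNIV g" using g(1) wirt_imp_continuous_on by blast
 have ext: "continuous_on UNIV (%z. p z * q z)" if "continuous_on U p" "continuous_on UNIV q" "!!z. z \<notin> cball c r ==> q z = 0"
  for p q :: "complex => complex"
 proof -
  have "continuous_on U (%z. p z * q z)" by (intro continuous_intros that(1) continuous_on_subset[OF that(2)]) auto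
  moreover have "continuous_on (- cball c r) (%z. p z * q z)"
   by (rule continuous_on_eq[of _ "%_. 0"]) (use that(3) in auto)
  ultimately have "continuous_on (U \<union> - cball c r) (%z. p z * q z)"
   using U by (intro continuous_on_open_Un) auto
  moreover have "U \<union> - cball c r = UNIV" using U by auto
  ultimately show ?thesis by simp
 qed
 have i: "integrable lborel (%z. p z * q z)" if "continuous_on U p" "continuous_on UNIV q" "!!z. z \<notin> cball c r ==> q z = 0"
  for p q :: "complex => complex"
  by (rule integrable_compact_support[of c r]) (use continuous_on_subset[OF ext[OF that]] that(3) in auto)
 show I: "integrable lborel (%z. a z * g z)" "integrable lborel (%z. b z * g z)"
  "integrable lborel (%z. f z * ga z)" "integrable lborel (%z. f z * gb z)"
  by (rule i; use f g cf cg supp z in blast)+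
 have W: "has_wirt (%z. f z * g z) (f z * ga z + a z * g z) (f z * gb z + b z * g z) z" for z
 proof (cases "z \<in> U")
  case True then show ?thesis by (intro wirt_mult f g)
 next
  case False
  then have nz: "z \<notin> cball c r" using U by auto
  have "has_wirt (%z. f z * g z) 0 0 z"
   by (rule wirt_transform[OF wirt_const[of 0], of "- cball c r"]) (use nz supp in auto)
  then show ?thesis using z[OF nz] supp[OF nz] by simp
 qed
 have s: "(LINT z|lborel. f z * ga z + a z * g z) = 0" "(LINT z|lborel. f z * gb z + b z * g z) = 0"
  by (rule stokes_compact[OF W, of c r]; (intro continuous_on_add ext f g cf cg)?; use supp z in simp)+
 have "(LINT z|lborel. f z * ga z) + (LINT z|lborel. a z * g z) = 0"
  using s(1) I by (simp add: Bochner_Integration.integral_add)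
 then show "(LINT z|lborel. f z * ga z) = - (LINT z|lborel. a z * g z)" by (simp add: eq_neg_iff_add_eq_0)
 have "(LINT z|lborel. f z * gb z) + (LINT z|lborel. b z * g z) = 0"
  using s(2) I by (simp add: Bochner_Integration.integral_add)
 then show "(LINT z|lborel. f z * gb z) = - (LINT z|lborel. b z * g z)" by (simp add: eq_neg_iff_add_eq_0)
qed

lemma dir_deriv_local:
 assumes "f differentiable (at z)" "open N" "z \<in> N" "!!w. w \<in> N ==> f w = g w"
 shows "g differentiable (at z)" "dir_deriv v f z = dir_deriv v g z"
proof -
 from assms(1) obtain D where D: "(f has_derivative D) (at z)" by (auto simp: differentiable_def)
 have D': "(g has_derivative D) (at z)"
  by (rule has_derivative_transform_within_open[OF D assms(2,3)]) (use assms(4) in auto)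
 then show "g differentiable (at z)" by (auto simp: differentiable_def)
 show "dir_deriv v f z = dir_deriv v g z" using dir_deriv_eq[OF D] dir_deriv_eq[OF D'] by simp
qed

text \<open>Meant for periodisations: near each point such a function is one translate of a
  compactly supported \<open>\<kappa>\<close>.\<close>

lemma Ck_on_local:
 assumes "!!z. \<exists>N \<kappa>. open N \<and> z \<in> N \<and> Ck_on k \<kappa> UNIV \<and> (\<forall>w\<in>N. \<kappa> w = \<phi> w)"
 shows "Ck_on k \<phi> UNIV"
 using assms
proof (induction k arbitrary: \<phi>)
 case 0
 have "isCont \<phi> z" for z
 proof -
  obtain N \<kappa> where N: "open N" "z \<in> N" "Ck_on 0 \<kappa> UNIV" "!!w. w \<in> N ==> \<kappa> w = \<phi> w" using 0[of z] by blast
  then have "continuous_on N \<phi>" by (auto intro: continuous_on_eq[of N \<kappa>] continuous_on_subset)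
  then show ?thesis using N by (simp add: continuous_on_eq_continuous_at)
 qed
 then show ?case by (simp add: continuous_at_imp_continuous_on)
next
 case (Suc k)
 have d: "\<phi> differentiable (at z) \<and> (\<forall>v\<in>{1,\<i>}. \<exists>N \<kappa>. open N \<and> z \<in> N \<and> Ck_on k \<kappa> UNIV \<and> (\<forall>w\<in>N. \<kappa> w = dir_deriv v \<phi> w))" for z
 proof -
  obtain N \<kappa> where N: "open N" "z \<in> N" "Ck_on (Suc k) \<kappa> UNIV" "!!w. w \<in> N ==> \<kappa> w = \<phi> w" using Suc.prems[of z] by blast
  then have df: "\<kappa> differentiable (at w)" for w by simp
  have "\<phi> differentiable (at z)" by (rule dir_deriv_local(1)[OF df N(1,2)]) (use N in auto)
  moreover have "dir_deriv v \<kappa> w = dir_deriv v \<phi> w" if "w \<in> N" for v w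
   by (rule dir_deriv_local(2)[OF df N(1) that]) (use N in auto)
  ultimately show ?thesis using N by auto
 qed
 have "Ck_on k (dir_deriv v \<phi>) UNIV" if "v \<in> {1, \<i>}" for v
  by (rule Suc.IH) (use d that in blast)
 then show ?case using d by simp
qed

lemma Ck_Suc_imp: "Ck_on (Suc k) f UNIV ==> Ck_on k f UNIV"
proof (induction k arbitrary: f)
 case 0 then show ?case
  by (auto intro!: continuous_at_imp_continuous_on differentiable_imp_continuous_within)
next
 case (Suc k)
 have "\<forall>z. f differentiable (at z)" "Ck_on (Suc k) (dir_deriv 1 f) UNIV" "Ck_on (Suc k) (dir_deriv \<i> f) UNIV"
  using Suc.prems by (simp_all only: Ck_on.simps) auto
 then have "Ck_on k (dir_deriv 1 f) UNIV" "Ck_on k (dir_deriv \<i> f) UNIV" "\<forall>z\<in>UNIV. f differentiable (at z)"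
  using Suc.IH[of "dir_deriv 1 f"] Suc.IH[of "dir_deriv \<i> f"] by blast+
 then show ?case unfolding Ck_on.simps(2)[of k f UNIV] by blast
qed

lemma Ck_const: "Ck_on k (%z. c) UNIV"
proof (induction k arbitrary: c)
 case (Suc k)
 have "dir_deriv v (%z. c) = (%z. 0)" for v by (rule ext, rule dir_deriv_eq) (rule has_derivative_const)
 then show ?case using Suc by simp
qed simp

lemma dir_deriv_D: "f differentiable (at z) ==> (f has_derivative (%v. dir_deriv v f z)) (at z)"
 unfolding dir_deriv_def by (simp add: frechet_derivative_works)

lemma Ck_add: "Ck_on k f UNIV ==> Ck_on k g UNIV ==> Ck_on k (%z. f z + g z) UNIV"
proof (induction k arbitrary: f g)
 case 0 then show ?case by (auto intro: continuous_intros)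
next
 case (Suc k)
 have "dir_deriv v (%z. f z + g z) = (%z. dir_deriv v f z + dir_deriv v g z)" for v
  by (rule ext, rule dir_deriv_eq) (use Suc.prems in \<open>auto intro!: has_derivative_add dir_deriv_D\<close>)
 then show ?case using Suc by (auto intro: differentiable_add)
qed

lemma Ck_mult: "Ck_on k f UNIV ==> Ck_on k g UNIV ==> Ck_on k (%z. f z * g z) UNIV"
proof (induction k arbitrary: f g)
 case 0 then show ?case by (auto intro: continuous_intros)
next
 case (Suc k)
 have "dir_deriv v (%z. f z * g z) = (%z. f z * dir_deriv v g z + dir_deriv v f z * g z)" for v
  by (rule ext, rule dir_deriv_eq) (use Suc.prems in \<open>auto intro!: has_derivative_mult dir_deriv_D\<close>)
 then show ?case using Suc.IH Suc.prems Ck_Suc_imp[OF Suc.prems(1)] Ck_Suc_imp[OF Suc.prems(2)]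
  by (auto intro!: differentiable_mult Ck_add)
qed

text \<open>\<open>q\<close> lists a function together with all its derivatives. The derivative of q
  n (f z) contains q (n + 1) (f z) again, so the induction on the order runs with \<open>n\<close>
  arbitrary.\<close>

lemma Ck_chain:
 fixes q :: "nat => real => real"
 assumes q: "!!n x. x \<in> I ==> (q n has_real_derivative q (Suc n) x) (at x)" and fI: "!!z. f z \<in> I"
 shows "Ck_on k f UNIV ==> Ck_on k (%z. q n (f z)) UNIV"
proof (induction k arbitrary: n)
 case 0
 have "isCont (q n) (f z)" for z using q[OF fI] DERIV_isCont by blast
 moreover have "isCont f z" for z using 0 by (simp add: continuous_on_eq_continuous_at)
 ultimately have "isCont (%z. q n (f z)) z" for z by (rule isCont_o2[rotated])
 then show ?case by (simp add: continuous_at_imp_continuous_on)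
next
 case (Suc k)
 have D: "((%z. q n (f z)) has_derivative (%v. q (Suc n) (f z) * dir_deriv v f z)) (at z)" for z
  by (rule has_derivative_compose[of f, OF dir_deriv_D])
   (use Suc.prems q[OF fI, of n z] in \<open>auto simp: has_field_derivative_def\<close>)
 have "dir_deriv v (%z. q n (f z)) = (%z. q (Suc n) (f z) * dir_deriv v f z)" for v
  by (rule ext) (rule dir_deriv_eq[OF D])
 moreover have "Ck_on k (%z. q (Suc n) (f z) * dir_deriv v f z) UNIV" if "v \<in> {1, \<i>}" for v
  using that Suc.prems by (intro Ck_mult Suc.IH[OF Ck_Suc_imp[OF Suc.prems]]) auto
 moreover have "(%z. q n (f z)) differentiable (at z)" for z using D by (auto simp: differentiable_def)
 ultimately show ?case by simp
qed

lemma Ck_Re: "Ck_on k Re UNIV" and Ck_Im: "Ck_on k Im UNIV"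
proof -
 have "dir_deriv v Re = (%z. Re v)" "dir_deriv v Im = (%z. Im v)" for v
  by (rule ext, rule dir_deriv_eq, auto intro!: derivative_eq_intros)+
 moreover have "Re differentiable (at z)" "Im differentiable (at z)" for z
  unfolding differentiable_def by (auto intro!: derivative_eq_intros exI)
 ultimately show "Ck_on k Re UNIV" "Ck_on k Im UNIV"
  by (cases k; auto simp: Ck_const continuous_on_Re continuous_on_Im)+
qed

lemma Ck_cmod2: "Ck_on k (%z. (cmod (z - c))\<^sup>2) UNIV"
proof -
 have "(cmod (z - c))\<^sup>2 = (Re z + - Re c) * (Re z + - Re c) + (Im z + - Im c) * (Im z + - Im c)" for z
  by (simp only: cmod_power2) (simp add: power2_eq_square)
 then show ?thesis by (simp only:) (intro Ck_add Ck_mult Ck_Re Ck_Im Ck_const)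
qed

lemma Ck_shift: "Ck_on k \<kappa> UNIV ==> Ck_on k (%z. \<kappa> (z - w)) UNIV"
proof (induction k arbitrary: \<kappa>)
 case 0 then show ?case by (auto intro!: continuous_intros continuous_on_compose2[of UNIV \<kappa>])
next
 case (Suc k)
 have D: "((%z. \<kappa> (z - w)) has_derivative (%v. dir_deriv v \<kappa> (z - w))) (at z)" for z
  by (rule has_derivative_compose[of "%z. z - w" "%v. v", OF _ dir_deriv_D])
   (use Suc.prems in \<open>auto intro!: derivative_eq_intros\<close>)
 have "dir_deriv v (%z. \<kappa> (z - w)) = (%z. dir_deriv v \<kappa> (z - w))" for v
  by (rule ext) (rule dir_deriv_eq[OF D])
 then show ?case using D Suc by (auto simp: differentiable_def)
qed

section \<open>Smooth cut-off functions\<close>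

definition flat :: "real poly => real => real" where
 "flat p x = (if x > 0 then poly p (1 / x) * exp (- (1 / x)) else 0)"

text \<open>With y = 1/x the x-derivative of p(y) exp (-y) is y^2 (p(y) - p'(y)) exp (-y). Functions
  of this shape are therefore closed under differentiation, as \<open>Ck_chain\<close>
  demands.\<close>

definition flat_step :: "real poly => real poly" where
 "flat_step p = [:0, 0, 1:] * (p - pderiv p)"

lemma poly_exp_tendsto_0: "((%y::real. y ^ k * poly p y * exp (- y)) \<longlongrightarrow> 0) at_top"
proof (induction p arbitrary: k)
 case (pCons a p)
 have "((%y::real. a * (y ^ k / exp y)) \<longlongrightarrow> a * 0) at_top"
  by (intro tendsto_intros tendsto_power_div_exp_0)
 from tendsto_add[OF this pCons.IH[of "Suc k"]] show ?case
  by (simp add: algebra_simps exp_minus divide_inverse)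
qed simp

lemma flat_deriv: "(flat p has_real_derivative flat (flat_step p) x) (at x)"
proof (cases x "0 :: real" rule: linorder_cases)
 case greater
 have "((%x. poly p (1 / x) * exp (- (1 / x))) has_real_derivative flat (flat_step p) x) (at x)"
  using greater by (auto intro!: derivative_eq_intros simp: flat_def flat_step_def power2_eq_square field_simps)
 then show ?thesis
  by (rule has_field_derivative_transform_within_open[of _ _ _ "{0<..}"]) (use greater in \<open>auto simp: flat_def\<close>)
next
 case less
 have "((%x. 0) has_real_derivative 0) (at x)" by simp
 then have "(flat p has_real_derivative 0) (at x)"
  by (rule has_field_derivative_transform_within_open[of _ _ _ "{..<0}"]) (use less in \<open>auto simp: flat_def\<close>)
 then show ?thesis using less by (simp add: flat_def)
next
 case equal
 have "((%h. flat p h / h) \<longlongrightarrow> 0) (at 0)"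
 proof (rule filterlim_split_at)
  show "((%h. flat p h / h) \<longlongrightarrow> 0) (at_left 0)"
   by (rule tendsto_eventually) (auto simp: eventually_at_filter flat_def)
  \<comment> \<open>At 0 the difference quotient is y p(y) exp (-y) with y = 1/h, and the
    exponential wins.\<close>
  have "((%h. (%y. y ^ 1 * poly p y * exp (- y)) (inverse h)) \<longlongrightarrow> 0) (at_right 0)"
   by (rule filterlim_compose[OF poly_exp_tendsto_0 filterlim_inverse_at_top_right])
  then show "((%h. flat p h / h) \<longlongrightarrow> 0) (at_right 0)"
   by (rule Lim_transform_eventually) (auto simp: eventually_at_filter flat_def inverse_eq_divide mult_ac)
 qed
 then show ?thesis using equal by (simp add: has_field_derivative_iff flat_def)
qed

definition flat_chain :: "nat => real => real" where
 "flat_chain n = flat ((flat_step ^^ n) [:1:])"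

lemma flat_chain_deriv: "(flat_chain n has_real_derivative flat_chain (Suc n) x) (at x)"
 unfolding flat_chain_def by (simp add: flat_deriv)

text \<open>The cut-off is used at t = |z - c|^2 / \<rho> and equals 1 at t = 0. It depends on t^2,
  so that \<open>bump1\<close> vanishes linearly at 0; this compensates a logarithm in
  \<open>weak_representation\<close>.\<close>

definition bump :: "real => real" where "bump t = exp 1 * flat_chain 0 (1 - t\<^sup>2)"
definition bump1 :: "real => real" where "bump1 t = exp 1 * (flat_chain 1 (1 - t\<^sup>2) * (- 2 * t))"
definition bump2 :: "real => real" where
 "bump2 t = exp 1 * (flat_chain 2 (1 - t\<^sup>2) * (- 2 * t)\<^sup>2 - 2 * flat_chain 1 (1 - t\<^sup>2))"

lemma bump_deriv: "(bump has_real_derivative bump1 t) (at t)"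
 unfolding bump_def bump1_def
 by (rule derivative_eq_intros DERIV_chain'[OF _ flat_chain_deriv] refl)+ (simp add: algebra_simps)

lemma bump1_deriv: "(bump1 has_real_derivative bump2 t) (at t)"
 unfolding bump1_def bump2_def
 by (rule derivative_eq_intros DERIV_chain'[OF _ flat_chain_deriv] refl)+
  (simp add: algebra_simps power2_eq_square numeral_2_eq_2)

lemma flat_chain_cont: "continuous_on S (flat_chain n)"
 using flat_chain_deriv DERIV_isCont by (blast intro: continuous_at_imp_continuous_on)

lemma bump2_cont: "continuous_on S bump2"
 unfolding bump2_def
 by (intro continuous_intros continuous_on_compose2[OF flat_chain_cont[of UNIV]]) auto

lemma bump_zero: assumes "t \<ge> 1" shows "bump t = 0" "bump1 t = 0" "bump2 t = 0"
proof -
 have "1 - t\<^sup>2 <= 0" using assms by simp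
 then show "bump t = 0" "bump1 t = 0" "bump2 t = 0"
  by (simp_all add: bump_def bump1_def bump2_def flat_chain_def flat_def)
qed

lemma bump_0: "bump 0 = 1" by (simp add: bump_def flat_chain_def flat_def flip: exp_add)

lemma bump_bounds: "0 <= bump t" "bump t <= 1"
proof -
 show "0 <= bump t" by (simp add: bump_def flat_chain_def flat_def)
 show "bump t <= 1"
 proof (cases "1 - t\<^sup>2 > 0")
  case True
  then have "1 <= 1 / (1 - t\<^sup>2)" by (simp add: le_divide_eq)
  then have "exp 1 * exp (- (1 / (1 - t\<^sup>2))) <= 1" by (simp flip: exp_add)
  then show ?thesis using True by (simp add: bump_def flat_chain_def flat_def)
 qed (simp add: bump_def flat_chain_def flat_def)
qed

lemma bump1_nonpos: "0 <= t ==> bump1 t <= 0"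
 by (auto simp: bump1_def flat_chain_def flat_def flat_step_def mult_nonneg_nonpos)

lemma bump_const: obtains C where "0 < C" "!!t. 0 <= t ==> \<bar>bump1 t\<bar> <= C * t" "!!t. 0 <= t ==> \<bar>bump1 t\<bar> <= C"
 "!!t. 0 <= t ==> \<bar>bump2 t\<bar> <= C"
proof -
 have b: "\<exists>K. \<forall>t\<in>{0..1}. \<bar>f t\<bar> <= K" if "continuous_on {0..1} f" for f :: "real => real"
  using compact_imp_bounded[OF compact_continuous_image[OF that compact_Icc]] by (auto simp: bounded_iff)
 \<comment> \<open>The bounded function is \<open>bump1 t / t\<close>, continued to t = 0.\<close>
 obtain K1 where K1: "!!t. t \<in> {0..1} ==> \<bar>exp 1 * (flat_chain 1 (1 - t\<^sup>2) * (- 2))\<bar> <= K1"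
 proof -
  have "continuous_on {0..1} (%t. exp 1 * (flat_chain 1 (1 - t\<^sup>2) * (- 2)))"
   by (intro continuous_intros continuous_on_compose2[OF flat_chain_cont[of UNIV]]) auto
  from b[OF this] show ?thesis using that by blast
 qed
 obtain K2 where K2: "!!t. t \<in> {0..1} ==> \<bar>bump2 t\<bar> <= K2" using b[OF bump2_cont] by blast
 define C where "C = max 1 (max K1 K2)"
 have C: "\<bar>bump1 t\<bar> <= C * t \<and> \<bar>bump1 t\<bar> <= C \<and> \<bar>bump2 t\<bar> <= C" if t: "0 <= t" for t
 proof (cases "t <= 1")
  case True
  have e: "\<bar>bump1 t\<bar> = \<bar>exp 1 * (flat_chain 1 (1 - t\<^sup>2) * (- 2))\<bar> * t"
   using t by (simp add: bump1_def abs_mult)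
  have "\<bar>exp 1 * (flat_chain 1 (1 - t\<^sup>2) * (- 2))\<bar> <= C" using K1[of t] t True unfolding C_def by auto
  from mult_right_mono[OF this t] have 1: "\<bar>bump1 t\<bar> <= C * t" by (simp only: e)
  have "C * t <= C * 1" using True by (intro mult_left_mono) (auto simp: C_def)
  moreover have "\<bar>bump2 t\<bar> <= C" using K2[of t] t True unfolding C_def by (simp add: le_max_iff_disj)
  ultimately show ?thesis using 1 by simp
 next
  case False then show ?thesis using bump_zero[of t] t by (simp add: C_def)
 qed
 show thesis by (rule that[of C]) (use C in \<open>auto simp: C_def\<close>)
qed

lemma Ck_bump: "Ck_on k (%z. bump ((cmod (z - c))\<^sup>2 / \<rho>)) UNIV"
proof -
 have e: "bump ((cmod (z - c))\<^sup>2 / \<rho>) = exp 1 * flat_chain 0 (1 + (- 1 / \<rho>\<^sup>2) * ((cmod (z - c))\<^sup>2 * (cmod (z - c))\<^sup>2))" for z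
  by (simp add: bump_def power2_eq_square)
 show ?thesis unfolding e
  by (intro Ck_mult Ck_const Ck_chain[where q = flat_chain and I = UNIV] flat_chain_deriv Ck_add Ck_cmod2) auto
qed

section \<open>Approximate identities\<close>

lemma integral_pos_continuous:
 fixes f :: "complex => real"
 assumes "continuous_on UNIV f" "!!z. 0 <= f z" "integrable lborel f" "f c > 0"
 shows "0 < (LINT z|lborel. f z)"
proof -
 have "open {z. f c / 2 < f z}" by (intro open_Collect_less continuous_intros assms)
 then obtain e where e: "e > 0" "ball c e \<subseteq> {z. f c / 2 < f z}"
  unfolding open_contains_ball using assms(4) by (metis half_gt_zero_iff less_add_same_cancel1 field_sum_of_halves mem_Collect_eq)
 have i: "integrable lborel (%z. (f c / 2) * indicator (ball c e) z)"
  by (simp add: emeasure_ball unit_ball_vol_2 e less_imp_le)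
 have "0 < (f c / 2) * measure lborel (ball c e)"
  using assms(4) e by (simp add: measure_def emeasure_ball unit_ball_vol_2 less_imp_le)
 also have "\<dots> = (LINT z|lborel. (f c / 2) * indicator (ball c e) z)"
  by (simp add: emeasure_ball unit_ball_vol_2 e less_imp_le)
 also have "\<dots> <= (LINT z|lborel. f z)"
 proof (rule integral_mono[OF i assms(3)])
  fix z show "(f c / 2) * indicator (ball c e) z <= f z"
   using e assms(2)[of z] by (auto simp: indicator_def less_imp_le subset_eq)
 qed
 finally show ?thesis .
qed

lemma set_integrable_mult_bounded:
 fixes f g :: "complex => real"
 assumes "set_integrable lborel A f" "g \<in> borel_measurable borel" "!!z. z \<in> A ==> \<bar>g z\<bar> <= K"
 shows "set_integrable lborel A (%z. f z * g z)"
proof -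
 have 1: "integrable lborel (%z. K * (indicator A z * f z))" using assms(1) by (simp add: set_integrable_def)
 show ?thesis unfolding set_integrable_def real_scaleR_def
 proof (rule Bochner_Integration.integrable_bound[OF 1])
  have "(%z. indicator A z * f z) \<in> borel_measurable lborel" using assms(1) by (auto simp: set_integrable_def dest: borel_measurable_integrable)
  then have "(%z. (indicator A z * f z) * g z) \<in> borel_measurable lborel" using assms(2) by simp
  then show "(%z. indicator A z * (f z * g z)) \<in> borel_measurable lborel" by (simp add: mult.assoc)
  show "AE z in lborel. norm (indicator A z * (f z * g z)) <= norm (K * (indicator A z * f z))"
  proof (rule AE_I2)
   fix z show "norm (indicator A z * (f z * g z)) <= norm (K * (indicator A z * f z))"
   proof (cases "z \<in> A")
    case True
    have "\<bar>g z\<bar> <= \<bar>K\<bar>" using assms(3)[OF True] by linarith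
    then have "\<bar>f z\<bar> * \<bar>g z\<bar> <= \<bar>f z\<bar> * \<bar>K\<bar>" by (intro mult_left_mono) auto
    with True show ?thesis by (simp add: abs_mult mult_ac)
   qed simp
  qed
 qed
qed

lemma lborel_integral_scale:
 fixes f :: "complex => real"
 assumes [measurable]: "f \<in> borel_measurable borel" and c: "c > 0"
 shows "(LINT z|lborel. f z) = c\<^sup>2 * (LINT z|lborel. f (a + c *\<^sub>R z))"
proof -
 have "(LINT z|lborel. f z) = (LINT z|density (distr lborel borel (%x. a + c *\<^sub>R x)) (%_. \<bar>c\<bar> ^ DIM(complex)). f z)"
  using lborel_affine[of c a] c by simp
 also have "\<dots> = (LINT z|lborel. c\<^sup>2 * f (a + c *\<^sub>R z))"
  using c by (subst integral_density) (auto simp: integral_distr)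
 finally show ?thesis by simp
qed

text \<open>The integrand is the Laplacian of (1/2) ln (|z|^2 + 1), a regularised ln |z|; its mass 2
  pi is that of the Laplacian of ln |z|. In t = |z|^2 it has the antiderivative -2 / (t +
  1).\<close>

lemma integral_poisson_kernel:
 "(LINT z|lborel. 2 / ((cmod z)\<^sup>2 + 1)\<^sup>2) = 2 * pi"
 "integrable lborel (%z. 2 / ((cmod z)\<^sup>2 + 1)\<^sup>2)"
proof -
 have "(\<integral>\<^sup>+t. ennreal (2 / (t + 1)\<^sup>2) * indicator {0..} t \<partial>lborel) = ennreal (0 - (- 2 / (0 + 1)))"
 proof (rule nn_integral_FTC_atLeast)
  show "((%t. - 2 / (t + 1)) has_real_derivative 2 / (x + 1)\<^sup>2) (at x)" if x: "0 <= x" for x :: real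
   using x by (auto intro!: derivative_eq_intros simp: power2_eq_square field_simps)
  have "filterlim (%t::real. t + 1) at_top at_top"
   by (rule filterlim_tendsto_add_at_top[OF tendsto_const filterlim_ident, of 1, simplified add.commute])
  then show "((%t::real. - 2 / (t + 1)) \<longlongrightarrow> 0) at_top"
   by (intro tendsto_divide_0[OF tendsto_const] filterlim_at_top_imp_at_infinity)
 qed auto
 then have "(\<integral>\<^sup>+z. ennreal (2 / ((cmod z)\<^sup>2 + 1)\<^sup>2) \<partial>lborel) = ennreal pi * ennreal 2"
  using nn_integral_radial[of "%t. ennreal (2 / (t + 1)\<^sup>2)" 0] by simp
 also have "ennreal pi * ennreal 2 = ennreal (2 * pi)"
  by (subst ennreal_mult[symmetric]) (auto simp: mult.commute)
 finally have e: "(\<integral>\<^sup>+z. ennreal (2 / ((cmod z)\<^sup>2 + 1)\<^sup>2) \<partial>lborel) = ennreal (2 * pi)" .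
 have m: "(%z::complex. 2 / ((cmod z)\<^sup>2 + 1)\<^sup>2) \<in> borel_measurable lborel" by simp
 show "integrable lborel (%z::complex. 2 / ((cmod z)\<^sup>2 + 1)\<^sup>2)"
  by (rule integrableI_nonneg[OF m]) (use e in auto)
 show "(LINT z|lborel. 2 / ((cmod z)\<^sup>2 + 1)\<^sup>2) = 2 * pi"
  by (rule integral_eq_nn_integral[THEN trans]) (use m e in auto)
qed

text \<open>\<open>k\<close> is the Laplacian of (1/2) ln (|z - a|^2 + \<delta>^2) times a cut-off.
  Away from \<open>a\<close> it is uniformly of order \<delta>^2. Near \<open>a\<close>, where
  \<open>u\<close> is bounded, the substitution z = a + \<delta> w turns it into the kernel of mass
  2 pi, and dominated convergence applies.\<close>

lemma kernel_limit:
 fixes u :: "complex => real"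
 assumes int: "set_integrable lborel (cball a r) u" and cont: "isCont u a"
  and \<rho>: "0 < \<rho>" "\<rho> <= r\<^sup>2" "0 < r" and \<delta>: "!!n. 0 < \<delta> n" "\<delta> \<longlonglongrightarrow> 0"
 defines "k \<equiv> %n z. 2 * (\<delta> n)\<^sup>2 * bump ((cmod (z - a))\<^sup>2 / \<rho>) / ((cmod (z - a))\<^sup>2 + (\<delta> n)\<^sup>2)\<^sup>2"
 shows "(%n. (LINT z|lborel. u z * k n z)) \<longlonglongrightarrow> 2 * pi * u a"
proof -
 have bump_cont: "continuous_on UNIV bump"
  using bump_deriv DERIV_isCont by (blast intro: continuous_at_imp_continuous_on)
 have kb: "k n z = 0" if "z \<notin> cball a r" for n z
 proof -
  have "r < cmod (z - a)" using that by (simp add: dist_norm norm_minus_commute)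
  then have "r\<^sup>2 <= (cmod (z - a))\<^sup>2" using \<rho> by (intro power_mono) auto
  with \<rho>(2) have "\<rho> <= (cmod (z - a))\<^sup>2" by (rule order_trans)
  then have "1 <= (cmod (z - a))\<^sup>2 / \<rho>" using \<rho>(1) by (simp add: le_divide_eq)
  then show ?thesis using bump_zero by (simp add: k_def)
 qed
 have [measurable]: "bump \<in> borel_measurable borel" using bump_cont by (rule borel_measurable_continuous_onI)
 have km [measurable]: "k n \<in> borel_measurable borel" for n unfolding k_def by simp
 have k_nonneg: "0 <= k n z" for n z unfolding k_def using bump_bounds by simp
 define U where "U z = indicator (cball a r) z * u z" for z
 have Ui: "integrable lborel U" using int unfolding set_integrable_def U_def[abs_def] by simp
 then have Um [measurable]: "U \<in> borel_measurable borel" by (auto dest: borel_measurable_integrable)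
 have eqU: "u z * k n z = U z * k n z" for n z using kb[of z n] by (cases "z \<in> cball a r") (simp_all add: U_def)
 from cont \<rho> obtain \<eta> where \<eta>: "0 < \<eta>" "\<eta> <= r" "!!z. dist z a < \<eta> ==> \<bar>u z - u a\<bar> < 1"
 proof -
  from cont obtain d where d: "d > 0" "!!z. dist z a < d ==> dist (u z) (u a) < 1"
   unfolding continuous_at_eps_delta by (meson zero_less_one)
  show ?thesis by (rule that[of "min d r"]) (use d \<rho> in \<open>auto simp: dist_real_def\<close>)
 qed
 \<comment> \<open>Near \<open>a\<close> the function is bounded; far away it is only integrable,
   but there the kernel is uniformly small.\<close>
 define U1 where "U1 z = indicator (ball a \<eta>) z * U z" for z
 define U2 where "U2 z = indicator (- ball a \<eta>) z * U z" for z
 have U12: "U z = U1 z + U2 z" for z by (simp add: U1_def U2_def indicator_def)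
 have [measurable]: "U1 \<in> borel_measurable borel" "U2 \<in> borel_measurable borel"
  unfolding U1_def[abs_def] U2_def[abs_def] by (intro borel_measurable_times borel_measurable_indicator Um; simp)+
 have U2i: "integrable lborel U2"
  by (rule Bochner_Integration.integrable_bound[OF Ui]) (auto simp: U2_def indicator_def)
 have U1b: "\<bar>U1 z\<bar> <= \<bar>u a\<bar> + 1" for z
 proof (cases "z \<in> ball a \<eta>")
  case True
  then have "\<bar>u z - u a\<bar> < 1" using \<eta>(3)[of z] by (simp add: dist_commute)
  then have "\<bar>u z\<bar> <= \<bar>u a\<bar> + 1" by linarith
  then show ?thesis by (simp add: U1_def U_def indicator_def)
 qed (simp add: U1_def)
 have d1: "(\<delta> n)\<^sup>2 > 0" for n using \<delta>(1)[of n] by simp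
 have kbound: "\<bar>k n z\<bar> <= 2 * (\<delta> n)\<^sup>2 / (\<eta>\<^sup>2)\<^sup>2" if "z \<notin> ball a \<eta>" for n z
 proof -
  have "\<eta> <= cmod (z - a)" using that by (simp add: dist_norm norm_minus_commute)
  then have "\<eta>\<^sup>2 <= (cmod (z - a))\<^sup>2 + (\<delta> n)\<^sup>2" using \<eta>(1) by (intro add_increasing2 power_mono) auto
  then have "(\<eta>\<^sup>2)\<^sup>2 <= ((cmod (z - a))\<^sup>2 + (\<delta> n)\<^sup>2)\<^sup>2" by (intro power_mono) auto
  moreover have "2 * (\<delta> n)\<^sup>2 * bump ((cmod (z - a))\<^sup>2 / \<rho>) <= 2 * (\<delta> n)\<^sup>2 * 1"
   by (intro mult_left_mono bump_bounds) auto
  ultimately have "k n z <= 2 * (\<delta> n)\<^sup>2 / (\<eta>\<^sup>2)\<^sup>2" unfolding k_def using \<eta>(1)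
   by (intro frac_le) auto
  then show ?thesis using k_nonneg[of n z] by simp
 qed
 have far: "(%n. (LINT z|lborel. U2 z * k n z)) \<longlonglongrightarrow> 0"
 proof -
  have b: "\<bar>U2 z * k n z\<bar> <= 2 * (\<delta> n)\<^sup>2 / (\<eta>\<^sup>2)\<^sup>2 * \<bar>U2 z\<bar>" for n z
  proof (cases "z \<in> ball a \<eta>")
   case False
   then show ?thesis using mult_left_mono[OF kbound[OF False], of "\<bar>U2 z\<bar>" n] by (simp add: abs_mult mult_ac)
  qed (simp add: U2_def)
  have i1: "integrable lborel (%z. 2 * (\<delta> n)\<^sup>2 / (\<eta>\<^sup>2)\<^sup>2 * \<bar>U2 z\<bar>)" for n
   using U2i by (intro integrable_mult_right integrable_abs)
  have "\<bar>LINT z|lborel. U2 z * k n z\<bar> <= 2 * (\<delta> n)\<^sup>2 / (\<eta>\<^sup>2)\<^sup>2 * (LINT z|lborel. \<bar>U2 z\<bar>)" for n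
  proof -
   have "integrable lborel (%z. U2 z * k n z)"
   proof (rule Bochner_Integration.integrable_bound[OF i1])
    show "AE z in lborel. norm (U2 z * k n z) <= norm (2 * (\<delta> n)\<^sup>2 / (\<eta>\<^sup>2)\<^sup>2 * \<bar>U2 z\<bar>)"
     using b by (auto simp: abs_mult intro!: AE_I2)
   qed simp
   then have "\<bar>LINT z|lborel. U2 z * k n z\<bar> <= (LINT z|lborel. \<bar>U2 z * k n z\<bar>)" by simp
   also have "\<dots> <= (LINT z|lborel. 2 * (\<delta> n)\<^sup>2 / (\<eta>\<^sup>2)\<^sup>2 * \<bar>U2 z\<bar>)"
    by (rule integral_mono) (use b i1 \<open>integrable lborel (%z. U2 z * k n z)\<close> in auto)
   finally show ?thesis by simp
  qed
  then have ev: "\<forall>\<^sub>F n in sequentially. norm (LINT z|lborel. U2 z * k n z) <= 2 * (\<delta> n)\<^sup>2 / (\<eta>\<^sup>2)\<^sup>2 * (LINT z|lborel. \<bar>U2 z\<bar>)"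
   by simp
  have "(%n. 2 * (\<delta> n)\<^sup>2 / (\<eta>\<^sup>2)\<^sup>2 * (LINT z|lborel. \<bar>U2 z\<bar>)) \<longlonglongrightarrow> 2 * 0\<^sup>2 / (\<eta>\<^sup>2)\<^sup>2 * (LINT z|lborel. \<bar>U2 z\<bar>)"
   by (intro tendsto_intros \<delta>) (use \<eta> in auto)
  then have "(%n. 2 * (\<delta> n)\<^sup>2 / (\<eta>\<^sup>2)\<^sup>2 * (LINT z|lborel. \<bar>U2 z\<bar>)) \<longlonglongrightarrow> 0" by simp
  then show ?thesis by (rule Lim_null_comparison[OF ev])
 qed
 have near: "(%n. (LINT z|lborel. U1 z * k n z)) \<longlonglongrightarrow> 2 * pi * u a"
 proof -
  define s where "s n z = U1 (a + \<delta> n *\<^sub>R z) * bump (((\<delta> n)\<^sup>2 * (cmod z)\<^sup>2) / \<rho>) * (2 / ((cmod z)\<^sup>2 + 1)\<^sup>2)" for n z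
  have "(LINT z|lborel. U1 z * k n z) = (LINT z|lborel. s n z)" for n
  proof -
   have "(\<delta> n)\<^sup>2 * (U1 (a + \<delta> n *\<^sub>R z) * k n (a + \<delta> n *\<^sub>R z)) = s n z" for z
   proof -
    have "(cmod (a + \<delta> n *\<^sub>R z - a))\<^sup>2 = (\<delta> n)\<^sup>2 * (cmod z)\<^sup>2" by (simp add: power_mult_distrib)
    then have "k n (a + \<delta> n *\<^sub>R z) = 2 * (\<delta> n)\<^sup>2 * bump ((\<delta> n)\<^sup>2 * (cmod z)\<^sup>2 / \<rho>) / ((\<delta> n)\<^sup>2 * ((cmod z)\<^sup>2 + 1))\<^sup>2"
     by (simp add: k_def algebra_simps)
    moreover have "D * (x * (2 * D * B / (D * T)\<^sup>2)) = x * B * (2 / T\<^sup>2)" if "D > 0" for D x B T :: real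
     using that by (cases "T = 0") (simp_all add: power_mult_distrib power2_eq_square field_simps)
    ultimately show ?thesis using d1[of n] by (simp only: s_def)
   qed
   moreover have "(LINT z|lborel. U1 z * k n z) = (\<delta> n)\<^sup>2 * (LINT z|lborel. U1 (a + \<delta> n *\<^sub>R z) * k n (a + \<delta> n *\<^sub>R z))"
    by (rule lborel_integral_scale) (use \<delta> in auto)
   ultimately show ?thesis by (simp flip: integral_mult_right_zero)
  qed
  moreover have "(%n. (LINT z|lborel. s n z)) \<longlonglongrightarrow> (LINT z|lborel. u a * (2 / ((cmod z)\<^sup>2 + 1)\<^sup>2))"
  proof (rule integral_dominated_convergence[where w = "%z. (\<bar>u a\<bar> + 1) * (2 / ((cmod z)\<^sup>2 + 1)\<^sup>2)"])
   show "integrable lborel (%z. (\<bar>u a\<bar> + 1) * (2 / ((cmod z)\<^sup>2 + 1)\<^sup>2))"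
    using integral_poisson_kernel(2) by (rule integrable_mult_right)
   show "s n \<in> borel_measurable lborel" for n unfolding s_def by simp
   show "AE z in lborel. norm (s n z) <= (\<bar>u a\<bar> + 1) * (2 / ((cmod z)\<^sup>2 + 1)\<^sup>2)" for n
   proof (rule AE_I2)
    fix z
    have "\<bar>U1 (a + \<delta> n *\<^sub>R z)\<bar> * bump (((\<delta> n)\<^sup>2 * (cmod z)\<^sup>2) / \<rho>) <= (\<bar>u a\<bar> + 1) * 1"
     by (intro mult_mono U1b bump_bounds) auto
    then have "\<bar>U1 (a + \<delta> n *\<^sub>R z)\<bar> * bump (((\<delta> n)\<^sup>2 * (cmod z)\<^sup>2) / \<rho>) * (2 / ((cmod z)\<^sup>2 + 1)\<^sup>2) <= (\<bar>u a\<bar> + 1) * 1 * (2 / ((cmod z)\<^sup>2 + 1)\<^sup>2)"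
     by (intro mult_right_mono) auto
    then show "norm (s n z) <= (\<bar>u a\<bar> + 1) * (2 / ((cmod z)\<^sup>2 + 1)\<^sup>2)"
     using bump_bounds by (simp add: s_def abs_mult)
   qed
   show "AE z in lborel. (%n. s n z) \<longlonglongrightarrow> u a * (2 / ((cmod z)\<^sup>2 + 1)\<^sup>2)"
   proof (rule AE_I2)
    fix z
    have "(%n. a + \<delta> n *\<^sub>R z) \<longlonglongrightarrow> a + 0 *\<^sub>R z" by (intro tendsto_intros \<delta>)
    then have l: "(%n. a + \<delta> n *\<^sub>R z) \<longlonglongrightarrow> a" by simp
    have "(%n. u (a + \<delta> n *\<^sub>R z)) \<longlonglongrightarrow> u a" by (rule isCont_tendsto_compose[OF cont l])
    moreover have "\<forall>\<^sub>F n in sequentially. u (a + \<delta> n *\<^sub>R z) = U1 (a + \<delta> n *\<^sub>R z)"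
     using tendstoD[OF l \<eta>(1)]
    proof (rule eventually_mono)
     fix n assume "dist (a + \<delta> n *\<^sub>R z) a < \<eta>"
     then have "a + \<delta> n *\<^sub>R z \<in> ball a \<eta>" "a + \<delta> n *\<^sub>R z \<in> cball a r" using \<eta>(2) by (auto simp: dist_commute)
     then show "u (a + \<delta> n *\<^sub>R z) = U1 (a + \<delta> n *\<^sub>R z)" by (simp add: U1_def U_def)
    qed
    ultimately have 1: "(%n. U1 (a + \<delta> n *\<^sub>R z)) \<longlonglongrightarrow> u a" by (rule Lim_transform_eventually)
    have "(%n. (\<delta> n)\<^sup>2 * (cmod z)\<^sup>2 / \<rho>) \<longlonglongrightarrow> 0\<^sup>2 * (cmod z)\<^sup>2 / \<rho>" by (intro tendsto_intros \<delta>) (use \<rho> in auto)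
    then have "(%n. (\<delta> n)\<^sup>2 * (cmod z)\<^sup>2 / \<rho>) \<longlonglongrightarrow> 0" by simp
    moreover have "isCont bump 0" using bump_deriv DERIV_isCont by blast
    ultimately have 2: "(%n. bump ((\<delta> n)\<^sup>2 * (cmod z)\<^sup>2 / \<rho>)) \<longlonglongrightarrow> bump 0"
     using isCont_tendsto_compose by blast
    show "(%n. s n z) \<longlonglongrightarrow> u a * (2 / ((cmod z)\<^sup>2 + 1)\<^sup>2)"
     using tendsto_mult[OF tendsto_mult[OF 1 2] tendsto_const[of "2 / ((cmod z)\<^sup>2 + 1)\<^sup>2"]]
     unfolding s_def bump_0 mult_1_right .
   qed
  qed simp
  moreover have "(LINT z|lborel. u a * (2 / ((cmod z)\<^sup>2 + 1)\<^sup>2)) = 2 * pi * u a"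
   by (simp only: integral_mult_right_zero integral_poisson_kernel(1) mult.commute)
  ultimately show ?thesis by simp
 qed
 have split: "(LINT z|lborel. u z * k n z) = (LINT z|lborel. U1 z * k n z) + (LINT z|lborel. U2 z * k n z)" for n
 proof -
  have kub: "\<bar>k n z\<bar> <= 2 / (\<delta> n)\<^sup>2" for z
  proof -
   have "((\<delta> n)\<^sup>2)\<^sup>2 <= ((cmod (z - a))\<^sup>2 + (\<delta> n)\<^sup>2)\<^sup>2" by (intro power_mono) auto
   moreover have "2 * (\<delta> n)\<^sup>2 * bump ((cmod (z - a))\<^sup>2 / \<rho>) <= 2 * (\<delta> n)\<^sup>2 * 1"
    by (intro mult_left_mono bump_bounds) auto
   ultimately have "k n z <= 2 * (\<delta> n)\<^sup>2 / ((\<delta> n)\<^sup>2)\<^sup>2" unfolding k_def using d1[of n]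
    by (intro frac_le) auto
   moreover have "2 * D / D\<^sup>2 = 2 / D" if "D > 0" for D :: real
    using that by (simp add: power2_eq_square)
   ultimately have "k n z <= 2 / (\<delta> n)\<^sup>2" using d1[of n] by (simp only:)
   then show ?thesis using k_nonneg[of n z] by simp
  qed
  have U1i: "integrable lborel U1"
   by (rule Bochner_Integration.integrable_bound[OF Ui]) (auto simp: U1_def indicator_def)
  have "set_integrable lborel UNIV (%z. U1 z * k n z)" "set_integrable lborel UNIV (%z. U2 z * k n z)"
   by (rule set_integrable_mult_bounded[OF _ km kub]; use U1i U2i in \<open>simp add: set_integrable_def\<close>)+
  then have "integrable lborel (%z. U1 z * k n z)" "integrable lborel (%z. U2 z * k n z)"
   by (simp_all add: set_integrable_def)
  then show ?thesis unfolding eqU by (simp add: U12 distrib_right)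
 qed
 show ?thesis unfolding split using tendsto_add[OF near far] by simp
qed

context torus_lattice
begin

section \<open>Weak solutions\<close>

text \<open>The lattice point to be subtracted from \<open>z\<close> in order to land in the fundamental
 parallelogram centred at \<open>c\<close>.\<close>

definition nearest :: "complex => complex => complex" where
 "nearest c z = of_int \<lfloor>cs (z - c) + 1 / 2\<rfloor> * \<omega>\<^sub>1 + of_int \<lfloor>ct (z - c) + 1 / 2\<rfloor> * \<omega>\<^sub>2"

text \<open>For \<open>f\<close> supported near \<open>c\<close> this is the sum of its lattice
  translates, at most one of which is nonzero at a given point.\<close>

definition periodize :: "complex => (complex => real) => complex => real" where
 "periodize c f z = f (z - nearest c z)"

lemma nearest_in: "nearest c z \<in> \<Lambda>" by (auto simp: nearest_def lattice_def)

lemma nearest_add: assumes "w \<in> \<Lambda>" shows "nearest c (z + w) = nearest c z + w"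
proof -
 obtain m n where mn: "cs w = of_int m" "ct w = of_int n" using assms by (auto simp: lattice_iff elim!: Ints_cases)
 have "cs (z + w - c) + 1 / 2 = of_int m + (cs (z - c) + 1 / 2)" "ct (z + w - c) + 1 / 2 = of_int n + (ct (z - c) + 1 / 2)"
  by (simp_all add: cs_simps ct_simps mn)
 then have "\<lfloor>cs (z + w - c) + 1 / 2\<rfloor> = m + \<lfloor>cs (z - c) + 1 / 2\<rfloor>" "\<lfloor>ct (z + w - c) + 1 / 2\<rfloor> = n + \<lfloor>ct (z - c) + 1 / 2\<rfloor>"
  by (simp_all only: int_add_floor)
 then show ?thesis using coords[of w] mn by (simp add: nearest_def algebra_simps)
qed

lemma periodize_periodic: "periodic (periodize c f)"
 by (rule periodicI) (simp add: periodize_def nearest_add)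

lemma nearest_0: assumes "\<bar>cs (z - c)\<bar> < 1 / 2" "\<bar>ct (z - c)\<bar> < 1 / 2" shows "nearest c z = 0"
proof -
 have "\<lfloor>cs (z - c) + 1 / 2\<rfloor> = 0" "\<lfloor>ct (z - c) + 1 / 2\<rfloor> = 0" using assms by (auto simp: floor_eq_iff)
 then show ?thesis by (simp add: nearest_def)
qed

lemma nearest_0_ball: assumes "cmod (z - c) <= rmin / 3" shows "nearest c z = 0"
proof (rule nearest_0)
 have "cmod (z - c) / rmin <= 1 / 3" using assms rmin_pos by (simp add: field_simps)
 then show "\<bar>cs (z - c)\<bar> < 1 / 2" "\<bar>ct (z - c)\<bar> < 1 / 2" using coord_bound[of "z - c"] by linarith+
qed

text \<open>Where \<open>nearest\<close> jumps, a coordinate relative to \<open>c\<close> is 1/2,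
  whereas \<open>f\<close> vanishes as soon as a coordinate exceeds 1/3. The margin 1/6 is the size
  of the neighbourhood \<open>N\<close>; on it either the same lattice point is subtracted or both
  values are 0.\<close>

lemma periodize_local:
 assumes supp: "!!z. rmin / 3 <= cmod (z - c) ==> f z = 0"
 obtains N where "open N" "z0 \<in> N" "!!z. z \<in> N ==> periodize c f z = f (z - nearest c z0)"
proof
 define N where "N = {z. \<bar>cs z - cs z0\<bar> < 1 / 6} \<inter> {z. \<bar>ct z - ct z0\<bar> < 1 / 6}"
 show "open N" unfolding N_def by (intro open_Int open_Collect_less continuous_intros)
 show "z0 \<in> N" by (simp add: N_def)
 have far: "f x = 0" if "1 / 3 < \<bar>cs (x - c)\<bar> \<or> 1 / 3 < \<bar>ct (x - c)\<bar>" for x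
 proof (rule supp)
  have "1 / 3 < cmod (x - c) / rmin" using that coord_bound[of "x - c"] by linarith
  then show "rmin / 3 <= cmod (x - c)" using rmin_pos by (simp add: field_simps)
 qed
 fix z assume z: "z \<in> N"
 define m where "m = \<lfloor>cs (z - c) + 1 / 2\<rfloor>"
 define n where "n = \<lfloor>ct (z - c) + 1 / 2\<rfloor>"
 define m0 where "m0 = \<lfloor>cs (z0 - c) + 1 / 2\<rfloor>"
 define n0 where "n0 = \<lfloor>ct (z0 - c) + 1 / 2\<rfloor>"
 note mn = m_def n_def m0_def n0_def
 have e: "nearest c z = of_int m * \<omega>\<^sub>1 + of_int n * \<omega>\<^sub>2" "nearest c z0 = of_int m0 * \<omega>\<^sub>1 + of_int n0 * \<omega>\<^sub>2"
  by (simp_all add: nearest_def mn)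
 have b: "\<bar>cs (z - c) - of_int m\<bar> <= 1 / 2" "\<bar>ct (z - c) - of_int n\<bar> <= 1 / 2" "\<bar>cs (z0 - c) - of_int m0\<bar> <= 1 / 2" "\<bar>ct (z0 - c) - of_int n0\<bar> <= 1 / 2"
  unfolding mn by linarith+
 have d: "\<bar>cs (z - c) - cs (z0 - c)\<bar> < 1 / 6" "\<bar>ct (z - c) - ct (z0 - c)\<bar> < 1 / 6"
  using z by (auto simp: N_def cs_simps ct_simps)
 show "periodize c f z = f (z - nearest c z0)"
 proof (cases "m = m0 \<and> n = n0")
  case True then show ?thesis by (simp add: periodize_def e)
 next
  case False
  have c1: "cs (z - nearest c z - c) = cs (z - c) - of_int m" "cs (z - nearest c z0 - c) = cs (z - c) - of_int m0"
   "ct (z - nearest c z - c) = ct (z - c) - of_int n" "ct (z - nearest c z0 - c) = ct (z - c) - of_int n0"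
   by (simp_all add: e cs_simps ct_simps)
  have g: "1 / 3 < \<bar>x - real_of_int p\<bar> \<and> 1 / 3 < \<bar>x - real_of_int p0\<bar>"
   if "p ~= p0" "\<bar>x - of_int p\<bar> <= 1 / 2" "\<bar>y - of_int p0\<bar> <= 1 / 2" "\<bar>x - y\<bar> < 1 / 6" for x y :: real and p p0 :: int
  proof -
   have "\<bar>real_of_int p - real_of_int p0\<bar> \<ge> 1" using that(1) by linarith
   then show ?thesis using that(2-4) by linarith
  qed
  have "f (z - nearest c z) = 0" "f (z - nearest c z0) = 0"
   using g[of m m0 "cs (z - c)" "cs (z0 - c)"] g[of n n0 "ct (z - c)" "ct (z0 - c)"] b d False c1
   by (auto intro!: far)
  then show ?thesis by (simp add: periodize_def)
 qed
qed

lemma Ck_periodize: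
 assumes supp: "!!z. rmin / 3 <= cmod (z - c) ==> f z = 0" and "Ck_on k f UNIV"
 shows "Ck_on k (periodize c f) UNIV"
proof (rule Ck_on_local)
 fix z0
 obtain N where "open N" "z0 \<in> N" "!!z. z \<in> N ==> periodize c f z = f (z - nearest c z0)"
  by (rule periodize_local[of c f z0, OF supp]) (assumption, blast)
 then show "\<exists>N \<kappa>. open N \<and> z0 \<in> N \<and> Ck_on k \<kappa> UNIV \<and> (\<forall>w\<in>N. \<kappa> w = periodize c f w)"
  using Ck_shift[OF assms(2)] by (intro exI[of _ N] exI[of _ "%z. f (z - nearest c z0)"]) auto
qed

lemma ball_shift_P: assumes "z \<in> cball c r" "r <= rmin / 3" shows "z - (c - (\<omega>\<^sub>1 + \<omega>\<^sub>2) / 2) \<in> P"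
proof -
 have "cmod (z - c) <= rmin / 3" using assms by (simp add: dist_norm norm_minus_commute)
 then have "cmod (z - c) / rmin <= 1 / 3" using rmin_pos by (simp add: field_simps)
 then have b: "\<bar>cs (z - c)\<bar> <= 1 / 3" "\<bar>ct (z - c)\<bar> <= 1 / 3" using coord_bound[of "z - c"] by linarith+
 have h: "cs ((\<omega>\<^sub>1 + \<omega>\<^sub>2) / 2) = 1 / 2" "ct ((\<omega>\<^sub>1 + \<omega>\<^sub>2) / 2) = 1 / 2"
  using cs_simps(4)[of "1/2" "\<omega>\<^sub>1 + \<omega>\<^sub>2"] ct_simps(4)[of "1/2" "\<omega>\<^sub>1 + \<omega>\<^sub>2"] by (simp_all add: cs_simps ct_simps)
 have "z - (c - (\<omega>\<^sub>1 + \<omega>\<^sub>2) / 2) = (z - c) + (\<omega>\<^sub>1 + \<omega>\<^sub>2) / 2" by simp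
 then have "cs (z - (c - (\<omega>\<^sub>1 + \<omega>\<^sub>2) / 2)) = cs (z - c) + 1 / 2" "ct (z - (c - (\<omega>\<^sub>1 + \<omega>\<^sub>2) / 2)) = ct (z - c) + 1 / 2"
  using h by (simp_all only: cs_simps(1) ct_simps(1))
 then show ?thesis unfolding parallelogram_iff using b by linarith
qed

lemma shift_P_integral:
 fixes F :: "complex => real"
 assumes "periodic F" "set_integrable lborel P F"
 shows "integrable lborel (%z. indicator P (z - h) * F z)"
  "(LINT z|lborel. indicator P (z - h) * F z) = sint P F"
proof -
 have i: "integrable lborel (%z. indicator P z * F (z + h))"
  using torus_shift(1)[OF assms, of h] by (simp add: set_integrable_def)
 from lborel_translate(1)[OF i, of "- h"] show I: "integrable lborel (%z. indicator P (z - h) * F z)" by simp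
 have "(LINT z|lborel. indicator P (z - h) * F z) = (LINT z|lborel. indicator P z * F (z + h))"
  using lborel_translate(2)[of "%z. indicator P (z - h) * F z" h] I by (auto dest: borel_measurable_integrable)
 then show "(LINT z|lborel. indicator P (z - h) * F z) = sint P F"
  using torus_shift(2)[OF assms, of h] by (simp add: set_lebesgue_integral_def)
qed

lemma ball_integral_le:
 fixes F :: "complex => real"
 assumes "periodic F" "set_integrable lborel P F" "r <= rmin / 3"
 shows "set_integrable lborel (cball c r) F"
  "sint (cball c r) (%z. \<bar>F z\<bar>) <= sint P (%z. \<bar>F z\<bar>)"
proof -
 let ?h = "c - (\<omega>\<^sub>1 + \<omega>\<^sub>2) / 2"
 have i: "integrable lborel (%z. indicator P (z - ?h) * F z)" by (rule shift_P_integral[OF assms(1,2)])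
 have "integrable lborel (%z. indicator (cball c r) z * (indicator P (z - ?h) * F z))"
  using integrable_mult_indicator[OF _ i, of "cball c r"] by simp
 moreover have "indicator (cball c r) z * (indicator P (z - ?h) * F z) = indicator (cball c r) z *\<^sub>R F z" for z
  using ball_shift_P[OF _ assms(3), of z c] by (simp add: indicator_def)
 ultimately show s: "set_integrable lborel (cball c r) F" by (simp add: set_integrable_def)
 have pa: "periodic (%z. \<bar>F z\<bar>)" using assms(1) by (simp add: doubly_periodic_def)
 have ia: "set_integrable lborel P (%z. \<bar>F z\<bar>)" using assms(2) by (rule set_integrable_abs)
 have "sint (cball c r) (%z. \<bar>F z\<bar>) <= (LINT z|lborel. indicator P (z - ?h) * \<bar>F z\<bar>)"
  unfolding set_lebesgue_integral_def
 proof (rule integral_mono)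
  show "integrable lborel (%z. indicator (cball c r) z *\<^sub>R \<bar>F z\<bar>)"
   using set_integrable_abs[OF s] by (simp add: set_integrable_def)
  show "integrable lborel (%z. indicator P (z - ?h) * \<bar>F z\<bar>)" by (rule shift_P_integral[OF pa ia])
  show "indicator (cball c r) z *\<^sub>R \<bar>F z\<bar> <= indicator P (z - ?h) * \<bar>F z\<bar>" for z
   using ball_shift_P[OF _ assms(3), of z c] by (simp add: indicator_def)
 qed
 then show "sint (cball c r) (%z. \<bar>F z\<bar>) <= sint P (%z. \<bar>F z\<bar>)"
  unfolding shift_P_integral(2)[OF pa ia] .
qed

text \<open>The parallelogram centred at \<open>c\<close> replaces \<open>P\<close>. It contains the
  ball, and two of its points that differ by a lattice point coincide, so the ball carries the whole
  integral.\<close>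

lemma unfold_integral:
 fixes F :: "complex => real"
 assumes "periodic F" "set_integrable lborel P F" "r <= rmin / 3"
  and supp: "!!z. (!!w. w \<in> \<Lambda> ==> z - w \<notin> cball c r) ==> F z = 0"
 shows "sint P F = sint (cball c r) F"
proof -
 let ?h = "c - (\<omega>\<^sub>1 + \<omega>\<^sub>2) / 2"
 have eq: "indicator P (z - ?h) * F z = indicator (cball c r) z *\<^sub>R F z" for z
 proof (cases "z \<in> cball c r")
  case True then show ?thesis using ball_shift_P[OF True assms(3)] by simp
 next
  case nb: False
  show ?thesis
  proof (cases "z - ?h \<in> P \<and> F z ~= 0")
   case True
   then obtain w where w: "w \<in> \<Lambda>" "z - w \<in> cball c r" using supp by blast
   from ball_shift_P[OF w(2) assms(3)] have "z - ?h - w \<in> P" by (simp add: algebra_simps)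
   then have "0 <= cs (z - ?h) - cs w" "cs (z - ?h) - cs w < 1" "0 <= ct (z - ?h) - ct w" "ct (z - ?h) - ct w < 1"
    by (simp_all add: parallelogram_iff cs_simps ct_simps)
   moreover have "0 <= cs (z - ?h)" "cs (z - ?h) < 1" "0 <= ct (z - ?h)" "ct (z - ?h) < 1"
    using True by (simp_all add: parallelogram_iff)
   moreover obtain m n where "cs w = of_int m" "ct w = of_int n" using w(1) by (auto simp: lattice_iff elim!: Ints_cases)
   ultimately have "cs w = 0" "ct w = 0" by auto
   then have "w = 0" using coords[of w] by simp
   with w nb show ?thesis by simp
  qed (use nb in auto)
 qed
 show ?thesis using shift_P_integral(2)[OF assms(1,2), of ?h] unfolding eq set_lebesgue_integral_def by simp
qed

text \<open>The test function is the periodisation of q (|z - a|^2). In t = |z - a|^2 its Laplacian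
  is 4 (t q'' + q'), and the small support reduces the torus integrals to one ball. The Dirac term
  is the value at the lattice point inside the parallelogram centred at \<open>a\<close>.\<close>

lemma weak_radial:
 assumes weak: "weak_laplacian \<omega>\<^sub>1 \<omega>\<^sub>2 u c0 0 h" and per: "periodic u" "periodic h"
  and q1: "!!t. 0 <= t ==> (q has_real_derivative q1 t) (at t)"
  and q2: "!!t. 0 <= t ==> (q1 has_real_derivative q2 t) (at t)" and q2c: "continuous_on {0..} q2"
  and smooth: "!!k w. Ck_on k (%z. q ((cmod (z - w))\<^sup>2)) UNIV"
  and supp: "!!t. r\<^sup>2 <= t ==> q t = 0" and r: "0 < r" "r < rmin / 3"
 defines "L \<equiv> %t. 4 * (q2 t * t + q1 t)"
 shows "set_integrable lborel (cball a r) (%z. u z * L ((cmod (z - a))\<^sup>2))"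
  "set_integrable lborel (cball a r) (%z. h z * q ((cmod (z - a))\<^sup>2))"
  "sint (cball a r) (%z. u z * L ((cmod (z - a))\<^sup>2)) =
   c0 * q ((cmod (0 - nearest a 0 - a))\<^sup>2) + sint (cball a r) (%z. h z * q ((cmod (z - a))\<^sup>2))"
proof -
 have supp': "q ((cmod (z - c))\<^sup>2) = 0" if "r <= cmod (z - c)" for z c
  using that r by (intro supp power_mono) auto
 \<comment> \<open>Beyond r^2 the function \<open>q\<close> vanishes on an open set, hence so do its
   derivatives.\<close>
 have q12: "q1 t = 0" "q2 t = 0" if "r\<^sup>2 < t" for t
 proof -
  have pos: "0 <= t'" if "r\<^sup>2 < t'" for t' using that by (meson less_imp_le order_trans zero_le_power2)
  have e1: "q1 t = 0" if "r\<^sup>2 < t" for t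
  proof -
   have "((%_. 0) has_real_derivative q1 t) (at t)"
    by (rule has_field_derivative_transform_within_open[OF q1[OF pos[OF that]], of "{r\<^sup>2<..}"])
     (use that supp in auto)
   then show ?thesis using DERIV_unique[OF _ DERIV_const] by blast
  qed
  have "((%_. 0) has_real_derivative q2 t) (at t)"
   by (rule has_field_derivative_transform_within_open[OF q2[OF pos[OF that]], of "{r\<^sup>2<..}"])
    (use that e1 in auto)
  then show "q1 t = 0" "q2 t = 0" using DERIV_unique[OF _ DERIV_const] e1[OF that] by blast+
 qed
 define \<phi> where "\<phi> = periodize a (%z. q ((cmod (z - a))\<^sup>2))"
 have fs: "q ((cmod (z - a))\<^sup>2) = 0" if "rmin / 3 <= cmod (z - a)" for z
  using that r by (intro supp') auto
 have \<phi>_per: "periodic \<phi>" unfolding \<phi>_def by (rule periodize_periodic)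
 have \<phi>_smooth: "Ck_on k \<phi> UNIV" for k unfolding \<phi>_def by (rule Ck_periodize[OF fs smooth])
 have q2w: "continuous_on UNIV (%z::complex. q2 ((cmod (z - w))\<^sup>2))" for w
  by (rule continuous_on_compose2[OF q2c]) (auto intro!: continuous_intros)
 have q1c: "continuous_on {0..} q1"
  using q2 DERIV_isCont by (force intro!: continuous_at_imp_continuous_on)
 have q1w: "continuous_on UNIV (%z::complex. q1 ((cmod (z - w))\<^sup>2))" for w
  by (rule continuous_on_compose2[OF q1c]) (auto intro!: continuous_intros)
 have W1: "has_wirt (%z. of_real (q ((cmod (z - w))\<^sup>2))) (of_real (q1 ((cmod (z - w))\<^sup>2)) * cnj (z - w)) (cnj (of_real (q1 ((cmod (z - w))\<^sup>2)) * cnj (z - w))) z" for w z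
  using wirt_radial[OF q1[of "(cmod (z - w))\<^sup>2"]] by simp
 have idw: "has_wirt (%z. cnj (z - w)) 0 1 z" for z w
  by (rule wirt_eq_rhs[OF wirt_cnj[OF wirt_holo[of "%z. z - w" 1 z]]]) (auto intro!: derivative_eq_intros)
 have W2: "has_wirt (%z. of_real (q1 ((cmod (z - w))\<^sup>2)) * cnj (z - w)) (of_real (q2 ((cmod (z - w))\<^sup>2)) * (cnj (z - w))\<^sup>2)
  (of_real (L ((cmod (z - w))\<^sup>2) / 4)) z" for w z
 proof (rule wirt_eq_rhs[OF wirt_mult[OF wirt_radial[OF q2] idw]])
  have n: "(z - w) * cnj (z - w) = of_real ((cmod (z - w))\<^sup>2)" by (simp only: complex_norm_square)
  show "of_real (q1 ((cmod (z - w))\<^sup>2)) * 1 + of_real (q2 ((cmod (z - w))\<^sup>2)) * (z - w) * cnj (z - w) = of_real (L ((cmod (z - w))\<^sup>2) / 4)"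
   unfolding mult.assoc n L_def by simp
 qed (simp_all add: power2_eq_square)
 have lap: "laplacian \<phi> z = L ((cmod (z - nearest a z - a))\<^sup>2)" for z
 proof -
  obtain N where N: "open N" "z \<in> N" "!!x. x \<in> N ==> \<phi> x = q ((cmod (x - nearest a z - a))\<^sup>2)"
   unfolding \<phi>_def by (rule periodize_local[of a "%z. q ((cmod (z - a))\<^sup>2)" z, OF fs]) (assumption, blast)
  define w where "w = nearest a z + a"
  have N': "\<phi> x = q ((cmod (x - w))\<^sup>2)" if "x \<in> N" for x using N(3)[OF that] by (simp add: w_def algebra_simps)
  have "laplacian \<phi> z = 4 * Re (of_real (L ((cmod (z - w))\<^sup>2) / 4))"
  proof (rule Ck2_laplacian_I(2)[OF N(1) _ W2 _ _ N(2)])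
   fix x assume x: "x \<in> N"
   show "has_wirt (%z. of_real (\<phi> z)) (of_real (q1 ((cmod (x - w))\<^sup>2)) * cnj (x - w)) (cnj (of_real (q1 ((cmod (x - w))\<^sup>2)) * cnj (x - w))) x"
    by (rule wirt_transform[OF W1 N(1) x]) (simp add: N')
  next
   show "continuous_on N (%z. of_real (q2 ((cmod (z - w))\<^sup>2)) * (cnj (z - w))\<^sup>2)"
    by (intro continuous_intros continuous_on_subset[OF q2w]) auto
   show "continuous_on N (%z. complex_of_real (L ((cmod (z - w))\<^sup>2) / 4))"
    unfolding L_def by (intro continuous_intros continuous_on_subset[OF q2w] continuous_on_subset[OF q1w]) auto
  qed
  then show ?thesis by (simp add: w_def algebra_simps)
 qed
 have lap_per: "periodic (laplacian \<phi>)" by (rule periodicI) (simp add: lap nearest_add)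
 have "Ck_on 2 \<phi> UNIV" by (rule \<phi>_smooth)
 then have lap_cont: "continuous_on UNIV (laplacian \<phi>)"
  unfolding Ck_2_iff laplacian_def[abs_def] by (intro continuous_intros) auto
 obtain K where K: "!!z. norm (laplacian \<phi> z) <= K" using continuous_periodic_bounded[OF lap_per lap_cont] by blast
 have "Ck_on 0 \<phi> UNIV" by (rule \<phi>_smooth)
 then have \<phi>_cont: "continuous_on UNIV \<phi>" by simp
 obtain K' where K': "!!z. norm (\<phi> z) <= K'" using continuous_periodic_bounded[OF \<phi>_per \<phi>_cont] by blast
 have wI: "set_integrable lborel P u" "set_integrable lborel P h"
  using weak by (auto simp: weak_laplacian_def torus_integrable_def)
 have I1: "set_integrable lborel P (%z. u z * laplacian \<phi> z)"
  by (rule set_integrable_mult_bounded[OF wI(1) borel_measurable_continuous_onI[OF lap_cont]]) (use K in auto)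
 have I2: "set_integrable lborel P (%z. h z * \<phi> z)"
  by (rule set_integrable_mult_bounded[OF wI(2) borel_measurable_continuous_onI[OF \<phi>_cont]]) (use K' in auto)
 have p1: "periodic (%z. u z * laplacian \<phi> z)" "periodic (%z. h z * \<phi> z)"
  using per lap_per \<phi>_per by (auto simp: doubly_periodic_def)
 have eq: "nearest a z = 0" if "z \<in> cball a r" for z
  using that r by (intro nearest_0_ball) (simp add: dist_norm norm_minus_commute)
 have e1: "u z * laplacian \<phi> z = u z * L ((cmod (z - a))\<^sup>2)" "h z * \<phi> z = h z * q ((cmod (z - a))\<^sup>2)" if "z \<in> cball a r" for z
  using eq[OF that] by (simp_all only: lap) (simp_all add: \<phi>_def periodize_def)
 have far: "r < cmod (z - nearest a z - a)" if "!!w. w \<in> \<Lambda> ==> z - w \<notin> cball a r" for z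
  using that[OF nearest_in[of a z]] by (simp add: dist_norm norm_minus_commute algebra_simps)
 have s: "u z * laplacian \<phi> z = 0" "h z * \<phi> z = 0" if "!!w. w \<in> \<Lambda> ==> z - w \<notin> cball a r" for z
 proof -
  have "r\<^sup>2 < (cmod (z - nearest a z - a))\<^sup>2" using far[OF that] r by (intro power_strict_mono) auto
  then show "u z * laplacian \<phi> z = 0" "h z * \<phi> z = 0"
   using q12[of "(cmod (z - nearest a z - a))\<^sup>2"] supp[of "(cmod (z - nearest a z - a))\<^sup>2"]
   by (simp_all only: lap) (simp_all add: \<phi>_def periodize_def L_def)
 qed
 have r': "r <= rmin / 3" using r by simp
 have b1: "sint P (%z. u z * laplacian \<phi> z) = sint (cball a r) (%z. u z * laplacian \<phi> z)"
  by (rule unfold_integral[OF p1(1) I1 r' s(1)])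
 have b2: "sint P (%z. h z * \<phi> z) = sint (cball a r) (%z. h z * \<phi> z)"
  by (rule unfold_integral[OF p1(2) I2 r' s(2)])
 have cg1: "sint (cball a r) (%z. u z * laplacian \<phi> z) = sint (cball a r) (%z. u z * L ((cmod (z - a))\<^sup>2))"
  by (rule set_lebesgue_integral_cong) (use e1 in auto)
 have cg2: "sint (cball a r) (%z. h z * \<phi> z) = sint (cball a r) (%z. h z * q ((cmod (z - a))\<^sup>2))"
  by (rule set_lebesgue_integral_cong) (use e1 in auto)
 have "set_integrable lborel (cball a r) (%z. u z * laplacian \<phi> z)" by (rule ball_integral_le(1)[OF p1(1) I1 r'])
 then show "set_integrable lborel (cball a r) (%z. u z * L ((cmod (z - a))\<^sup>2))"
  by (subst set_integrable_cong[OF refl refl e1(1)[symmetric]]) auto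
 have "set_integrable lborel (cball a r) (%z. h z * \<phi> z)" by (rule ball_integral_le(1)[OF p1(2) I2 r'])
 then show "set_integrable lborel (cball a r) (%z. h z * q ((cmod (z - a))\<^sup>2))"
  by (subst set_integrable_cong[OF refl refl e1(2)[symmetric]]) auto
 have "sint P (%z. u z * laplacian \<phi> z) = c0 * \<phi> 0 + sint P (%z. h z * \<phi> z)"
  using weak \<phi>_per \<phi>_smooth by (auto simp: weak_laplacian_def torus_integral_def smooth_fun_on_def)
 then show "sint (cball a r) (%z. u z * L ((cmod (z - a))\<^sup>2)) =
   c0 * q ((cmod (0 - nearest a 0 - a))\<^sup>2) + sint (cball a r) (%z. h z * q ((cmod (z - a))\<^sup>2))"
  unfolding b1 b2 cg1 cg2 by (simp add: \<phi>_def periodize_def)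
qed

end

text \<open>The successive derivatives of ln, in the form demanded by
  \<open>Ck_chain\<close>.\<close>

definition ln_chain :: "nat => real => real" where
 "ln_chain n x = (if n = 0 then ln x else (- 1) ^ (n - 1) * fact (n - 1) / x ^ n)"

lemma ln_chain_deriv: assumes "x > 0" shows "(ln_chain n has_real_derivative ln_chain (Suc n) x) (at x)"
proof (cases n)
 case 0
 have "ln_chain 0 = ln" by (auto simp: ln_chain_def)
 then show ?thesis using 0 DERIV_ln[OF assms] by (simp add: ln_chain_def inverse_eq_divide)
next
 case (Suc m)
 have e: "ln_chain n = (%x. (- 1) ^ m * fact m / x ^ Suc m)" by (auto simp: ln_chain_def Suc)
 have "((%x. (- 1) ^ m * fact m / x ^ Suc m) has_real_derivative
   (0 * x ^ Suc m - (- 1) ^ m * fact m * (real (Suc m) * x ^ m)) / (x ^ Suc m * x ^ Suc m)) (at x)"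
  using assms DERIV_pow[of "Suc m" x] by (intro DERIV_divide DERIV_const) (simp_all del: power_Suc)
 also have "(0 * x ^ Suc m - (- 1) ^ m * fact m * (real (Suc m) * x ^ m)) / (x ^ Suc m * x ^ Suc m) = ln_chain (Suc n) x"
  using assms by (simp add: ln_chain_def Suc field_simps)
 finally show ?thesis unfolding e .
qed

lemma Ck_ln: assumes "Ck_on k f UNIV" "!!z. f z > 0" shows "Ck_on k (%z. ln (f z)) UNIV"
proof -
 have "Ck_on k (%z. ln_chain 0 (f z)) UNIV"
  by (rule Ck_chain[where I = "{0<..}"]) (use assms ln_chain_deriv in auto)
 then show ?thesis by (simp add: ln_chain_def)
qed

lemma mult_ln_bound: assumes "0 <= t" "t <= x" "0 < x" "x <= (1::real)" shows "t * \<bar>ln x\<bar> <= 1"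
proof -
 have "ln (1 / x) <= 1 / x - 1" using assms by (intro ln_le_minus_one) auto
 then have "\<bar>ln x\<bar> <= 1 / x" using assms by (simp add: ln_div)
 then have "t * \<bar>ln x\<bar> <= x * (1 / x)" using assms by (intro mult_mono) auto
 then show ?thesis using assms by simp
qed

lemma bump_scaled_deriv:
 "((%t. bump (t / c)) has_real_derivative bump1 (t / c) / c) (at t)"
 "((%t. bump1 (t / c)) has_real_derivative bump2 (t / c) / c) (at t)"
 by (rule DERIV_cong[OF DERIV_chain'[OF DERIV_cdivide[OF DERIV_ident] bump_deriv]], simp)
  (rule DERIV_cong[OF DERIV_chain'[OF DERIV_cdivide[OF DERIV_ident] bump1_deriv]], simp)

context torus_lattice
begin

text \<open>Let \<open>D\<close> be the defect in the classical equation. If it is nonzero at a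
  point, its mean against a bump on a ball where it varies by at most half of its value is nonzero;
  yet the weak equation and two partial integrations make this mean vanish.\<close>

lemma weak_classical:
 assumes weak: "weak_laplacian \<omega>\<^sub>1 \<omega>\<^sub>2 u c0 0 h" and per: "periodic u" "periodic h"
  and C2: "Ck_on 2 u (- \<Lambda>)" and hc: "continuous_on (- \<Lambda>) h"
 obtains a \<alpha> where "!!z. z \<notin> \<Lambda> ==> has_wirt (%z. of_real (u z)) (a z) (cnj (a z)) z"
  "!!z. z \<notin> \<Lambda> ==> has_wirt a (\<alpha> z) (of_real (h z / 4)) z" "continuous_on (- \<Lambda>) \<alpha>"
proof -
 obtain a \<alpha> \<beta> where W: "!!z. z \<in> - \<Lambda> ==> has_wirt (%z. of_real (u z)) (a z) (cnj (a z)) z"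
  "!!z. z \<in> - \<Lambda> ==> has_wirt a (\<alpha> z) (\<beta> z) z" "continuous_on (- \<Lambda>) \<alpha>" "continuous_on (- \<Lambda>) \<beta>"
  by (rule Ck2_wirt[OF open_compl_lattice C2]) (rule that)
 have ca: "continuous_on (- \<Lambda>) a" using W(2) by (rule wirt_imp_continuous_on)
 have beta: "\<beta> z1 = of_real (h z1 / 4)" if z1: "z1 \<in> - \<Lambda>" for z1
 proof (rule ccontr)
  assume neq: "\<beta> z1 ~= of_real (h z1 / 4)"
  define D where "D z = 4 * \<beta> z - of_real (h z)" for z
  have D1: "D z1 ~= 0"
  proof
   assume "D z1 = 0"
   then have "\<beta> z1 * 4 = of_real (h z1)" by (simp add: D_def mult.commute)
   then have "\<beta> z1 = of_real (h z1) / 4" by (simp add: eq_divide_eq)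
   then show False using neq by simp
  qed
  have Dc: "continuous_on (- \<Lambda>) D" unfolding D_def by (intro continuous_intros W hc)
  then have "isCont D z1" using z1 open_compl_lattice by (simp add: continuous_on_eq_continuous_at)
  then obtain e1 where e1: "e1 > 0" "!!z. dist z z1 < e1 ==> dist (D z) (D z1) < cmod (D z1) / 2"
   unfolding continuous_at_eps_delta using D1 by (metis half_gt_zero zero_less_norm_iff)
  obtain e2 where e2: "e2 > 0" "ball z1 e2 \<subseteq> - \<Lambda>" using z1 open_compl_lattice open_contains_ball by blast
  \<comment> \<open>Small enough for the continuity of \<open>D\<close>, for the ball to avoid the
    lattice, and for \<open>weak_radial\<close>.\<close>
  define s where "s = min (min e1 e2 / 2) (rmin / 4)"
  have s: "0 < s" "s < e1" "s < e2" "s < rmin / 3" using e1 e2 rmin_pos by (auto simp: s_def min_def)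
  define q where "q t = bump (t / s\<^sup>2)" for t
  define q1 where "q1 t = bump1 (t / s\<^sup>2) / s\<^sup>2" for t
  define q2 where "q2 t = bump2 (t / s\<^sup>2) / s\<^sup>2 / s\<^sup>2" for t
  have dq: "(q has_real_derivative q1 t) (at t)" for t unfolding q_def q1_def
   by (rule bump_scaled_deriv)
  have dq1: "(q1 has_real_derivative q2 t) (at t)" for t unfolding q1_def q2_def
   by (rule DERIV_cdivide, rule bump_scaled_deriv)
  have q2c: "continuous_on S q2" for S unfolding q2_def
   by (intro continuous_intros continuous_on_compose2[OF bump2_cont[of UNIV]]) (use s in auto)
  have q1c: "continuous_on S q1" for S
   using dq1 DERIV_isCont by (blast intro: continuous_at_imp_continuous_on)
  have qs: "q t = 0" "q1 t = 0" "q2 t = 0" if "s\<^sup>2 <= t" for t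
   using that s bump_zero[of "t / s\<^sup>2"] by (simp_all add: q_def q1_def q2_def le_divide_eq)
  define L where "L t = 4 * (q2 t * t + q1 t)" for t
  have off: "s\<^sup>2 <= (cmod (z - z1))\<^sup>2" if "z \<notin> cball z1 s" for z
   using that s by (intro power_mono) (auto simp: dist_norm norm_minus_commute)
  note R = weak_radial[OF weak per dq dq1 q2c _ qs(1) s(1,4), of z1, folded L_def]
  have sm: "Ck_on k (%z. q ((cmod (z - w))\<^sup>2)) UNIV" for k w unfolding q_def by (rule Ck_bump)
  \<comment> \<open>The bump is supported off the lattice, so the Dirac mass contributes
    nothing.\<close>
  have q0: "q ((cmod (0 - nearest z1 0 - z1))\<^sup>2) = 0"
  proof (rule qs(1))
   have "- nearest z1 0 \<in> \<Lambda>" by (simp add: lattice_minus_iff nearest_in)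
   then have "- nearest z1 0 \<notin> ball z1 e2" using e2 by blast
   then have "s <= cmod (0 - nearest z1 0 - z1)" using s by (simp add: dist_norm norm_minus_commute)
   then show "s\<^sup>2 <= (cmod (0 - nearest z1 0 - z1))\<^sup>2" using s by (intro power_mono) auto
  qed
  have full: "indicator (cball z1 s) z *\<^sub>R (u z * L ((cmod (z - z1))\<^sup>2)) = u z * L ((cmod (z - z1))\<^sup>2)"
   "indicator (cball z1 s) z *\<^sub>R (h z * q ((cmod (z - z1))\<^sup>2)) = h z * q ((cmod (z - z1))\<^sup>2)" for z
   using qs[OF off[of z]] by (auto simp: indicator_def L_def)
  have iuL: "integrable lborel (%z. u z * L ((cmod (z - z1))\<^sup>2))" and ihq: "integrable lborel (%z. h z * q ((cmod (z - z1))\<^sup>2))"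
   and eqR: "(LINT z|lborel. u z * L ((cmod (z - z1))\<^sup>2)) = (LINT z|lborel. h z * q ((cmod (z - z1))\<^sup>2))"
   using R[OF sm] q0 unfolding set_integrable_def set_lebesgue_integral_def full by auto
  define g where "g z = complex_of_real (q ((cmod (z - z1))\<^sup>2))" for z
  define ga where "ga z = of_real (q1 ((cmod (z - z1))\<^sup>2)) * cnj (z - z1)" for z
  define gb where "gb z = of_real (q1 ((cmod (z - z1))\<^sup>2)) * (z - z1)" for z
  have g1: "has_wirt g (ga z) (gb z) z" for z unfolding g_def ga_def gb_def by (rule wirt_radial[OF dq])
  have idw: "has_wirt (%z. z - z1) 1 0 z" for z by (rule wirt_holo) (auto intro!: derivative_eq_intros)
  have gb1: "has_wirt gb (of_real (L ((cmod (z - z1))\<^sup>2) / 4)) (of_real (q2 ((cmod (z - z1))\<^sup>2)) * (z - z1)\<^sup>2) z" for z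
   unfolding gb_def
  proof (rule wirt_eq_rhs[OF wirt_mult[OF wirt_radial[OF dq1] idw]])
   have n: "cnj (z - z1) * (z - z1) = of_real ((cmod (z - z1))\<^sup>2)" by (simp only: complex_norm_square mult.commute)
   show "of_real (q1 ((cmod (z - z1))\<^sup>2)) * 1 + of_real (q2 ((cmod (z - z1))\<^sup>2)) * cnj (z - z1) * (z - z1) = of_real (L ((cmod (z - z1))\<^sup>2) / 4)"
    unfolding mult.assoc n L_def by simp
  qed (simp_all add: power2_eq_square)
  have gc: "continuous_on UNIV ga" "continuous_on UNIV gb"
   "continuous_on UNIV (%z. complex_of_real (L ((cmod (z - z1))\<^sup>2) / 4))"
   "continuous_on UNIV (%z. complex_of_real (q2 ((cmod (z - z1))\<^sup>2)) * (z - z1)\<^sup>2)"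
   unfolding ga_def gb_def L_def
   by (intro continuous_intros continuous_on_compose2[OF q1c[of UNIV]] continuous_on_compose2[OF q2c[of UNIV]]; simp)+
  have sub: "cball z1 s \<subseteq> - \<Lambda>" using e2 s by (force simp: subset_eq)
  have g0: "g z = 0" "gb z = 0" if "z \<notin> cball z1 s" for z
   using qs[OF off[OF that]] by (simp_all add: g_def gb_def)
  have ua: "continuous_on (- \<Lambda>) (%z. cnj (a z))" by (intro continuous_intros ca)
  \<comment> \<open>Two partial integrations, first in z and then in zbar, move the Laplacian from
    the bump to \<open>u\<close>.\<close>
  note S1 = stokes_product[OF open_compl_lattice sub W(1) ca ua gb1 gc(3,4) g0(2)]
  note S2 = stokes_product[OF open_compl_lattice sub W(2) W(3,4) g1 gc(1,2) g0(1)]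
  have "(LINT z|lborel. of_real (u z) * of_real (L ((cmod (z - z1))\<^sup>2) / 4)) = (LINT z|lborel. \<beta> z * g z)"
   using S1(5) S2(6) by simp
  moreover have "(%z. complex_of_real (u z) * of_real (L ((cmod (z - z1))\<^sup>2) / 4)) = (%z. of_real (u z * L ((cmod (z - z1))\<^sup>2)) / 4)"
   by auto
  ultimately have "(LINT z|lborel. complex_of_real (u z * L ((cmod (z - z1))\<^sup>2)) / 4) = (LINT z|lborel. \<beta> z * g z)"
   by (simp only:)
  then have i1: "of_real (LINT z|lborel. u z * L ((cmod (z - z1))\<^sup>2)) = 4 * (LINT z|lborel. \<beta> z * g z)"
   by (simp only: integral_divide_zero integral_complex_of_real) (simp add: field_simps)
  have ihg: "integrable lborel (%z. complex_of_real (h z * q ((cmod (z - z1))\<^sup>2)))"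
   using ihq by (rule integrable_of_real)
  have ibg: "integrable lborel (%z. \<beta> z * g z)" by (rule S2(2))
  have Dg: "D z * g z = 4 * (\<beta> z * g z) - of_real (h z * q ((cmod (z - z1))\<^sup>2))" for z
   by (simp add: D_def g_def algebra_simps)
  have iD: "integrable lborel (%z. D z * g z)"
   unfolding Dg by (intro Bochner_Integration.integrable_diff integrable_mult_right ibg ihg)
  have "(LINT z|lborel. D z * g z) = 4 * (LINT z|lborel. \<beta> z * g z) - of_real (LINT z|lborel. h z * q ((cmod (z - z1))\<^sup>2))"
   unfolding Dg using ibg ihg
   by (simp only: Bochner_Integration.integral_diff integrable_mult_right integral_mult_right_zero integral_complex_of_real)
  then have D0: "(LINT z|lborel. D z * g z) = 0" using i1 eqR by simp
  define \<kappa> where "\<kappa> z = q ((cmod (z - z1))\<^sup>2)" for z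
  have \<kappa>c: "continuous_on UNIV \<kappa>" using sm[of 0] by (simp add: \<kappa>_def)
  have \<kappa>0: "0 <= \<kappa> z" for z using bump_bounds by (simp add: \<kappa>_def q_def)
  have \<kappa>i: "integrable lborel \<kappa>"
   by (rule integrable_compact_support[of z1 s]) (use continuous_on_subset[OF \<kappa>c] qs(1)[OF off] in \<open>auto simp: \<kappa>_def\<close>)
  have pos: "0 < (LINT z|lborel. \<kappa> z)"
   by (rule integral_pos_continuous[OF \<kappa>c \<kappa>0 \<kappa>i, of z1]) (simp add: \<kappa>_def q_def bump_0)
  have gk: "g z = of_real (\<kappa> z)" for z by (simp add: g_def \<kappa>_def)
  have iDd: "integrable lborel (%z. (D z - D z1) * g z)"
   unfolding left_diff_distrib gk
   by (intro Bochner_Integration.integrable_diff integrable_mult_right integrable_of_real \<kappa>i) (use iD gk in simp)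
  have "(LINT z|lborel. (D z - D z1) * g z) = - (D z1 * of_real (LINT z|lborel. \<kappa> z))"
  proof -
   have "(LINT z|lborel. (D z - D z1) * g z) = (LINT z|lborel. D z * g z) - (LINT z|lborel. D z1 * g z)"
    unfolding left_diff_distrib
    by (intro Bochner_Integration.integral_diff iD integrable_mult_right) (use \<kappa>i gk in simp)
   also have "(LINT z|lborel. D z1 * g z) = D z1 * of_real (LINT z|lborel. \<kappa> z)"
    unfolding gk by (simp only: integral_mult_right_zero integral_complex_of_real)
   finally show ?thesis using D0 by simp
  qed
  then have "cmod (D z1) * (LINT z|lborel. \<kappa> z) = cmod (LINT z|lborel. (D z - D z1) * g z)"
   using pos by (simp add: norm_mult)
  also have "\<dots> <= (LINT z|lborel. cmod ((D z - D z1) * g z))" by (rule integral_norm_bound)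
  also have "\<dots> <= (LINT z|lborel. cmod (D z1) / 2 * \<kappa> z)"
  proof (rule integral_mono)
   show "integrable lborel (%z. cmod ((D z - D z1) * g z))" using iDd by (rule integrable_norm)
   show "integrable lborel (%z. cmod (D z1) / 2 * \<kappa> z)" using \<kappa>i by (rule integrable_mult_right)
   fix z
   show "cmod ((D z - D z1) * g z) <= cmod (D z1) / 2 * \<kappa> z"
   proof (cases "z \<in> cball z1 s")
    case True
    then have "cmod (D z - D z1) <= cmod (D z1) / 2" using e1(2)[of z] s(2) by (simp add: dist_norm norm_minus_commute)
    from mult_right_mono[OF this \<kappa>0[of z]] show ?thesis using \<kappa>0[of z] by (simp add: gk norm_mult)
   next
    case False then show ?thesis using g0(1)[OF False] \<kappa>0[of z] by (simp del: times_divide_eq_left)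
   qed
  qed
  also have "\<dots> = cmod (D z1) / 2 * (LINT z|lborel. \<kappa> z)" by (rule integral_mult_right_zero)
  finally have "cmod (D z1) * (LINT z|lborel. \<kappa> z) <= cmod (D z1) / 2 * (LINT z|lborel. \<kappa> z)" .
  then have "cmod (D z1) <= cmod (D z1) / 2" using pos by (rule mult_right_le_imp_le)
  then show False using D1 by simp
 qed
 show thesis
 proof (rule that[of a \<alpha>])
  fix z assume "z \<notin> \<Lambda>"
  then have z: "z \<in> - \<Lambda>" by simp
  show "has_wirt (%z. of_real (u z)) (a z) (cnj (a z)) z" by (rule W(1)[OF z])
  show "has_wirt a (\<alpha> z) (of_real (h z / 4)) z" using W(2)[OF z] unfolding beta[OF z] .
 qed (rule W(3))
qed

text \<open>The test function is the regularised, truncated fundamental solution -(1/2) ln (t +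
  \<delta>^2) bump (t / \<rho>) with t = |z - a|^2. Its Laplacian is minus the kernel of
  \<open>kernel_limit\<close> plus a term \<open>B\<close> in which the cut-off is differentiated;
  \<open>B\<close> is bounded uniformly in \<open>a\<close> and \<open>\<delta>\<close>, which makes
  \<open>K\<close> uniform.\<close>

lemma weak_representation:
 assumes weak: "weak_laplacian \<omega>\<^sub>1 \<omega>\<^sub>2 u c0 0 h" and per: "periodic u" "periodic h"
  and \<rho>: "0 < \<rho>" "\<rho> <= 1 / 2" "sqrt \<rho> < rmin / 3"
 obtains K where "!!a \<delta>. cmod a <= rmin / 6 ==> 0 < \<delta> ==> \<delta> <= 1 / 2 ==>
  \<bar>sint (cball a (sqrt \<rho>)) (%z. u z * (2 * \<delta>\<^sup>2 * bump ((cmod (z - a))\<^sup>2 / \<rho>) / ((cmod (z - a))\<^sup>2 + \<delta>\<^sup>2)\<^sup>2))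
   - c0 / 2 * ln ((cmod a)\<^sup>2 + \<delta>\<^sup>2) * bump ((cmod a)\<^sup>2 / \<rho>)
   + sint (cball a (sqrt \<rho>)) (%z. h z * (- (1 / 2) * ln ((cmod (z - a))\<^sup>2 + \<delta>\<^sup>2) * bump ((cmod (z - a))\<^sup>2 / \<rho>)))\<bar> <= K"
  "!!a \<delta>. 0 < \<delta> ==> \<delta> <= 1 / 2 ==>
   set_integrable lborel (cball a (sqrt \<rho>)) (%z. h z * (- (1 / 2) * ln ((cmod (z - a))\<^sup>2 + \<delta>\<^sup>2) * bump ((cmod (z - a))\<^sup>2 / \<rho>)))"
proof -
 obtain C where C: "0 < C" "!!t. 0 <= t ==> \<bar>bump1 t\<bar> <= C * t" "!!t. 0 <= t ==> \<bar>bump1 t\<bar> <= C"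
  "!!t. 0 <= t ==> \<bar>bump2 t\<bar> <= C" by (rule bump_const) (rule that)
 \<comment> \<open>One summand for each term of \<open>B\<close>: the mixed first derivatives, the
   second derivative of the cut-off, and the logarithm times its first derivative.\<close>
 define K0 where "K0 = 2 * (2 * C / \<rho> + C / \<rho>\<^sup>2 + C / \<rho>\<^sup>2)"
 have K0: "0 <= K0" using C \<rho> by (simp add: K0_def)
 have wI: "set_integrable lborel P u" using weak by (auto simp: weak_laplacian_def torus_integrable_def)
 define r where "r = sqrt \<rho>"
 have r: "0 < r" "r < rmin / 3" "r\<^sup>2 = \<rho>" using \<rho> by (auto simp: r_def)
 have bump_m: "bump \<in> borel_measurable borel"
  using bump_deriv DERIV_isCont by (blast intro: borel_measurable_continuous_onI continuous_at_imp_continuous_on)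
 have key: "set_integrable lborel (cball a r) (%z. h z * (- (1 / 2) * ln ((cmod (z - a))\<^sup>2 + \<delta>\<^sup>2) * bump ((cmod (z - a))\<^sup>2 / \<rho>))) \<and>
   (cmod a <= rmin / 6 --> \<bar>sint (cball a r) (%z. u z * (2 * \<delta>\<^sup>2 * bump ((cmod (z - a))\<^sup>2 / \<rho>) / ((cmod (z - a))\<^sup>2 + \<delta>\<^sup>2)\<^sup>2))
   - c0 / 2 * ln ((cmod a)\<^sup>2 + \<delta>\<^sup>2) * bump ((cmod a)\<^sup>2 / \<rho>)
   + sint (cball a r) (%z. h z * (- (1 / 2) * ln ((cmod (z - a))\<^sup>2 + \<delta>\<^sup>2) * bump ((cmod (z - a))\<^sup>2 / \<rho>)))\<bar>
   <= K0 * sint P (%z. \<bar>u z\<bar>))"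
  if \<delta>: "0 < \<delta>" "\<delta> <= 1 / 2" for a \<delta>
 proof -
  have d2: "0 < \<delta>\<^sup>2" "\<delta>\<^sup>2 <= 1 / 4"
   using \<delta> power_mono[of \<delta> "1/2" 2] by (auto simp: power2_eq_square)
  define q where "q t = - (1 / 2) * ln (t + \<delta>\<^sup>2) * bump (t / \<rho>)" for t
  define q1 where "q1 t = - (1 / 2) * (bump (t / \<rho>) / (t + \<delta>\<^sup>2) + ln (t + \<delta>\<^sup>2) * (bump1 (t / \<rho>) / \<rho>))" for t
  define q2 where "q2 t = - (1 / 2) * (- bump (t / \<rho>) / (t + \<delta>\<^sup>2)\<^sup>2 + 2 * (bump1 (t / \<rho>) / \<rho>) / (t + \<delta>\<^sup>2)
   + ln (t + \<delta>\<^sup>2) * (bump2 (t / \<rho>) / \<rho>\<^sup>2))" for t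
  have db: "((%t. bump (t / \<rho>)) has_real_derivative bump1 (t / \<rho>) / \<rho>) (at t)" for t
   by (rule bump_scaled_deriv)
  have db1: "((%t. bump1 (t / \<rho>) / \<rho>) has_real_derivative bump2 (t / \<rho>) / \<rho>\<^sup>2) (at t)" for t
   by (rule DERIV_cong[OF DERIV_cdivide[OF bump_scaled_deriv(2)]]) (simp add: power2_eq_square)
  have dln: "((%t. ln (t + \<delta>\<^sup>2)) has_real_derivative 1 / (t + \<delta>\<^sup>2)) (at t)" if "0 <= t" for t
   using add_nonneg_pos[OF that d2(1)] by (auto intro!: derivative_eq_intros)
  have dinv: "((%t. 1 / (t + \<delta>\<^sup>2)) has_real_derivative - 1 / (t + \<delta>\<^sup>2)\<^sup>2) (at t)" if "0 <= t" for t
   using add_nonneg_pos[OF that d2(1)] by (auto intro!: derivative_eq_intros simp: power2_eq_square)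
  have dq: "(q has_real_derivative q1 t) (at t)" if "0 <= t" for t
   unfolding q_def q1_def mult.assoc
   by (rule DERIV_cong[OF DERIV_cmult[OF DERIV_mult[OF dln[OF that] db]]]) (simp add: algebra_simps)
  have q1_alt: "q1 = (%t. - (1 / 2) * (bump (t / \<rho>) * (1 / (t + \<delta>\<^sup>2)) + ln (t + \<delta>\<^sup>2) * (bump1 (t / \<rho>) / \<rho>)))"
   by (auto simp: q1_def)
  have dq1: "(q1 has_real_derivative q2 t) (at t)" if "0 <= t" for t
   unfolding q1_alt q2_def
   by (rule DERIV_cong[OF DERIV_cmult[OF DERIV_add[OF DERIV_mult[OF db dinv[OF that]] DERIV_mult[OF dln[OF that] db1]]]])
    (simp add: algebra_simps)
  have bc: "continuous_on {0..} (%t. bump (t / \<rho>))" "continuous_on {0..} (%t. bump1 (t / \<rho>) / \<rho>)"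
   using db db1 DERIV_isCont by (blast intro: continuous_at_imp_continuous_on)+
  have b2c: "continuous_on {0..} (%t. bump2 (t / \<rho>))"
   by (rule continuous_on_compose2[OF bump2_cont[of UNIV]]) (use \<rho> in \<open>auto intro!: continuous_intros\<close>)
  have q2c: "continuous_on {0..} q2" unfolding q2_def
   by (intro continuous_intros bc b2c) (use d2 \<rho> in \<open>auto simp: add_nonneg_eq_0_iff\<close>)
  have sm: "Ck_on k (%z. q ((cmod (z - w))\<^sup>2)) UNIV" for k w
   unfolding q_def by (intro Ck_mult Ck_const Ck_bump Ck_ln Ck_add Ck_cmod2) (use d2 in \<open>auto intro: add_nonneg_pos\<close>)
  have qs: "q t = 0" if "r\<^sup>2 <= t" for t
   using that \<rho> bump_zero[of "t / \<rho>"] by (simp add: q_def r(3) le_divide_eq)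
  define k where "k t = 2 * \<delta>\<^sup>2 * bump (t / \<rho>) / (t + \<delta>\<^sup>2)\<^sup>2" for t
  define L where "L t = 4 * (q2 t * t + q1 t)" for t
  define B where "B t = L t + k t" for t
  have B: "\<bar>B t\<bar> <= K0" if t: "0 <= t" "t <= \<rho>" for t
  proof -
   define x where "x = t + \<delta>\<^sup>2"
   have x: "0 < x" "t <= x" "x <= 1" using t d2 \<rho> add_nonneg_pos[OF t(1) d2(1)] unfolding x_def by linarith+
   have tx: "\<delta>\<^sup>2 = x - t" by (simp add: x_def)
   have "B t = - 2 * (2 * (bump1 (t / \<rho>) / \<rho>) * (t / x) + (t * ln x) * (bump2 (t / \<rho>) / \<rho>\<^sup>2) + ln x * (bump1 (t / \<rho>) / \<rho>))"
    unfolding B_def L_def k_def q1_def q2_def x_def[symmetric] tx using x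
    by (simp add: field_simps power2_eq_square)
   then have "\<bar>B t\<bar> = 2 * \<bar>2 * (bump1 (t / \<rho>) / \<rho>) * (t / x) + (t * ln x) * (bump2 (t / \<rho>) / \<rho>\<^sup>2) + ln x * (bump1 (t / \<rho>) / \<rho>)\<bar>"
    by (simp only: abs_mult)
   also have "\<dots> <= 2 * (\<bar>2 * (bump1 (t / \<rho>) / \<rho>) * (t / x)\<bar> + \<bar>(t * ln x) * (bump2 (t / \<rho>) / \<rho>\<^sup>2)\<bar> + \<bar>ln x * (bump1 (t / \<rho>) / \<rho>)\<bar>)"
   proof -
    have "2 * \<bar>A + B + C\<bar> <= 2 * (\<bar>A\<bar> + \<bar>B\<bar> + \<bar>C\<bar>)" for A B C :: real
     by (rule mult_left_mono[OF order_trans[OF abs_triangle_ineq add_right_mono[OF abs_triangle_ineq]]]) simp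
    then show ?thesis .
   qed
   also have "\<dots> <= K0" unfolding K0_def
   proof (intro mult_left_mono add_mono)
    have t\<rho>: "0 <= t / \<rho>" using t \<rho> by simp
    have "\<bar>2 * (bump1 (t / \<rho>) / \<rho>) * (t / x)\<bar> = 2 * (\<bar>bump1 (t / \<rho>)\<bar> / \<rho>) * (t / x)"
     using t x \<rho> by (simp add: abs_mult)
    also have "\<dots> <= 2 * (C / \<rho>) * 1"
     using C(3)[OF t\<rho>] t x \<rho> C(1) by (intro mult_mono divide_right_mono) auto
    finally show "\<bar>2 * (bump1 (t / \<rho>) / \<rho>) * (t / x)\<bar> <= 2 * C / \<rho>" by simp
    have tl: "t * \<bar>ln x\<bar> <= 1" using mult_ln_bound[OF t(1) x(2,1,3)] .
    have "\<bar>(t * ln x) * (bump2 (t / \<rho>) / \<rho>\<^sup>2)\<bar> = (t * \<bar>ln x\<bar>) * (\<bar>bump2 (t / \<rho>)\<bar> / \<rho>\<^sup>2)"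
     using t by (simp add: abs_mult)
    also have "\<dots> <= 1 * (C / \<rho>\<^sup>2)" using C(4)[OF t\<rho>] tl t by (intro mult_mono divide_right_mono) auto
    finally show "\<bar>(t * ln x) * (bump2 (t / \<rho>) / \<rho>\<^sup>2)\<bar> <= C / \<rho>\<^sup>2" by simp
    have "\<bar>ln x * (bump1 (t / \<rho>) / \<rho>)\<bar> = \<bar>ln x\<bar> * (\<bar>bump1 (t / \<rho>)\<bar> / \<rho>)"
     using \<rho> by (simp add: abs_mult)
    \<comment> \<open>The linear vanishing of \<open>bump1\<close> turns ln x into the bounded
      quantity t ln x.\<close>
    also have "\<dots> <= \<bar>ln x\<bar> * (C * (t / \<rho>) / \<rho>)" using C(2)[OF t\<rho>] \<rho> by (intro mult_left_mono divide_right_mono) auto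
    also have "\<dots> = (t * \<bar>ln x\<bar>) * (C / \<rho>\<^sup>2)" by (simp add: power2_eq_square)
    also have "\<dots> <= 1 * (C / \<rho>\<^sup>2)" using tl C(1) by (intro mult_right_mono) auto
    finally show "\<bar>ln x * (bump1 (t / \<rho>) / \<rho>)\<bar> <= C / \<rho>\<^sup>2" by simp
   qed auto
   finally show ?thesis .
  qed
  note R = weak_radial[OF weak per dq dq1 q2c sm qs r(1,2), of a, folded L_def]
  have tin: "(cmod (z - a))\<^sup>2 <= \<rho>" if "z \<in> cball a r" for z
   using that power_mono[of "cmod (z - a)" r 2] r by (simp add: dist_norm norm_minus_commute)
  have kb: "\<bar>k ((cmod (z - a))\<^sup>2)\<bar> <= 2 / \<delta>\<^sup>2" for z
  proof -
   have "(\<delta>\<^sup>2)\<^sup>2 <= ((cmod (z - a))\<^sup>2 + \<delta>\<^sup>2)\<^sup>2" by (intro power_mono) auto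
   moreover have "2 * \<delta>\<^sup>2 * bump ((cmod (z - a))\<^sup>2 / \<rho>) <= 2 * \<delta>\<^sup>2 * 1" by (intro mult_left_mono bump_bounds) auto
   ultimately have "k ((cmod (z - a))\<^sup>2) <= 2 * \<delta>\<^sup>2 / (\<delta>\<^sup>2)\<^sup>2" unfolding k_def using d2 by (intro frac_le) auto
   moreover have "2 * D / D\<^sup>2 = 2 / D" if "D > 0" for D :: real using that by (simp add: power2_eq_square)
   ultimately have "k ((cmod (z - a))\<^sup>2) <= 2 / \<delta>\<^sup>2" using d2 by (simp only:)
   moreover have "0 <= k ((cmod (z - a))\<^sup>2)" unfolding k_def using bump_bounds by simp
   ultimately show ?thesis by simp
  qed
  have bm: "(%z. bump ((cmod (z - a))\<^sup>2 / \<rho>)) \<in> borel_measurable borel"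
   by (rule measurable_compose[OF _ bump_m]) simp
  have km: "(%z. k ((cmod (z - a))\<^sup>2)) \<in> borel_measurable borel" unfolding k_def using bm by simp
  have bi: "set_integrable lborel (cball a r) u" by (rule ball_integral_le(1)[OF per(1) wI]) (use r in simp)
  have ik: "set_integrable lborel (cball a r) (%z. u z * k ((cmod (z - a))\<^sup>2))"
   by (rule set_integrable_mult_bounded[OF bi km kb])
  have iB: "set_integrable lborel (cball a r) (%z. u z * B ((cmod (z - a))\<^sup>2))"
   unfolding B_def distrib_left by (intro set_integral_add R ik)
  have sum: "sint (cball a r) (%z. u z * B ((cmod (z - a))\<^sup>2)) =
    sint (cball a r) (%z. u z * L ((cmod (z - a))\<^sup>2)) + sint (cball a r) (%z. u z * k ((cmod (z - a))\<^sup>2))"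
   unfolding B_def distrib_left by (intro set_integral_add R ik)
  have "\<bar>sint (cball a r) (%z. u z * B ((cmod (z - a))\<^sup>2))\<bar> <= K0 * sint P (%z. \<bar>u z\<bar>)"
  proof -
   have "\<bar>sint (cball a r) (%z. u z * B ((cmod (z - a))\<^sup>2))\<bar> <= (LINT z|lborel. \<bar>indicator (cball a r) z *\<^sub>R (u z * B ((cmod (z - a))\<^sup>2))\<bar>)"
    unfolding set_lebesgue_integral_def by (rule integral_abs_bound)
   also have "\<dots> <= (LINT z|lborel. K0 * (indicator (cball a r) z *\<^sub>R \<bar>u z\<bar>))"
   proof (rule integral_mono)
    show "integrable lborel (%z. \<bar>indicator (cball a r) z *\<^sub>R (u z * B ((cmod (z - a))\<^sup>2))\<bar>)"
     using iB unfolding set_integrable_def by (rule integrable_abs)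
    show "integrable lborel (%z. K0 * (indicator (cball a r) z *\<^sub>R \<bar>u z\<bar>))"
     using set_integrable_abs[OF bi] unfolding set_integrable_def by (rule integrable_mult_right)
    fix z show "\<bar>indicator (cball a r) z *\<^sub>R (u z * B ((cmod (z - a))\<^sup>2))\<bar> <= K0 * (indicator (cball a r) z *\<^sub>R \<bar>u z\<bar>)"
    proof (cases "z \<in> cball a r")
     case True
     have "\<bar>u z\<bar> * \<bar>B ((cmod (z - a))\<^sup>2)\<bar> <= \<bar>u z\<bar> * K0" by (intro mult_left_mono B tin True) auto
     then show ?thesis using True by (simp add: abs_mult mult.commute)
    qed simp
   qed
   also have "\<dots> = K0 * sint (cball a r) (%z. \<bar>u z\<bar>)"
    unfolding set_lebesgue_integral_def by (rule integral_mult_right_zero)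
   also have "\<dots> <= K0 * sint P (%z. \<bar>u z\<bar>)"
    by (intro mult_left_mono ball_integral_le(2)[OF per(1) wI] K0) (use r in simp)
   finally show ?thesis .
  qed
  \<comment> \<open>For small \<open>a\<close> the lattice point met by the test function is 0
    itself, which makes the Dirac term explicit.\<close>
  moreover have "nearest a 0 = 0" if "cmod a <= rmin / 6" using that rmin_pos by (intro nearest_0_ball) simp
  ultimately show ?thesis using R(2,3) sum unfolding k_def q_def by auto
 qed
 show thesis
  by (rule that[of "K0 * sint P (%z. \<bar>u z\<bar>)"]) (use key in \<open>auto simp: r_def\<close>)
qed

end

section \<open>Weierstrass functions\<close>

lemma summable_int_weight: "(%m::int. (1 + \<bar>real_of_int m\<bar>) powr (- 3 / 2)) summable_on UNIV"
proof -
 have s: "summable (%n. real (Suc n) powr (- 3 / 2))"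
  by (subst summable_Suc_iff) (simp add: summable_real_powr_iff)
 have 1: "(%n::nat. (1 + real n) powr (- 3 / 2)) summable_on UNIV"
  by (subst summable_on_UNIV_nonneg_real_iff) (use s in \<open>simp_all add: add.commute\<close>)
 have b1: "bij_betw int UNIV {0..}" by (rule bij_betwI[where g = nat]) auto
 have b2: "bij_betw (%n. - int n - 1) UNIV {..<0}" by (rule bij_betwI[where g = "%m. nat (- m - 1)"]) auto
 have "(%m::int. (1 + \<bar>real_of_int m\<bar>) powr (- 3 / 2)) summable_on {0..}"
  using 1 by (subst summable_on_reindex_bij_betw[OF b1, symmetric]) simp
 moreover have "(%m::int. (1 + \<bar>real_of_int m\<bar>) powr (- 3 / 2)) summable_on {..<0}"
 proof (subst summable_on_reindex_bij_betw[OF b2, symmetric], rule summable_on_comparison_test[OF 1])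
  fix n :: nat
  have "1 + \<bar>real_of_int (- int n - 1)\<bar> = 2 + real n" by simp
  then show "(1 + \<bar>real_of_int (- int n - 1)\<bar>) powr (- 3 / 2) <= (1 + real n) powr (- 3 / 2)"
   by (simp only:) (intro powr_mono2', auto)
 qed auto
 ultimately have "(%m::int. (1 + \<bar>real_of_int m\<bar>) powr (- 3 / 2)) summable_on ({0..} \<union> {..<0})"
  by (rule summable_on_Un_disjoint) auto
 moreover have "{0..} \<union> {..<0} = (UNIV :: int set)" by auto
 ultimately show ?thesis by simp
qed

lemma summable_int2_weight:
 "(%(m::int, n::int). (1 + \<bar>real_of_int m\<bar>) powr (- 3 / 2) * (1 + \<bar>real_of_int n\<bar>) powr (- 3 / 2)) summable_on UNIV"
proof -
 let ?c = "%m::int. (1 + \<bar>real_of_int m\<bar>) powr (- 3 / 2)"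
 have "(%(m, n). ?c m * ?c n) summable_on (SIGMA m:UNIV. UNIV)"
 proof (rule summable_on_SigmaI)
  show "((%y. case (x, y) of (m, n) => ?c m * ?c n) has_sum ?c x * infsum ?c UNIV) UNIV" for x
   using has_sum_cmult_right[OF has_sum_infsum[OF summable_int_weight], of "?c x"] by simp
  show "(%x. ?c x * infsum ?c UNIV) summable_on UNIV"
   by (rule summable_on_cmult_left[OF summable_int_weight])
 qed auto
 then show ?thesis by simp
qed

context torus_lattice
begin

text \<open>With N = max (|m|, |n|) one has |w| >= rmin N and (1 + |m|) (1 + |n|) <= (2 N)^2. The
  power -3/2 of the last inequality bounds 1 / N^3 by a product of two one-dimensional weights, so
  the double sum factors; 3/2 > 1 makes each factor converge.\<close>

lemma summable_inv_cube: "(%w. 1 / cmod w ^ 3) summable_on (\<Lambda> - {0})"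
proof -
 define h where "h = (%(m::int, n::int). of_int m * \<omega>\<^sub>1 + of_int n * \<omega>\<^sub>2)"
 let ?c = "%m::int. (1 + \<bar>real_of_int m\<bar>) powr (- 3 / 2)"
 have csh: "cs (h x) = of_int (fst x)" "ct (h x) = of_int (snd x)" for x
  by (auto simp: h_def cs_simps ct_simps split: prod.splits)
 have inj: "inj h" by (rule injI) (metis csh of_int_eq_iff prod_eqI)
 have img: "\<Lambda> - {0} = h ` (UNIV - {(0,0)})"
 proof -
  have "\<Lambda> = h ` UNIV" by (auto simp: lattice_def h_def image_def)
  moreover have "h (0,0) = 0" by (simp add: h_def)
  ultimately show ?thesis using inj by (metis image_empty image_insert image_set_diff)
 qed
 have "(%x. 8 / rmin ^ 3 * (case x of (m, n) => ?c m * ?c n)) summable_on (UNIV - {(0,0)})"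
  by (rule summable_on_cmult_right, rule summable_on_subset_banach[OF summable_int2_weight]) auto
 then have "(%x. 1 / cmod (h x) ^ 3) summable_on (UNIV - {(0,0)})"
 proof (rule summable_on_comparison_test)
  fix x assume x: "x \<in> UNIV - {(0::int,0::int)}"
  obtain m n where mn: "x = (m, n)" by (cases x)
  define N where "N = max \<bar>real_of_int m\<bar> \<bar>real_of_int n\<bar>"
  have "m ~= 0 \<or> n ~= 0" using x mn by auto
  then have N1: "1 <= N" unfolding N_def by linarith
  have "N <= cmod (h x) / rmin" using coord_bound[of "h x"] csh[of x] mn by (simp add: N_def)
  then have hN: "rmin * N <= cmod (h x)" using rmin_pos by (simp add: field_simps)
  have le: "(1 + \<bar>real_of_int m\<bar>) * (1 + \<bar>real_of_int n\<bar>) <= (2 * N) * (2 * N)"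
   using N1 by (intro mult_mono) (auto simp: N_def)
  have pw: "x powr (- 3) = 1 / x ^ 3" if "x > 0" for x :: real
   using powr_minus_divide[of x 3] that by simp
  have "1 / N ^ 3 = 8 * ((2 * N) * (2 * N)) powr (- 3 / 2)"
  proof -
   have "((2 * N) * (2 * N)) powr (- 3 / 2) = (2 * N) powr (- 3)"
   proof -
    have "((2 * N) * (2 * N)) powr (- 3 / 2) = (2 * N) powr (- 3 / 2) * (2 * N) powr (- 3 / 2)"
     by (rule powr_mult)
    also have "\<dots> = (2 * N) powr (- 3 / 2 + - 3 / 2)" by (rule powr_add[symmetric])
    finally show ?thesis by simp
   qed
   also have "\<dots> = 1 / (2 * N) ^ 3" using N1 by (intro pw) auto
   finally show ?thesis by (simp add: power_mult_distrib)
  qed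
  also have "\<dots> <= 8 * ((1 + \<bar>real_of_int m\<bar>) * (1 + \<bar>real_of_int n\<bar>)) powr (- 3 / 2)"
   using le by (intro mult_left_mono powr_mono2') auto
  also have "\<dots> = 8 * (?c m * ?c n)" by (subst powr_mult) auto
  finally have c: "1 / N ^ 3 <= 8 * (?c m * ?c n)" .
  have "1 / cmod (h x) ^ 3 <= 1 / (rmin * N) ^ 3"
  proof -
   have p: "0 < rmin * N" using rmin_pos N1 by simp
   show ?thesis by (intro frac_le power_mono hN zero_less_power p) (use p in auto)
  qed
  also have "\<dots> = (1 / rmin ^ 3) * (1 / N ^ 3)" by (simp add: power_mult_distrib)
  also have "\<dots> <= (1 / rmin ^ 3) * (8 * (?c m * ?c n))" using rmin_pos by (intro mult_left_mono c) auto
  finally show "1 / cmod (h x) ^ 3 <= 8 / rmin ^ 3 * (case x of (m, n) => ?c m * ?c n)" by (simp add: mn)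
 qed auto
 then show ?thesis unfolding img by (subst summable_on_reindex) (auto intro: inj_on_subset[OF inj] simp: o_def)
qed

abbreviation "L0 \<equiv> \<Lambda> - {0}"

text \<open>The summands of the Weierstrass zeta function. The added 1/w + z/w^2 makes them of order
  |w|^(-3), and their derivatives are the negatives of \<open>pterm\<close>.\<close>

definition zterm :: "complex => complex => complex" where "zterm w z = 1 / (z - w) + 1 / w + z / w\<^sup>2"
definition pterm :: "complex => complex => complex" where "pterm w z = 1 / (z - w)\<^sup>2 - 1 / w\<^sup>2"
definition zeta :: "complex => complex" where "zeta z = 1 / z + infsum (%w. zterm w z) L0"
abbreviation "wp \<equiv> weierstrass_p \<omega>\<^sub>1 \<omega>\<^sub>2"

lemma wp_def: "wp z = 1 / z\<^sup>2 + infsum (%w. pterm w z) L0"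
 by (simp add: weierstrass_p_def pterm_def)

lemma finite_lattice_cball: "finite (\<Lambda> \<inter> cball 0 R)"
proof -
 have "\<not> x islimpt \<Lambda>" for x
  using sparse_lattice by (auto simp: sparse_in_def)
 then have "\<not> x islimpt (\<Lambda> \<inter> cball 0 R)" for x using islimpt_subset by blast
 moreover have "compact (\<Lambda> \<inter> cball 0 R)" using closed_lattice by (simp add: closed_Int_compact)
 ultimately show ?thesis using finite_not_islimpt_in_compact[of "\<Lambda> \<inter> cball 0 R" "\<Lambda> \<inter> cball 0 R"] by auto
qed

text \<open>For |z| < R the finitely many lattice points with |w| <= 2 R carry all singularities.
  For the others |z - w| >= |w| / 2, so the tail is dominated by |w|^(-3); it is a uniform limit and
  may be differentiated termwise.\<close>

lemma local_sums:
 assumes R: "R > 0"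
 obtains H H' where "!!z. z \<in> ball 0 R ==> (H has_field_derivative - H' z) (at z)"
  "!!z. z \<in> ball 0 R ==> infsum (%w. zterm w z) L0 = (\<Sum>w\<in>\<Lambda> \<inter> cball 0 (2 * R) - {0}. zterm w z) + H z"
  "!!z. z \<in> ball 0 R ==> infsum (%w. pterm w z) L0 = (\<Sum>w\<in>\<Lambda> \<inter> cball 0 (2 * R) - {0}. pterm w z) + H' z"
  "!!z. z \<in> ball 0 R ==> (%w. zterm w z) summable_on L0"
  "!!z. z \<in> ball 0 R ==> (%w. pterm w z) summable_on L0"
proof -
 define F where "F = \<Lambda> \<inter> cball 0 (2 * R) - {0}"
 define G where "G = L0 - F"
 have FG: "L0 = F \<union> G" "F \<inter> G = {}" by (auto simp: F_def G_def)
 have finF: "finite F" using finite_lattice_cball by (simp add: F_def)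
 have G: "2 * R < cmod w" "w ~= 0" if "w \<in> G" for w using that by (auto simp: G_def F_def)
 have zw: "cmod w / 2 <= cmod (z - w)" if "w \<in> G" "z \<in> cball 0 R" for w z
  using norm_triangle_ineq2[of w z] G[OF that(1)] that(2) by (simp add: norm_minus_commute)
 have b1: "cmod (zterm w z) <= 2 * R\<^sup>2 * (1 / cmod w ^ 3)" if w: "w \<in> G" and z: "z \<in> cball 0 R" for w z
 proof -
  have nz: "z - w ~= 0" "w ~= 0" using zw[OF that] G[OF w] by auto
  have "zterm w z = z\<^sup>2 / (w\<^sup>2 * (z - w))" using nz
   by (simp add: zterm_def field_simps power2_eq_square)
  then have "cmod (zterm w z) = (cmod z)\<^sup>2 / ((cmod w)\<^sup>2 * cmod (z - w))" by (simp add: norm_divide norm_mult norm_power)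
  also have "\<dots> <= R\<^sup>2 / ((cmod w)\<^sup>2 * (cmod w / 2))"
   using z zw[OF that] nz R by (intro frac_le power_mono mult_left_mono mult_pos_pos) auto
  also have "\<dots> = 2 * R\<^sup>2 * (1 / cmod w ^ 3)" using nz by (simp add: power3_eq_cube power2_eq_square)
  finally show ?thesis .
 qed
 have b2: "cmod (pterm w z) <= 10 * R * (1 / cmod w ^ 3)" if w: "w \<in> G" and z: "z \<in> cball 0 R" for w z
 proof -
  have nz: "z - w ~= 0" "w ~= 0" using zw[OF that] G[OF w] by auto
  have "pterm w z = (1 * w\<^sup>2 - 1 * (z - w)\<^sup>2) / ((z - w)\<^sup>2 * w\<^sup>2)" using nz
   unfolding pterm_def by (intro diff_frac_eq) auto
  also have "\<dots> = z * (2 * w - z) / (w\<^sup>2 * (z - w)\<^sup>2)"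
   by (simp add: power2_eq_square algebra_simps)
  finally have "pterm w z = z * (2 * w - z) / (w\<^sup>2 * (z - w)\<^sup>2)" .
  then have "cmod (pterm w z) = cmod z * cmod (2 * w - z) / ((cmod w)\<^sup>2 * (cmod (z - w))\<^sup>2)" by (simp add: norm_divide norm_mult norm_power)
  also have "\<dots> <= R * (5 / 2 * cmod w) / ((cmod w)\<^sup>2 * (cmod w / 2)\<^sup>2)"
  proof (intro frac_le mult_mono mult_left_mono power_mono mult_pos_pos)
   show "cmod (2 * w - z) <= 5 / 2 * cmod w" using norm_triangle_ineq4[of "2 * w" z] z G[OF w] by (simp add: norm_mult)
  qed (use z zw[OF that] nz R in auto)
  also have "\<dots> = 10 * R * (1 / cmod w ^ 3)" using nz by (simp add: power3_eq_cube power2_eq_square)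
  finally show ?thesis .
 qed
 have cube: "(%w. 1 / cmod w ^ 3) summable_on G"
  using summable_on_subset_banach[OF summable_inv_cube, of G] by (auto simp: G_def)
 have s1: "(%w. zterm w z) summable_on G" and s2: "(%w. pterm w z) summable_on G" if z: "z \<in> cball 0 R" for z
 proof -
  have a: "(%w. norm (2 * R\<^sup>2 * (1 / cmod w ^ 3))) summable_on G" "(%w. norm (10 * R * (1 / cmod w ^ 3))) summable_on G"
  proof -
   have "norm (2 * R\<^sup>2 * (1 / cmod w ^ 3)) = 2 * R\<^sup>2 * (1 / cmod w ^ 3)" "norm (10 * R * (1 / cmod w ^ 3)) = 10 * R * (1 / cmod w ^ 3)" for w
    using R by (simp_all add: abs_mult)
   then show "(%w. norm (2 * R\<^sup>2 * (1 / cmod w ^ 3))) summable_on G" "(%w. norm (10 * R * (1 / cmod w ^ 3))) summable_on G"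
    by (simp_all only: summable_on_cmult_right[OF cube])
  qed
  show "(%w. zterm w z) summable_on G"
   by (rule abs_summable_summable, rule Infinite_Sum.abs_summable_on_comparison_test[OF a(1)], rule order_trans[OF b1[OF _ z]]) (use R in auto)
  show "(%w. pterm w z) summable_on G"
   by (rule abs_summable_summable, rule Infinite_Sum.abs_summable_on_comparison_test[OF a(2)], rule order_trans[OF b2[OF _ z]]) (use R in auto)
 qed
 define H where "H z = infsum (%w. zterm w z) G" for z
 define H' where "H' z = infsum (%w. pterm w z) G" for z
 have ul: "uniform_limit (cball 0 R) (%X z. \<Sum>w\<in>X. zterm w z) H (finite_subsets_at_top G)"
  unfolding H_def by (rule Weierstrass_m_test_general[OF b1 summable_on_cmult_right[OF cube]])
 have d: "((%z. zterm w z) has_field_derivative - pterm w z) (at z)" if "z ~= w" "w ~= 0" for w z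
  unfolding zterm_def pterm_def using that
  by (auto intro!: derivative_eq_intros simp: power2_eq_square divide_inverse)
 have ev: "\<forall>\<^sub>F X in finite_subsets_at_top G. continuous_on (cball 0 R) (%z. \<Sum>w\<in>X. zterm w z) \<and>
   (\<forall>z\<in>ball 0 R. ((%z. \<Sum>w\<in>X. zterm w z) has_field_derivative (\<Sum>w\<in>X. - pterm w z)) (at z))"
 proof (rule eventually_finite_subsets_at_top_weakI)
  fix X assume X: "finite X" "X \<subseteq> G"
  have dz: "((%z. \<Sum>w\<in>X. zterm w z) has_field_derivative (\<Sum>w\<in>X. - pterm w z)) (at z)" if z: "z \<in> cball 0 R" for z
  proof (rule DERIV_sum)
   fix w assume "w \<in> X"
   then have "w \<in> G" using X by auto
   then show "((%z. zterm w z) has_field_derivative - pterm w z) (at z)" using zw[OF _ z, of w] G[of w] by (intro d) auto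
  qed
  then have "continuous_on (cball 0 R) (%z. \<Sum>w\<in>X. zterm w z)"
   using DERIV_isCont by (blast intro: continuous_at_imp_continuous_on)
  then show "continuous_on (cball 0 R) (%z. \<Sum>w\<in>X. zterm w z) \<and>
   (\<forall>z\<in>ball 0 R. ((%z. \<Sum>w\<in>X. zterm w z) has_field_derivative (\<Sum>w\<in>X. - pterm w z)) (at z))"
   using dz by auto
 qed
 obtain g' where g': "!!z. z \<in> ball 0 R ==> (H has_field_derivative g' z) (at z) \<and>
  ((%X. \<Sum>w\<in>X. - pterm w z) \<longlongrightarrow> g' z) (finite_subsets_at_top G)"
  using has_complex_derivative_uniform_limit[OF ev ul _ R] by auto
 have Hd: "(H has_field_derivative - H' z) (at z)" if z: "z \<in> ball 0 R" for z
 proof -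
  have "((%w. - pterm w z) has_sum g' z) G" using g'[OF z] by (simp add: has_sum_def)
  then have "g' z = infsum (%w. - pterm w z) G" by (simp add: infsumI)
  then show ?thesis using g'[OF z] by (simp add: H'_def infsum_uminus)
 qed
 have sF: "f summable_on F" "infsum f F = sum f F" for f :: "complex => complex" using finF by auto
 show thesis
 proof (rule that[OF Hd], goal_cases)
  case (2 z)
  then show ?case unfolding FG(1) F_def[symmetric] H_def by (subst infsum_Un_disjoint[OF sF(1) s1 FG(2)]) (auto simp: sF)
 next
  case (3 z)
  then show ?case unfolding FG(1) F_def[symmetric] H'_def by (subst infsum_Un_disjoint[OF sF(1) s2 FG(2)]) (auto simp: sF)
 next
  case (4 z) then show ?case unfolding FG(1) by (intro summable_on_Un_disjoint[OF sF(1) s1 FG(2)]) auto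
 next
  case (5 z) then show ?case unfolding FG(1) by (intro summable_on_Un_disjoint[OF sF(1) s2 FG(2)]) auto
 qed auto
qed

lemma summable_terms: "(%w. zterm w z) summable_on L0" "(%w. pterm w z) summable_on L0"
proof -
 have R: "cmod z + 1 > 0" using norm_ge_zero[of z] by linarith
 have "z \<in> ball 0 (cmod z + 1)" by simp
 then show "(%w. zterm w z) summable_on L0" "(%w. pterm w z) summable_on L0"
  using local_sums[OF R] by metis+
qed

lemma zeta_wp_principal:
 assumes s: "s \<in> \<Lambda>"
 obtains r h h' where "r > 0" "!!z. z \<in> ball s r ==> (h has_field_derivative - h' z) (at z)"
  "!!z. z \<in> ball s r - {s} ==> zeta z = 1 / (z - s) + h z"
  "!!z. z \<in> ball s r - {s} ==> wp z = 1 / (z - s)\<^sup>2 + h' z"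
  "ball s r \<inter> \<Lambda> = {s}"
proof -
 define R where "R = cmod s + rmin + 1"
 have R: "R > 0" using rmin_pos norm_ge_zero[of s] unfolding R_def by linarith
 obtain H H' where H: "!!z. z \<in> ball 0 R ==> (H has_field_derivative - H' z) (at z)"
  "!!z. z \<in> ball 0 R ==> infsum (%w. zterm w z) L0 = (\<Sum>w\<in>\<Lambda> \<inter> cball 0 (2 * R) - {0}. zterm w z) + H z"
  "!!z. z \<in> ball 0 R ==> infsum (%w. pterm w z) L0 = (\<Sum>w\<in>\<Lambda> \<inter> cball 0 (2 * R) - {0}. pterm w z) + H' z"
  using local_sums[OF R] by metis
 define F where "F = \<Lambda> \<inter> cball 0 (2 * R)"
 have finF: "finite F" unfolding F_def by (rule finite_lattice_cball)
 have sF: "s \<in> F" "0 \<in> F" using s R rmin_pos norm_ge_zero[of s] by (auto simp: F_def R_def)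
 have sub: "z \<in> ball 0 R" if "z \<in> ball s rmin" for z
  using that norm_triangle_ineq2[of z s] by (simp add: R_def dist_norm norm_minus_commute)
 have sep: "z ~= w" if "z \<in> ball s rmin" "w \<in> \<Lambda>" "w ~= s" for z w
  using lattice_dist[OF s that(2)] that by (auto simp: dist_norm)
 \<comment> \<open>The correction terms are absent for w = 0. With this convention 1/z joins the
   finite sum, from which the singular term at any lattice point \<open>s\<close> can be removed in
   the same way.\<close>
 define A where "A w = (if w = 0 then 0 else 1 / w)" for w :: complex
 define B where "B w = (if w = 0 then 0 else 1 / w\<^sup>2)" for w :: complex
 define h where "h z = (\<Sum>w\<in>F - {s}. 1 / (z - w)) + (\<Sum>w\<in>F. A w + z * B w) + H z" for z
 define h' where "h' z = (\<Sum>w\<in>F - {s}. 1 / (z - w)\<^sup>2) - (\<Sum>w\<in>F. B w) + H' z" for z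
 have e1: "zeta z = (\<Sum>w\<in>F. 1 / (z - w)) + (\<Sum>w\<in>F. A w + z * B w) + H z" if "z \<in> ball 0 R" for z
 proof -
  have "(\<Sum>w\<in>F. 1 / (z - w)) + (\<Sum>w\<in>F. A w + z * B w) = (\<Sum>w\<in>F. 1 / (z - w) + A w + z * B w)"
   by (simp add: sum.distrib algebra_simps)
  also have "\<dots> = 1 / z + (\<Sum>w\<in>F - {0}. 1 / (z - w) + A w + z * B w)"
   by (subst sum.remove[OF finF sF(2)]) (simp add: A_def B_def)
  also have "(\<Sum>w\<in>F - {0}. 1 / (z - w) + A w + z * B w) = (\<Sum>w\<in>F - {0}. zterm w z)"
   by (rule sum.cong) (auto simp: A_def B_def zterm_def)
  finally show ?thesis using H(2)[OF that] by (simp add: zeta_def F_def)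
 qed
 have e2: "wp z = (\<Sum>w\<in>F. 1 / (z - w)\<^sup>2) - (\<Sum>w\<in>F. B w) + H' z" if "z \<in> ball 0 R" for z
 proof -
  have "(\<Sum>w\<in>F. 1 / (z - w)\<^sup>2) - (\<Sum>w\<in>F. B w) = (\<Sum>w\<in>F. 1 / (z - w)\<^sup>2 - B w)"
   by (simp add: sum_subtractf)
  also have "\<dots> = 1 / z\<^sup>2 + (\<Sum>w\<in>F - {0}. 1 / (z - w)\<^sup>2 - B w)"
   by (subst sum.remove[OF finF sF(2)]) (simp add: B_def)
  also have "(\<Sum>w\<in>F - {0}. 1 / (z - w)\<^sup>2 - B w) = (\<Sum>w\<in>F - {0}. pterm w z)"
   by (rule sum.cong) (auto simp: B_def pterm_def)
  finally show ?thesis using H(3)[OF that] by (simp add: wp_def F_def)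
 qed
 show thesis
 proof (rule that[of rmin h h'])
  show "0 < rmin" by (rule rmin_pos)
  show "ball s rmin \<inter> \<Lambda> = {s}"
  proof (intro equalityI subsetI)
   fix x assume "x \<in> ball s rmin \<inter> \<Lambda>" then show "x \<in> {s}" using sep[of x x] by blast
  qed (use s rmin_pos in simp)
  fix z assume z: "z \<in> ball s rmin"
  have "((%z. \<Sum>w\<in>F - {s}. 1 / (z - w)) has_field_derivative (\<Sum>w\<in>F - {s}. - (1 / (z - w)\<^sup>2))) (at z)"
  proof (rule DERIV_sum)
   fix w assume "w \<in> F - {s}"
   then have "z ~= w" using sep[OF z, of w] by (auto simp: F_def)
   then show "((%z. 1 / (z - w)) has_field_derivative - (1 / (z - w)\<^sup>2)) (at z)"
    by (auto intro!: derivative_eq_intros simp: power2_eq_square divide_inverse)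
  qed
  moreover have "((%z. \<Sum>w\<in>F. A w + z * B w) has_field_derivative (\<Sum>w\<in>F. B w)) (at z)"
   by (intro DERIV_sum) (auto intro!: derivative_eq_intros)
  ultimately have "(h has_field_derivative ((\<Sum>w\<in>F - {s}. - (1 / (z - w)\<^sup>2)) + (\<Sum>w\<in>F. B w) + - H' z)) (at z)"
   unfolding h_def by (intro DERIV_add H(1) sub z)
  moreover have "((\<Sum>w\<in>F - {s}. - (1 / (z - w)\<^sup>2)) + (\<Sum>w\<in>F. B w) + - H' z) = - h' z"
   by (simp add: h'_def sum_negf)
  ultimately show "(h has_field_derivative - h' z) (at z)" by simp
 next
  fix z assume z: "z \<in> ball s rmin - {s}"
  then have zz: "z \<in> ball 0 R" using sub by auto
  show "zeta z = 1 / (z - s) + h z" unfolding e1[OF zz] h_def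
   by (subst sum.remove[OF finF sF(1)]) simp
  show "wp z = 1 / (z - s)\<^sup>2 + h' z" unfolding e2[OF zz] h'_def
   by (subst sum.remove[OF finF sF(1)]) simp
 qed
qed

lemma zeta_deriv: assumes z: "z \<notin> \<Lambda>" shows "(zeta has_field_derivative - wp z) (at z)"
proof -
 define R where "R = cmod z + 1"
 have R: "R > 0" using norm_ge_zero[of z] unfolding R_def by linarith
 obtain H H' where H: "!!z. z \<in> ball 0 R ==> (H has_field_derivative - H' z) (at z)"
  "!!z. z \<in> ball 0 R ==> infsum (%w. zterm w z) L0 = (\<Sum>w\<in>\<Lambda> \<inter> cball 0 (2 * R) - {0}. zterm w z) + H z"
  "!!z. z \<in> ball 0 R ==> infsum (%w. pterm w z) L0 = (\<Sum>w\<in>\<Lambda> \<inter> cball 0 (2 * R) - {0}. pterm w z) + H' z"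
  using local_sums[OF R] by metis
 define F where "F = \<Lambda> \<inter> cball 0 (2 * R) - {0}"
 have zR: "z \<in> ball 0 R" by (simp add: R_def)
 have nz: "z ~= 0" using z by auto
 have "((%z. \<Sum>w\<in>F. zterm w z) has_field_derivative (\<Sum>w\<in>F. - pterm w z)) (at z)"
 proof (rule DERIV_sum)
  fix w assume "w \<in> F"
  then have "z ~= w" "w ~= 0" using z by (auto simp: F_def)
  then show "((%z. zterm w z) has_field_derivative - pterm w z) (at z)"
   unfolding zterm_def pterm_def
   by (auto intro!: derivative_eq_intros simp: power2_eq_square divide_inverse)
 qed
 moreover have "((%z. 1 / z) has_field_derivative - (1 / z\<^sup>2)) (at z)"
  using nz by (auto intro!: derivative_eq_intros simp: power2_eq_square divide_inverse)
 ultimately have "((%z. 1 / z + ((\<Sum>w\<in>F. zterm w z) + H z)) has_field_derivative - (1 / z\<^sup>2) + ((\<Sum>w\<in>F. - pterm w z) + - H' z)) (at z)"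
  by (intro DERIV_add H(1) zR)
 then have "(zeta has_field_derivative - (1 / z\<^sup>2) + ((\<Sum>w\<in>F. - pterm w z) + - H' z)) (at z)"
  by (rule has_field_derivative_transform_within_open[of _ _ _ "ball 0 R"]) (use zR H(2) in \<open>auto simp: zeta_def F_def\<close>)
 moreover have "- (1 / z\<^sup>2) + ((\<Sum>w\<in>F. - pterm w z) + - H' z) = - wp z"
  unfolding wp_def H(3)[OF zR] F_def[symmetric] by (simp add: sum_negf)
 ultimately show ?thesis by simp
qed

lemma zeta_odd: "zeta (- z) = - zeta z"
proof -
 have "infsum (%w. zterm w (- z)) L0 = infsum (%w. - zterm w z) L0"
 proof (rule infsum_reindex_bij_witness[of _ uminus uminus])
  fix w assume "w \<in> L0"
  have "1 / (- z - w) = - (1 / (z + w))" by (subst minus_divide_right) simp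
  then show "- zterm (- w) z = zterm w (- z)" by (simp add: zterm_def)
 qed (auto simp: lattice_minus_iff)
 then show ?thesis by (simp add: zeta_def infsum_uminus)
qed

lemma wp_even: "wp (- z) = wp z"
proof -
 have "infsum (%w. pterm w (- z)) L0 = infsum (%w. pterm w z) L0"
 proof (rule infsum_reindex_bij_witness[of _ uminus uminus])
  fix w assume "w \<in> L0"
  have "(z + w)\<^sup>2 = (- z - w)\<^sup>2" by (simp add: power2_eq_square algebra_simps)
  then show "pterm (- w) z = pterm w (- z)" by (simp add: pterm_def)
 qed (auto simp: lattice_minus_iff)
 then show ?thesis by (simp add: wp_def)
qed

text \<open>Reindexing the sum by v shows that \<open>wp (z + v) - wp z\<close> is a constant, and
  evenness at z = -v/2 makes it 0. Because 1/0 = 0, the identity between summands holds for every z,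
  so -v/2 is admissible even when it is a lattice point.\<close>

lemma wp_periodic: "periodic wp"
proof -
 define T where "T w z = 1 / (z - w)\<^sup>2 - (if w = 0 then 0 else 1 / w\<^sup>2)" for w z :: complex
 have T0: "(%w. T w z) summable_on L0" "infsum (%w. T w z) L0 = infsum (%w. pterm w z) L0" for z
 proof -
  have e: "T w z = pterm w z" if "w \<in> L0" for w using that by (auto simp: T_def pterm_def)
  show "(%w. T w z) summable_on L0" using summable_terms(2)[of z] summable_on_cong[of L0 "%w. T w z" "%w. pterm w z"] e by auto
  show "infsum (%w. T w z) L0 = infsum (%w. pterm w z) L0" by (rule infsum_cong) (rule e)
 qed
 have L: "\<Lambda> = {0} \<union> L0" by auto
 have Ts: "(%w. T w z) summable_on \<Lambda>" for z
  by (subst L) (intro summable_on_Un_disjoint T0, auto)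
 have wpT: "wp z = infsum (%w. T w z) \<Lambda>" for z
  by (subst L, subst infsum_Un_disjoint) (auto intro: T0 simp: T0(2) wp_def, simp add: T_def)
 have shift: "\<exists>c. \<forall>z. wp (z + v) = wp z + c" if v: "v \<in> \<Lambda>" for v
 proof -
  have e: "T (w + v) (z + v) = T w z + T (w + v) v - T w 0" for w z
   by (auto simp: T_def)
  have bij: "bij_betw (%w. w + v) \<Lambda> \<Lambda>"
   by (rule bij_betwI[where g = "%w. w - v"]) (auto intro: lattice_add lattice_diff v)
  have s: "(%w. T (w + v) x) summable_on \<Lambda>" for x using Ts by (subst summable_on_reindex_bij_betw[OF bij])
  have "wp (z + v) = wp z + (infsum (%w. T (w + v) v) \<Lambda> - infsum (%w. T w 0) \<Lambda>)" for z
  proof -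
   have "wp (z + v) = infsum (%w. T (w + v) (z + v)) \<Lambda>" unfolding wpT by (rule infsum_reindex_bij_betw[OF bij, symmetric])
   also have "\<dots> = infsum (%w. T w z + T (w + v) v - T w 0) \<Lambda>" by (simp only: e)
   also have "\<dots> = infsum (%w. T w z) \<Lambda> + infsum (%w. T (w + v) v) \<Lambda> - infsum (%w. T w 0) \<Lambda>"
   proof (rule infsumI)
    show "((%w. T w z + T (w + v) v - T w 0) has_sum infsum (%w. T w z) \<Lambda> + infsum (%w. T (w + v) v) \<Lambda> - infsum (%w. T w 0) \<Lambda>) \<Lambda>"
     unfolding diff_conv_add_uminus
     by (intro has_sum_add has_sum_uminus[THEN iffD2] has_sum_infsum Ts s) (simp add: has_sum_infsum Ts has_sum_uminus)
   qed
   finally show ?thesis by (simp add: wpT)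
  qed
  then show ?thesis by blast
 qed
 have half: "wp (z + v) = wp z" if v: "v \<in> \<Lambda>" for v z
 proof -
  obtain c where c: "!!z. wp (z + v) = wp z + c" using shift[OF v] by blast
  have "wp (- v / 2 + v) = wp (- v / 2) + c" by (rule c)
  moreover have "- v / 2 + v = v / 2" "- v / 2 = - (v / 2)" by (simp_all add: field_simps)
  ultimately have "c = 0" using wp_even[of "v / 2"] by simp
  then show ?thesis using c by simp
 qed
 then show ?thesis by (rule periodicI)
qed

end

text \<open>The limit condition is Riemann's criterion for a removable singularity at each point of
  the closed discrete set \<open>S\<close>.\<close>

lemma extend_entire:
 assumes S: "closed S" "!!x. \<not> x islimpt S" and f: "f holomorphic_on (- S)"
  and lim: "!!s. s \<in> S ==> ((%z. (z - s) * f z) \<longlongrightarrow> 0) (at s)"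
 obtains g where "g holomorphic_on UNIV" "!!z. z \<notin> S ==> g z = f z"
proof (rule that[of "remove_sings f"])
 have an: "f analytic_on {z}" if "z \<notin> S" for z
  using that f S(1) analytic_at[of f z] by auto
 show eq: "remove_sings f z = f z" if "z \<notin> S" for z
  by (rule remove_sings_at_analytic[OF an[OF that]])
 have "remove_sings f analytic_on {z}" for z
 proof (cases "z \<in> S")
  case False
  then show ?thesis using remove_sings_analytic_on an by blast
 next
  case True
  obtain e where e: "e > 0" "!!x. x \<in> S ==> x ~= z ==> e <= dist x z"
   using S(2)[of z] unfolding islimpt_approachable by (meson not_less)
  have sub: "ball z e - {z} \<subseteq> - S" using e(2) by (force simp: dist_commute)
  have h: "f holomorphic_on ball z e - {z}" by (rule holomorphic_on_subset[OF f sub])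
  obtain g where g: "g holomorphic_on ball z e" "!!x. x \<in> ball z e - {z} ==> g x = f x"
   using holomorphic_on_extend_lim[OF h] lim[OF True] e(1) by (auto simp: interior_open)
  have "isCont g z" using g(1) e(1) by (auto simp: continuous_on_eq_continuous_at dest!: holomorphic_on_imp_continuous_on)
  then have "(g \<longlongrightarrow> g z) (at z)" by (simp add: isCont_def)
  moreover have "\<forall>\<^sub>F x in at z. g x = f x"
   unfolding eventually_at using g(2) e(1) by (intro exI[of _ e]) (auto simp: dist_commute)
  ultimately have "f \<midarrow>z\<rightarrow> g z" by (rule Lim_transform_eventually)
  moreover have "isolated_singularity_at f z"
   by (rule isolated_singularity_at_holomorphic[OF h]) (use e in auto)
  ultimately show ?thesis by (intro remove_sings_analytic_at)
 qed
 then have "remove_sings f analytic_on UNIV" using analytic_on_analytic_at by blast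
 then show "remove_sings f holomorphic_on UNIV" by (rule analytic_imp_holomorphic)
qed

context torus_lattice
begin

section \<open>Liouville's theorem for elliptic functions and identities derived from it\<close>

definition orbit :: "complex set => complex set" where "orbit C = {z. \<exists>c\<in>C. z - c \<in> \<Lambda>}"

lemma orbit_eq: "orbit C = (\<Union>c\<in>C. (+) c ` \<Lambda>)"
proof -
 have "z - c \<in> \<Lambda> \<longleftrightarrow> z \<in> (+) c ` \<Lambda>" for z c by (auto simp: image_iff) (metis add_diff_cancel_left' diff_add_cancel add.commute)
 then show ?thesis by (auto simp: orbit_def)
qed

lemma orbit_0: "orbit {0} = \<Lambda>" by (simp add: orbit_def)

lemma orbit_props: assumes "finite C" shows "closed (orbit C)" "countable (orbit C)" "\<not> x islimpt (orbit C)"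
proof -
 show "closed (orbit C)" "countable (orbit C)" unfolding orbit_eq
  using assms uniform_discrete_translates by (blast intro: closed_UN countable_UN countable_finite)+
 have nl: "\<not> x islimpt ((+) c ` \<Lambda>)" for c using uniform_discrete_translates(1)[of c] by (auto simp: sparse_in_def)
 show "\<not> x islimpt (orbit C)" unfolding orbit_eq using assms
  by (induction C rule: finite_induct) (auto simp: islimpt_Un nl)
qed

lemma orbit_add: "w \<in> \<Lambda> ==> z + w \<in> orbit C \<longleftrightarrow> z \<in> orbit C"
proof -
 assume w: "w \<in> \<Lambda>"
 have "z + w - c \<in> \<Lambda> \<longleftrightarrow> z - c \<in> \<Lambda>" for c using lattice_add_iff[OF w, of "z - c"] by (simp add: algebra_simps)
 then show ?thesis by (simp add: orbit_def)
qed

lemma eventually_not_orbit: "finite C ==> \<forall>\<^sub>F z in at x. z \<notin> orbit C"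
 using orbit_props(3)[of C x] by (auto simp: islimpt_iff_eventually)

text \<open>Periodicity transports the limit condition to all translates, the singularities are
  removable, and a compact cell bounds the extension. The identities between \<open>wp\<close>,
  \<open>zeta\<close> and \<open>sigma\<close> below come from it by matching poles with
  zeros.\<close>

lemma elliptic_const:
 assumes C: "finite C" and f: "f holomorphic_on - orbit C"
  and per: "!!z w. z \<notin> orbit C ==> w \<in> \<Lambda> ==> f (z + w) = f z"
  and lim: "!!c. c \<in> C ==> ((%z. (z - c) * f z) \<longlongrightarrow> 0) (at c)"
 shows "\<exists>k. \<forall>z. z \<notin> orbit C --> f z = k"
proof -
 have lim': "((%z. (z - s) * f z) \<longlongrightarrow> 0) (at s)" if s: "s \<in> orbit C" for s
 proof -
  obtain c where c: "c \<in> C" "s - c \<in> \<Lambda>" using s by (auto simp: orbit_def)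
  have "(%x. (%z. (z - c) * f z) (x + (c - s))) \<midarrow>(c - (c - s))\<rightarrow> 0" by (rule LIM_offset[OF lim[OF c(1)]])
  then have "((%x. (x - s) * f (x + (c - s))) \<longlongrightarrow> 0) (at s)" by (simp add: algebra_simps)
  moreover have "\<forall>\<^sub>F x in at s. (x - s) * f (x + (c - s)) = (x - s) * f x"
   using eventually_not_orbit[OF C, of s]
  proof (rule eventually_mono)
   fix x assume "x \<notin> orbit C"
   then have "f (x + (c - s)) = f x" using c(2) lattice_minus[of "s - c"] by (intro per) auto
   then show "(x - s) * f (x + (c - s)) = (x - s) * f x" by simp
  qed
  ultimately show ?thesis by (rule Lim_transform_eventually)
 qed
 obtain g where g: "g holomorphic_on UNIV" "!!z. z \<notin> orbit C ==> g z = f z"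
  using extend_entire[OF orbit_props(1)[OF C] orbit_props(3)[OF C] f lim'] by blast
 have gc: "continuous_on UNIV g" using g(1) by (rule holomorphic_on_imp_continuous_on)
 have "bounded (g ` cell)"
  by (intro compact_imp_bounded compact_continuous_image compact_cell continuous_on_subset[OF gc]) auto
 then obtain K where K: "!!z. z \<in> cell ==> cmod (g z) <= K" unfolding bounded_iff by blast
 have K1: "cmod (g z) <= K" if z: "z \<notin> orbit C" for z
 proof -
  obtain w where w: "w \<in> \<Lambda>" "z - w \<in> P" by (rule lattice_reduce)
  have mw: "- w \<in> \<Lambda>" using w(1) by (rule lattice_minus)
  have zw: "z + - w \<notin> orbit C" using orbit_add[OF mw, of z C] z by simp
  have "g z = f z" by (rule g(2)[OF z])
  also have "\<dots> = f (z + - w)" by (rule per[OF z mw, symmetric])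
  also have "\<dots> = g (z + - w)" by (rule g(2)[OF zw, symmetric])
  finally show ?thesis using K w P_subset_cell by auto
 qed
 have "cmod (g z) <= K" for z
 proof (rule Lim_norm_ubound[of "at z" g])
  show "(g \<longlongrightarrow> g z) (at z)" using gc by (simp add: continuous_on_eq_continuous_at isCont_def)
  show "\<forall>\<^sub>F x in at z. cmod (g x) <= K" using eventually_not_orbit[OF C, of z] K1 by (rule eventually_mono)
 qed simp
 then have "bounded (range g)" by (auto simp: bounded_iff)
 then obtain k where "!!z. g z = k" using Liouville_theorem[OF g(1)] by (auto simp: constant_on_def)
 then show ?thesis using g(2) by metis
qed

lemma ev_not_lattice: "\<forall>\<^sub>F z in at x. z \<notin> \<Lambda>"
 using eventually_not_orbit[of "{0}" x] by (simp add: orbit_0)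

lemma half_not_lattice: "\<omega>\<^sub>1 / 2 \<notin> \<Lambda>"
proof
 assume "\<omega>\<^sub>1 / 2 \<in> \<Lambda>"
 then obtain m where "cs (\<omega>\<^sub>1 / 2) = of_int m" by (auto simp: lattice_iff elim!: Ints_cases)
 moreover have "cs (\<omega>\<^sub>1 / 2) = 1 / 2" using cs_simps(4)[of "1/2" \<omega>\<^sub>1] by (simp add: cs_simps)
 ultimately have "real_of_int 1 = real_of_int (2 * m)" by simp
 then have "1 = 2 * m" by (simp only: of_int_eq_iff)
 then show False by presburger
qed

lemma zeta_lim: assumes "s \<in> \<Lambda>" shows "((%z. (z - s) * zeta z) \<longlongrightarrow> 1) (at s)"
 and wp_lim: "((%z. (z - s)\<^sup>2 * wp z) \<longlongrightarrow> 1) (at s)"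
proof -
 obtain r h h' where r: "r > 0" "!!z. z \<in> ball s r ==> (h has_field_derivative - h' z) (at z)"
  "!!z. z \<in> ball s r - {s} ==> zeta z = 1 / (z - s) + h z"
  "!!z. z \<in> ball s r - {s} ==> wp z = 1 / (z - s)\<^sup>2 + h' z"
  by (rule zeta_wp_principal[OF assms]) (rule that)
 have ev: "\<forall>\<^sub>F z in at s. z \<in> ball s r - {s}"
  unfolding eventually_at using r(1) by (intro exI[of _ r]) (auto simp: dist_commute)
 have ch: "isCont h s" using r(1) r(2)[of s] DERIV_isCont by auto
 have "h holomorphic_on ball s r" using r(2) unfolding holomorphic_on_open[OF open_ball] by blast
 then have dh: "deriv h holomorphic_on ball s r" by (rule holomorphic_deriv) auto
 have "h' holomorphic_on ball s r"
  by (rule holomorphic_transform[of "%z. - deriv h z"]) (use dh DERIV_imp_deriv[OF r(2)] in \<open>auto intro!: holomorphic_intros\<close>)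
 then have ch': "isCont h' s" using r(1) by (auto simp: continuous_on_eq_continuous_at dest!: holomorphic_on_imp_continuous_on)
 have "((%z. 1 + (z - s) * h z) \<longlongrightarrow> 1 + (s - s) * h s) (at s)"
  using ch unfolding isCont_def by (intro tendsto_intros)
 moreover have "\<forall>\<^sub>F z in at s. 1 + (z - s) * h z = (z - s) * zeta z"
  using ev by (rule eventually_mono) (simp add: r(3) algebra_simps)
 ultimately show "((%z. (z - s) * zeta z) \<longlongrightarrow> 1) (at s)"
  by (auto intro: Lim_transform_eventually)
 have "((%z. 1 + (z - s)\<^sup>2 * h' z) \<longlongrightarrow> 1 + (s - s)\<^sup>2 * h' s) (at s)"
  using ch' unfolding isCont_def by (intro tendsto_intros)
 moreover have "\<forall>\<^sub>F z in at s. 1 + (z - s)\<^sup>2 * h' z = (z - s)\<^sup>2 * wp z"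
  using ev by (rule eventually_mono) (simp add: r(4) distrib_left)
 ultimately show "((%z. (z - s)\<^sup>2 * wp z) \<longlongrightarrow> 1) (at s)"
  by (auto intro: Lim_transform_eventually)
qed

lemma zeta_holo: "zeta holomorphic_on - \<Lambda>"
 using zeta_deriv open_compl_lattice by (auto simp: holomorphic_on_open)

lemma wp_holo: "wp holomorphic_on - \<Lambda>"
proof -
 have "deriv zeta holomorphic_on - \<Lambda>" using zeta_holo open_compl_lattice by (rule holomorphic_deriv)
 then have "(%z. - deriv zeta z) holomorphic_on - \<Lambda>" by (rule holomorphic_on_minus)
 then show ?thesis by (rule holomorphic_transform) (use DERIV_imp_deriv[OF zeta_deriv] in auto)
qed

abbreviation "wp1 \<equiv> deriv wp"

lemma wp_deriv: "z \<notin> \<Lambda> ==> (wp has_field_derivative wp1 z) (at z)"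
 using holomorphic_derivI[OF wp_holo open_compl_lattice] by auto

lemma wp1_holo: "wp1 holomorphic_on - \<Lambda>"
 using wp_holo open_compl_lattice by (rule holomorphic_deriv)

text \<open>The regular part is even, and its value at 0 is 0 because every \<open>pterm\<close>
  vanishes there.\<close>

lemma wp_at_0:
 obtains r g where "r > 0" "g holomorphic_on ball 0 r" "g 0 = 0" "deriv g 0 = 0"
  "!!z. z \<in> ball 0 r - {0} ==> wp z = 1 / z\<^sup>2 + g z" "ball 0 r \<inter> \<Lambda> = {0}"
proof -
 define R where "R = rmin / 4"
 have R: "R > 0" using rmin_pos by (simp add: R_def)
 obtain H H' where H: "!!z. z \<in> ball 0 R ==> (H has_field_derivative - H' z) (at z)"
  "!!z. z \<in> ball 0 R ==> infsum (%w. pterm w z) L0 = (\<Sum>w\<in>\<Lambda> \<inter> cball 0 (2 * R) - {0}. pterm w z) + H' z"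
  using local_sums[OF R] by metis
 have E: "\<Lambda> \<inter> cball 0 (2 * R) - {0} = {}" using lattice_norm_ge rmin_pos by (force simp: R_def)
 have H2: "infsum (%w. pterm w z) L0 = H' z" if "z \<in> ball 0 R" for z using H(2)[OF that] unfolding E by simp
 have h0: "H' 0 = 0" using H2[of 0] R by (simp add: pterm_def)
 have wpe: "wp z = 1 / z\<^sup>2 + H' z" if "z \<in> ball 0 R" for z using H2[OF that] by (simp add: wp_def)
 have "H holomorphic_on ball 0 R" using H(1) unfolding holomorphic_on_open[OF open_ball] by blast
 then have dh: "deriv H holomorphic_on ball 0 R" by (rule holomorphic_deriv) auto
 have hol: "H' holomorphic_on ball 0 R"
  by (rule holomorphic_transform[of "%z. - deriv H z"]) (use dh DERIV_imp_deriv[OF H(1)] in \<open>auto intro!: holomorphic_intros\<close>)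
 have even: "H' (- z) = H' z" if "z \<in> ball 0 R" for z
  using wpe[OF that] wpe[of "- z"] that wp_even[of z] by simp
 have d: "(H' has_field_derivative deriv H' 0) (at 0)" using holomorphic_derivI[OF hol, of 0] R by simp
 then have "((%z. H' (- z)) has_field_derivative deriv H' 0 * (- 1)) (at 0)"
  by (intro DERIV_chain'[of uminus "-1" 0 UNIV H']) (auto intro!: derivative_eq_intros)
 then have "(H' has_field_derivative deriv H' 0 * (- 1)) (at 0)"
  by (rule has_field_derivative_transform_within_open[of _ _ _ "ball 0 R"]) (use R even in auto)
 from DERIV_unique[OF d this] have "deriv H' 0 = 0" by simp
 moreover have "ball 0 R \<inter> \<Lambda> = {0}" using lattice_norm_ge rmin_pos by (force simp: R_def)
 ultimately show thesis using that[of R H'] R hol h0 wpe by simp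
qed

lemma holo_const:
 assumes "open U" "connected U" "!!z. z \<in> U ==> (f has_field_derivative 0) (at z)" "x \<in> U" "y \<in> U"
 shows "f x = (f y :: complex)"
 by (rule wirt_zero_const[OF assms(1,2) _ assms(4,5)]) (rule wirt_holo[OF assms(3)])

lemma connected_compl_lattice: "connected (- \<Lambda>)" by (rule connected_compl_countable[OF countable_lattice])

text \<open>The difference has derivative 0 because \<open>wp\<close> is periodic, and the
  complement of the countable lattice is connected.\<close>

lemma zeta_quasi: assumes w: "w \<in> \<Lambda>" obtains e where "!!z. z \<notin> \<Lambda> ==> zeta (z + w) = zeta z + e"
proof -
 have "((%z. zeta (z + w) - zeta z) has_field_derivative 0) (at z)" if "z \<in> - \<Lambda>" for z
 proof -
  have zw: "z + w \<notin> \<Lambda>" using that w lattice_add_iff by simp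
  have "((%z. zeta (z + w)) has_field_derivative - wp (z + w) * 1) (at z)"
   by (intro DERIV_chain'[of "%z. z + w" 1 z UNIV zeta] zeta_deriv zw) (auto intro!: derivative_eq_intros)
  then have "((%z. zeta (z + w) - zeta z) has_field_derivative (- wp (z + w) * 1 - - wp z)) (at z)"
   using that by (intro DERIV_diff zeta_deriv) auto
  then show ?thesis using periodic_lattice[OF wp_periodic w, of z] by simp
 qed
 note hc = holo_const[OF open_compl_lattice connected_compl_lattice this]
 have h: "\<omega>\<^sub>1 / 2 \<in> - \<Lambda>" using half_not_lattice by simp
 have "zeta (z + w) = zeta z + (zeta (\<omega>\<^sub>1 / 2 + w) - zeta (\<omega>\<^sub>1 / 2))" if "z \<notin> \<Lambda>" for z
  using hc[of z "\<omega>\<^sub>1 / 2"] that h by (simp add: algebra_simps)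
 then show thesis by (rule that)
qed

definition eta :: "complex => complex" where "eta w = (THE e. \<forall>z. z \<notin> \<Lambda> --> zeta (z + w) = zeta z + e)"

lemma zeta_shift: assumes "w \<in> \<Lambda>" "z \<notin> \<Lambda>" shows "zeta (z + w) = zeta z + eta w"
proof -
 obtain e where e: "!!z. z \<notin> \<Lambda> ==> zeta (z + w) = zeta z + e" by (rule zeta_quasi[OF assms(1)]) (rule that)
 have "eta w = e" unfolding eta_def
 proof (rule the_equality)
  fix e' assume "\<forall>z. z \<notin> \<Lambda> --> zeta (z + w) = zeta z + e'"
  then show "e' = e" using e[OF assms(2)] assms(2) by (metis add_left_cancel)
 qed (use e in auto)
 then show ?thesis using e assms by simp
qed

text \<open>The expansion in zeta functions of the integrand wp'(a) / (wp z - wp a) of the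
  developing map, as \<open>zz_wp\<close> shows.\<close>

definition zz :: "complex => complex => complex" where "zz a z = zeta (z - a) - zeta (z + a) + 2 * zeta a"

lemma wp_not_locally_const: "\<not> (\<forall>\<^sub>F z in at a. wp z = k)" if a: "a \<notin> \<Lambda>"
proof
 assume ev: "\<forall>\<^sub>F z in at a. wp z = k"
 then obtain d where d: "d > 0" "!!z. z ~= a ==> dist z a < d ==> wp z = k" unfolding eventually_at by auto
 have lp: "a islimpt (ball a d - {a} - \<Lambda>)" unfolding islimpt_iff_eventually
 proof
  assume "\<forall>\<^sub>F y in at a. y \<notin> ball a d - {a} - \<Lambda>"
  moreover have "\<forall>\<^sub>F y in at a. y \<in> ball a d - {a}"
   unfolding eventually_at using d(1) by (intro exI[of _ d]) (auto simp: dist_commute)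
  ultimately have "\<forall>\<^sub>F y in at a. False" using ev_not_lattice[of a] by eventually_elim auto
  then show False by simp
 qed
 have h: "(%z. wp z - k) holomorphic_on - \<Lambda>" by (intro holomorphic_intros wp_holo)
 have "wp z - k = 0" if "z \<in> - \<Lambda>" for z
  by (rule analytic_continuation[OF h open_compl_lattice connected_compl_lattice _ _ lp _ that])
   (use a d in \<open>auto simp: dist_commute\<close>)
 then have c: "wp z = k" if "z \<notin> \<Lambda>" for z using that by simp
 have "((%z. (z - 0)\<^sup>2 * k) \<longlongrightarrow> (0 - 0)\<^sup>2 * k) (at 0)" by (intro tendsto_intros)
 moreover have "\<forall>\<^sub>F z in at 0. (z - 0)\<^sup>2 * k = (z - 0)\<^sup>2 * wp z"
  using ev_not_lattice[of 0] by (rule eventually_mono) (simp add: c)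
 ultimately have "((%z. (z - 0)\<^sup>2 * wp z) \<longlongrightarrow> 0) (at 0)" by (auto intro: Lim_transform_eventually)
 from tendsto_unique[OF _ this wp_lim[OF lattice_0]] show False by simp
qed

text \<open>If \<open>B\<close> were omitted, 1 / (wp - B) would be elliptic without poles and tend
  to 0 at the lattice, hence be identically 0.\<close>

lemma wp_surj: obtains a where "a \<notin> \<Lambda>" "wp a = B"
proof (rule ccontr)
 assume "\<not> thesis"
 then have no: "wp z - B ~= 0" if "z \<notin> \<Lambda>" for z using that \<open>!!a. a \<notin> \<Lambda> ==> wp a = B ==> thesis\<close> by auto
 define f where "f z = 1 / (wp z - B)" for z
 have hf: "f holomorphic_on - orbit {0}" unfolding f_def orbit_0
  by (intro holomorphic_intros wp_holo) (use no in auto)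
 have pf: "f (z + w) = f z" if "z \<notin> orbit {0}" "w \<in> \<Lambda>" for z w
  using periodic_lattice[OF wp_periodic that(2), of z] by (simp add: f_def)
 have "((%z. z\<^sup>2 / ((z - 0)\<^sup>2 * wp z - z\<^sup>2 * B)) \<longlongrightarrow> 0\<^sup>2 / (1 - 0\<^sup>2 * B)) (at 0)"
  by (intro tendsto_intros wp_lim[OF lattice_0]) auto
 moreover have "\<forall>\<^sub>F z in at 0. z\<^sup>2 / ((z - 0)\<^sup>2 * wp z - z\<^sup>2 * B) = f z"
  unfolding eventually_at by (intro exI[of _ 1]) (auto simp: f_def right_diff_distrib[symmetric])
 ultimately have f0: "(f \<longlongrightarrow> 0) (at 0)" by (auto intro: Lim_transform_eventually)
 have "((%z. (z - 0) * f z) \<longlongrightarrow> (0 - 0) * 0) (at 0)" by (intro tendsto_intros f0)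
 then have lim: "((%z. (z - 0) * f z) \<longlongrightarrow> 0) (at 0)" by simp
 have "\<exists>k. \<forall>z. z \<notin> orbit {0} --> f z = k"
  by (rule elliptic_const) (use hf pf lim in auto)
 then obtain k where k: "!!z. z \<notin> orbit {0} ==> f z = k" by blast
 have "\<forall>\<^sub>F z in at 0. f z = k" using ev_not_lattice[of 0] by (rule eventually_mono) (simp add: k orbit_0)
 then have "(f \<longlongrightarrow> k) (at 0)" by (rule tendsto_eventually)
 then have "k = 0" using tendsto_unique[OF _ f0] by simp
 moreover note half_not_lattice
 ultimately show False using k[of "\<omega>\<^sub>1 / 2"] no[of "\<omega>\<^sub>1 / 2"] by (simp add: orbit_0 f_def)
qed

lemma zz_deriv: assumes "z - a \<notin> \<Lambda>" "z + a \<notin> \<Lambda>"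
 shows "(zz a has_field_derivative wp (z + a) - wp (z - a)) (at z)"
proof -
 have 1: "((%z. zeta (z - a)) has_field_derivative - wp (z - a) * 1) (at z)"
  by (intro DERIV_chain'[of "%z. z - a" 1 z UNIV zeta] zeta_deriv assms) (auto intro!: derivative_eq_intros)
 have 2: "((%z. zeta (z + a)) has_field_derivative - wp (z + a) * 1) (at z)"
  by (intro DERIV_chain'[of "%z. z + a" 1 z UNIV zeta] zeta_deriv assms) (auto intro!: derivative_eq_intros)
 have "((%z. zeta (z - a) - zeta (z + a) + 2 * zeta a) has_field_derivative (- wp (z - a) * 1 - (- wp (z + a) * 1) + 0)) (at z)"
  by (intro DERIV_add DERIV_diff 1 2 DERIV_const)
 then show ?thesis by (simp add: zz_def[abs_def])
qed

lemma zz_periodic: assumes "z - a \<notin> \<Lambda>" "z + a \<notin> \<Lambda>" "w \<in> \<Lambda>" shows "zz a (z + w) = zz a z"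
 using zeta_shift[OF assms(3,1)] zeta_shift[OF assms(3,2)] by (simp add: zz_def algebra_simps)

lemma zeta_lim_shift: "((%z. (z - a) * zeta (z - a)) \<longlongrightarrow> 1) (at a)"
 and wp_lim_shift: "((%z. (z - a)\<^sup>2 * wp (z - a)) \<longlongrightarrow> 1) (at a)"
 using LIM_offset[OF zeta_lim(1)[OF lattice_0], of "- a"] LIM_offset[OF wp_lim[OF lattice_0], of "- a"] by simp_all

lemma zeta_isCont: "z \<notin> \<Lambda> ==> isCont zeta z" and wp_isCont: "z \<notin> \<Lambda> ==> isCont wp z"
 using zeta_deriv wp_deriv DERIV_isCont by blast+

lemma zz_0: assumes "a \<notin> \<Lambda>" shows "zz a 0 = 0" "(zz a has_field_derivative 0) (at 0)"
proof -
 show "zz a 0 = 0" unfolding zz_def diff_0 add_0_left zeta_odd by algebra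
 have "0 - a \<notin> \<Lambda>" "0 + a \<notin> \<Lambda>" unfolding diff_0 add_0_left lattice_minus_iff using assms by auto
 then show "(zz a has_field_derivative 0) (at 0)"
  using zz_deriv[of 0 a] unfolding diff_0 add_0_left wp_even diff_self by blast
qed

lemma zz_lim: assumes "2 * a \<notin> \<Lambda>" shows "((%z. (z - a) * zz a z) \<longlongrightarrow> 1) (at a)" "((%z. (z - - a) * zz a z) \<longlongrightarrow> - 1) (at (- a))"
proof -
 have c1: "((%z. zeta (z + a)) \<longlongrightarrow> zeta (a + a)) (at a)"
 proof (rule isCont_tendsto_compose[of _ zeta])
  show "isCont zeta (a + a)" using zeta_isCont[OF assms] unfolding mult_2 .
 qed (intro tendsto_intros)
 have "((%z. (z - a) * zeta (z - a) + (z - a) * (2 * zeta a - zeta (z + a))) \<longlongrightarrow> 1 + (a - a) * (2 * zeta a - zeta (a + a))) (at a)"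
  by (intro tendsto_intros zeta_lim_shift c1)
 then show "((%z. (z - a) * zz a z) \<longlongrightarrow> 1) (at a)" by (simp add: zz_def algebra_simps)
 have "- a - a = - (2 * a)" by simp
 then have ma: "- a - a \<notin> \<Lambda>" using assms lattice_minus_iff[of "2 * a"] by metis
 have c2: "((%z. zeta (z - a)) \<longlongrightarrow> zeta (- a - a)) (at (- a))"
  by (rule isCont_tendsto_compose[of _ zeta, OF zeta_isCont[OF ma]]) (intro tendsto_intros)
 have "((%z. (z - - a) * (zeta (z - a) + 2 * zeta a) - (z - - a) * zeta (z - - a)) \<longlongrightarrow> (- a - - a) * (zeta (- a - a) + 2 * zeta a) - 1) (at (- a))"
  by (intro tendsto_intros zeta_lim_shift c2)
 then show "((%z. (z - - a) * zz a z) \<longlongrightarrow> - 1) (at (- a))" by (simp add: zz_def algebra_simps)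
qed

lemma double_not_lattice: "2 * a \<notin> \<Lambda> ==> a \<notin> \<Lambda>" using lattice_add[of a a] unfolding mult_2 by blast

lemma DERIV_quotient_lim: "(f has_field_derivative d) (at a) ==> ((%z. (f z - f a) / (z - a)) \<longlongrightarrow> d) (at (a :: complex))"
 by (simp add: has_field_derivative_iff)

text \<open>The simple poles of \<open>zz a\<close> at a and -a meet zeros of wp - wp a, and the
  double pole of \<open>wp\<close> at 0 meets a double zero of \<open>zz a\<close>; the limit at a
  identifies the constant. Were it 0, the pole of \<open>zz a\<close> would make \<open>wp\<close>
  locally constant.\<close>

lemma zz_wp:
 assumes a: "2 * a \<notin> \<Lambda>"
 shows "wp1 a ~= 0" "!!z. z \<notin> orbit {0, a, - a} ==> zz a z * (wp z - wp a) = wp1 a"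
proof -
 have a0: "a \<notin> \<Lambda>" "- a \<notin> \<Lambda>" using double_not_lattice[OF a] by (auto simp: lattice_minus_iff)
 define f where "f z = zz a z * (wp z - wp a)" for z
 have off: "z \<notin> \<Lambda> \<and> z - a \<notin> \<Lambda> \<and> z + a \<notin> \<Lambda>" if "z \<notin> orbit {0, a, - a}" for z using that by (auto simp: orbit_def)
 have opn: "open (- orbit {0, a, - a})" using orbit_props(1)[of "{0, a, - a}"] by auto
 have hz: "zz a holomorphic_on - orbit {0, a, - a}"
  unfolding holomorphic_on_open[OF opn] using zz_deriv off by blast
 have hw: "wp holomorphic_on - orbit {0, a, - a}" by (rule holomorphic_on_subset[OF wp_holo]) (use off in auto)
 have hf: "f holomorphic_on - orbit {0, a, - a}" unfolding f_def by (intro holomorphic_intros hz hw)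
 have pf: "f (z + w) = f z" if "z \<notin> orbit {0, a, - a}" "w \<in> \<Lambda>" for z w
  using off[OF that(1)] that(2) periodic_lattice[OF wp_periodic that(2)] by (simp add: f_def zz_periodic)
 have wc: "((%z. wp z - wp a) \<longlongrightarrow> wp a - wp a) (at a)" "((%z. wp z - wp a) \<longlongrightarrow> wp (- a) - wp a) (at (- a))"
  by (intro tendsto_diff tendsto_const; use wp_isCont[OF a0(1)] wp_isCont[OF a0(2)] in \<open>simp add: isCont_def\<close>)+
 have la: "((%z. (z - a) * f z) \<longlongrightarrow> 0) (at a)"
  using tendsto_mult[OF zz_lim(1)[OF a] wc(1)] by (simp add: f_def mult.assoc)
 have lma: "((%z. (z - - a) * f z) \<longlongrightarrow> 0) (at (- a))"
  using tendsto_mult[OF zz_lim(2)[OF a] wc(2)] by (simp add: f_def mult.assoc wp_even)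
 have "((%z. zz a z / z) \<longlongrightarrow> 0) (at 0)" using DERIV_quotient_lim[OF zz_0(2)[OF a0(1)]] zz_0(1)[OF a0(1)] by simp
 then have "((%z. zz a z / z * ((z - 0)\<^sup>2 * wp z - z\<^sup>2 * wp a)) \<longlongrightarrow> 0 * (1 - 0\<^sup>2 * wp a)) (at 0)"
  by (intro tendsto_intros wp_lim[OF lattice_0])
 moreover have "\<forall>\<^sub>F z in at 0. zz a z / z * ((z - 0)\<^sup>2 * wp z - z\<^sup>2 * wp a) = (z - 0) * f z"
  unfolding eventually_at by (intro exI[of _ 1]) (auto simp: f_def power2_eq_square algebra_simps)
 ultimately have l0: "((%z. (z - 0) * f z) \<longlongrightarrow> 0) (at 0)" by (auto intro: Lim_transform_eventually)
 have "\<exists>k. \<forall>z. z \<notin> orbit {0, a, - a} --> f z = k"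
 proof (rule elliptic_const)
  fix c assume "c \<in> {0, a, - a}"
  then show "((%z. (z - c) * f z) \<longlongrightarrow> 0) (at c)" using l0 la lma by blast
 qed (use hf pf in auto)
 then obtain k where k: "!!z. z \<notin> orbit {0, a, - a} ==> f z = k" by blast
 have ev: "\<forall>\<^sub>F z in at a. z \<notin> orbit {0, a, - a}" by (rule eventually_not_orbit) simp
 have na: "\<forall>\<^sub>F z in at a. z ~= a" by (simp add: eventually_at_filter)
 have "((%z. ((z - a) * zz a z) * ((wp z - wp a) / (z - a))) \<longlongrightarrow> 1 * wp1 a) (at a)"
  by (intro tendsto_mult zz_lim(1)[OF a] DERIV_quotient_lim wp_deriv a0)
 moreover have "\<forall>\<^sub>F z in at a. ((z - a) * zz a z) * ((wp z - wp a) / (z - a)) = k"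
  using ev na by eventually_elim (use k in \<open>auto simp: f_def\<close>)
 ultimately have "((%z. k) \<longlongrightarrow> wp1 a) (at a)" by (auto intro: Lim_transform_eventually)
 then have kw: "k = wp1 a" by (simp add: tendsto_const_iff)
 show "zz a z * (wp z - wp a) = wp1 a" if "z \<notin> orbit {0, a, - a}" for z using k[OF that] kw by (simp add: f_def)
 show "wp1 a ~= 0"
 proof
  assume "wp1 a = 0"
  have "\<forall>\<^sub>F z in at a. (z - a) * zz a z ~= 0" using zz_lim(1)[OF a] by (rule tendsto_imp_eventually_ne) simp
  then have "\<forall>\<^sub>F z in at a. wp z = wp a"
   using ev by eventually_elim (use k kw \<open>wp1 a = 0\<close> in \<open>auto simp: f_def\<close>)
  then show False using wp_not_locally_const[OF a0(1)] by blast
 qed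
qed

text \<open>The reflection z -> 2 a - z fixes \<open>wp\<close>, so wp - wp a has a double zero at
  the half period a, which cancels the double pole of the other factor. The same happens at
  0.\<close>

lemma wp_half:
 assumes a: "a \<notin> \<Lambda>" "2 * a \<in> \<Lambda>"
 obtains k where "wp1 a = 0" "k ~= 0" "!!z. z \<notin> orbit {0, a} ==> (wp z - wp a) * (wp (z + a) - wp a) = k"
proof -
 have rfl: "wp (2 * a - z) = wp z" for z
  using periodic_lattice[OF wp_periodic a(2), of "- z"] wp_even[of z] by (simp add: algebra_simps)
 have "((%z. wp (2 * a - z)) has_field_derivative wp1 (2 * a - a) * (0 - 1)) (at a)"
  by (intro DERIV_chain'[of "%z. 2 * a - z" "0 - 1" a UNIV wp] wp_deriv DERIV_diff DERIV_const DERIV_ident) (use a in simp)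
 then have "(wp has_field_derivative - wp1 a) (at a)" using rfl by simp
 from DERIV_unique[OF this wp_deriv[OF a(1)]] have w0: "wp1 a = 0" by simp
 define f where "f z = (wp z - wp a) * (wp (z + a) - wp a)" for z
 have off: "z \<notin> \<Lambda> \<and> z + a \<notin> \<Lambda>" if "z \<notin> orbit {0, a}" for z
 proof -
  have "z \<notin> \<Lambda>" "z - a \<notin> \<Lambda>" using that by (auto simp: orbit_def)
  moreover have "(z - a) + 2 * a = z + a" by simp
  ultimately show ?thesis using lattice_add_iff[OF a(2), of "z - a"] by metis
 qed
 have sh: "wp (z + a) = wp (z - a)" for z
  using periodic_lattice[OF wp_periodic a(2), of "z - a"] by (simp add: algebra_simps)
 have opn: "open (- orbit {0, a})" using orbit_props(1)[of "{0, a}"] by auto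
 have hw: "wp holomorphic_on - orbit {0, a}" by (rule holomorphic_on_subset[OF wp_holo]) (use off in auto)
 have hw2: "(%z. wp (z + a)) holomorphic_on - orbit {0, a}"
  by (rule holomorphic_on_compose_gen[of "%z. z + a" _ wp "- \<Lambda>", unfolded o_def]) (use wp_holo off in \<open>auto intro!: holomorphic_intros\<close>)
 have hf: "f holomorphic_on - orbit {0, a}" unfolding f_def by (intro holomorphic_intros hw hw2)
 have pf: "f (z + w) = f z" if "z \<notin> orbit {0, a}" "w \<in> \<Lambda>" for z w
  using periodic_lattice[OF wp_periodic that(2), of z] periodic_lattice[OF wp_periodic that(2), of "z + a"]
  by (simp add: f_def algebra_simps)
 have q: "((%z. (wp z - wp a) / (z - a)) \<longlongrightarrow> 0) (at a)"
  using DERIV_quotient_lim[OF wp_deriv[OF a(1)]] w0 by simp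
 have na: "\<forall>\<^sub>F z in at c. z ~= c" for c :: complex by (simp add: eventually_at_filter)
 have "((%z. (wp z - wp a) / (z - a) * ((z - a)\<^sup>2 * wp (z - a) - (z - a)\<^sup>2 * wp a)) \<longlongrightarrow> 0 * (1 - (a - a)\<^sup>2 * wp a)) (at a)"
  by (intro tendsto_intros q wp_lim_shift)
 moreover have "\<forall>\<^sub>F z in at a. (wp z - wp a) / (z - a) * ((z - a)\<^sup>2 * wp (z - a) - (z - a)\<^sup>2 * wp a) = (z - a) * f z"
  using na[of a]
 proof eventually_elim
  case (elim z)
  have "(wp z - wp a) / (z - a) * ((z - a)\<^sup>2 * wp (z - a) - (z - a)\<^sup>2 * wp a) = (wp z - wp a) / d * (d\<^sup>2 * (wp (z - a) - wp a))"
   if "d = z - a" for d using that by (simp add: right_diff_distrib)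
  from this[OF refl] elim show ?case by (simp add: f_def sh power2_eq_square)
 qed
 ultimately have la: "((%z. (z - a) * f z) \<longlongrightarrow> 0) (at a)" by (auto intro: Lim_transform_eventually)
 have "((%z. (wp (z + a) - wp (0 + a)) / (z - 0)) \<longlongrightarrow> wp1 a * 1) (at 0)"
  by (rule DERIV_quotient_lim, rule DERIV_chain'[of "%z. z + a" 1 0 UNIV wp]) (use wp_deriv[OF a(1)] in \<open>auto intro!: derivative_eq_intros\<close>)
 then have q0: "((%z. (wp (z + a) - wp a) / z) \<longlongrightarrow> 0) (at 0)" by (simp add: w0)
 have "((%z. ((z - 0)\<^sup>2 * wp z - z\<^sup>2 * wp a) * ((wp (z + a) - wp a) / z)) \<longlongrightarrow> (1 - 0\<^sup>2 * wp a) * 0) (at 0)"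
  by (intro tendsto_intros q0 wp_lim[OF lattice_0])
 moreover have "\<forall>\<^sub>F z in at 0. ((z - 0)\<^sup>2 * wp z - z\<^sup>2 * wp a) * ((wp (z + a) - wp a) / z) = (z - 0) * f z"
  using na[of 0] by eventually_elim (simp add: f_def power2_eq_square field_simps)
 ultimately have l0: "((%z. (z - 0) * f z) \<longlongrightarrow> 0) (at 0)" by (auto intro: Lim_transform_eventually)
 have "\<exists>k. \<forall>z. z \<notin> orbit {0, a} --> f z = k"
 proof (rule elliptic_const)
  fix c assume "c \<in> {0, a}"
  then show "((%z. (z - c) * f z) \<longlongrightarrow> 0) (at c)" using l0 la by blast
 qed (use hf pf in auto)
 then obtain k where k: "!!z. z \<notin> orbit {0, a} ==> f z = k" by blast
 have "k ~= 0"
 proof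
  assume k0: "k = 0"
  have "((%z. (z - a)\<^sup>2 * wp (z - a) - (z - a)\<^sup>2 * wp a) \<longlongrightarrow> 1 - (a - a)\<^sup>2 * wp a) (at a)"
   by (intro tendsto_intros wp_lim_shift)
  then have "\<forall>\<^sub>F z in at a. (z - a)\<^sup>2 * wp (z - a) - (z - a)\<^sup>2 * wp a ~= 0" by (rule tendsto_imp_eventually_ne) simp
  moreover have "\<forall>\<^sub>F z in at a. z \<notin> orbit {0, a}" by (rule eventually_not_orbit) simp
  ultimately have "\<forall>\<^sub>F z in at a. wp z = wp a"
   by eventually_elim (use k k0 sh in \<open>auto simp: f_def\<close>)
  then show False using wp_not_locally_const[OF a(1)] by blast
 qed
 then show thesis using that[of k] w0 k by (simp add: f_def)
qed

text \<open>A Weierstrass product with simple zeros at the nonzero lattice points, times z, has a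
  logarithmic derivative with the poles of \<open>zeta\<close>. The two differ by an entire
  function, and the exponential of its primitive corrects the product.\<close>

lemma sigma_exists: "\<exists>s. s holomorphic_on UNIV \<and> (\<forall>z. s z = 0 \<longleftrightarrow> z \<in> \<Lambda>) \<and>
 (\<forall>z. z \<notin> \<Lambda> --> deriv s z = zeta z * s z) \<and> (\<forall>z\<in>\<Lambda>. deriv s z ~= 0)"
proof -
 have inf: "infinite L0"
 proof -
  have "inj (%n::nat. of_int (int (Suc n)) * \<omega>\<^sub>1)" by (rule injI) (use omega_nz in auto)
  then have "infinite (range (%n::nat. of_int (int (Suc n)) * \<omega>\<^sub>1))" using range_inj_infinite by blast
  moreover have "of_int (int (Suc n)) * \<omega>\<^sub>1 \<in> L0" for n
  proof -
   have "cs (of_int (int (Suc n)) * \<omega>\<^sub>1) = of_int (int (Suc n))" "ct (of_int (int (Suc n)) * \<omega>\<^sub>1) = 0"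
    by (simp_all only: cs_simps ct_simps mult_1_right mult_zero_right)
   then have "of_int (int (Suc n)) * \<omega>\<^sub>1 \<in> \<Lambda>" unfolding lattice_iff by (metis Ints_0 Ints_of_int)
   then show ?thesis using omega_nz by (simp del: of_nat_Suc)
  qed
  then have "range (%n::nat. of_int (int (Suc n)) * \<omega>\<^sub>1) \<subseteq> L0" by (rule image_subsetI)
  ultimately show ?thesis using infinite_super by blast
 qed
 define a where "a = from_nat_into L0"
 have bij: "bij_betw a UNIV L0" unfolding a_def
  by (rule bij_betw_from_nat_into[OF _ inf]) (simp add: countable_lattice)
 have aL: "a n \<in> L0" for n using bij by (auto simp: bij_betw_def)
 have inja: "inj a" and rng: "range a = L0" using bij by (auto simp: bij_betw_def)
 \<comment> \<open>Elementary factors of order 2 converge because the inverse cubes are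
   summable.\<close>
 interpret W: weierstrass_product a "%_. 2"
 proof
  show "a n ~= 0" for n using aL by auto
  have fin: "finite {n. \<not> Z <= norm (a n)}" for Z
  proof (rule finite_subset)
   show "{n. \<not> Z <= norm (a n)} \<subseteq> a -` (\<Lambda> \<inter> cball 0 Z)" using aL by (auto simp: not_le less_imp_le)
   show "finite (a -` (\<Lambda> \<inter> cball 0 Z))" by (rule finite_vimageI[OF finite_lattice_cball inja])
  qed
  show "filterlim a at_infinity sequentially"
   unfolding filterlim_at_infinity_conv_norm_at_top filterlim_at_top cofinite_eq_sequentially[symmetric]
   using fin by (auto simp: eventually_cofinite)
  fix r :: real assume r: "r > 0"
  have "(%n. 1 / cmod (a n) ^ 3) summable_on UNIV"
   using summable_inv_cube by (subst summable_on_reindex_bij_betw[OF bij])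
  then have "summable (%n. 1 / cmod (a n) ^ 3)" by (subst (asm) summable_on_UNIV_nonneg_real_iff) auto
  then have "summable (%n. r ^ 3 * (1 / cmod (a n) ^ 3))" by (rule summable_mult)
  then show "summable (%n. (r / norm (a n)) ^ Suc 2)" by (simp add: power_divide eval_nat_numeral)
 qed
 define h where "h z = z * W.f z" for z
 have hh: "h holomorphic_on UNIV" unfolding h_def by (intro holomorphic_intros W.holomorphic)
 have h0: "h z = 0 \<longleftrightarrow> z \<in> \<Lambda>" for z using rng by (auto simp: h_def W.zero)
 have dh: "(h has_field_derivative deriv h z) (at z)" for z using holomorphic_derivI[OF hh, of z] by simp
 have dW: "(W.f has_field_derivative deriv W.f z) (at z)" for z using holomorphic_derivI[OF W.holomorphic[of UNIV], of z] by simp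
 have hd: "deriv h z = W.f z + z * deriv W.f z" for z
  unfolding h_def[abs_def] by (rule DERIV_imp_deriv) (auto intro!: derivative_eq_intros dW)
 have nz: "deriv h s ~= 0" if s: "s \<in> \<Lambda>" for s
 proof (cases "s = 0")
  case True
  then show ?thesis using W.zero[of 0] rng by (auto simp: hd)
 next
  case False
  then obtain n where n: "s = a n" using rng s by auto
  have "a -` {s} = {n}" using inja n by (auto dest: injD)
  then have zo: "zorder W.f s = 1" using W.zorder[of s] by simp
  have "W.f 0 ~= 0" using W.zero[of 0] rng by auto
  then have "\<exists>w\<in>UNIV. W.f w ~= 0" by blast
  note ze = zorder_exist_zero[of W.f UNIV s, OF W.holomorphic open_UNIV connected_UNIV UNIV_I this]
  obtain r where r: "r > 0" "zor_poly W.f s holomorphic_on cball s r"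
   "!!w. w \<in> cball s r ==> W.f w = zor_poly W.f s w * (w - s) ^ nat (zorder W.f s) \<and> zor_poly W.f s w ~= 0"
   using conjunct2[OF ze] by blast
  have f: "W.f w = zor_poly W.f s w * (w - s)" if "w \<in> cball s r" for w using r(3)[OF that] zo by simp
  have "isCont (zor_poly W.f s) s"
   using r(1,2) by (auto dest!: holomorphic_on_imp_continuous_on intro: continuous_on_interior)
  then have "((%w. zor_poly W.f s w) \<longlongrightarrow> zor_poly W.f s s) (at s)" by (simp add: isCont_def)
  moreover have "\<forall>\<^sub>F w in at s. zor_poly W.f s w = (W.f w - W.f s) / (w - s)"
   unfolding eventually_at using r(1) f by (intro exI[of _ r]) (auto simp: dist_commute)
  ultimately have "((%w. (W.f w - W.f s) / (w - s)) \<longlongrightarrow> zor_poly W.f s s) (at s)" by (rule Lim_transform_eventually)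
  then have "(W.f has_field_derivative zor_poly W.f s s) (at s)" by (simp add: has_field_derivative_iff)
  then have "deriv W.f s ~= 0" using r(1) r(3)[of s] DERIV_imp_deriv by force
  moreover have "W.f s = 0" using f[of s] r(1) by simp
  ultimately show ?thesis using False by (simp add: hd)
 qed
 define F where "F z = deriv h z / h z - zeta z" for z
 have hF: "F holomorphic_on - \<Lambda>" unfolding F_def
  by (intro holomorphic_intros zeta_holo holomorphic_on_subset[OF holomorphic_deriv[OF hh]] holomorphic_on_subset[OF hh]) (auto simp: h0)
 have lF: "((%z. (z - s) * F z) \<longlongrightarrow> 0) (at s)" if s: "s \<in> \<Lambda>" for s
 proof -
  have dc: "(deriv h \<longlongrightarrow> deriv h s) (at s)"
  proof -
   have "deriv h holomorphic_on UNIV" by (rule holomorphic_deriv[OF hh]) simp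
   then have "isCont (deriv h) s" by (auto simp: continuous_on_eq_continuous_at dest!: holomorphic_on_imp_continuous_on)
   then show ?thesis by (simp add: isCont_def)
  qed
  have "((%z. deriv h z / ((h z - h s) / (z - s)) - (z - s) * zeta z) \<longlongrightarrow> deriv h s / deriv h s - 1) (at s)"
   by (intro tendsto_intros dc DERIV_quotient_lim dh zeta_lim(1)[OF s] nz[OF s])
  moreover have "\<forall>\<^sub>F z in at s. deriv h z / ((h z - h s) / (z - s)) - (z - s) * zeta z = (z - s) * F z"
   using h0[of s] s by (auto simp: eventually_at_filter F_def algebra_simps)
  ultimately show ?thesis using nz[OF s] by (auto intro: Lim_transform_eventually)
 qed
 have nl: "\<not> x islimpt \<Lambda>" for x using orbit_props(3)[of "{0}" x] by (simp add: orbit_0)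
 obtain g where g: "g holomorphic_on UNIV" "!!z. z \<notin> \<Lambda> ==> g z = F z"
  using extend_entire[OF closed_lattice nl hF lF] by blast
 obtain K where K: "!!z. (K has_field_derivative g z) (at z)"
  using holomorphic_convex_primitive'[OF convex_UNIV open_UNIV g(1)] by auto
 define s where "s z = h z * exp (- K z)" for z
 have ds: "(s has_field_derivative (deriv h z - h z * g z) * exp (- K z)) (at z)" for z
  unfolding s_def by (auto intro!: derivative_eq_intros dh K simp: algebra_simps)
 have "s holomorphic_on UNIV" using ds by (auto simp: holomorphic_on_open)
 moreover have "\<forall>z. s z = 0 \<longleftrightarrow> z \<in> \<Lambda>" by (simp add: s_def h0)
 moreover have "deriv s z = zeta z * s z" if "z \<notin> \<Lambda>" for z
 proof -
  have "deriv h z - h z * g z = zeta z * h z" using g(2)[OF that] h0[of z] that by (simp add: F_def field_simps)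
  then show ?thesis unfolding DERIV_imp_deriv[OF ds] by (simp only: s_def mult.assoc)
 qed
 moreover have "deriv s z ~= 0" if "z \<in> \<Lambda>" for z
  using DERIV_imp_deriv[OF ds] nz[OF that] h0[of z] that by simp
 ultimately show ?thesis by blast
qed

text \<open>The Weierstrass sigma function up to a constant factor. The factor is immaterial:
  \<open>sigma\<close> enters through its zeros, its logarithmic derivative and quotients.\<close>

definition sigma :: "complex => complex" where
 "sigma = (SOME s. s holomorphic_on UNIV \<and> (\<forall>z. s z = 0 \<longleftrightarrow> z \<in> \<Lambda>) \<and>
 (\<forall>z. z \<notin> \<Lambda> --> deriv s z = zeta z * s z) \<and> (\<forall>z\<in>\<Lambda>. deriv s z ~= 0))"

lemma sigma_holo: "sigma holomorphic_on UNIV" and sigma_zero: "sigma z = 0 \<longleftrightarrow> z \<in> \<Lambda>"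
 and sigma_deriv_nz: "z \<in> \<Lambda> ==> deriv sigma z ~= 0"
 and sigma_deriv: "(sigma has_field_derivative deriv sigma z) (at z)"
 and sigma_zeta: "z \<notin> \<Lambda> ==> deriv sigma z = zeta z * sigma z"
proof -
 note * = someI_ex[OF sigma_exists, folded sigma_def]
 from * show h: "sigma holomorphic_on UNIV" by blast
 from * show "sigma z = 0 \<longleftrightarrow> z \<in> \<Lambda>" "z \<in> \<Lambda> ==> deriv sigma z ~= 0" "z \<notin> \<Lambda> ==> deriv sigma z = zeta z * sigma z" by blast+
 show "(sigma has_field_derivative deriv sigma z) (at z)" using holomorphic_derivI[OF h, of z] by simp
qed

text \<open>After the factor exp (- eta w z) the logarithmic derivative of the quotient vanishes.
  The constant \<open>C\<close> stays unspecified since it cancels later.\<close>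

lemma sigma_quasi:
 assumes w: "w \<in> \<Lambda>" obtains C where "C ~= 0" "!!z. sigma (z + w) = C * exp (eta w * z) * sigma z"
proof -
 define f where "f z = sigma (z + w) * exp (- eta w * z) / sigma z" for z
 have fd: "(f has_field_derivative 0) (at z)" if z: "z \<in> - \<Lambda>" for z
 proof -
  have zw: "z + w \<notin> \<Lambda>" using z w lattice_add_iff by simp
  have s0: "sigma z ~= 0" "sigma (z + w) ~= 0" using z zw by (simp_all add: sigma_zero)
  have 0: "((%z. sigma (z + w)) has_field_derivative deriv sigma (z + w) * 1) (at z)"
   by (rule DERIV_chain'[of "%z. z + w" 1 z UNIV sigma]) (auto intro!: derivative_eq_intros sigma_deriv)
  have "zeta (z + w) = zeta z + eta w" using zeta_shift[OF w] z by simp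
  then have d: "deriv sigma (z + w) = (zeta z + eta w) * sigma (z + w)" "deriv sigma z = zeta z * sigma z"
   using sigma_zeta zw z by simp_all
  have 1: "((%z. sigma (z + w)) has_field_derivative (zeta z + eta w) * sigma (z + w)) (at z)"
   using 0 unfolding d(1) by simp
  have 2: "(sigma has_field_derivative zeta z * sigma z) (at z)" using sigma_deriv[of z] unfolding d(2) .
  show ?thesis unfolding f_def using s0
   by (auto intro!: derivative_eq_intros 1 2 simp: field_simps)
 qed
 define C where "C = f (\<omega>\<^sub>1 / 2)"
 have fC: "f z = C" if "z \<notin> \<Lambda>" for z unfolding C_def
  by (rule holo_const[OF open_compl_lattice connected_compl_lattice fd]) (use that half_not_lattice in auto)
 have "\<omega>\<^sub>1 / 2 + w \<notin> \<Lambda>" using half_not_lattice w lattice_add_iff by simp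
 then have C0: "C ~= 0" using half_not_lattice by (simp add: C_def f_def sigma_zero)
 have "sigma (z + w) = C * exp (eta w * z) * sigma z" for z
 proof (cases "z \<in> \<Lambda>")
  case True
  then show ?thesis using lattice_add[OF True w] by (simp add: sigma_zero[THEN iffD2])
 next
  case False
  then have "sigma z ~= 0" by (simp add: sigma_zero)
  then show ?thesis using fC[OF False] by (simp add: f_def field_simps exp_minus)
 qed
 then show thesis using that C0 by blast
qed

end

section \<open>Logarithmic potentials\<close>

lemma wirt_Re_holo:
 assumes "(f has_field_derivative d) (at z)"
 shows "has_wirt (%z. of_real (Re (f z))) (d / 2) (cnj (d / 2)) z"
proof -
 have "((%z. Re (f z)) has_derivative (%h. Re (d * h))) (at z)"
  using assms unfolding has_field_derivative_def by (rule has_derivative_Re)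
 then show ?thesis unfolding wirt_of_real_iff by (simp add: diff_divide_distrib)
qed

lemma wirt_ln_cmod:
 assumes d: "(f has_field_derivative d) (at z)" and nz: "f z ~= 0"
 shows "has_wirt (%z. of_real (ln (cmod (f z)))) (d / (2 * f z)) (cnj (d / (2 * f z))) z"
proof -
 have "has_wirt (%z. of_real ((cmod (f z))\<^sup>2)) (d * cnj (f z)) (f z * cnj d) z"
  using wirt_mult[OF wirt_holo[OF d] wirt_cnj[OF wirt_holo[OF d]]] by (simp add: complex_norm_square del: of_real_power)
 then have "has_wirt (%z. of_real (ln ((cmod (f z))\<^sup>2))) (of_real (1 / (cmod (f z))\<^sup>2) * (d * cnj (f z))) (of_real (1 / (cmod (f z))\<^sup>2) * (f z * cnj d)) z"
  by (rule wirt_of_real_comp) (use nz in \<open>auto intro!: derivative_eq_intros\<close>)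
 from wirt_cmult[OF this, of "1 / 2"] have "has_wirt (%z. of_real (ln (cmod (f z)))) (d / (2 * f z)) (1 / 2 * (of_real (1 / (cmod (f z))\<^sup>2) * (f z * cnj d))) z"
  using nz by (simp add: complex_norm_square field_simps ln_realpow del: of_real_power)
 then show ?thesis by (rule wirt_eq_rhs) (use nz in \<open>auto simp: complex_norm_square field_simps simp del: of_real_power\<close>)
qed

text \<open>In the squared radius this is pi times the integral of t^(-1/2) over [0, r^2].\<close>

lemma integral_inv_dist:
 assumes r: "0 <= r"
 shows "set_integrable lborel (cball a r) (%z. 1 / cmod (z - a))"
  "sint (cball a r) (%z. 1 / cmod (z - a)) = 2 * pi * r"
proof -
 define F where "F t = ennreal (1 / sqrt t) * indicator {0..r\<^sup>2} t" for t :: real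
 have Fm: "F \<in> borel_measurable borel" unfolding F_def by measurable
 have "((%x. x powr (- 1 / 2)) has_integral ((r\<^sup>2) powr (- 1 / 2 + 1) / (- 1 / 2 + 1))) {0..r\<^sup>2}"
  by (rule has_integral_powr_from_0) auto
 moreover have "(r\<^sup>2) powr (- 1 / 2 + 1) / (- 1 / 2 + 1) = 2 * r" using r by (simp add: powr_half_sqrt)
 moreover have "x powr (- 1 / 2) = 1 / sqrt x" if "x \<ge> 0" for x :: real
  using powr_minus_divide[of x "1 / 2"] powr_half_sqrt[OF that] by (simp only: minus_divide_left)
 ultimately have "((%x. 1 / sqrt x) has_integral 2 * r) {0..r\<^sup>2}"
  by (metis (no_types, lifting) atLeastAtMost_iff has_integral_cong)
 then have "(\<integral>\<^sup>+t. F t \<partial>lborel) = ennreal (2 * r)"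
  unfolding F_def by (intro nn_integral_has_integral_lebesgue') auto
 moreover have "F t * indicator {0..} t = F t" for t by (auto simp: F_def indicator_def)
 ultimately have "(\<integral>\<^sup>+z. F ((cmod (z - a))\<^sup>2) \<partial>lborel) = ennreal (2 * pi * r)"
  using nn_integral_radial[OF Fm, of a] r by (simp add: mult_ac flip: ennreal_mult)
 moreover have "F ((cmod (z - a))\<^sup>2) = ennreal (indicator (cball a r) z *\<^sub>R (1 / cmod (z - a)))" for z
  using r by (auto simp: F_def indicator_def dist_norm norm_minus_commute abs_le_square_iff[symmetric])
 ultimately have N: "(\<integral>\<^sup>+z. ennreal (indicator (cball a r) z *\<^sub>R (1 / cmod (z - a))) \<partial>lborel) = ennreal (2 * pi * r)"
  by simp
 have [measurable]: "(%z. cmod (z - a)) \<in> borel_measurable borel"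
  by (intro borel_measurable_continuous_onI continuous_intros)
 have m: "(%z. indicator (cball a r) z *\<^sub>R (1 / cmod (z - a))) \<in> borel_measurable lborel"
  by (intro borel_measurable_scaleR borel_measurable_indicator borel_measurable_divide) auto
 show "set_integrable lborel (cball a r) (%z. 1 / cmod (z - a))"
  unfolding set_integrable_def by (rule integrableI_nonneg[OF m]) (use N in auto)
 show "sint (cball a r) (%z. 1 / cmod (z - a)) = 2 * pi * r"
  unfolding set_lebesgue_integral_def by (rule integral_eq_nn_integral[OF m, THEN trans]) (use N r in auto)
qed

text \<open>Compares the logarithmic kernel, uniformly in the regularisation, with 1/|z - a|, whose
  integral over discs is explicit.\<close>

lemma neg_half_ln_bounds:
 assumes "0 < t" "0 <= d" "t + d <= (1::real)"
 shows "0 <= - (1 / 2) * ln (t + d)" "- (1 / 2) * ln (t + d) <= 1 / sqrt t"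
proof -
 show "0 <= - (1 / 2) * ln (t + d)" using assms by simp
 have "- (1 / 2) * ln (t + d) <= - (1 / 2) * ln t" using assms by simp
 also have "\<dots> = ln (1 / sqrt t)" using assms by (simp add: ln_div ln_sqrt)
 also have "\<dots> <= 1 / sqrt t" using ln_le_minus_one[of "1 / sqrt t"] assms by simp
 finally show "- (1 / 2) * ln (t + d) <= 1 / sqrt t" .
qed

text \<open>A factor linear in |a|^2 absorbs ln |a|; so the cut-off in the Dirac term of
  \<open>weak_representation\<close> costs a bounded error only.\<close>

lemma one_minus_bump: obtains C where "0 < C" "!!x. 0 <= x ==> 1 - bump x <= C * x"
proof -
 obtain C where C: "0 < C" "!!t. 0 <= t ==> \<bar>bump1 t\<bar> <= C" using bump_const by metis
 have "1 - bump x <= C * x" if x: "0 <= x" for x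
 proof (cases "x = 0")
  case False
  then obtain y where y: "0 < y" "y < x" "bump x - bump 0 = (x - 0) * bump1 y"
   using MVT2[of 0 x bump bump1] bump_deriv x by auto
  have "x * (- bump1 y) <= x * C" using C(2)[of y] y x by (intro mult_left_mono) auto
  then show ?thesis using y by (simp add: bump_0 mult.commute)
 qed (simp add: bump_0)
 then show thesis using C(1) that by blast
qed

text \<open>Pulled back by \<open>exp\<close>, \<open>\<phi>\<close> becomes the real part of a holomorphic function on a half plane, where
 Cauchy's inequality is available on discs of arbitrarily large radius.\<close>

lemma bounded_harmonic_residue:
 assumes r: "0 < r" and g: "g holomorphic_on ball 0 r - {0}"
  and W: "!!z. z \<in> ball 0 r - {0} ==> has_wirt (%z. of_real (\<phi> z)) (g z) (cnj (g z)) z"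
  and B: "!!z. z \<in> ball 0 r - {0} ==> \<bar>\<phi> z\<bar> <= C"
 shows "((%z. z * g z) \<longlongrightarrow> 0) (at 0)"
proof -
 have bound: "cmod (z0 * g z0) <= exp (2 * C) / (ln r - ln (cmod z0))" if z0: "z0 ~= 0" "cmod z0 < r" for z0
 proof -
  \<comment> \<open>The distance from Ln z0 to the boundary of the half plane Re w < ln r, on which
    the pullback lives.\<close>
  define R where "R = ln r - ln (cmod z0)"
  have R: "R > 0" using z0 r by (simp add: R_def)
  define Z where "Z = Ln z0"
  have ex: "exp w \<in> ball 0 r - {0}" if "w \<in> ball Z R" for w
  proof -
   have "Re w - Re Z <= cmod (w - Z)" by (metis complex_Re_le_cmod minus_complex.simps(1))
   then have "Re w < ln r" using that z0 by (simp add: R_def Z_def dist_norm norm_minus_commute)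
   then have "exp (Re w) < r" using r by (metis exp_less_mono exp_ln)
   then show ?thesis by simp
  qed
  have hol: "(%w. 2 * (exp w * g (exp w))) holomorphic_on ball Z R"
   by (intro holomorphic_intros holomorphic_on_compose_gen[OF _ g, unfolded o_def]) (use ex in auto)
  obtain J where J: "!!x. x \<in> ball Z R ==> (J has_field_derivative 2 * (exp x * g (exp x))) (at x)"
   using holomorphic_convex_primitive'[OF _ _ hol] at_within_open[of _ "ball Z R"] by (metis convex_ball open_ball)
  have ZR: "Z \<in> ball Z R" using R by simp
  have ReJ: "Re (J x) - Re (J Z) = \<phi> (exp x) - \<phi> (exp Z)" if x: "x \<in> ball Z R" for x
  proof -
   have "has_wirt (%z. of_real (Re (J z)) - of_real (\<phi> (exp z))) 0 0 y" if y: "y \<in> ball Z R" for y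
    by (rule wirt_eq_rhs[OF wirt_diff[OF wirt_Re_holo[OF J[OF y]] wirt_holo_comp[OF DERIV_exp W[OF ex[OF y]]]]]) auto
   from wirt_zero_const[OF open_ball connected_ball this x ZR] show ?thesis
    unfolding of_real_diff[symmetric] of_real_eq_iff by simp
  qed
  \<comment> \<open>The exponential turns the two-sided bound on the real part of \<open>J\<close>
    into a bound on a modulus, as Cauchy's inequality needs.\<close>
  define E where "E x = exp (J x - J Z)" for x
  have E': "(E has_field_derivative E x * (2 * (exp x * g (exp x)))) (at x)" if "x \<in> ball Z R" for x
   unfolding E_def[abs_def] using J[OF that] by (auto intro!: derivative_eq_intros)
  have Eb: "cmod (E x) <= exp (2 * C)" if x: "x \<in> ball Z R" for x
  proof -
   have "Re (J x) - Re (J Z) <= 2 * C" using ReJ[OF x] B[OF ex[OF x]] B[OF ex[OF ZR]] by linarith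
   then show ?thesis by (simp add: E_def)
  qed
  have "cmod ((deriv ^^ 1) E Z) <= fact 1 * exp (2 * C) / (R / 2) ^ 1"
  proof (rule Cauchy_inequality)
   have "E holomorphic_on ball Z R" by (auto simp: holomorphic_on_open intro: E')
   moreover have "cball Z (R / 2) \<subseteq> ball Z R" using R by auto
   ultimately show "E holomorphic_on ball Z (R / 2)" "continuous_on (cball Z (R / 2)) E"
    by (meson ball_subset_cball holomorphic_on_imp_continuous_on holomorphic_on_subset subset_trans)+
   fix x assume "cmod (Z - x) = R / 2"
   then show "cmod (E x) <= exp (2 * C)" using R by (intro Eb) (simp add: dist_norm)
  qed (use R in simp)
  moreover have "deriv E Z = 2 * (z0 * g z0)"
   using DERIV_imp_deriv[OF E'[OF ZR]] z0 by (simp add: E_def Z_def)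
  ultimately show ?thesis using R by (simp add: R_def norm_mult field_simps)
 qed
 have "((%z::complex. exp (2 * C) / (ln r - ln (cmod z))) \<longlongrightarrow> 0) (at 0)"
 proof (rule tendsto_divide_0[OF tendsto_const filterlim_at_top_imp_at_infinity])
  have "filterlim (%z::complex. cmod z) (at_right 0) (at 0)"
   unfolding filterlim_at by (auto intro!: tendsto_norm_zero tendsto_ident_at simp: eventually_at_filter)
  from filterlim_compose[OF ln_at_0 this] have "filterlim (%z. - ln (cmod z)) at_top (at (0::complex))"
   by (simp add: filterlim_uminus_at_top)
  from filterlim_tendsto_add_at_top[OF tendsto_const[of "ln r"] this]
  show "filterlim (%z. ln r - ln (cmod z)) at_top (at (0::complex))" by simp
 qed
 moreover have "\<forall>\<^sub>F z in at (0::complex). cmod (z * g z) <= exp (2 * C) / (ln r - ln (cmod z))"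
  using r by (auto simp: eventually_at intro!: exI[of _ r] bound)
 ultimately show ?thesis by (rule Lim_null_comparison[rotated])
qed

section \<open>Pointwise bounds from the weak equation, and quasi-periodic functions\<close>

context torus_lattice
begin

definition potential :: "(complex => real) => real => complex => real => real" where
 "potential h \<rho> a \<delta> = sint (cball a (sqrt \<rho>))
  (%z. h z * (- (1 / 2) * ln ((cmod (z - a))\<^sup>2 + \<delta>\<^sup>2) * bump ((cmod (z - a))\<^sup>2 / \<rho>)))"

text \<open>The limit \<delta> -> 0 in \<open>weak_representation\<close>: the kernel integral tends
  to 2 pi u(a), so uniform bounds on the potential become pointwise bounds on \<open>u\<close>. An
  upper bound on the potential gives a lower bound on \<open>u\<close>, and conversely.\<close>

lemma weak_bounds:
 assumes weak: "weak_laplacian \<omega>\<^sub>1 \<omega>\<^sub>2 u c0 0 h" and per: "periodic u" "periodic h"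
  and \<rho>: "0 < \<rho>" "\<rho> <= 1 / 2" "sqrt \<rho> < rmin / 3"
 shows "\<exists>C. \<forall>a U. a ~= 0 --> cmod a <= rmin / 6 --> isCont u a -->
  ((\<forall>\<delta>. 0 < \<delta> \<and> \<delta> <= 1 / 2 --> potential h \<rho> a \<delta> <= U) --> c0 * ln (cmod a) - U - C <= 2 * pi * u a) \<and>
  ((\<forall>\<delta>. 0 < \<delta> \<and> \<delta> <= 1 / 2 --> U <= potential h \<rho> a \<delta>) --> 2 * pi * u a <= c0 * ln (cmod a) - U + C)"
proof -
 obtain K where K: "!!a \<delta>. cmod a <= rmin / 6 ==> 0 < \<delta> ==> \<delta> <= 1 / 2 ==>
  \<bar>sint (cball a (sqrt \<rho>)) (%z. u z * (2 * \<delta>\<^sup>2 * bump ((cmod (z - a))\<^sup>2 / \<rho>) / ((cmod (z - a))\<^sup>2 + \<delta>\<^sup>2)\<^sup>2))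
   - c0 / 2 * ln ((cmod a)\<^sup>2 + \<delta>\<^sup>2) * bump ((cmod a)\<^sup>2 / \<rho>) + potential h \<rho> a \<delta>\<bar> <= K"
  by (rule weak_representation[OF weak per \<rho>]) (rule that, unfold potential_def, blast)
 obtain C where C: "0 < C" "!!x. 0 <= x ==> 1 - bump x <= C * x" by (rule one_minus_bump) (rule that)
 define R where "R = rmin / 6"
 \<comment> \<open>Bounds |c0 ln |a|| (1 - bump) by means of |ln s| <= s + 1/s and
   \<open>one_minus_bump\<close>.\<close>
 define M where "M = \<bar>c0\<bar> * ((R ^ 3 + R) * C / \<rho>)"
 have uI: "set_integrable lborel P u" using weak by (auto simp: weak_laplacian_def torus_integrable_def)
 show ?thesis
 proof (rule exI[of _ "K + M"], intro allI impI)
  fix a U assume a: "a ~= 0" "cmod a <= rmin / 6" and cont: "isCont u a"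
  define s where "s = cmod a"
  have s: "0 < s" "s <= R" using a by (auto simp: s_def R_def)
  define \<delta> where "\<delta> n = inverse (real (Suc n)) / 2" for n
  have \<delta>: "0 < \<delta> n" "\<delta> n <= 1 / 2" for n by (auto simp: \<delta>_def field_simps)
  have \<delta>0: "\<delta> \<longlonglongrightarrow> 0"
   unfolding \<delta>_def[abs_def] by (intro tendsto_divide_zero LIMSEQ_inverse_real_of_nat)
  define k where "k n z = 2 * (\<delta> n)\<^sup>2 * bump ((cmod (z - a))\<^sup>2 / \<rho>) / ((cmod (z - a))\<^sup>2 + (\<delta> n)\<^sup>2)\<^sup>2" for n z
  define X where "X n = sint (cball a (sqrt \<rho>)) (%z. u z * k n z)" for n
  define b where "b = bump (s\<^sup>2 / \<rho>)"
  define Y where "Y n = c0 / 2 * ln (s\<^sup>2 + (\<delta> n)\<^sup>2) * b" for n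
  have "bump ((cmod (z - a))\<^sup>2 / \<rho>) = 0" if "z \<notin> cball a (sqrt \<rho>)" for z
  proof (rule bump_zero)
   have "sqrt \<rho> < cmod (z - a)" using that by (simp add: dist_norm norm_minus_commute)
   then have "\<rho> <= (cmod (z - a))\<^sup>2" by (simp add: real_sqrt_less_iff sqrt_le_D)
   then show "1 <= (cmod (z - a))\<^sup>2 / \<rho>" using \<rho> by simp
  qed
  then have "indicator (cball a (sqrt \<rho>)) z *\<^sub>R (u z * k n z) = u z * k n z" for n z
   by (cases "z \<in> cball a (sqrt \<rho>)") (auto simp: k_def)
  then have X': "X n = (LINT z|lborel. u z * k n z)" for n by (simp only: X_def set_lebesgue_integral_def)
  have X: "X \<longlonglongrightarrow> 2 * pi * u a" unfolding X'[abs_def] k_def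
   by (rule kernel_limit[OF ball_integral_le(1)[OF per(1) uI, of "sqrt \<rho>"] cont]) (use \<rho> \<delta> \<delta>0 in auto)
  have "Y \<longlonglongrightarrow> c0 / 2 * ln (s\<^sup>2 + 0\<^sup>2) * b" unfolding Y_def
   by (intro tendsto_intros \<delta>0) (use s in auto)
  then have Y: "Y \<longlonglongrightarrow> c0 * ln s * b" using s by (simp add: ln_realpow)
  have XY: "\<bar>X n - Y n + potential h \<rho> a (\<delta> n)\<bar> <= K" for n
   using K[of a "\<delta> n"] a \<delta>[of n] unfolding X_def Y_def k_def b_def s_def by simp
  have b1: "0 <= 1 - b" "1 - b <= C * (s\<^sup>2 / \<rho>)" using bump_bounds C(2)[of "s\<^sup>2 / \<rho>"] \<rho> by (auto simp: b_def)
  have lns: "\<bar>ln s\<bar> <= s + 1 / s"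
  proof -
   have "1 / s \<ge> 0" "ln s <= s - 1" "- ln s <= 1 / s - 1"
    using ln_le_minus_one[of s] ln_le_minus_one[of "1 / s"] s by (auto simp: ln_div)
   then show ?thesis using s by linarith
  qed
  have "\<bar>ln s\<bar> * (1 - b) <= (s + 1 / s) * (C * (s\<^sup>2 / \<rho>))" by (intro mult_mono lns b1) (use s in auto)
  also have "\<dots> = (s ^ 3 + s) * C / \<rho>" using s \<rho> by (simp add: field_simps power2_eq_square power3_eq_cube)
  also have "\<dots> <= (R ^ 3 + R) * C / \<rho>"
   using s C \<rho> by (intro divide_right_mono mult_right_mono add_mono power_mono) auto
  finally have M0: "\<bar>c0\<bar> * (\<bar>ln s\<bar> * (1 - b)) <= M" unfolding M_def by (rule mult_left_mono) simp
  have M: "\<bar>c0 * ln s - c0 * ln s * b\<bar> <= M"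
  proof -
   have "c0 * ln s - c0 * ln s * b = c0 * (ln s * (1 - b))" by (simp add: algebra_simps)
   then show ?thesis using M0 b1(1) by (simp only: abs_mult abs_of_nonneg)
  qed
  show "((\<forall>\<delta>. 0 < \<delta> \<and> \<delta> <= 1 / 2 --> potential h \<rho> a \<delta> <= U) --> c0 * ln (cmod a) - U - (K + M) <= 2 * pi * u a) \<and>
  ((\<forall>\<delta>. 0 < \<delta> \<and> \<delta> <= 1 / 2 --> U <= potential h \<rho> a \<delta>) --> 2 * pi * u a <= c0 * ln (cmod a) - U + (K + M))"
  proof (intro conjI impI)
   assume U: "\<forall>\<delta>. 0 < \<delta> \<and> \<delta> <= 1 / 2 --> potential h \<rho> a \<delta> <= U"
   have "c0 * ln s * b - (U + K) <= 2 * pi * u a"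
   proof (rule LIMSEQ_le[OF tendsto_diff[OF Y tendsto_const] X], intro exI allI impI)
    fix n show "Y n - (U + K) <= X n" using XY[of n] U[rule_format, of "\<delta> n"] \<delta>[of n] by auto
   qed
   then show "c0 * ln (cmod a) - U - (K + M) <= 2 * pi * u a" using M by (simp add: s_def abs_le_iff)
  next
   assume U: "\<forall>\<delta>. 0 < \<delta> \<and> \<delta> <= 1 / 2 --> U <= potential h \<rho> a \<delta>"
   have "2 * pi * u a <= c0 * ln s * b - (U - K)"
   proof (rule LIMSEQ_le[OF X tendsto_diff[OF Y tendsto_const]], intro exI allI impI)
    fix n show "X n <= Y n - (U - K)" using XY[of n] U[rule_format, of "\<delta> n"] \<delta>[of n] by auto
   qed
   then show "2 * pi * u a <= c0 * ln (cmod a) - U + (K + M)" using M by (simp add: s_def abs_le_iff)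
  qed
 qed
qed

lemma potential_integrable:
 assumes \<delta>: "0 < \<delta>" and h: "set_integrable lborel (cball a r) h"
 shows "set_integrable lborel (cball a r) (%z. h z * (- (1 / 2) * ln ((cmod (z - a))\<^sup>2 + \<delta>\<^sup>2) * bump ((cmod (z - a))\<^sup>2 / \<rho>)))"
proof -
 define g where "g z = - (1 / 2) * ln ((cmod (z - a))\<^sup>2 + \<delta>\<^sup>2) * bump ((cmod (z - a))\<^sup>2 / \<rho>)" for z
 have bc: "continuous_on UNIV (%z. bump ((cmod (z - a))\<^sup>2 / \<rho>))" using Ck_bump[of 0 a \<rho>] by simp
 have pos: "(cmod (z - a))\<^sup>2 + \<delta>\<^sup>2 ~= 0" for z using \<delta> by (simp add: add_nonneg_eq_0_iff)
 have gc: "continuous_on UNIV g" unfolding g_def by (intro continuous_intros bc) (use pos in auto)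
 have "compact (g ` cball a r)" by (rule compact_continuous_image[OF continuous_on_subset[OF gc]]) auto
 then obtain K where K: "!!x. x \<in> g ` cball a r ==> norm x <= K" using compact_imp_bounded bounded_iff by metis
 have "set_integrable lborel (cball a r) (%z. h z * g z)"
  by (rule set_integrable_mult_bounded[OF h borel_measurable_continuous_onI[OF gc]]) (use K in force)
 then show ?thesis by (simp add: g_def)
qed

lemma half_period_iff: assumes "z \<notin> \<Lambda>" shows "half_period_point \<omega>\<^sub>1 \<omega>\<^sub>2 z \<longleftrightarrow> 2 * z \<in> \<Lambda>"
proof
 assume "half_period_point \<omega>\<^sub>1 \<omega>\<^sub>2 z"
 then obtain p where p: "p \<in> {\<omega>\<^sub>1 / 2, \<omega>\<^sub>2 / 2, (\<omega>\<^sub>1 + \<omega>\<^sub>2) / 2}" "z - p \<in> \<Lambda>" unfolding half_period_point_def by blast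
 have "2 * p = \<omega>\<^sub>1 \<or> 2 * p = \<omega>\<^sub>2 \<or> 2 * p = \<omega>\<^sub>1 + \<omega>\<^sub>2" using p(1) by (auto simp: mult.commute)
 then have "2 * p \<in> \<Lambda>" using lattice_basis lattice_add[OF lattice_basis] by metis
 from lattice_add[OF lattice_add[OF p(2,2)] this] show "2 * z \<in> \<Lambda>" by (simp add: algebra_simps)
next
 assume "2 * z \<in> \<Lambda>"
 then obtain m n where mn: "2 * z = of_int m * \<omega>\<^sub>1 + of_int n * \<omega>\<^sub>2" unfolding lattice_def by blast
 define a b where "a = m mod 2" and "b = n mod 2"
 have "m = 2 * (m div 2) + a" "n = 2 * (n div 2) + b" by (auto simp: a_def b_def)
 then have m: "(of_int m :: complex) = 2 * of_int (m div 2) + of_int a" "(of_int n :: complex) = 2 * of_int (n div 2) + of_int b"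
  by (metis of_int_add of_int_mult of_int_numeral)+
 have "2 * (z - (of_int a * \<omega>\<^sub>1 + of_int b * \<omega>\<^sub>2) / 2) = 2 * (of_int (m div 2) * \<omega>\<^sub>1 + of_int (n div 2) * \<omega>\<^sub>2)"
  using mn unfolding m by (simp add: algebra_simps)
 then have "z - (of_int a * \<omega>\<^sub>1 + of_int b * \<omega>\<^sub>2) / 2 = of_int (m div 2) * \<omega>\<^sub>1 + of_int (n div 2) * \<omega>\<^sub>2"
  by (simp only: mult_cancel_left) simp
 then have *: "z - (of_int a * \<omega>\<^sub>1 + of_int b * \<omega>\<^sub>2) / 2 \<in> \<Lambda>" unfolding lattice_def by blast
 have "a = 0 \<or> a = 1" "b = 0 \<or> b = 1" by (auto simp: a_def b_def)
 then show "half_period_point \<omega>\<^sub>1 \<omega>\<^sub>2 z" using * assms by (auto simp: half_period_point_def)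
qed

text \<open>The additive constants carry removability from 0 to every lattice point and disappear on
  differentiation; the derivative is thus elliptic and entire, hence constant.\<close>

lemma quasi_periodic_linear:
 assumes qh: "q holomorphic_on - \<Lambda>" and qper: "!!z w. z \<notin> \<Lambda> ==> w \<in> \<Lambda> ==> q (z + w) = q z + k w"
  and q0: "((%z. z * q z) \<longlongrightarrow> 0) (at 0)"
 shows "\<exists>c d. \<forall>z. z \<notin> \<Lambda> --> q z = c * z + d"
proof -
 obtain Q where Q: "Q holomorphic_on UNIV" "!!z. z \<notin> \<Lambda> ==> Q z = q z"
 proof (rule extend_entire[of \<Lambda> q])
  fix x show "\<not> x islimpt \<Lambda>" using orbit_props(3)[of "{0}" x] by (simp add: orbit_0)
  fix s assume s: "s \<in> \<Lambda>"
  have "((%z. z * q z + z * k s) \<longlongrightarrow> 0 + 0 * k s) (at 0)" by (intro tendsto_intros q0)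
  then have "((%z. z * q z + z * k s) \<longlongrightarrow> 0) (at 0)" by simp
  then have "((%h. (s + h - s) * q (s + h)) \<longlongrightarrow> 0) (at 0)"
   by (rule Lim_transform_eventually)
    (use ev_not_lattice[of 0] in eventually_elim, use qper[OF _ s] in \<open>simp add: add.commute distrib_left\<close>)
  then show "((%z. (z - s) * q z) \<longlongrightarrow> 0) (at s)" by (subst LIM_offset_zero_iff) auto
 qed (use closed_lattice qh that in auto)
 have DQ: "(Q has_field_derivative deriv Q z) (at z)" for z
  by (rule holomorphic_derivI[OF Q(1)]) auto
 have "\<exists>c. \<forall>z. z \<notin> orbit {0} --> deriv Q z = c"
 proof (rule elliptic_const)
  show "deriv Q holomorphic_on - orbit {0}" by (rule holomorphic_on_subset[OF holomorphic_deriv[OF Q(1)]]) auto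
  have "isCont (deriv Q) 0"
   using holomorphic_deriv[OF Q(1)] holomorphic_on_imp_continuous_on continuous_on_eq_continuous_at[of UNIV] by auto
  then have "((%z. (z - 0) * deriv Q z) \<longlongrightarrow> (0 - 0) * deriv Q 0) (at 0)" by (intro tendsto_intros) (simp add: isCont_def)
  then show "((%z. (z - c) * deriv Q z) \<longlongrightarrow> 0) (at c)" if "c \<in> {0}" for c using that by simp
  fix z w assume z: "z \<notin> orbit {0}" and w: "w \<in> \<Lambda>"
  have zL: "z \<notin> \<Lambda>" using z by (simp add: orbit_0)
  have 1: "((%z. Q (z + w)) has_field_derivative deriv Q (z + w)) (at z)"
   using DERIV_shift DQ[of "z + w"] by (metis)
  have 2: "((%z. Q z + k w) has_field_derivative deriv Q z) (at z)" using DQ[of z] by (auto intro!: derivative_eq_intros)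
  have "((%z. Q (z + w)) has_field_derivative deriv Q z) (at z)"
   by (rule has_field_derivative_transform_within_open[OF 2 open_compl_lattice]) (use zL qper[OF _ w] Q(2) lattice_add_iff[OF w] in auto)
  with 1 show "deriv Q (z + w) = deriv Q z" by (rule DERIV_unique)
 qed auto
 then obtain c where c: "!!z. z \<notin> \<Lambda> ==> deriv Q z = c" by (auto simp: orbit_0)
 have "q z = c * z + (q (\<omega>\<^sub>1 / 2) - c * (\<omega>\<^sub>1 / 2))" if z: "z \<notin> \<Lambda>" for z
 proof -
  have "(%z. Q z - c * z) z = (%z. Q z - c * z) (\<omega>\<^sub>1 / 2)"
   by (rule holo_const[OF open_compl_lattice connected_compl_lattice])
    (use z half_not_lattice DQ c in \<open>auto intro!: derivative_eq_intros\<close>)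
  then show ?thesis using Q(2)[OF z] Q(2)[OF half_not_lattice] by (simp add: algebra_simps)
 qed
 then show ?thesis by blast
qed

end

section \<open>The Green function\<close>

locale torus_green = torus_lattice +
 fixes \<Gamma> :: "complex => complex => real"
 assumes green: "green_function \<omega>\<^sub>1 \<omega>\<^sub>2 \<Gamma>"
begin

abbreviation "G z \<equiv> \<Gamma> z 0"
abbreviation "A \<equiv> torus_area \<omega>\<^sub>1 \<omega>\<^sub>2"

lemma G_props: "periodic (%z. G z)" "Ck_on 2 (%z. G z) (- \<Lambda>)"
 "weak_laplacian \<omega>\<^sub>1 \<omega>\<^sub>2 (%z. G z) (- 1) 0 (%_. 1 / A)"
proof -
 show "periodic (%z. G z)" using green by (auto simp: green_function_def doubly_periodic_def)
 have "smooth_fun_on (%z. G z) {z. z - 0 \<notin> \<Lambda>}" using green unfolding green_function_def by blast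
 moreover have "{z. z - 0 \<notin> \<Lambda>} = - \<Lambda>" by auto
 ultimately show "Ck_on 2 (%z. G z) (- \<Lambda>)" by (simp add: smooth_fun_on_def)
 show "weak_laplacian \<omega>\<^sub>1 \<omega>\<^sub>2 (%z. G z) (- 1) 0 (%_. 1 / A)" using green by (auto simp: green_function_def)
qed

lemma small_ball: "z \<in> ball 0 (rmin / 6) - {0} ==> z \<notin> \<Lambda>"
 using lattice_norm_ge[of z] rmin_pos by fastforce

text \<open>The density is constant, so its potential lies between 0 and a multiple of the integral
  of 1/|z - a|, uniformly in \<open>a\<close> and \<delta>.\<close>

lemma G_log_bound:
 obtains C where "!!z. z \<in> ball 0 (rmin / 6) - {0} ==> \<bar>2 * pi * G z + ln (cmod z)\<bar> <= C"
proof -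
 define \<rho> where "\<rho> = min (1 / 2) ((rmin / 4)\<^sup>2)"
 have \<rho>: "0 < \<rho>" "\<rho> <= 1 / 2" using rmin_pos by (auto simp: \<rho>_def)
 have "sqrt \<rho> <= sqrt ((rmin / 4)\<^sup>2)" unfolding \<rho>_def by (rule real_sqrt_le_mono) simp
 then have s\<rho>: "sqrt \<rho> < rmin / 3" using rmin_pos by simp
 have hp: "periodic (%_::complex. 1 / A)" by (simp add: doubly_periodic_def)
 define B where "B = (1 / A) * (2 * pi * sqrt \<rho>)"
 have pot: "0 <= potential (%_. 1 / A) \<rho> a \<delta> \<and> potential (%_. 1 / A) \<rho> a \<delta> <= B" if \<delta>: "0 < \<delta>" "\<delta> <= 1 / 2" for a \<delta>
 proof -
  define l where "l z = 1 / A * (- (1 / 2) * ln ((cmod (z - a))\<^sup>2 + \<delta>\<^sup>2) * bump ((cmod (z - a))\<^sup>2 / \<rho>))" for z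
  have li: "set_integrable lborel (cball a (sqrt \<rho>)) l" unfolding l_def
   by (intro potential_integrable \<delta>, unfold set_integrable_def) (rule borel_integrable_compact, auto)
  have lb: "0 <= l z \<and> l z <= 1 / A * (1 / cmod (z - a))" if z: "z \<in> cball a (sqrt \<rho>)" "z ~= a" for z
  proof -
   have "cmod (z - a) <= sqrt \<rho>" using z by (simp add: dist_norm norm_minus_commute)
   then have "(cmod (z - a))\<^sup>2 <= \<rho>" by (simp add: sqrt_ge_absD)
   moreover have "\<delta>\<^sup>2 <= (1 / 2)\<^sup>2" using \<delta> by (intro power_mono) auto
   ultimately have "(cmod (z - a))\<^sup>2 + \<delta>\<^sup>2 <= 1" using \<rho> by (simp add: power2_eq_square)
   from neg_half_ln_bounds[OF _ _ this] z have ln: "0 <= - (1 / 2) * ln ((cmod (z - a))\<^sup>2 + \<delta>\<^sup>2)"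
    "- (1 / 2) * ln ((cmod (z - a))\<^sup>2 + \<delta>\<^sup>2) <= 1 / cmod (z - a)" by auto
   have lem: "0 <= L ==> L <= x ==> 0 <= b ==> b <= 1 ==> 0 <= 1 / A * (L * b) \<and> 1 / A * (L * b) <= 1 / A * x" for L x b :: real
    using mult_mono[of L x b 1] torus_area_pos by (auto intro!: divide_right_mono)
   show ?thesis unfolding l_def by (rule lem[OF ln bump_bounds])
  qed
  have ae: "AE z in lborel. z ~= a" by (rule AE_lborel_singleton)
  have i2: "set_integrable lborel (cball a (sqrt \<rho>)) (%z. 1 / A * (1 / cmod (z - a)))"
   by (rule set_integrable_mult_right) (use integral_inv_dist(1)[of "sqrt \<rho>" a] \<rho> in simp)
  have "sint (cball a (sqrt \<rho>)) l <= sint (cball a (sqrt \<rho>)) (%z. 1 / A * (1 / cmod (z - a)))"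
   unfolding set_lebesgue_integral_def
   by (rule integral_mono_AE[OF li[unfolded set_integrable_def] i2[unfolded set_integrable_def]])
    (use ae lb in \<open>auto simp: indicator_def elim!: eventually_mono\<close>)
  also have "\<dots> = B" unfolding B_def set_integral_mult_right using integral_inv_dist(2)[of "sqrt \<rho>" a] \<rho> by simp
  finally have 1: "sint (cball a (sqrt \<rho>)) l <= B" .
  have "0 <= sint (cball a (sqrt \<rho>)) l"
   unfolding set_lebesgue_integral_def
   by (rule integral_nonneg_AE) (use ae lb in \<open>auto simp: indicator_def elim: eventually_mono\<close>)
  with 1 show ?thesis unfolding potential_def l_def by blast
 qed
 from weak_bounds[OF G_props(3) G_props(1) hp \<rho> s\<rho>] obtain C where
  C: "!!a U. a ~= 0 ==> cmod a <= rmin / 6 ==> isCont (%z. G z) a ==>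
  ((\<forall>\<delta>. 0 < \<delta> \<and> \<delta> <= 1 / 2 --> potential (%_. 1 / A) \<rho> a \<delta> <= U) --> - 1 * ln (cmod a) - U - C <= 2 * pi * G a) \<and>
  ((\<forall>\<delta>. 0 < \<delta> \<and> \<delta> <= 1 / 2 --> U <= potential (%_. 1 / A) \<rho> a \<delta>) --> 2 * pi * G a <= - 1 * ln (cmod a) - U + C)"
  by blast
 show thesis
 proof (rule that[of "\<bar>B\<bar> + \<bar>C\<bar>"])
  fix z :: complex assume z: "z \<in> ball 0 (rmin / 6) - {0}"
  have "isCont (%z. G z) z"
   using G_props(2) small_ball[OF z] unfolding Ck_2_iff by (auto intro: differentiable_imp_continuous_within)
  with C[of z B] C[of z 0] z pot show "\<bar>2 * pi * G z + ln (cmod z)\<bar> <= \<bar>B\<bar> + \<bar>C\<bar>" by auto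
 qed
qed

lemma complex_zero_from_basis:
 assumes "Re (d * \<omega>\<^sub>1) = 0" "Re (d * \<omega>\<^sub>2) = 0" shows "d = 0"
proof -
 have "d * z = of_real (cs z) * (d * \<omega>\<^sub>1) + of_real (ct z) * (d * \<omega>\<^sub>2)" for z
  using arg_cong[OF coords[of z], of "%x. d * x"] by (simp add: algebra_simps)
 from arg_cong[OF this[of "cnj d"], of Re] have "Re (d * cnj d) = 0" using assms by simp
 then show ?thesis by (simp add: complex_mult_cnj complex_eq_iff)
qed

lemma green_structure:
 "\<exists>c C0. (\<forall>z. z \<notin> \<Lambda> --> G z = - ln (cmod (sigma z)) / (2 * pi) + (cmod z)\<^sup>2 / (4 * A) + Re (c * z\<^sup>2) + C0) \<and>
  (\<forall>w\<in>\<Lambda>. eta w = of_real (pi / A) * cnj w + 4 * of_real pi * c * w)"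
proof -
 have hp: "periodic (%_::complex. 1 / A)" by (simp add: doubly_periodic_def)
 have Apos: "A > 0" by (rule torus_area_pos)
 obtain g \<alpha> where g: "!!z. z \<notin> \<Lambda> ==> has_wirt (%z. of_real (G z)) (g z) (cnj (g z)) z"
  "!!z. z \<notin> \<Lambda> ==> has_wirt g (\<alpha> z) (of_real (1 / A / 4)) z"
  by (rule weak_classical[OF G_props(3) G_props(1) hp G_props(2) continuous_on_const]) (rule that)
 have per: "periodic (%z. complex_of_real (G z))" using G_props(1) by (simp add: doubly_periodic_def)
 have gper: "g (z + w) = g z" if "z \<notin> \<Lambda>" "w \<in> \<Lambda>" for z w
  by (rule wirt_periodic(1)[OF per, of "- \<Lambda>" g]) (use g(1) that lattice_add_iff in auto)
 have cnj_w: "has_wirt (%z. of_real (1 / (4 * A)) * cnj z) 0 (of_real (1 / (4 * A))) z" for z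
  using wirt_cmult[OF wirt_cnj[OF wirt_holo[OF DERIV_ident]], of "of_real (1 / (4 * A))" z] by simp
 \<comment> \<open>The Laplacian of \<open>G\<close> is 1/|T| off the lattice, so subtracting conj z
   / (4 |T|) from its z-derivative leaves a holomorphic function.\<close>
 define F where "F z = g z - of_real (1 / (4 * A)) * cnj z" for z
 have F: "(F has_field_derivative \<alpha> z) (at z)" if "z \<notin> \<Lambda>" for z
  unfolding F_def[abs_def]
  by (rule wirt_zero_imp_DERIV) (rule wirt_eq_rhs[OF wirt_diff[OF g(2)[OF that] cnj_w]], use Apos in \<open>auto simp: field_simps\<close>)
 have Fper: "F (z + w) = F z - of_real (1 / (4 * A)) * cnj w" if "z \<notin> \<Lambda>" "w \<in> \<Lambda>" for z w
  using gper[OF that] by (simp add: F_def algebra_simps add_divide_distrib)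
 have F0: "((%z. z * (F z + 1 / (4 * of_real pi * z))) \<longlongrightarrow> 0) (at 0)"
 proof -
  obtain C where C: "!!z. z \<in> ball 0 (rmin / 6) - {0} ==> \<bar>2 * pi * G z + ln (cmod z)\<bar> <= C"
   by (rule G_log_bound) (rule that)
  define \<phi> where "\<phi> z = G z + ln (cmod z) / (2 * pi) - (cmod z)\<^sup>2 / (4 * A)" for z
  show ?thesis
  proof (rule bounded_harmonic_residue[of "rmin / 6" _ \<phi> "C / (2 * pi) + (rmin / 6)\<^sup>2 / (4 * A)"])
   show "(%z. F z + 1 / (4 * of_real pi * z)) holomorphic_on ball 0 (rmin / 6) - {0}"
   proof (intro holomorphic_intros)
    show "F holomorphic_on ball 0 (rmin / 6) - {0}"
     by (rule holomorphic_onI) (meson F small_ball field_differentiable_def field_differentiable_at_within)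
   qed auto
  next
   fix z :: complex assume z: "z \<in> ball 0 (rmin / 6) - {0}"
   have "has_wirt (%z. of_real (G z) + of_real (1 / (2 * pi)) * of_real (ln (cmod z)) - of_real (1 / (4 * A)) * of_real ((cmod (z - 0))\<^sup>2))
    (g z + of_real (1 / (2 * pi)) * (1 / (2 * z)) - of_real (1 / (4 * A)) * cnj (z - 0)) (cnj (g z) + of_real (1 / (2 * pi)) * cnj (1 / (2 * z)) - of_real (1 / (4 * A)) * (z - 0)) z"
    by (intro wirt_diff wirt_add wirt_cmult wirt_cmod2 g(1) wirt_ln_cmod[OF DERIV_ident] small_ball[OF z]) (use z in auto)
   then show "has_wirt (%z. of_real (\<phi> z)) (F z + 1 / (4 * of_real pi * z)) (cnj (F z + 1 / (4 * of_real pi * z))) z"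
    by (simp add: \<phi>_def F_def algebra_simps)
   have eq: "G z + ln (cmod z) / (2 * pi) = (2 * pi * G z + ln (cmod z)) / (2 * pi)"
    by (simp add: add_divide_distrib)
   have "\<bar>G z + ln (cmod z) / (2 * pi)\<bar> = \<bar>2 * pi * G z + ln (cmod z)\<bar> / (2 * pi)"
    unfolding eq by (simp add: abs_divide)
   also have "\<dots> <= C / (2 * pi)" using C[OF z] by (intro divide_right_mono) auto
   finally have 1: "\<bar>G z + ln (cmod z) / (2 * pi)\<bar> <= C / (2 * pi)" .
   have "(cmod z)\<^sup>2 / (4 * A) <= (rmin / 6)\<^sup>2 / (4 * A)" using z Apos by (intro divide_right_mono power_mono) auto
   moreover have "0 <= (cmod z)\<^sup>2 / (4 * A)" using Apos by simp
   ultimately show "\<bar>\<phi> z\<bar> <= C / (2 * pi) + (rmin / 6)\<^sup>2 / (4 * A)" using 1 unfolding \<phi>_def by linarith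
  qed (use rmin_pos in auto)
 qed
 \<comment> \<open>Near 0 the function \<open>F\<close> behaves like -1 / (4 pi z) by
   \<open>bounded_harmonic_residue\<close>; adding zeta / (4 pi) removes this pole.\<close>
 define q where "q z = F z + zeta z / (4 * of_real pi)" for z
 define k where "k w = eta w / (4 * of_real pi) - of_real (1 / (4 * A)) * cnj w" for w
 have qper: "q (z + w) = q z + k w" if "z \<notin> \<Lambda>" "w \<in> \<Lambda>" for z w
  using Fper[OF that] zeta_shift[OF that(2,1)] by (simp add: q_def k_def add_divide_distrib)
 have qh: "q holomorphic_on - \<Lambda>"
  unfolding q_def[abs_def]
 proof (intro holomorphic_intros zeta_holo)
  show "F holomorphic_on - \<Lambda>"
   by (rule holomorphic_onI) (metis ComplD F field_differentiable_at_within field_differentiable_def)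
 qed auto
 have q0: "((%z. z * q z) \<longlongrightarrow> 0) (at 0)"
 proof -
  have "((%z. z * (F z + 1 / (4 * of_real pi * z)) + ((z - 0) * zeta z) / (4 * of_real pi) - 1 / (4 * of_real pi)) \<longlongrightarrow> 0 + 1 / (4 * of_real pi) - 1 / (4 * of_real pi)) (at 0)"
   by (intro tendsto_intros F0 zeta_lim) auto
  then have "((%z. z * (F z + 1 / (4 * of_real pi * z)) + ((z - 0) * zeta z) / (4 * of_real pi) - 1 / (4 * of_real pi)) \<longlongrightarrow> 0) (at 0)" by simp
  then show ?thesis
  proof (rule Lim_transform_eventually)
   show "\<forall>\<^sub>F z in at 0. z * (F z + 1 / (4 * of_real pi * z)) + ((z - 0) * zeta z) / (4 * of_real pi) - 1 / (4 * of_real pi) = z * q z"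
    using ev_not_lattice[of 0]
   proof eventually_elim
    case (elim z)
    then have "z ~= 0" by auto
    then show ?case by (simp add: q_def field_simps)
   qed
  qed
 qed
 obtain c d where qd: "!!z. z \<notin> \<Lambda> ==> q z = c * z + d"
  using quasi_periodic_linear[OF qh qper q0] by blast
 have gz: "g z = - zeta z / (4 * of_real pi) + of_real (1 / (4 * A)) * cnj z + c * z + d" if "z \<notin> \<Lambda>" for z
  using qd[OF that] by (simp add: q_def F_def algebra_simps)
 \<comment> \<open>Evenness of \<open>G\<close> is not part of the definition of a Green function.
   The function G(z) - G(-z) - Re (4 d z) has derivative 0, and periodicity of the first two terms
   makes Re (d w) vanish for every lattice point w.\<close>
 have "d = 0"
 proof -
  define D where "D z = complex_of_real (G z) - of_real (G (- z)) - of_real (Re (4 * d * z))" for z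
  have W: "has_wirt D 0 0 z" if z: "z \<in> - \<Lambda>" for z
  proof -
   have nz: "- z \<notin> \<Lambda>" using z lattice_minus_iff by auto
   have 1: "has_wirt (%z. of_real (G (- z))) (g (- z) * - 1) (cnj (g (- z)) * cnj (- 1)) z"
    by (rule wirt_holo_comp[where g = "%z. - z", OF _ g(1)[OF nz]]) (auto intro!: derivative_eq_intros)
   have 2: "has_wirt (%z. of_real (Re (4 * d * z))) (4 * d / 2) (cnj (4 * d / 2)) z"
    by (rule wirt_Re_holo) (auto intro!: derivative_eq_intros)
   have s: "g z + g (- z) = 2 * d" using gz z nz by (simp add: zeta_odd)
   have s': "cnj (g z) + cnj (g (- z)) = 2 * cnj d" using arg_cong[OF s, of cnj] by simp
   show ?thesis unfolding D_def[abs_def]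
    by (rule wirt_eq_rhs[OF wirt_diff[OF wirt_diff[OF g(1) 1] 2]]) (use z s s' in \<open>auto simp: algebra_simps\<close>)
  qed
  have "Re (d * w) = 0" if w: "w \<in> \<Lambda>" for w
  proof -
   have "\<omega>\<^sub>1 / 2 + w \<in> - \<Lambda>" using half_not_lattice lattice_add_iff[OF w] by simp
   from wirt_zero_const[OF open_compl_lattice connected_compl_lattice W this] half_not_lattice
   have "D (\<omega>\<^sub>1 / 2 + w) = D (\<omega>\<^sub>1 / 2)" by auto
   moreover have "G (\<omega>\<^sub>1 / 2 + w) = G (\<omega>\<^sub>1 / 2)" "G (- (\<omega>\<^sub>1 / 2) + - w) = G (- (\<omega>\<^sub>1 / 2))"
    using periodic_lattice[OF G_props(1)] w lattice_minus by blast+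
   ultimately show ?thesis by (simp add: D_def algebra_simps flip: of_real_diff of_real_add of_real_mult)
  qed
  then show "d = 0" using complex_zero_from_basis lattice_basis by blast
 qed
 note gz = gz[unfolded \<open>d = 0\<close> add_0_right]
 have eta: "eta w = of_real (pi / A) * cnj w + 4 * of_real pi * c * w" if w: "w \<in> \<Lambda>" for w
 proof -
  have nl: "\<omega>\<^sub>1 / 2 + w \<notin> \<Lambda>" using half_not_lattice lattice_add_iff[OF w] by simp
  have "eta w / (4 * of_real pi) = of_real (1 / (4 * A)) * cnj w + c * w"
  proof -
   have "c * w + of_real (1 / (4 * A)) * cnj w - eta w / (4 * of_real pi) = 0"
    using gper[OF half_not_lattice w] unfolding gz[OF half_not_lattice] gz[OF nl] zeta_shift[OF w half_not_lattice]
    by (simp add: algebra_simps add_divide_distrib diff_divide_distrib)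
   then show ?thesis by (simp only: right_minus_eq add.commute)
  qed
  then have "eta w = 4 * of_real pi * (of_real (1 / (4 * A)) * cnj w + c * w)" by (simp add: field_simps)
  then show ?thesis by (simp add: algebra_simps)
 qed
 define H where "H z = G z + ln (cmod (sigma z)) / (2 * pi) - (cmod z)\<^sup>2 / (4 * A) - Re (c * z\<^sup>2)" for z
 have HW: "has_wirt (%z. of_real (H z)) 0 0 z" if z: "z \<in> - \<Lambda>" for z
 proof -
  have s: "sigma z ~= 0" using z sigma_zero by auto
  have 1: "((%z. c * z\<^sup>2) has_field_derivative 2 * c * z) (at z)" by (auto intro!: derivative_eq_intros)
  have "has_wirt (%z. of_real (G z) + of_real (1 / (2 * pi)) * of_real (ln (cmod (sigma z))) - of_real (1 / (4 * A)) * of_real ((cmod (z - 0))\<^sup>2) - of_real (Re (c * z\<^sup>2)))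
    (g z + of_real (1 / (2 * pi)) * (deriv sigma z / (2 * sigma z)) - of_real (1 / (4 * A)) * cnj (z - 0) - 2 * c * z / 2)
    (cnj (g z) + of_real (1 / (2 * pi)) * cnj (deriv sigma z / (2 * sigma z)) - of_real (1 / (4 * A)) * (z - 0) - cnj (2 * c * z / 2)) z"
   by (intro wirt_diff wirt_add wirt_cmult wirt_cmod2 g(1) wirt_ln_cmod[OF sigma_deriv s] wirt_Re_holo 1) (use z in auto)
  then have W: "has_wirt (%z. of_real (H z)) (g z + of_real (1 / (2 * pi)) * (deriv sigma z / (2 * sigma z)) - of_real (1 / (4 * A)) * cnj (z - 0) - 2 * c * z / 2)
    (cnj (g z) + of_real (1 / (2 * pi)) * cnj (deriv sigma z / (2 * sigma z)) - of_real (1 / (4 * A)) * (z - 0) - cnj (2 * c * z / 2)) z"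
   by (simp add: H_def)
  have e0: "g z + of_real (1 / (2 * pi)) * (deriv sigma z / (2 * sigma z)) - of_real (1 / (4 * A)) * cnj (z - 0) - 2 * c * z / 2 = 0"
   using z s gz[of z] sigma_zeta[of z] by simp
  show ?thesis using W[unfolded wirt_of_real_cnj[OF W] e0] by simp
 qed
 have Hc: "H z = H (\<omega>\<^sub>1 / 2)" if "z \<notin> \<Lambda>" for z
  using wirt_zero_const[OF open_compl_lattice connected_compl_lattice HW, of z "\<omega>\<^sub>1 / 2"] that half_not_lattice by auto
 have "G z = - ln (cmod (sigma z)) / (2 * pi) + (cmod z)\<^sup>2 / (4 * A) + Re (c * z\<^sup>2) + H (\<omega>\<^sub>1 / 2)" if "z \<notin> \<Lambda>" for z
  using Hc[OF that] H_def[of z] by linarith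
 with eta show ?thesis by blast
qed

definition gc :: complex where
 "gc = (SOME c. \<exists>C0. (\<forall>z. z \<notin> \<Lambda> --> G z = - ln (cmod (sigma z)) / (2 * pi) + (cmod z)\<^sup>2 / (4 * A) + Re (c * z\<^sup>2) + C0) \<and>
  (\<forall>w\<in>\<Lambda>. eta w = of_real (pi / A) * cnj w + 4 * of_real pi * c * w))"

text \<open>The Wirtinger derivative G_z, whose zeros off the lattice are the critical
  points.\<close>

definition Gz :: "complex => complex" where
 "Gz z = - zeta z / (4 * of_real pi) + of_real (1 / (4 * A)) * cnj z + gc * z"

lemma G_formula: obtains C0 where "!!z. z \<notin> \<Lambda> ==> G z = - ln (cmod (sigma z)) / (2 * pi) + (cmod z)\<^sup>2 / (4 * A) + Re (gc * z\<^sup>2) + C0"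
 using someI_ex[OF green_structure, folded gc_def] by blast

lemma eta_eq: "w \<in> \<Lambda> ==> eta w = of_real (pi / A) * cnj w + 4 * of_real pi * gc * w"
 using someI_ex[OF green_structure, folded gc_def] by blast

lemma Gz_wirt: assumes z: "z \<notin> \<Lambda>" shows "has_wirt (%z. of_real (G z)) (Gz z) (cnj (Gz z)) z"
proof -
 obtain C0 where C0: "!!z. z \<notin> \<Lambda> ==> G z = - ln (cmod (sigma z)) / (2 * pi) + (cmod z)\<^sup>2 / (4 * A) + Re (gc * z\<^sup>2) + C0"
  by (rule G_formula) (rule that)
 have s: "sigma z ~= 0" using z sigma_zero by auto
 have 1: "((%z. gc * z\<^sup>2) has_field_derivative 2 * gc * z) (at z)" by (auto intro!: derivative_eq_intros)
 have "has_wirt (%z. of_real (- 1 / (2 * pi)) * of_real (ln (cmod (sigma z))) + of_real (1 / (4 * A)) * of_real ((cmod (z - 0))\<^sup>2) + of_real (Re (gc * z\<^sup>2)) + of_real C0)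
    (of_real (- 1 / (2 * pi)) * (deriv sigma z / (2 * sigma z)) + of_real (1 / (4 * A)) * cnj (z - 0) + 2 * gc * z / 2 + 0)
    (of_real (- 1 / (2 * pi)) * cnj (deriv sigma z / (2 * sigma z)) + of_real (1 / (4 * A)) * (z - 0) + cnj (2 * gc * z / 2) + 0) z"
  by (intro wirt_add wirt_cmult wirt_cmod2 wirt_ln_cmod[OF sigma_deriv s] wirt_Re_holo 1 wirt_const)
 then have "has_wirt (%z. of_real (- 1 / (2 * pi)) * of_real (ln (cmod (sigma z))) + of_real (1 / (4 * A)) * of_real ((cmod (z - 0))\<^sup>2) + of_real (Re (gc * z\<^sup>2)) + of_real C0)
  (Gz z) (cnj (Gz z)) z"
  by (rule wirt_eq_rhs) (use s sigma_zeta[OF z] in \<open>auto simp: Gz_def\<close>)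
 then show ?thesis by (rule wirt_transform[OF _ open_compl_lattice]) (use z C0 in auto)
qed

lemma Gz_holo: "z \<notin> \<Lambda> ==> has_wirt Gz (wp z / (4 * of_real pi) + gc) (of_real (1 / (4 * A))) z"
 unfolding Gz_def[abs_def]
 by (rule wirt_eq_rhs[OF wirt_add[OF wirt_add[OF wirt_holo[OF DERIV_cdivide[OF DERIV_minus[OF zeta_deriv]]] wirt_cmult[OF wirt_cnj[OF wirt_holo[OF DERIV_ident]]]] wirt_cmult[OF wirt_holo[OF DERIV_ident]]]]) auto

text \<open>The conjugate term of \<open>eta_eq\<close> would make complex conjugation complex
  linear on the two periods, a real basis, hence on the whole plane.\<close>

lemma eta_not_linear: "\<not> (\<forall>w\<in>\<Lambda>. eta w = e * w)"
proof
 assume e: "\<forall>w\<in>\<Lambda>. eta w = e * w"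
 define k where "k = (e - 4 * of_real pi * gc) * of_real (A / pi)"
 have "cnj w = k * w" if "w \<in> \<Lambda>" for w
  using e[rule_format, OF that] eta_eq[OF that] torus_area_pos by (simp add: k_def field_simps)
 then have w: "cnj \<omega>\<^sub>1 = k * \<omega>\<^sub>1" "cnj \<omega>\<^sub>2 = k * \<omega>\<^sub>2" using lattice_basis by auto
 have "cnj z = k * z" for z
  using arg_cong[OF coords[of z], of cnj] arg_cong[OF coords[of z], of "(*) k"] by (simp add: w algebra_simps)
 from this[of 1] this[of \<i>] show False by (simp add: complex_eq_iff)
qed

lemma extra_iff: "extra_critical_point \<omega>\<^sub>1 \<omega>\<^sub>2 (%z. G z) z \<longleftrightarrow> 2 * z \<notin> \<Lambda> \<and> Gz z = 0"
proof (cases "z \<in> \<Lambda>")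
 case True
 then show ?thesis using lattice_add[of z z] by (auto simp: extra_critical_point_def critical_point_def simp flip: mult_2)
next
 case False
 have "((%z. G z) has_derivative (%_. 0)) (at z) \<longleftrightarrow> has_wirt (%z. of_real (G z)) 0 (cnj 0) z"
  unfolding wirt_of_real_iff by simp
 also have "\<dots> \<longleftrightarrow> Gz z = 0" using Gz_wirt[OF False] wirt_unique(1) by fastforce
 finally show ?thesis using False half_period_iff[OF False] by (auto simp: extra_critical_point_def critical_point_def)
qed

end

section \<open>Scaling families\<close>

text \<open>Each point is the only one of \<open>T\<close> in some interval with rational end
  points.\<close>

lemma countable_isolated_reals:
 fixes T :: "real set"
 assumes "!!t. t \<in> T ==> \<forall>\<^sub>F s in at t. s \<notin> T"
 shows "countable T"
proof -
 have "\<exists>a b. a \<in> \<rat> \<and> b \<in> \<rat> \<and> {a<..<b} \<inter> T = {t}" if t: "t \<in> T" for t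
 proof -
  obtain d where d: "d > 0" "!!s. s ~= t ==> dist s t < d ==> s \<notin> T"
   using assms[OF t] unfolding eventually_at by blast
  obtain a where a: "a \<in> \<rat>" "t - d < a" "a < t" using Rats_dense_in_real[of "t - d" t] d by auto
  obtain b where b: "b \<in> \<rat>" "t < b" "b < t + d" using Rats_dense_in_real[of t "t + d"] d by auto
  have "{a<..<b} \<inter> T = {t}" using a b t d(2) by (force simp: dist_real_def)
  then show ?thesis using a b by blast
 qed
 then obtain a b where ab: "!!t. t \<in> T ==> a t \<in> \<rat> \<and> b t \<in> \<rat> \<and> {a t<..<b t} \<inter> T = {t}" by metis
 have "inj_on (%t. (a t, b t)) T" using ab by (intro inj_onI) (metis prod.inject singleton_inject)
 moreover have "countable ((%t. (a t, b t)) ` T)"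
  by (rule countable_subset[of _ "\<rat> \<times> \<rat>"]) (use ab countable_rat in auto)
 ultimately show ?thesis using countable_image_inj_on by blast
qed

section \<open>The developing map as a quotient of quasi-periodic functions\<close>

context torus_lattice
begin

text \<open>A path may rest at a lattice point, but there its velocity vanishes; hence the values of the
 integrand on the lattice are irrelevant.\<close>

lemma contour_integral_off_lattice:
 assumes \<gamma>: "valid_path \<gamma>" and fg: "!!\<xi>. \<xi> \<in> path_image \<gamma> ==> \<xi> \<notin> \<Lambda> ==> f \<xi> = g \<xi>"
 shows "contour_integral \<gamma> f = contour_integral \<gamma> g"
proof -
 obtain K where K: "finite K" "\<gamma> C1_differentiable_on {0..1} - K"
  using \<gamma> unfolding valid_path_def piecewise_C1_differentiable_on_def by blast
 have D: "(\<gamma> has_vector_derivative vector_derivative \<gamma> (at t)) (at t)" if "t \<in> {0..1} - K" for t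
  using K(2) that vector_derivative_works C1_differentiable_on_eq by blast
 \<comment> \<open>The times at which the path is at \<open>p\<close> with nonzero velocity. A
   nonzero velocity makes the path leave \<open>p\<close> at once, so these times are
   isolated.\<close>
 define T where "T p = {t \<in> {0..1} - K. \<gamma> t = p \<and> vector_derivative \<gamma> (at t) ~= 0}" for p
 have "countable (T p)" for p
 proof (rule countable_isolated_reals)
  fix t assume t: "t \<in> T p"
  define v where "v = vector_derivative \<gamma> (at t)"
  have v: "v ~= 0" "\<gamma> t = p" using t by (auto simp: T_def v_def)
  have "(\<gamma> has_derivative (%x. x *\<^sub>R v)) (at t)" using D[of t] t by (simp add: T_def v_def has_vector_derivative_def)
  then have "((%s. norm ((\<gamma> s - \<gamma> t) - (s - t) *\<^sub>R v) / norm (s - t)) \<longlongrightarrow> 0) (at t)"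
   unfolding has_derivative_iff_norm by blast
  from order_tendstoD(2)[OF this, of "norm v"] v
  have "\<forall>\<^sub>F s in at t. norm ((\<gamma> s - \<gamma> t) - (s - t) *\<^sub>R v) / norm (s - t) < norm v" by simp
  moreover have "\<forall>\<^sub>F s in at t. s ~= t" by (simp add: eventually_at_filter)
  ultimately show "\<forall>\<^sub>F s in at t. s \<notin> T p"
  proof eventually_elim
   case (elim s)
   have "\<gamma> s ~= \<gamma> t" using elim by auto
   then show ?case using v by (simp add: T_def)
  qed
 qed
 then have cT: "countable (\<Union>p\<in>\<Lambda>. T p)" using countable_lattice by auto
 show ?thesis unfolding contour_integral_integral
 proof (rule integral_spike[where S = "K \<union> (\<Union>p\<in>\<Lambda>. T p)"])
  show "negligible (K \<union> (\<Union>p\<in>\<Lambda>. T p))"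
   unfolding negligible_iff_null_sets
   by (intro null_sets_completionI countable_imp_null_set_lborel countable_Un cT countable_finite K(1))
  fix t assume t: "t \<in> {0..1} - (K \<union> (\<Union>p\<in>\<Lambda>. T p))"
  show "g (\<gamma> t) * vector_derivative \<gamma> (at t) = f (\<gamma> t) * vector_derivative \<gamma> (at t)"
  proof (cases "\<gamma> t \<in> \<Lambda>")
   case True
   then have "vector_derivative \<gamma> (at t) = 0" using t by (auto simp: T_def)
   then show ?thesis by simp
  next
   case False
   then show ?thesis using fg[of "\<gamma> t"] t by (auto simp: path_image_def)
  qed
 qed
qed

lemma AE_not_lattice: "AE z in lborel. z \<notin> \<Lambda>"
 by (rule AE_not_in) (rule countable_imp_null_set_lborel[OF countable_lattice])

text \<open>Normalised so that \<open>Y a 0 = 1\<close>; the developing map is \<open>Y a / Y (- a)\<close>.\<close>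

definition Y :: "complex => complex => complex" where
 "Y a z = exp (zeta a * z) * sigma (z - a) / sigma (- a)"

text \<open>The Wronskian of \<open>Y a\<close> and \<open>Y (- a)\<close>. For f =
  \<open>Y a / Y (- a)\<close> one has f' = W / Y(-a)^2, and the fraction in Liouville's formula
  with parameter l becomes |W|^2 / S^2, which is regular also at the poles of f.\<close>

definition W :: "complex => complex => complex" where
 "W a z = deriv (Y a) z * Y (- a) z - Y a z * deriv (Y (- a)) z"

definition S :: "complex => real => complex => real" where
 "S a l z = exp (- l) * (cmod (Y (- a) z))\<^sup>2 + exp l * (cmod (Y a z))\<^sup>2"

lemma Y_holo: "Y a holomorphic_on UNIV"
 unfolding Y_def[abs_def] divide_inverse
 by (intro holomorphic_intros holomorphic_on_compose_gen[OF _ sigma_holo, unfolded o_def]) auto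

lemma Y_deriv: "(Y a has_field_derivative deriv (Y a) z) (at z)"
 by (rule holomorphic_derivI[OF Y_holo]) auto

lemma Y_deriv2: "(deriv (Y a) has_field_derivative deriv (deriv (Y a)) z) (at z)"
 by (rule holomorphic_derivI[OF holomorphic_deriv[OF Y_holo]]) auto

lemma Y_zero: "a \<notin> \<Lambda> ==> Y a z = 0 \<longleftrightarrow> z - a \<in> \<Lambda>" and Y_0: "a \<notin> \<Lambda> ==> Y a 0 = 1"
 by (auto simp: Y_def sigma_zero lattice_minus_iff)

lemma Y_log_deriv: assumes "z - a \<notin> \<Lambda>" shows "deriv (Y a) z = (zeta a + zeta (z - a)) * Y a z"
proof -
 have "((%z. sigma (z - a)) has_field_derivative deriv sigma (z - a) * (1 - 0)) (at z)"
  by (rule DERIV_chain2[OF sigma_deriv]) (auto intro!: derivative_eq_intros)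
 moreover have "((%z. exp (zeta a * z)) has_field_derivative exp (zeta a * z) * zeta a) (at z)" by (auto intro!: derivative_eq_intros)
 ultimately have "(Y a has_field_derivative (exp (zeta a * z) * zeta a * sigma (z - a) + deriv sigma (z - a) * (1 - 0) * exp (zeta a * z)) / sigma (- a)) (at z)"
  unfolding Y_def[abs_def] by (intro DERIV_cdivide DERIV_mult)
 from DERIV_imp_deriv[OF this] show ?thesis unfolding sigma_zeta[OF assms] by (simp add: Y_def algebra_simps add_divide_distrib)
qed

lemma W_zz: assumes "z - a \<notin> \<Lambda>" "z + a \<notin> \<Lambda>" shows "W a z = zz a z * Y a z * Y (- a) z"
proof -
 have e: "deriv (Y (- a)) z = (- zeta a + zeta (z + a)) * Y (- a) z"
  using Y_log_deriv[of z "- a"] assms by (simp add: zeta_odd)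
 show ?thesis unfolding W_def e Y_log_deriv[OF assms(1)] zz_def by (simp add: algebra_simps)
qed

lemma ev_orbit: "\<forall>\<^sub>F w in at z. w \<notin> orbit {a, - a}" "\<forall>\<^sub>F w in at z. w \<notin> orbit {0, a, - a}"
 by (rule eventually_not_orbit, simp)+

lemma W_minus: "W (- a) z = - W a z" by (simp add: W_def)
lemma S_minus: "S (- a) (- l) z = S a l z" by (simp add: S_def)

lemma S_pos: assumes "2 * a \<notin> \<Lambda>" shows "0 < S a l z"
proof -
 have a: "a \<notin> \<Lambda>" "- a \<notin> \<Lambda>" using double_not_lattice[OF assms] lattice_minus_iff by auto
 have "Y a z ~= 0 \<or> Y (- a) z ~= 0"
  using lattice_diff[of "z - - a" "z - a"] assms unfolding Y_zero[OF a(1)] Y_zero[OF a(2)] by auto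
 then show ?thesis unfolding S_def by (auto intro: add_pos_nonneg add_nonneg_pos)
qed

text \<open>The multipliers of \<open>Y a\<close> and \<open>Y (- a)\<close> relative to
  \<open>sigma\<close> are inverse to each other, so the Wronskian transforms like the square of
  \<open>sigma\<close> for every \<open>a\<close>.\<close>

lemma Y_quasi:
 assumes w: "w \<in> \<Lambda>"
 obtains C where "C ~= 0" "!!a z. Y a (z + w) = exp (zeta a * w - eta w * a) * C * exp (eta w * z) * Y a z"
  "!!a z. W a (z + w) = (C * exp (eta w * z))\<^sup>2 * W a z"
  "!!z. sigma (z + w) = C * exp (eta w * z) * sigma z"
proof -
 obtain C where C: "C ~= 0" "!!z. sigma (z + w) = C * exp (eta w * z) * sigma z" by (rule sigma_quasi[OF w]) (rule that)
 define E where "E a = exp (zeta a * w - eta w * a) * C" for a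
 have Yq: "Y a (z + w) = E a * exp (eta w * z) * Y a z" for a z
  using C(2)[of "z - a"] by (simp add: Y_def E_def algebra_simps exp_add exp_diff)
 have dY: "deriv (Y a) (z + w) = E a * exp (eta w * z) * (eta w * Y a z + deriv (Y a) z)" for a z
 proof -
  have "((%z. Y a (z + w)) has_field_derivative deriv (Y a) (z + w)) (at z)"
   using DERIV_shift Y_deriv by blast
  moreover have "((%z. E a * exp (eta w * z) * Y a z) has_field_derivative E a * exp (eta w * z) * (eta w * Y a z + deriv (Y a) z)) (at z)"
   by (auto intro!: derivative_eq_intros Y_deriv simp: algebra_simps)
  ultimately show ?thesis unfolding Yq by (rule DERIV_unique)
 qed
 have EE: "E a * E (- a) = C\<^sup>2" for a
 proof -
  have "zeta (- a) * w - eta w * - a = - (zeta a * w - eta w * a)" by (simp add: zeta_odd)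
  then show ?thesis unfolding E_def by (simp only: exp_minus) (simp add: power2_eq_square field_simps)
 qed
 have "W a (z + w) = (E a * E (- a)) * (exp (eta w * z))\<^sup>2 * W a z" for a z
  unfolding W_def dY Yq by (simp add: algebra_simps power2_eq_square)
 then have WE: "W a (z + w) = (C * exp (eta w * z))\<^sup>2 * W a z" for a z unfolding EE by (simp add: power_mult_distrib)
 show thesis by (rule that[OF C(1) _ WE C(2)]) (simp only: Yq E_def)
qed

text \<open>W / sigma^2 is elliptic by \<open>Y_quasi\<close>. The double zero of
  \<open>zz a\<close> at 0 meets the double zero of sigma^2, so it has no pole and is
  constant.\<close>

lemma W_sigma:
 assumes a: "2 * a \<notin> \<Lambda>"
 obtains k where "k ~= 0" "!!z. z \<notin> \<Lambda> ==> W a z = k * (sigma z)\<^sup>2"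
proof -
 have aL: "a \<notin> \<Lambda>" "- a \<notin> \<Lambda>" using double_not_lattice[OF a] lattice_minus_iff by auto
 have Wh: "W a holomorphic_on UNIV" unfolding W_def[abs_def] by (intro holomorphic_intros Y_holo holomorphic_deriv) auto
 have "\<exists>k. \<forall>z. z \<notin> orbit {0} --> W a z / (sigma z)\<^sup>2 = k"
 proof (rule elliptic_const)
  show "(%z. W a z / (sigma z)\<^sup>2) holomorphic_on - orbit {0}"
   by (intro holomorphic_intros holomorphic_on_subset[OF Wh] holomorphic_on_subset[OF sigma_holo]) (auto simp: orbit_0 sigma_zero)
  fix z w assume w: "w \<in> \<Lambda>" and z: "z \<notin> orbit {0}"
  obtain C where C: "C ~= 0" "!!a z. W a (z + w) = (C * exp (eta w * z))\<^sup>2 * W a z" "!!z. sigma (z + w) = C * exp (eta w * z) * sigma z"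
   by (rule Y_quasi[OF w]) (rule that)
  show "W a (z + w) / (sigma (z + w))\<^sup>2 = W a z / (sigma z)\<^sup>2" using C(1) unfolding C(2,3) by (simp add: power_mult_distrib)
 next
  have s0: "sigma 0 = 0" by (simp add: sigma_zero)
  have "((%z. (sigma z - sigma 0) / (z - 0)) \<longlongrightarrow> deriv sigma 0) (at 0)" by (rule DERIV_quotient_lim[OF sigma_deriv])
  moreover have "((%z. (zz a z - zz a 0) / (z - 0)) \<longlongrightarrow> 0) (at 0)" by (rule DERIV_quotient_lim[OF zz_0(2)[OF aL(1)]])
  moreover have "(Y b \<longlongrightarrow> Y b 0) (at 0)" for b using DERIV_isCont[OF Y_deriv] by (simp add: isCont_def)
  ultimately have "((%z. ((zz a z - zz a 0) / (z - 0)) * Y a z * Y (- a) z / ((sigma z - sigma 0) / (z - 0))\<^sup>2) \<longlongrightarrow> 0 * Y a 0 * Y (- a) 0 / (deriv sigma 0)\<^sup>2) (at 0)"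
   by (intro tendsto_intros) (use sigma_deriv_nz[of 0] in auto)
  then have "((%z. ((zz a z - zz a 0) / (z - 0)) * Y a z * Y (- a) z / ((sigma z - sigma 0) / (z - 0))\<^sup>2) \<longlongrightarrow> 0) (at 0)" by simp
  then have "((%z. (z - 0) * (W a z / (sigma z)\<^sup>2)) \<longlongrightarrow> 0) (at 0)"
  proof (rule Lim_transform_eventually)
   show "\<forall>\<^sub>F z in at 0. ((zz a z - zz a 0) / (z - 0)) * Y a z * Y (- a) z / ((sigma z - sigma 0) / (z - 0))\<^sup>2 = (z - 0) * (W a z / (sigma z)\<^sup>2)"
    using ev_orbit(2)[of a 0]
   proof eventually_elim
    case (elim z)
    then have z: "z \<notin> \<Lambda>" "z - a \<notin> \<Lambda>" "z + a \<notin> \<Lambda>" by (auto simp: orbit_def)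
    then have "z ~= 0" "sigma z ~= 0" by (auto simp: sigma_zero)
    then show ?case unfolding W_zz[OF z(2,3)] by (simp add: s0 zz_0(1)[OF aL(1)] field_simps power2_eq_square)
   qed
  qed
  then show "((%z. (z - c) * (W a z / (sigma z)\<^sup>2)) \<longlongrightarrow> 0) (at c)" if "c \<in> {0}" for c using that by simp
 qed auto
 then obtain k where k: "!!z. z \<notin> \<Lambda> ==> W a z / (sigma z)\<^sup>2 = k" by (auto simp: orbit_0)
 obtain z where zn: "z \<notin> orbit {0, a, - a}" using eventually_happens'[OF _ ev_orbit(2)[of a 0]] by auto
 then have z: "z \<notin> \<Lambda>" "z - a \<notin> \<Lambda>" "z + a \<notin> \<Lambda>" by (auto simp: orbit_def)
 have zz: "zz a z ~= 0" using zz_wp(1)[OF a] zz_wp(2)[OF a zn] by auto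
 have "W a z ~= 0" unfolding W_zz[OF z(2,3)] using zz z aL by (simp add: Y_zero)
 then have "k ~= 0" using k[OF z(1)] z(1) by (auto simp: sigma_zero)
 then show thesis using k by (intro that[of k]) (auto simp: sigma_zero field_simps)
qed

text \<open>Green's second identity: \<open>stokes_torus\<close> is applied to v \<phi>_z - \<phi>
  v_z. The zbar-derivative has a quarter of the difference of the two integrands as real part, the
  products of first derivatives being imaginary together.\<close>

lemma weak_of_classical:
 assumes v: "!!z. has_wirt (%z. of_real (v z)) (a z) (cnj (a z)) z" "!!z. has_wirt a (\<alpha> z) (\<beta> z) z"
  and c: "continuous_on UNIV \<alpha>" "continuous_on UNIV \<beta>" and per: "periodic v"
  and \<phi>: "periodic \<phi>" "Ck_on 2 \<phi> UNIV"
 shows "sint P (%z. v z * laplacian \<phi> z) = sint P (%z. laplacian v z * \<phi> z)"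
  "set_integrable lborel P (%z. v z * laplacian \<phi> z)" "set_integrable lborel P (%z. laplacian v z * \<phi> z)"
proof -
 have lv: "laplacian v z = 4 * Re (\<beta> z)" for z by (rule Ck2_laplacian_I(2)[OF open_UNIV v c]) auto
 obtain p \<mu> \<nu> where p: "!!z. has_wirt (%z. of_real (\<phi> z)) (p z) (cnj (p z)) z" "!!z. has_wirt p (\<mu> z) (\<nu> z) z"
  and pc: "continuous_on UNIV \<mu>" "continuous_on UNIV \<nu>" and lp: "!!z. laplacian \<phi> z = 4 * Re (\<nu> z)"
 proof (rule Ck2_wirt[OF open_UNIV \<phi>(2)])
  fix p \<mu> \<nu> assume "!!z. z \<in> UNIV ==> has_wirt (%z. of_real (\<phi> z)) (p z) (cnj (p z)) z" "!!z. z \<in> UNIV ==> has_wirt p (\<mu> z) (\<nu> z) z"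
   "continuous_on UNIV \<mu>" "continuous_on UNIV \<nu>" "!!z. z \<in> UNIV ==> laplacian \<phi> z = 4 * Re (\<nu> z)"
  then show thesis by (intro that[of p \<mu> \<nu>]) simp_all
 qed
 have cont: "continuous_on UNIV (%z. complex_of_real (v z))" "continuous_on UNIV (%z. complex_of_real (\<phi> z))" "continuous_on UNIV a" "continuous_on UNIV p"
  by (rule wirt_imp_continuous_on, rule v p)+
 from continuous_on_Re[OF cont(1)] continuous_on_Re[OF cont(2)] have contr: "continuous_on UNIV v" "continuous_on UNIV \<phi>" by simp_all
 define \<Psi> where "\<Psi> z = of_real (v z) * p z - of_real (\<phi> z) * a z" for z
 define A where "A z = (of_real (v z) * \<mu> z + a z * p z) - (of_real (\<phi> z) * \<alpha> z + p z * a z)" for z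
 define B where "B z = (of_real (v z) * \<nu> z + cnj (a z) * p z) - (of_real (\<phi> z) * \<beta> z + cnj (p z) * a z)" for z
 have W: "has_wirt \<Psi> (A z) (B z) z" for z
  unfolding \<Psi>_def[abs_def] A_def B_def by (intro wirt_diff wirt_mult v p)
 have AB: "continuous_on UNIV A" "continuous_on UNIV B"
  unfolding A_def[abs_def] B_def[abs_def] by (intro continuous_intros cont pc c)+
 have pper: "periodic p"
  by (rule periodicI, rule wirt_periodic(1)[of "%z. of_real (\<phi> z)" UNIV p "%z. cnj (p z)"]) (use p \<phi> in \<open>auto simp: doubly_periodic_def\<close>)
 have aper: "periodic a"
  by (rule periodicI, rule wirt_periodic(1)[of "%z. of_real (v z)" UNIV a "%z. cnj (a z)"]) (use v per in \<open>auto simp: doubly_periodic_def\<close>)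
 have Pper: "periodic \<Psi>" using pper aper per \<phi>(1) by (simp add: doubly_periodic_def \<Psi>_def)
 have "sint P B = 0" by (rule stokes_torus(2)[OF W AB Pper])
 moreover have "set_integrable lborel P B" by (rule continuous_set_integrable_P[OF AB(2)])
 ultimately have "sint P (%z. Re (B z)) = 0"
  unfolding set_lebesgue_integral_def set_integrable_def
  using integral_Re[of lborel "%x. indicator P x *\<^sub>R B x"] by simp
 moreover have "4 * Re (B z) = v z * laplacian \<phi> z - laplacian v z * \<phi> z" for z
  by (simp add: B_def lv lp algebra_simps)
 ultimately have z: "sint P (%z. v z * laplacian \<phi> z - laplacian v z * \<phi> z) = 0"
  by (metis (no_types, lifting) mult_zero_right set_integral_mult_right set_lebesgue_integral_cong P_borel sets_lborel)
 show i: "set_integrable lborel P (%z. v z * laplacian \<phi> z)" "set_integrable lborel P (%z. laplacian v z * \<phi> z)"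
  unfolding lv lp by (intro continuous_set_integrable_P continuous_intros contr c pc)+
 show "sint P (%z. v z * laplacian \<phi> z) = sint P (%z. laplacian v z * \<phi> z)"
  using z set_integral_diff(2)[OF i] by simp
qed

text \<open>Off the lattice the integrand is \<open>zz a\<close>, the logarithmic derivative of F =
  \<open>Y a / Y (- a)\<close>, and F(0) = 1. The exponential of such an integral is the quotient of
  the end values of F along any path avoiding its zeros and poles.\<close>

lemma developing_map_eq:
 assumes a: "2 * a \<notin> \<Lambda>" and z: "z \<notin> orbit {a, - a}"
 shows "developing_map \<omega>\<^sub>1 \<omega>\<^sub>2 a z = Y a z / Y (- a) z"
proof -
 have aL: "a \<notin> \<Lambda>" "- a \<notin> \<Lambda>" using double_not_lattice[OF a] lattice_minus_iff by auto
 define U where "U = - orbit {a, - a}"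
 have U: "open U" "connected U" using orbit_props(1,2)[of "{a, - a}"] by (auto simp: U_def intro: connected_compl_countable)
 have U_iff: "\<xi> \<in> U \<longleftrightarrow> \<xi> - a \<notin> \<Lambda> \<and> \<xi> + a \<notin> \<Lambda>" for \<xi> by (auto simp: U_def orbit_def)
 have 0: "0 \<in> U" using aL by (simp add: U_iff)
 define Q where "Q \<gamma> \<longleftrightarrow> valid_path \<gamma> \<and> pathstart \<gamma> = 0 \<and> pathfinish \<gamma> = z \<and>
     (\<forall>\<xi>\<in>path_image \<gamma>. \<xi> - a \<notin> \<Lambda> \<and> \<xi> + a \<notin> \<Lambda>)" for \<gamma>
 define \<gamma> where "\<gamma> = (SOME \<gamma>. Q \<gamma>)"
 have "\<exists>\<gamma>. Q \<gamma>"
  using connected_open_polynomial_connected[OF U 0, of z] z U_iff unfolding Q_def U_def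
  by (metis ComplI U_def U_iff subsetD valid_path_polynomial_function)
 then have "Q \<gamma>" unfolding \<gamma>_def by (rule someI_ex)
 then have \<gamma>: "valid_path \<gamma>" "pathstart \<gamma> = 0" "pathfinish \<gamma> = z" "path_image \<gamma> \<subseteq> U" by (auto simp: Q_def U_iff)
 define F where "F z = Y a z / Y (- a) z" for z
 have nz: "Y a \<xi> ~= 0" "Y (- a) \<xi> ~= 0" if "\<xi> \<in> U" for \<xi> using that aL by (auto simp: U_iff Y_zero)
 have F': "(F has_field_derivative W a \<xi> / (Y (- a) \<xi>)\<^sup>2) (at \<xi>)" if "\<xi> \<in> U" for \<xi>
  unfolding F_def[abs_def] W_def using nz[OF that] DERIV_divide[OF Y_deriv Y_deriv] by (simp add: power2_eq_square)
 have Fh: "F holomorphic_on U" using F' U by (auto simp: holomorphic_on_open)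
 have F0: "0 \<notin> path_image (F \<circ> \<gamma>)"
 proof
  assume "0 \<in> path_image (F \<circ> \<gamma>)"
  then obtain t where "t \<in> {0..1}" "F (\<gamma> t) = 0" by (auto simp: path_image_def)
  moreover from this have "\<gamma> t \<in> U" using \<gamma>(4) by (auto simp: path_image_def)
  ultimately show False using nz by (auto simp: F_def)
 qed
 have vF: "valid_path (F \<circ> \<gamma>)" by (rule valid_path_compose_holomorphic[OF \<gamma>(1) Fh U(1) \<gamma>(4)])
 have "contour_integral \<gamma> (%\<xi>. wp1 a / (wp \<xi> - wp a)) = contour_integral \<gamma> (%\<xi>. deriv F \<xi> / (F \<xi> - 0))"
 \<comment> \<open>On the lattice \<open>wp\<close> takes a default value, so the integrands are
   compared off it only.\<close>
 proof (rule contour_integral_off_lattice[OF \<gamma>(1)])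
  fix \<xi> assume \<xi>: "\<xi> \<in> path_image \<gamma>" "\<xi> \<notin> \<Lambda>"
  then have U': "\<xi> \<in> U" using \<gamma>(4) by auto
  then have "zz a \<xi> * (wp \<xi> - wp a) = wp1 a" using \<xi> by (intro zz_wp(2)[OF a]) (auto simp: U_iff orbit_def)
  with zz_wp(1)[OF a] have "wp1 a / (wp \<xi> - wp a) = zz a \<xi>" by (metis mult_eq_0_iff nonzero_eq_divide_eq)
  also have "\<dots> = deriv F \<xi> / (F \<xi> - 0)"
   using DERIV_imp_deriv[OF F'[OF U']] nz[OF U'] W_zz[of \<xi> a] U' by (simp add: U_iff F_def power2_eq_square)
  finally show "wp1 a / (wp \<xi> - wp a) = deriv F \<xi> / (F \<xi> - 0)" .
 qed
 also have "\<dots> = integral {0..1} (%t. vector_derivative (F \<circ> \<gamma>) (at t) / ((F \<circ> \<gamma>) t - 0))"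
 proof -
  obtain K where K: "finite K" "\<gamma> C1_differentiable_on {0..1} - K"
   using \<gamma>(1) unfolding valid_path_def piecewise_C1_differentiable_on_def by blast
  show ?thesis unfolding contour_integral_integral
  proof (rule integral_spike[OF negligible_finite[OF K(1)]])
   fix t assume t: "t \<in> {0..1} - K"
   have "\<gamma> t \<in> U" using \<gamma>(4) t by (auto simp: path_image_def)
   then have "F field_differentiable at (\<gamma> t)" using F' field_differentiable_def by blast
   moreover have "\<gamma> differentiable at t" using K(2) t C1_differentiable_on_eq by blast
   ultimately have "vector_derivative (F \<circ> \<gamma>) (at t) = vector_derivative \<gamma> (at t) * deriv F (\<gamma> t)"
    by (intro vector_derivative_chain_at_general)
   then show "vector_derivative (F \<circ> \<gamma>) (at t) / ((F \<circ> \<gamma>) t - 0) = deriv F (\<gamma> t) / (F (\<gamma> t) - 0) * vector_derivative \<gamma> (at t)" by simp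
  qed
 qed
 finally have ci: "contour_integral \<gamma> (%\<xi>. wp1 a / (wp \<xi> - wp a)) = integral {0..1} (%t. vector_derivative (F \<circ> \<gamma>) (at t) / ((F \<circ> \<gamma>) t - 0))" .
 have "exp (- contour_integral \<gamma> (%\<xi>. wp1 a / (wp \<xi> - wp a))) * ((F \<circ> \<gamma>) 1 - 0) = (F \<circ> \<gamma>) 0 - 0"
  unfolding ci by (rule winding_number_exp_integral(2)) (use vF F0 in \<open>auto simp: valid_path_def path_image_def\<close>)
 moreover have "(F \<circ> \<gamma>) 1 = F z" "(F \<circ> \<gamma>) 0 = 1" using \<gamma> aL by (simp_all add: pathfinish_def pathstart_def F_def Y_0)
 ultimately have "exp (contour_integral \<gamma> (%\<xi>. wp1 a / (wp \<xi> - wp a))) = F z" by (simp add: exp_minus field_simps)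
 then show ?thesis unfolding developing_map_def F_def \<gamma>_def Q_def .
qed

text \<open>As an exponential, the function never takes the value 0. Near the points congruent to a
  or -a it coincides with a quotient that has a zero or a pole there, so whatever value it takes at
  such a point, it is not analytic.\<close>

lemma developing_map_analytic_iff:
 assumes a: "2 * a \<notin> \<Lambda>"
 shows "developing_map \<omega>\<^sub>1 \<omega>\<^sub>2 a analytic_on {z} \<longleftrightarrow> z \<notin> orbit {a, - a}"
proof
 have aL: "a \<notin> \<Lambda>" "- a \<notin> \<Lambda>" using double_not_lattice[OF a] lattice_minus_iff by auto
 define f where "f = developing_map \<omega>\<^sub>1 \<omega>\<^sub>2 a"
 have fnz: "f z ~= 0" for z by (simp add: f_def developing_map_def)
 have ev: "\<forall>\<^sub>F w in at z. f w = Y a w / Y (- a) w"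
  using ev_orbit(1)[of a z] by eventually_elim (auto simp: f_def developing_map_eq[OF a])
 have Yc: "(Y b \<longlongrightarrow> Y b z) (at z)" for b using DERIV_isCont[OF Y_deriv] by (simp add: isCont_def)
 assume "developing_map \<omega>\<^sub>1 \<omega>\<^sub>2 a analytic_on {z}"
 then have "isCont f z" unfolding f_def by (metis analytic_at_imp_isCont)
 then have fl: "(f \<longlongrightarrow> f z) (at z)" by (simp add: isCont_def)
 have m: "\<forall>\<^sub>F w in at z. f w * Y (- a) w = Y a w"
  using ev ev_orbit(1)[of a z] by eventually_elim (use aL in \<open>auto simp: Y_zero orbit_def\<close>)
 have "((%w. f w * Y (- a) w) \<longlongrightarrow> f z * Y (- a) z) (at z)" by (intro tendsto_intros fl Yc)
 from Lim_transform_eventually[OF this m] have "f z * Y (- a) z = Y a z" using Yc LIM_unique by blast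
 with fnz[of z] have "z - a \<in> \<Lambda> \<longleftrightarrow> z - - a \<in> \<Lambda>" using Y_zero aL by (metis mult_eq_0_iff)
 moreover have "\<not> (z - a \<in> \<Lambda> \<and> z - - a \<in> \<Lambda>)" using lattice_diff[of "z - - a" "z - a"] a by auto
 ultimately show "z \<notin> orbit {a, - a}" by (auto simp: orbit_def)
next
 have aL: "a \<notin> \<Lambda>" "- a \<notin> \<Lambda>" using double_not_lattice[OF a] lattice_minus_iff by auto
 assume z: "z \<notin> orbit {a, - a}"
 have "(%z. Y a z / Y (- a) z) holomorphic_on - orbit {a, - a}"
  by (intro holomorphic_intros holomorphic_on_subset[OF Y_holo]) (use aL in \<open>auto simp: Y_zero orbit_def\<close>)
 then have "developing_map \<omega>\<^sub>1 \<omega>\<^sub>2 a holomorphic_on - orbit {a, - a}"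
  by (rule holomorphic_transform) (simp add: developing_map_eq[OF a])
 then show "developing_map \<omega>\<^sub>1 \<omega>\<^sub>2 a analytic_on {z}"
  using z orbit_props(1)[of "{a, - a}"] unfolding analytic_at by (intro exI[of _ "- orbit {a, - a}"]) auto
qed

lemma scaling_familyI:
 assumes a: "2 * a \<notin> \<Lambda>"
  and sol: "!!l. mean_field_solution \<omega>\<^sub>1 \<omega>\<^sub>2 (8 * pi) (u l)"
  and u: "!!l z. z \<notin> \<Lambda> ==> u l z = - ln pi + ln ((cmod (W a z))\<^sup>2 / (S a l z)\<^sup>2)"
 shows "scaling_family \<omega>\<^sub>1 \<omega>\<^sub>2 (8 * pi) (developing_map \<omega>\<^sub>1 \<omega>\<^sub>2 a) u"
proof -
 have aL: "a \<notin> \<Lambda>" "- a \<notin> \<Lambda>" using double_not_lattice[OF a] lattice_minus_iff by auto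
 define f where "f = developing_map \<omega>\<^sub>1 \<omega>\<^sub>2 a"
 define U where "U = - orbit {a, - a}"
 have oU: "open U" using orbit_props(1)[of "{a, - a}"] by (auto simp: U_def)
 have f: "f z = Y a z / Y (- a) z" if "z \<in> U" for z using that by (simp add: f_def U_def developing_map_eq[OF a])
 have an: "f analytic_on {z} \<longleftrightarrow> z \<in> U" for z using developing_map_analytic_iff[OF a] by (simp add: f_def U_def)
 have nz: "Y (- a) z ~= 0" if "z \<in> U" for z using that aL by (auto simp: U_def Y_zero orbit_def)
 have f': "deriv f z = W a z / (Y (- a) z)\<^sup>2" if z: "z \<in> U" for z
 proof -
  have "((%z. Y a z / Y (- a) z) has_field_derivative W a z / (Y (- a) z)\<^sup>2) (at z)"
   unfolding W_def using nz[OF z] DERIV_divide[OF Y_deriv Y_deriv] by (simp add: power2_eq_square)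
  then have "(f has_field_derivative W a z / (Y (- a) z)\<^sup>2) (at z)"
   by (rule has_field_derivative_transform_within_open[OF _ oU z]) (simp add: f)
  then show ?thesis by (rule DERIV_imp_deriv)
 qed
 have mer: "f meromorphic_on UNIV"
 proof -
  have "(%z. Y a z / Y (- a) z) meromorphic_on UNIV"
   by (intro meromorphic_intros analytic_on_imp_meromorphic_on) (auto simp: analytic_on_open Y_holo)
  moreover have "f meromorphic_on UNIV \<longleftrightarrow> (%z. Y a z / Y (- a) z) meromorphic_on UNIV"
  proof (rule meromorphic_on_cong)
   fix z show "\<forall>\<^sub>F w in at z. f w = Y a w / Y (- a) w"
    using ev_orbit(1)[of a z] by eventually_elim (auto simp: f U_def)
  qed simp
  ultimately show ?thesis by simp
 qed
 have nc: "\<not> (\<exists>c. \<forall>z. f analytic_on {z} --> f z = c)"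
 proof
  assume "\<exists>c. \<forall>z. f analytic_on {z} --> f z = c"
  then obtain c where c: "!!z. z \<in> U ==> f z = c" by (auto simp: an)
  obtain z where "z \<notin> orbit {0, a, - a}" using eventually_happens'[OF _ ev_orbit(2)[of a 0]] by auto
  then have z: "z \<in> U" "z \<notin> \<Lambda>" by (auto simp: orbit_def U_def)
  obtain k where k: "k ~= 0" "!!z. z \<notin> \<Lambda> ==> W a z = k * (sigma z)\<^sup>2" by (rule W_sigma[OF a]) (rule that)
  have "((%z. c) has_field_derivative 0) (at z)" by simp
  then have "(f has_field_derivative 0) (at z)"
   by (rule has_field_derivative_transform_within_open[OF _ oU z(1)]) (simp add: c)
  then have "W a z / (Y (- a) z)\<^sup>2 = 0" using f'[OF z(1)] DERIV_imp_deriv by metis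
  then show False using nz[OF z(1)] k(1) z(2) unfolding k(2)[OF z(2)] by (simp add: sigma_zero)
 qed
 have form: "u l z = - ln pi + ln (exp (2 * l) * (cmod (deriv f z))\<^sup>2 / (1 + exp (2 * l) * (cmod (f z))\<^sup>2)\<^sup>2)"
  if z: "z \<notin> \<Lambda>" "z \<in> U" for l z
 proof -
  define x y e where "x = cmod (Y a z)" and "y = cmod (Y (- a) z)" and "e = exp l"
  have y: "y > 0" using nz[OF z(2)] by (simp add: y_def)
  have e: "e > 0" "exp (2 * l) = e\<^sup>2" "exp (- l) = 1 / e" by (auto simp: e_def exp_minus divide_inverse power2_eq_square simp flip: exp_add)
  have S: "S a l z = y\<^sup>2 / e + e * x\<^sup>2" unfolding S_def e(3) by (simp add: x_def y_def e_def)
  have 1: "1 + e\<^sup>2 * (x / y)\<^sup>2 = e * S a l z / y\<^sup>2" unfolding S using y e(1) by (simp add: field_simps power2_eq_square)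
  have Sp: "S a l z > 0" by (rule S_pos[OF a])
  have "e\<^sup>2 * (cmod (W a z) / y\<^sup>2)\<^sup>2 / (e * S a l z / y\<^sup>2)\<^sup>2 = (cmod (W a z))\<^sup>2 / (S a l z)\<^sup>2"
   using y e(1) Sp by (simp add: field_simps power2_eq_square)
  then show ?thesis unfolding u[OF z(1)] f'[OF z(2)] f[OF z(2)] e(2) norm_divide norm_power x_def[symmetric] y_def[symmetric] 1 by simp
 qed
 \<comment> \<open>The constant c_1 = - ln pi is forced by 8 pi exp c_1 = 8.\<close>
 show ?thesis unfolding scaling_family_def f_def[symmetric]
  by (intro conjI mer nc exI[of _ "- ln pi"]) (use sol form an in \<open>auto simp: exp_minus\<close>)
qed

end

section \<open>Solutions from an extra critical point\<close>

context torus_green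
begin

text \<open>On the lattice \<open>u\<close> has arbitrary values. Measurability of exp u comes from
  that of \<open>u\<close>, and its integrals from the continuous function \<open>q\<close>, which
  equals it off a null set.\<close>

lemma G_measurable_AE:
 fixes u q :: "complex => real"
 assumes "set_integrable lborel P u" "q \<in> borel_measurable borel" "!!z. z \<notin> \<Lambda> ==> exp (u z) = q z" "continuous_on UNIV q"
 shows "set_integrable lborel P (%z. exp (u z))"
  "continuous_on UNIV \<phi> ==> sint P (%z. exp (u z) * \<phi> z) = sint P (%z. q z * \<phi> z)"
proof -
 have um: "(%z. indicator P z *\<^sub>R u z) \<in> borel_measurable lborel" using assms(1) unfolding set_integrable_def by (rule borel_measurable_integrable)
 have eq: "indicator P z *\<^sub>R exp (u z) = indicator P z *\<^sub>R exp (indicator P z *\<^sub>R u z)" for z by (auto simp: indicator_def)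
 have [measurable]: "indicator P \<in> borel_measurable lborel" using P_borel by simp
 have em: "(%z. indicator P z *\<^sub>R exp (u z)) \<in> borel_measurable lborel" unfolding eq
  by (intro borel_measurable_scaleR borel_measurable_continuous_on[where f = exp, OF _ um] continuous_at_imp_continuous_on ballI isCont_exp) auto
 have qm: "(%z. indicator P z *\<^sub>R q z) \<in> borel_measurable lborel"
  by (intro borel_measurable_scaleR) (use assms(2) in auto)
 have ae: "AE z in lborel. indicator P z *\<^sub>R exp (u z) = indicator P z *\<^sub>R q z"
  using AE_not_lattice by (rule eventually_mono) (simp add: assms(3))
 show "set_integrable lborel P (%z. exp (u z))"
  using continuous_set_integrable_P[OF assms(4)] integrable_cong_AE[OF em qm ae] by (simp add: set_integrable_def)
 assume \<phi>: "continuous_on UNIV \<phi>"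
 have \<phi>m: "\<phi> \<in> borel_measurable lborel" using borel_measurable_continuous_onI[OF \<phi>] by simp
 show "sint P (%z. exp (u z) * \<phi> z) = sint P (%z. q z * \<phi> z)"
  unfolding set_lebesgue_integral_def
  by (rule integral_cong_AE)
   (use borel_measurable_times[OF em \<phi>m] borel_measurable_times[OF qm \<phi>m] AE_not_lattice in \<open>auto simp: mult.assoc assms(3) elim!: eventually_mono\<close>)
qed

lemma solution_of_critical_point:
 assumes a: "2 * a \<notin> \<Lambda>" "Gz a = 0"
 obtains u where "!!l. mean_field_solution \<omega>\<^sub>1 \<omega>\<^sub>2 (8 * pi) (u l)"
  "!!l z. z \<notin> \<Lambda> ==> u l z = - ln pi + ln ((cmod (W a z))\<^sup>2 / (S a l z)\<^sup>2)"
proof -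
 have aL: "a \<notin> \<Lambda>" "- a \<notin> \<Lambda>" using double_not_lattice[OF a(1)] lattice_minus_iff by auto
 obtain k where k: "k ~= 0" "!!z. z \<notin> \<Lambda> ==> W a z = k * (sigma z)\<^sup>2" by (rule W_sigma[OF a(1)]) (rule that)
 obtain C0 where C0: "!!z. z \<notin> \<Lambda> ==> G z = - ln (cmod (sigma z)) / (2 * pi) + (cmod z)\<^sup>2 / (4 * A) + Re (gc * z\<^sup>2) + C0"
  by (rule G_formula) (rule that)
 have Sp: "S a l z > 0" for l z by (rule S_pos[OF a(1)])
 define c1 where "c1 = - ln pi + 2 * ln (cmod k) + 8 * pi * C0"
 define v where "v l z = c1 - 2 * ln (S a l z) + 2 * pi / A * (cmod z)\<^sup>2 + Re (8 * of_real pi * gc * z\<^sup>2)" for l z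
 \<comment> \<open>Up to a constant, -8 pi G contributes the 4 ln |sigma| contained in ln |W|^2; the
   quadratic terms of \<open>v\<close> compensate those of \<open>G\<close>. Hence \<open>v\<close>
   is smooth everywhere and the Dirac mass of \<open>u\<close> is that of -8 pi G.\<close>
 define u where "u l z = v l z - 8 * pi * G z" for l z
 have u_eq: "u l z = - ln pi + ln ((cmod (W a z))\<^sup>2 / (S a l z)\<^sup>2)" if z: "z \<notin> \<Lambda>" for l z
 proof -
  have s: "cmod (sigma z) > 0" using z by (simp add: sigma_zero)
  have "ln ((cmod (W a z))\<^sup>2 / (S a l z)\<^sup>2) = 2 * (ln (cmod k) + 2 * ln (cmod (sigma z))) - 2 * ln (S a l z)"
   using s k(1) Sp[of l z] unfolding k(2)[OF z] by (simp add: ln_div ln_mult norm_mult norm_power ln_realpow)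
  moreover have "Re (8 * of_real pi * gc * z\<^sup>2) = 8 * pi * Re (gc * z\<^sup>2)" by (simp add: algebra_simps)
  moreover have "8 * pi * (- ln (cmod (sigma z)) / (2 * pi) + (cmod z)\<^sup>2 / (4 * A) + Re (gc * z\<^sup>2) + C0) =
    - 4 * ln (cmod (sigma z)) + 2 * pi / A * (cmod z)\<^sup>2 + 8 * pi * Re (gc * z\<^sup>2) + 8 * pi * C0"
   using torus_area_pos by (simp add: field_simps)
  ultimately show ?thesis unfolding u_def v_def c1_def C0[OF z] by (simp add: algebra_simps)
 qed
 define Sz where "Sz l z = of_real (exp (- l)) * (deriv (Y (- a)) z * cnj (Y (- a) z)) + of_real (exp l) * (deriv (Y a) z * cnj (Y a z))" for l z
 define Szz where "Szz l z = of_real (exp (- l)) * (deriv (deriv (Y (- a))) z * cnj (Y (- a) z)) + of_real (exp l) * (deriv (deriv (Y a)) z * cnj (Y a z))" for l z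
 define Szb where "Szb l z = of_real (exp (- l)) * (deriv (Y (- a)) z * cnj (deriv (Y (- a)) z)) + of_real (exp l) * (deriv (Y a) z * cnj (deriv (Y a) z))" for l z
 have S_cx: "complex_of_real (S a l z) = of_real (exp (- l)) * (Y (- a) z * cnj (Y (- a) z)) + of_real (exp l) * (Y a z * cnj (Y a z))" for l z
  by (simp add: S_def complex_norm_square del: of_real_power)
 have SW: "has_wirt (%z. of_real (S a l z)) (Sz l z) (cnj (Sz l z)) z" for l z
  unfolding S_cx
  by (rule wirt_eq_rhs[OF wirt_add[OF wirt_cmult[OF wirt_mult[OF wirt_holo[OF Y_deriv] wirt_cnj[OF wirt_holo[OF Y_deriv]]]]
   wirt_cmult[OF wirt_mult[OF wirt_holo[OF Y_deriv] wirt_cnj[OF wirt_holo[OF Y_deriv]]]]]]) (auto simp: Sz_def mult_ac)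
 have SzW: "has_wirt (Sz l) (Szz l z) (Szb l z) z" for l z
  unfolding Sz_def[abs_def]
  by (rule wirt_eq_rhs[OF wirt_add[OF wirt_cmult[OF wirt_mult[OF wirt_holo[OF Y_deriv2] wirt_cnj[OF wirt_holo[OF Y_deriv]]]]
   wirt_cmult[OF wirt_mult[OF wirt_holo[OF Y_deriv2] wirt_cnj[OF wirt_holo[OF Y_deriv]]]]]]) (auto simp: Szz_def Szb_def mult_ac)
 \<comment> \<open>Lagrange's identity for the 2 by 2 determinant \<open>W\<close>, the weights exp
   (-l) and exp l having product 1. It is the source of the nonlinear term exp u.\<close>
 have key: "Szb l z * of_real (S a l z) - Sz l z * cnj (Sz l z) = of_real ((cmod (W a z))\<^sup>2)" for l z
 proof -
  have pq: "(p * (y' * cnj y') + q * (x' * cnj x')) * (p * (y * cnj y) + q * (x * cnj x)) - (p * (y' * cnj y) + q * (x' * cnj x)) * (p * (cnj y' * y) + q * (cnj x' * x))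
   = (p * q) * ((x' * y - x * y') * cnj (x' * y - x * y'))" for p q x y x' y' :: complex
   by (simp add: algebra_simps)
  have "complex_of_real (exp (- l)) * of_real (exp l) = 1" by (simp flip: of_real_mult exp_add)
  then show ?thesis unfolding Szb_def S_cx Sz_def complex_norm_square W_def
   using pq[of "of_real (exp (- l))" "deriv (Y (- a)) z" "of_real (exp l)" "deriv (Y a) z" "Y (- a) z" "Y a z"] by simp
 qed
 define va where "va l z = - 2 * (Sz l z / of_real (S a l z)) + of_real (2 * pi / A) * cnj z + 8 * of_real pi * gc * z" for l z
 define v\<alpha> where "v\<alpha> l z = - 2 * ((Szz l z * of_real (S a l z) - Sz l z * Sz l z) / (of_real (S a l z))\<^sup>2) + 8 * of_real pi * gc" for l z
 define v\<beta> :: "real => complex => complex" where "v\<beta> l z = - 2 * (of_real ((cmod (W a z))\<^sup>2) / (of_real (S a l z))\<^sup>2) + of_real (2 * pi / A)" for l z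
 have Snz: "complex_of_real (S a l z) ~= 0" for l z using Sp[of l z] by simp
 have vW: "has_wirt (%z. of_real (v l z)) (va l z) (cnj (va l z)) z" for l z
 proof -
  have 1: "has_wirt (%z. of_real (ln (S a l z))) (of_real (1 / S a l z) * Sz l z) (of_real (1 / S a l z) * cnj (Sz l z)) z"
   by (rule wirt_of_real_comp[OF SW]) (use Sp[of l z] in \<open>auto intro!: derivative_eq_intros\<close>)
  have 2: "((%z. 8 * of_real pi * gc * z\<^sup>2) has_field_derivative 8 * of_real pi * gc * (2 * z)) (at z)"
   by (auto intro!: derivative_eq_intros)
  have "has_wirt (%z. of_real c1 - 2 * of_real (ln (S a l z)) + of_real (2 * pi / A) * of_real ((cmod (z - 0))\<^sup>2) + of_real (Re (8 * of_real pi * gc * z\<^sup>2)))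
   (0 - 2 * (of_real (1 / S a l z) * Sz l z) + of_real (2 * pi / A) * cnj (z - 0) + 8 * of_real pi * gc * (2 * z) / 2)
   (0 - 2 * (of_real (1 / S a l z) * cnj (Sz l z)) + of_real (2 * pi / A) * (z - 0) + cnj (8 * of_real pi * gc * (2 * z) / 2)) z"
   by (intro wirt_add wirt_diff wirt_cmult wirt_const wirt_cmod2 1 wirt_Re_holo 2)
  then have "has_wirt (%z. of_real (v l z)) (0 - 2 * (of_real (1 / S a l z) * Sz l z) + of_real (2 * pi / A) * cnj (z - 0) + 8 * of_real pi * gc * (2 * z) / 2)
   (0 - 2 * (of_real (1 / S a l z) * cnj (Sz l z)) + of_real (2 * pi / A) * (z - 0) + cnj (8 * of_real pi * gc * (2 * z) / 2)) z"
   by (simp only: v_def of_real_add of_real_diff of_real_mult of_real_numeral diff_zero)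
  then show ?thesis by (rule wirt_eq_rhs) (simp_all add: va_def)
 qed
 have vaW: "has_wirt (va l) (v\<alpha> l z) (v\<beta> l z) z" for l z
 proof -
  have "has_wirt (va l) (- 2 * ((Szz l z * of_real (S a l z) - Sz l z * Sz l z) / (of_real (S a l z))\<^sup>2) + of_real (2 * pi / A) * cnj 0 + 8 * of_real pi * gc * 1)
   (- 2 * ((Szb l z * of_real (S a l z) - Sz l z * cnj (Sz l z)) / (of_real (S a l z))\<^sup>2) + of_real (2 * pi / A) * cnj 1 + 8 * of_real pi * gc * 0) z"
   unfolding va_def[abs_def]
   by (intro wirt_add wirt_cmult wirt_divide SzW SW wirt_cnj wirt_holo[OF DERIV_ident] Snz)
  then show ?thesis unfolding key by (simp add: v\<alpha>_def v\<beta>_def)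
 qed
 have Yc: "continuous_on UNIV (Y b)" "continuous_on UNIV (deriv (Y b))" "continuous_on UNIV (deriv (deriv (Y b)))" for b
  by (intro holomorphic_on_imp_continuous_on Y_holo holomorphic_deriv; simp)+
 have Wc: "continuous_on UNIV (W a)" unfolding W_def[abs_def] by (intro continuous_intros Yc)
 have Sc: "continuous_on UNIV (S a l)" for l unfolding S_def[abs_def] by (intro continuous_intros Yc)
 have vc: "continuous_on UNIV (v\<alpha> l)" "continuous_on UNIV (v\<beta> l)" for l
  unfolding v\<alpha>_def[abs_def] v\<beta>_def[abs_def] Szz_def Sz_def by (intro continuous_intros Yc Sc Wc; use Snz in auto)+
 have vcont: "continuous_on UNIV (v l)" for l
 proof -
  have "continuous_on UNIV (%z. complex_of_real (v l z))" by (rule wirt_imp_continuous_on, rule vW)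
  from continuous_on_Re[OF this] show ?thesis by simp
 qed
 have vper: "periodic (v l)" for l
 proof (rule periodicI)
  fix z w assume w: "w \<in> \<Lambda>"
  obtain C where C: "C ~= 0" "!!a z. Y a (z + w) = exp (zeta a * w - eta w * a) * C * exp (eta w * z) * Y a z"
   "!!a z. W a (z + w) = (C * exp (eta w * z))\<^sup>2 * W a z"
   by (rule Y_quasi[OF w]) (rule that)
  \<comment> \<open>The critical point equation. With \<open>eta_eq\<close> it makes zeta a * w -
    eta w * a imaginary, so all multipliers are unimodular and |W|^2 / S^2 is periodic.\<close>
  have "zeta a = of_real (pi / A) * cnj a + 4 * of_real pi * gc * a"
   using a(2) by (simp add: Gz_def field_simps)
  then have "zeta a * w - eta w * a = of_real (pi / A) * (cnj a * w - cnj (cnj a * w))"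
   unfolding eta_eq[OF w] by (simp add: algebra_simps)
  then have "Re (zeta a * w - eta w * a) = 0" by simp
  then have m1: "cmod (exp (zeta a * w - eta w * a)) = 1" "cmod (exp (zeta (- a) * w - eta w * - a)) = 1"
   by (simp_all add: zeta_odd)
  have off: "v l (x + w) = v l x" if x: "x \<notin> \<Lambda>" for x
  proof -
   define M where "M = cmod (C * exp (eta w * x))"
   have M: "M > 0" using C(1) by (simp add: M_def)
   have xw: "x + w \<notin> \<Lambda>" using x lattice_add_iff[OF w] by simp
   have "cmod (Y b (x + w)) = M * cmod (Y b x)" if "b = a \<or> b = - a" for b
    using m1 that unfolding C(2) M_def norm_mult by auto
   then have "S a l (x + w) = M\<^sup>2 * S a l x" by (simp add: S_def power_mult_distrib algebra_simps)
   moreover have "cmod (W a (x + w)) = M\<^sup>2 * cmod (W a x)" unfolding C(3) M_def by (simp add: norm_mult norm_power)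
   ultimately have "(cmod (W a (x + w)))\<^sup>2 / (S a l (x + w))\<^sup>2 = (cmod (W a x))\<^sup>2 / (S a l x)\<^sup>2"
    using M by (simp add: power_mult_distrib)
   then have "u l (x + w) = u l x" by (simp only: u_eq[OF x] u_eq[OF xw])
   then show ?thesis using periodic_lattice[OF G_props(1) w, of x] by (simp add: u_def)
  qed
  \<comment> \<open>The formula for \<open>u\<close>, and with it periodicity, is known off the
    lattice only; continuity of \<open>v\<close> extends it.\<close>
  have vic: "isCont (v l) x" for x using vcont[of l] continuous_on_eq_continuous_at[OF open_UNIV] by blast
  have "isCont (%x. v l (x + w)) z" by (rule isCont_o2[OF _ vic]) (intro continuous_intros)
  from isCont_diff[OF this vic] have "((%x. v l (x + w) - v l x) \<longlongrightarrow> v l (z + w) - v l z) (at z)" by (simp add: isCont_def)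
  moreover have "((%x. v l (x + w) - v l x) \<longlongrightarrow> 0) (at z)"
   by (rule tendsto_eventually) (use ev_not_lattice[of z] off in \<open>auto elim!: eventually_mono\<close>)
  ultimately have "v l (z + w) - v l z = 0" by (rule LIM_unique)
  then show "v l (z + w) = v l z" by simp
 qed
 have Gint: "set_integrable lborel P (%z. G z)" using G_props(3) by (simp add: weak_laplacian_def torus_integrable_def)
 have uint: "set_integrable lborel P (u l)" for l unfolding u_def[abs_def]
  by (intro set_integral_diff continuous_set_integrable_P vcont set_integrable_mult_right Gint)
 define q where "q l z = (cmod (W a z))\<^sup>2 / (S a l z)\<^sup>2 / pi" for l z
 have qc: "continuous_on UNIV (q l)" for l unfolding q_def[abs_def] by (intro continuous_intros Wc Sc) (use Sp in \<open>auto simp: less_imp_neq[OF Sp, symmetric]\<close>)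
 have eu: "exp (u l z) = q l z" if z: "z \<notin> \<Lambda>" for l z
 proof -
  have "W a z ~= 0" using k z by (simp add: sigma_zero)
  define y where "y = (cmod (W a z))\<^sup>2 / (S a l z)\<^sup>2"
  have "y > 0" using \<open>W a z ~= 0\<close> Sp[of l z] by (simp add: y_def)
  then show ?thesis unfolding u_eq[OF z] q_def y_def[symmetric] by (simp add: exp_diff)
 qed
 have eI: "set_integrable lborel P (%z. exp (u l z))" for l
  by (rule G_measurable_AE(1)[OF uint borel_measurable_continuous_onI[OF qc] _ qc]) (rule eu)
 have lapv: "laplacian (v l) z = 8 * pi / A - 8 * pi * q l z" for l z
  unfolding Ck2_laplacian_I(2)[OF open_UNIV vW vaW vc UNIV_I] by (simp add: v\<beta>_def q_def Re_divide_of_real flip: of_real_power)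
 have sol: "mean_field_solution \<omega>\<^sub>1 \<omega>\<^sub>2 (8 * pi) (u l)" for l
  unfolding mean_field_solution_def
 proof (intro conjI)
  show "periodic (u l)" using vper[of l] G_props(1) by (simp add: doubly_periodic_def u_def)
  show "Ck_on 2 (u l) (- \<Lambda>)"
  proof (rule Ck2_laplacian_I(1)[OF open_compl_lattice])
   fix z assume z: "z \<in> - \<Lambda>"
   have "has_wirt (%z. of_real (v l z) - of_real (8 * pi) * of_real (G z)) (va l z - of_real (8 * pi) * Gz z) (cnj (va l z) - of_real (8 * pi) * cnj (Gz z)) z"
    by (intro wirt_diff wirt_cmult vW Gz_wirt) (use z in auto)
   then show "has_wirt (%z. of_real (u l z)) (va l z - of_real (8 * pi) * Gz z) (cnj (va l z - of_real (8 * pi) * Gz z)) z"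
    by (simp add: u_def)
   show "has_wirt (%z. va l z - of_real (8 * pi) * Gz z) (v\<alpha> l z - of_real (8 * pi) * (wp z / (4 * of_real pi) + gc)) (v\<beta> l z - of_real (8 * pi) * of_real (1 / (4 * A))) z"
    by (intro wirt_diff wirt_cmult vaW Gz_holo) (use z in auto)
  next
   show "continuous_on (- \<Lambda>) (%z. v\<alpha> l z - of_real (8 * pi) * (wp z / (4 * of_real pi) + gc))"
    "continuous_on (- \<Lambda>) (%z. v\<beta> l z - of_real (8 * pi) * of_real (1 / (4 * A)))"
    by (intro continuous_intros continuous_on_subset[OF vc(1)] continuous_on_subset[OF vc(2)] holomorphic_on_imp_continuous_on[OF wp_holo]; simp)+
  qed
  show "weak_laplacian \<omega>\<^sub>1 \<omega>\<^sub>2 (u l) (8 * pi) 0 (%z. - (8 * pi) * exp (u l z))"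
   unfolding weak_laplacian_def torus_integrable_def torus_integral_def
  proof (intro conjI allI impI)
   show "set_integrable lborel P (u l)" by (rule uint)
   show "set_integrable lborel P (%z. - (8 * pi) * exp (u l z))" by (intro set_integrable_mult_right eI)
   fix \<phi> assume \<phi>: "periodic \<phi> \<and> smooth_fun_on \<phi> UNIV"
   then have \<phi>2: "Ck_on 2 \<phi> UNIV" and \<phi>c: "continuous_on UNIV \<phi>" unfolding smooth_fun_on_def by (blast, metis Ck_on.simps(1))
   note vw = weak_of_classical[OF vW vaW vc vper conjunct1[OF \<phi>] \<phi>2, of l]
   have Gw: "sint P (%z. G z * laplacian \<phi> z) = - 1 * \<phi> 0 + sint P (%z. 1 / A * \<phi> z)"
    using G_props(3) \<phi> unfolding weak_laplacian_def torus_integral_def by blast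
   have lc: "continuous_on UNIV (laplacian \<phi>)"
   proof (rule Ck2_wirt[OF open_UNIV \<phi>2])
    fix p \<mu> \<nu> assume "continuous_on UNIV \<nu>" "!!z. z \<in> UNIV ==> laplacian \<phi> z = 4 * Re (\<nu> z)"
    then show ?thesis using continuous_on_cong[of UNIV UNIV "laplacian \<phi>" "%z. 4 * Re (\<nu> z)"] by (simp add: continuous_intros)
   qed
   have "periodic (laplacian \<phi>)"
   proof (rule periodicI)
    fix z w assume w: "w \<in> \<Lambda>"
    show "laplacian \<phi> (z + w) = laplacian \<phi> z"
    proof (rule Ck2_wirt[OF open_UNIV \<phi>2])
     fix p \<mu> \<nu> assume p: "!!z. z \<in> UNIV ==> has_wirt (%z. of_real (\<phi> z)) (p z) (cnj (p z)) z" "!!z. z \<in> UNIV ==> has_wirt p (\<mu> z) (\<nu> z) z"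
      and l: "!!z. z \<in> UNIV ==> laplacian \<phi> z = 4 * Re (\<nu> z)"
     have \<phi>p: "periodic (%z. complex_of_real (\<phi> z))" using \<phi> by (simp add: doubly_periodic_def)
     have "periodic p" by (rule periodicI, rule wirt_periodic(1)[OF \<phi>p p(1)]) auto
     from wirt_periodic(2)[OF this p(2) w UNIV_I UNIV_I, of z] show ?thesis by (simp add: l)
    qed
   qed
   from continuous_periodic_bounded[OF this lc] obtain K where K: "!!z. \<bar>laplacian \<phi> z\<bar> <= K" by (metis real_norm_def)
   have Gi: "set_integrable lborel P (%z. G z * laplacian \<phi> z)"
    by (rule set_integrable_mult_bounded[OF Gint borel_measurable_continuous_onI[OF lc] K])
   have qi: "set_integrable lborel P (%z. q l z * \<phi> z)" by (intro continuous_set_integrable_P continuous_intros qc \<phi>c)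
   have \<phi>i: "set_integrable lborel P \<phi>" by (rule continuous_set_integrable_P[OF \<phi>c])
   have e2: "sint P (%z. exp (u l z) * \<phi> z) = sint P (%z. q l z * \<phi> z)"
    by (rule G_measurable_AE(2)[OF uint borel_measurable_continuous_onI[OF qc] _ qc \<phi>c]) (rule eu)
   have "sint P (%z. u l z * laplacian \<phi> z) =
    sint P (%z. v l z * laplacian \<phi> z) - 8 * pi * sint P (%z. G z * laplacian \<phi> z)"
    unfolding u_def left_diff_distrib mult.assoc
    by (subst set_integral_diff(2)[OF vw(2)]) (auto intro!: set_integrable_mult_right Gi)
   also have "sint P (%z. v l z * laplacian \<phi> z) = 8 * pi / A * sint P \<phi> - 8 * pi * sint P (%z. q l z * \<phi> z)"
    unfolding vw(1) lapv left_diff_distrib mult.assoc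
    by (subst set_integral_diff(2)) (auto intro!: set_integrable_mult_right qi \<phi>i)
   also have "8 * pi / A * sint P \<phi> - 8 * pi * sint P (%z. q l z * \<phi> z) - 8 * pi * sint P (%z. G z * laplacian \<phi> z) =
    8 * pi * \<phi> 0 - 8 * pi * sint P (%z. q l z * \<phi> z)"
    unfolding Gw set_integral_mult_right by (simp add: algebra_simps)
   also have "\<dots> = 8 * pi * \<phi> 0 + sint P (%z. - (8 * pi) * exp (u l z) * \<phi> z)"
    unfolding mult.assoc[of "- (8 * pi)"] set_integral_mult_right e2 by simp
   finally show "sint P (%z. u l z * laplacian \<phi> z) = 8 * pi * \<phi> 0 + sint P (%z. - (8 * pi) * exp (u l z) * \<phi> z)" .
  qed
 qed
 show thesis by (rule that[of u]) (rule sol, rule u_eq)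
qed

lemma scaling_families:
 assumes "extra_critical_point \<omega>\<^sub>1 \<omega>\<^sub>2 (%z. G z) a"
 shows "\<exists>u. scaling_family \<omega>\<^sub>1 \<omega>\<^sub>2 (8 * pi) (developing_map \<omega>\<^sub>1 \<omega>\<^sub>2 a) u \<and>
  scaling_family \<omega>\<^sub>1 \<omega>\<^sub>2 (8 * pi) (developing_map \<omega>\<^sub>1 \<omega>\<^sub>2 (- a)) (%l. u (- l))"
proof -
 have a: "2 * a \<notin> \<Lambda>" "Gz a = 0" using assms by (auto simp: extra_iff)
 have a': "2 * - a \<notin> \<Lambda>" using a lattice_minus_iff[of "2 * a"] by simp
 obtain u where u: "!!l. mean_field_solution \<omega>\<^sub>1 \<omega>\<^sub>2 (8 * pi) (u l)"
  "!!l z. z \<notin> \<Lambda> ==> u l z = - ln pi + ln ((cmod (W a z))\<^sup>2 / (S a l z)\<^sup>2)"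
  by (rule solution_of_critical_point[OF a]) (rule that)
 have "scaling_family \<omega>\<^sub>1 \<omega>\<^sub>2 (8 * pi) (developing_map \<omega>\<^sub>1 \<omega>\<^sub>2 a) u" by (rule scaling_familyI[OF a(1) u])
 moreover have Sm: "S (- a) l z = S a (- l) z" for l z using S_minus[of a "- l" z] by simp
 have "scaling_family \<omega>\<^sub>1 \<omega>\<^sub>2 (8 * pi) (developing_map \<omega>\<^sub>1 \<omega>\<^sub>2 (- a)) (%l. u (- l))"
  by (rule scaling_familyI[OF a' u(1)]) (simp add: u(2) W_minus Sm)
 ultimately show ?thesis by blast
qed

end

section \<open>Solutions near the origin\<close>

text \<open>Jensen's inequality for a subprobability, via the tangent line of \<open>exp\<close>.\<close>

lemma exp_integral_le:
 fixes w l g :: "complex => real"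
 assumes w: "integrable lborel w" "!!z. 0 <= w z" "(LINT z|lborel. w z) <= 1"
  and wl: "integrable lborel (%z. w z * l z)" and g: "integrable lborel g" "!!z. 0 <= g z"
  and le: "AE z in lborel. w z * exp (l z) <= g z"
 shows "exp (LINT z|lborel. w z * l z) <= exp 1 + (LINT z|lborel. g z)"
proof -
 define x where "x = (LINT z|lborel. w z * l z)"
 define m where "m = (LINT z|lborel. w z)"
 have g0: "0 <= (LINT z|lborel. g z)" using g(2) by simp
 have "exp x <= exp 1 + (LINT z|lborel. g z)"
 proof (cases "x <= 1")
  case True
  then have "exp x <= exp 1" by simp
  with g0 show ?thesis by linarith
 next
  case False
  have i: "integrable lborel (%z. exp x * (1 - x) * w z)" "integrable lborel (%z. exp x * (w z * l z))"
   by (intro integrable_mult_right w wl)+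
  have "(LINT z|lborel. exp x * (1 - x) * w z + exp x * (w z * l z)) <= (LINT z|lborel. g z)"
  proof (rule integral_mono_AE[OF Bochner_Integration.integrable_add[OF i] g(1)])
   show "AE z in lborel. exp x * (1 - x) * w z + exp x * (w z * l z) <= g z"
    using le
   proof eventually_elim
    case (elim z)
    have "exp x * (1 + (l z - x)) <= exp x * exp (l z - x)" by (intro mult_left_mono exp_ge_add_one_self) simp
    also have "\<dots> = exp (l z)" by (simp flip: exp_add)
    finally have "w z * (exp x * (1 + (l z - x))) <= w z * exp (l z)" using w(2) by (rule mult_left_mono)
    then show ?case using elim by (simp add: algebra_simps)
   qed
  qed
  also have "(LINT z|lborel. exp x * (1 - x) * w z + exp x * (w z * l z)) = exp x * (1 - x) * m + exp x * x"
   by (subst Bochner_Integration.integral_add[OF i]) (simp add: m_def x_def)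
  finally have 1: "exp x * (1 - x) * m + exp x * x <= (LINT z|lborel. g z)" .
  have "0 <= exp x * ((1 - m) * (x - 1))" using False w(3) by (intro mult_nonneg_nonneg) (auto simp: m_def)
  then have "exp x <= exp x * (1 - x) * m + exp x * x" by (simp add: algebra_simps)
  with 1 have "exp x <= (LINT z|lborel. g z)" by linarith
  then show ?thesis using exp_ge_zero[of "1::real"] by linarith
 qed
 then show ?thesis by (simp add: x_def)
qed

text \<open>The bound on exp l is for Jensen's inequality, the one on l^2 for the inequality between
  a product and the sum of squares. Both are uniform in \<delta> and integrable in z.\<close>

lemma log_kernel_bounds:
 fixes \<rho> :: real
 assumes z: "z \<in> cball a s" and s: "s <= 1 / 2" and \<delta>: "0 < \<delta>" "\<delta> <= 1 / 2"
 defines "l \<equiv> - (1 / 2) * ln ((cmod (z - a))\<^sup>2 + \<delta>\<^sup>2) * bump ((cmod (z - a))\<^sup>2 / \<rho>)"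
 shows "0 <= l" "z ~= a ==> exp l <= 1 / cmod (z - a)" "z ~= a ==> l\<^sup>2 <= 4 / cmod (z - a)"
proof -
 define x where "x = cmod (z - a)"
 have x: "0 <= x" "x <= 1 / 2" using z s by (auto simp: x_def dist_norm norm_minus_commute)
 have "x\<^sup>2 <= (1 / 2)\<^sup>2" "\<delta>\<^sup>2 <= (1 / 2)\<^sup>2" using x \<delta> by (intro power_mono; simp)+
 then have le1: "x\<^sup>2 + \<delta>\<^sup>2 <= 1" by (simp add: power2_eq_square)
 have pos: "x\<^sup>2 + \<delta>\<^sup>2 > 0" using \<delta> by (simp add: add_nonneg_pos)
 define L where "L = - (1 / 2) * ln (x\<^sup>2 + \<delta>\<^sup>2)"
 have L0: "0 <= L" using le1 pos by (simp add: L_def)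
 have l: "l = L * bump (x\<^sup>2 / \<rho>)" by (simp add: l_def L_def x_def)
 show l0: "0 <= l" unfolding l using L0 bump_bounds by simp
 have lL: "l <= L" unfolding l using mult_left_mono[OF bump_bounds(2) L0] by simp
 assume "z ~= a"
 then have x0: "x > 0" by (simp add: x_def)
 have "ln (x\<^sup>2) <= ln (x\<^sup>2 + \<delta>\<^sup>2)" by (subst ln_le_cancel_iff) (use x0 pos in auto)
 then have "L <= - ln x" using x0 by (simp add: L_def ln_realpow)
 then have lx: "l <= - ln x" using lL by simp
 then have "exp l <= exp (- ln x)" by simp
 also have "\<dots> = 1 / x" using x0 by (simp add: exp_minus divide_inverse)
 finally show "exp l <= 1 / cmod (z - a)" by (simp add: x_def)
 have "- ln x = 2 * ln (1 / sqrt x)" using x0 by (simp add: ln_div ln_sqrt)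
 also have "\<dots> <= 2 * (1 / sqrt x)" using ln_le_minus_one[of "1 / sqrt x"] x0 by simp
 finally have "l <= 2 / sqrt x" using lx by simp
 then have "l\<^sup>2 <= (2 / sqrt x)\<^sup>2" using l0 by (intro power_mono)
 then show "l\<^sup>2 <= 4 / cmod (z - a)" using x0 by (simp add: power_divide x_def)
qed

locale mean_field = torus_green +
 fixes u :: "complex => real"
 assumes sol: "mean_field_solution \<omega>\<^sub>1 \<omega>\<^sub>2 (8 * pi) u"
begin

lemma u_props: "periodic u" "Ck_on 2 u (- \<Lambda>)" "weak_laplacian \<omega>\<^sub>1 \<omega>\<^sub>2 u (8 * pi) 0 (%z. - (8 * pi) * exp (u z))"
 "periodic (%z. - (8 * pi) * exp (u z))" "set_integrable lborel P (%z. exp (u z))" "periodic (%z. exp (u z))"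
 "z \<notin> \<Lambda> ==> isCont u z"
proof -
 show 1: "periodic u" "Ck_on 2 u (- \<Lambda>)" "weak_laplacian \<omega>\<^sub>1 \<omega>\<^sub>2 u (8 * pi) 0 (%z. - (8 * pi) * exp (u z))"
  using sol by (auto simp: mean_field_solution_def)
 show "periodic (%z. - (8 * pi) * exp (u z))" "periodic (%z. exp (u z))" using 1(1) by (auto simp: doubly_periodic_def)
 have "set_integrable lborel P (%z. - (8 * pi) * exp (u z))" using 1(3) by (simp add: weak_laplacian_def torus_integrable_def)
 from set_integrable_mult_right[OF this, of "- 1 / (8 * pi)"] show "set_integrable lborel P (%z. exp (u z))" by simp
 show "z \<notin> \<Lambda> ==> isCont u z"
  using 1(2) unfolding Ck_2_iff by (auto intro: differentiable_imp_continuous_within)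
qed

lemma e_ball: "r <= rmin / 3 ==> set_integrable lborel (cball c r) (%z. exp (u z))"
 by (rule ball_integral_le(1)[OF u_props(6,5)])

text \<open>The mass of exp u over shrinking discs tends to 0. At mass 1/8 the function 8 exp u is a
  subprobability density; the factor 8 is what remains of 8 pi when the potential is divided by
  pi.\<close>

lemma small_mass:
 obtains R where "0 < R" "R <= 1" "R <= rmin / 6" "8 * sint (cball 0 R) (%z. exp (u z)) <= 1"
proof -
 define R0 where "R0 = min 1 (rmin / 6)"
 have R0: "0 < R0" "R0 <= 1" "R0 <= rmin / 6" using rmin_pos by (auto simp: R0_def)
 define r where "r n = R0 * inverse (real (Suc n))" for n
 have r: "0 < r n" "r n <= R0" for n using R0 by (auto simp: r_def mult_le_cancel_left1 inverse_le_1_iff)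
 have r0: "r \<longlonglongrightarrow> 0" unfolding r_def[abs_def] by (intro tendsto_mult_right_zero LIMSEQ_inverse_real_of_nat)
 define s where "s n z = indicator (cball 0 (r n)) z *\<^sub>R exp (u z)" for n z
 have si: "integrable lborel (s n)" for n
  using e_ball[of "r n" 0] r(2)[of n] R0 unfolding set_integrable_def s_def[abs_def] by simp
 have wi: "integrable lborel (%z. indicator (cball 0 R0) z *\<^sub>R exp (u z))"
  using e_ball[of R0 0] R0 unfolding set_integrable_def by simp
 have "(%n. integral\<^sup>L lborel (s n)) \<longlonglongrightarrow> integral\<^sup>L lborel (%z :: complex. 0 :: real)"
 proof (rule integral_dominated_convergence[OF _ _ wi])
  show "AE z in lborel. (%n. s n z) \<longlonglongrightarrow> 0" using AE_lborel_singleton[of 0]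
  proof eventually_elim
   case (elim z)
   have "\<forall>\<^sub>F n in sequentially. r n < cmod z" using order_tendstoD(2)[OF r0, of "cmod z"] elim by simp
   then show ?case by (intro tendsto_eventually) (auto simp: s_def elim!: eventually_mono)
  qed
  show "AE z in lborel. norm (s n z) <= indicator (cball 0 R0) z *\<^sub>R exp (u z)" for n
   using r(2)[of n] by (auto simp: s_def indicator_def)
 qed (use si borel_measurable_integrable in auto)
 from order_tendstoD(2)[OF this, of "1 / 8"] have "\<exists>n. integral\<^sup>L lborel (s n) < 1 / 8"
  by (auto simp: eventually_sequentially)
 then obtain n where "integral\<^sup>L lborel (s n) < 1 / 8" by blast
 then show thesis using r[of n] R0 by (intro that[of "r n"]) (auto simp: set_lebesgue_integral_def s_def[abs_def])
qed

text \<open>Two passes through \<open>weak_bounds\<close>. At radius R/2 Jensen's inequality bounds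
  exp (2 u) by a multiple of 1 + J, where J is the convolution of exp u with 1/|z|. By Fubini J is
  integrable, so exp u is square integrable near 0. At radius R/4 exp u times the logarithmic kernel
  is at most half the sum of their squares, so the potential is bounded.\<close>

lemma near_zero_bound:
 obtains r C where "0 < r" "r <= rmin / 6" "!!z. z \<in> ball 0 r - {0} ==> \<bar>u z - 4 * ln (cmod z)\<bar> <= C"
proof -
 define h where "h z = - (8 * pi) * exp (u z)" for z
 note wk = u_props(3)[folded h_def] and hper = u_props(4)[folded h_def]
 obtain R where R: "0 < R" "R <= 1" "R <= rmin / 6" "8 * sint (cball 0 R) (%z. exp (u z)) <= 1"
  by (rule small_mass) (rule that)
 define E0 where "E0 z = indicator (cball 0 R) z *\<^sub>R exp (u z)" for z
 have E0i: "integrable lborel E0" using e_ball[of R 0] R unfolding set_integrable_def E0_def[abs_def] by simp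
 have E0m [measurable]: "E0 \<in> borel_measurable borel" using borel_measurable_integrable[OF E0i] by simp
 have E0n: "0 <= E0 z" for z by (simp add: E0_def)
 have E0_1: "8 * (LINT z|lborel. E0 z) <= 1" using R(4) by (simp add: set_lebesgue_integral_def E0_def)
 define l where "l \<rho> a \<delta> z = - (1 / 2) * ln ((cmod (z - a))\<^sup>2 + \<delta>\<^sup>2) * bump ((cmod (z - a))\<^sup>2 / \<rho>)" for \<rho> a \<delta> z
 have pot: "potential h (s\<^sup>2) a \<delta> = - (8 * pi) * (LINT z|lborel. (indicator (cball a s) z *\<^sub>R exp (u z)) * l (s\<^sup>2) a \<delta> z)"
  if "0 < s" for s a \<delta>
 proof -
  have "sqrt (s\<^sup>2) = s" using that by simp
  moreover have "indicator B z *\<^sub>R (- (8 * pi) * exp (u z) * L) = - (8 * pi) * ((indicator B z *\<^sub>R exp (u z)) * L)" for B and z :: complex and L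
   by simp
  ultimately show ?thesis unfolding potential_def h_def set_lebesgue_integral_def l_def
   by (simp only: integral_mult_right_zero)
 qed
 have eli: "integrable lborel (%z. (indicator (cball a s) z *\<^sub>R exp (u z)) * l (s\<^sup>2) a \<delta> z)" if "0 < s" "s <= rmin / 3" "0 < \<delta>" for s a \<delta>
  using potential_integrable[OF that(3) e_ball[OF that(2)], of a "s\<^sup>2"] unfolding set_integrable_def l_def by (simp add: mult.assoc)
 have sub: "indicator (cball a s) z *\<^sub>R exp (u z) <= indicator (cball 0 (2 * s)) z *\<^sub>R exp (u z)" if "cmod a <= s" for a s z
 proof -
  have "cmod z <= cmod a + cmod (a - z)" by (metis diff_add_cancel norm_triangle_ineq3 norm_triangle_sub add.commute norm_minus_commute)
  then show ?thesis using that by (auto simp: indicator_def dist_norm)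
 qed
 have \<rho>: "0 < s\<^sup>2" "s\<^sup>2 <= 1 / 2" "sqrt (s\<^sup>2) < rmin / 3" if "0 < s" "s <= R / 2" for s
 proof -
  have "s\<^sup>2 <= (1 / 2)\<^sup>2" using that R by (intro power_mono) auto
  then show "s\<^sup>2 <= 1 / 2" by (simp add: power2_eq_square)
 qed (use that R rmin_pos in auto)
 define s1 where "s1 = R / 2"
 have s1: "0 < s1" "s1 <= R / 2" "s1 <= 1 / 2" using R by (auto simp: s1_def)
 obtain C1 where C1: "!!a U. a ~= 0 ==> cmod a <= rmin / 6 ==> isCont u a ==>
  ((\<forall>\<delta>. 0 < \<delta> \<and> \<delta> <= 1 / 2 --> potential h (s1\<^sup>2) a \<delta> <= U) --> 8 * pi * ln (cmod a) - U - C1 <= 2 * pi * u a) \<and>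
  ((\<forall>\<delta>. 0 < \<delta> \<and> \<delta> <= 1 / 2 --> U <= potential h (s1\<^sup>2) a \<delta>) --> 2 * pi * u a <= 8 * pi * ln (cmod a) - U + C1)"
  using weak_bounds[OF wk u_props(1) hper \<rho>[OF s1(1,2)]] by blast
 have nL: "a \<notin> \<Lambda>" if "a ~= 0" "cmod a <= R / 2" for a
  using lattice_norm_ge[of a] that R rmin_pos by auto
 define J where "J a = (\<integral>\<^sup>+z. ennreal (E0 z / cmod (z - a)) \<partial>lborel)" for a
 define K1 where "K1 = 8 * exp (C1 / pi)"
 have K1: "K1 > 0" by (simp add: K1_def)
 have claim1: "ennreal (exp (2 * u a)) <= ennreal K1 * (1 + J a)" if a: "a ~= 0" "cmod a <= R / 2" for a
 proof (cases "J a = \<infinity>")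
  case True
  then show ?thesis using K1 by (simp add: ennreal_mult_top)
 next
  case False
  have [measurable]: "(%z. cmod (z - a)) \<in> borel_measurable borel" by (intro borel_measurable_continuous_onI continuous_intros)
  have g1: "integrable lborel (%z. E0 z / cmod (z - a))"
   by (rule integrableI_nonneg) (use False E0n in \<open>auto simp: J_def top.not_eq_extremum\<close>)
  define j where "j = (LINT z|lborel. E0 z / cmod (z - a))"
  have Jj: "J a = ennreal j" unfolding J_def j_def by (rule nn_integral_eq_integral[OF g1]) (use E0n in auto)
  have j0: "0 <= j" unfolding j_def using E0n by simp
  \<comment> \<open>Chosen so that exp X is the bound delivered by Jensen's inequality.\<close>
  define X where "X = ln (exp 1 + 8 * j)"
  have eX: "exp X = exp 1 + 8 * j" using j0 by (simp add: X_def add_pos_nonneg)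
  have "- (pi * X) <= potential h (s1\<^sup>2) a \<delta>" if \<delta>: "0 < \<delta>" "\<delta> <= 1 / 2" for \<delta>
  proof -
   define w where "w z = 8 * (indicator (cball a s1) z *\<^sub>R exp (u z))" for z
   have wl: "w z * l (s1\<^sup>2) a \<delta> z = 8 * ((indicator (cball a s1) z *\<^sub>R exp (u z)) * l (s1\<^sup>2) a \<delta> z)" for z by (simp add: w_def)
   have wE: "w z <= 8 * E0 z" for z using sub[of a s1 z] a by (simp add: w_def E0_def s1_def)
   have wi: "integrable lborel w" unfolding w_def[abs_def]
    using e_ball[of s1 a] R s1 rmin_pos unfolding set_integrable_def by (intro integrable_mult_right) auto
   have "exp (LINT z|lborel. w z * l (s1\<^sup>2) a \<delta> z) <= exp 1 + (LINT z|lborel. 8 * (E0 z / cmod (z - a)))"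
   proof (rule exp_integral_le[OF wi])
    show "0 <= w z" for z by (simp add: w_def)
    have "(LINT z|lborel. w z) <= (LINT z|lborel. 8 * E0 z)" by (rule integral_mono[OF wi]) (use E0i wE in auto)
    then show "(LINT z|lborel. w z) <= 1" using E0_1 by simp
    show "integrable lborel (%z. w z * l (s1\<^sup>2) a \<delta> z)" unfolding wl
     using eli[of s1 \<delta> a] s1 R \<delta> rmin_pos by (intro integrable_mult_right) auto
    show "integrable lborel (%z. 8 * (E0 z / cmod (z - a)))" by (intro integrable_mult_right g1)
    show "0 <= 8 * (E0 z / cmod (z - a))" for z using E0n by simp
    show "AE z in lborel. w z * exp (l (s1\<^sup>2) a \<delta> z) <= 8 * (E0 z / cmod (z - a))"
     using AE_lborel_singleton[of a]
    proof eventually_elim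
     case (elim z)
     show ?case
     proof (cases "z \<in> cball a s1")
      case True
      have "w z * exp (l (s1\<^sup>2) a \<delta> z) <= (8 * E0 z) * (1 / cmod (z - a))"
       using log_kernel_bounds(2)[OF True s1(3) \<delta> elim] wE E0n by (intro mult_mono) (auto simp: l_def)
      then show ?thesis by simp
     next
      case False
      then show ?thesis using E0n by (simp add: w_def)
     qed
    qed
   qed
   also have "\<dots> = exp X" by (simp only: eX j_def integral_mult_right_zero)
   finally have "8 * (LINT z|lborel. (indicator (cball a s1) z *\<^sub>R exp (u z)) * l (s1\<^sup>2) a \<delta> z) <= X"
    unfolding wl exp_le_cancel_iff by simp
   from mult_left_mono[OF this, of pi] show ?thesis unfolding pot[OF s1(1)] by simp
  qed
  then have "2 * pi * u a <= 8 * pi * ln (cmod a) - - (pi * X) + C1"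
   using C1[of a "- (pi * X)"] a R u_props(7)[OF nL[OF a]] rmin_pos by auto
  \<comment> \<open>The term 8 pi ln |a| is not positive and may be dropped from an upper
    bound.\<close>
  moreover have "ln (cmod a) <= 0" using a R by (simp add: ln_le_zero_iff)
  then have "8 * pi * ln (cmod a) <= 0" by (simp add: mult_nonneg_nonpos)
  ultimately have "2 * pi * u a <= pi * X + C1" by linarith
  then have "2 * u a <= X + C1 / pi" by (simp add: field_simps)
  then have "exp (2 * u a) <= exp (X + C1 / pi)" by simp
  also have "\<dots> = (exp 1 + 8 * j) * exp (C1 / pi)" by (simp add: exp_add eX)
  also have "\<dots> <= (8 + 8 * j) * exp (C1 / pi)" using exp_le by (intro mult_right_mono) auto
  also have "\<dots> = K1 * (1 + j)" by (simp add: K1_def algebra_simps)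
  finally show ?thesis unfolding Jj using K1 j0
   by (simp add: ennreal_mult[symmetric] ennreal_plus[symmetric] flip: ennreal_1 del: ennreal_plus ennreal_1)
 qed
 define B where "B = cball (0::complex) (R / 2)"
 have [measurable]: "B \<in> sets borel" by (simp add: B_def)
 define k where "k z a = ennreal (E0 z) * (indicator B a * ennreal (1 / cmod (z - a)))" for z a
 have cm2 [measurable]: "(%p :: complex \<times> complex. cmod (fst p - snd p)) \<in> borel_measurable (lborel \<Otimes>\<^sub>M lborel)"
  by measurable
 have km: "(%(z, a). k z a) \<in> borel_measurable (lborel \<Otimes>\<^sub>M lborel)"
  unfolding k_def case_prod_beta by measurable
 have Jk: "indicator B a * J a = (\<integral>\<^sup>+z. k z a \<partial>lborel)" for a
 proof -
  have [measurable]: "(%z. cmod (z - a)) \<in> borel_measurable borel" by (intro borel_measurable_continuous_onI continuous_intros)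
  have "k z a = indicator B a * ennreal (E0 z / cmod (z - a))" for z
   unfolding k_def using E0n by (simp add: divide_inverse ennreal_mult mult_ac)
  then show ?thesis unfolding J_def by (simp add: nn_integral_cmult)
 qed
 \<comment> \<open>For |z| <= R the whole disc \<open>B\<close> lies within distance 2 R of z, and
   1/|z - a| has integral 2 pi (2 R) over that larger disc.\<close>
 have inner: "(\<integral>\<^sup>+a. k z a \<partial>lborel) <= ennreal (E0 z) * ennreal (4 * pi * R)" for z
 proof (cases "z \<in> cball 0 R")
  case True
  have [measurable]: "(%a. cmod (z - a)) \<in> borel_measurable borel" by (intro borel_measurable_continuous_onI continuous_intros)
  have "(\<integral>\<^sup>+a. indicator B a * ennreal (1 / cmod (z - a)) \<partial>lborel) <= (\<integral>\<^sup>+a. ennreal (indicator (cball z (2 * R)) a *\<^sub>R (1 / cmod (a - z))) \<partial>lborel)"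
  proof (intro nn_integral_mono)
   fix a
   have "cmod (z - a) <= 2 * R" if "a \<in> B" using that True R norm_triangle_ineq4[of z a] by (simp add: B_def)
   then show "indicator B a * ennreal (1 / cmod (z - a)) <= ennreal (indicator (cball z (2 * R)) a *\<^sub>R (1 / cmod (a - z)))"
    by (auto simp: indicator_def dist_norm norm_minus_commute)
  qed
  also have "\<dots> = ennreal (sint (cball z (2 * R)) (%a. 1 / cmod (a - z)))"
   unfolding set_lebesgue_integral_def
   by (rule nn_integral_eq_integral) (use integral_inv_dist(1)[of "2 * R" z] R in \<open>auto simp: set_integrable_def\<close>)
  also have "\<dots> = ennreal (4 * pi * R)" using integral_inv_dist(2)[of "2 * R" z] R by simp
  finally show ?thesis unfolding k_def by (subst nn_integral_cmult) (auto intro!: mult_left_mono)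
 next
  case False
  then show ?thesis by (simp add: k_def E0_def)
 qed
 have "(\<integral>\<^sup>+a. indicator B a * J a \<partial>lborel) = (\<integral>\<^sup>+z. \<integral>\<^sup>+a. k z a \<partial>lborel \<partial>lborel)"
  unfolding Jk by (rule lborel_pair.Fubini'[OF km])
 also have "\<dots> <= (\<integral>\<^sup>+z. ennreal (E0 z) * ennreal (4 * pi * R) \<partial>lborel)" by (intro nn_integral_mono inner)
 also have "\<dots> = ennreal (LINT z|lborel. E0 z) * ennreal (4 * pi * R)"
  by (subst nn_integral_multc) (use nn_integral_eq_integral[OF E0i] E0n in auto)
 also have "\<dots> < \<infinity>" by (simp add: ennreal_mult_less_top)
 finally have JB: "(\<integral>\<^sup>+a. indicator B a * J a \<partial>lborel) < \<infinity>" .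
 have Bfin: "emeasure lborel B < \<infinity>" unfolding B_def by (rule emeasure_lborel_cball_finite)
 define E2 where "E2 z = indicator B z *\<^sub>R (E0 z)\<^sup>2" for z
 have E2m: "E2 \<in> borel_measurable lborel" unfolding E2_def[abs_def] by simp
 have E2': "E2 z = exp (2 * u z)" if "z \<in> B" for z
  using that R by (auto simp: E2_def E0_def B_def power2_eq_square simp flip: exp_add)
 have "(\<integral>\<^sup>+a. ennreal (E2 a) \<partial>lborel) <= (\<integral>\<^sup>+a. ennreal K1 * (indicator B a + indicator B a * J a) \<partial>lborel)"
 proof (rule nn_integral_mono_AE)
  show "AE a in lborel. ennreal (E2 a) <= ennreal K1 * (indicator B a + indicator B a * J a)"
   using AE_lborel_singleton[of 0]
  proof eventually_elim
   case (elim a)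
   show ?case
   proof (cases "a \<in> B")
    case True
    then show ?thesis using claim1[of a] elim E2'[of a] by (simp add: B_def)
   next
    case False
    then show ?thesis by (simp add: E2_def)
   qed
  qed
 qed
 also have "\<dots> = ennreal K1 * (emeasure lborel B + (\<integral>\<^sup>+a. indicator B a * J a \<partial>lborel))"
 proof -
  have Jm: "(%a. indicator B a * J a) \<in> borel_measurable lborel"
   unfolding Jk using lborel.borel_measurable_nn_integral[of "%a z. k z a" lborel] measurable_pair_swap[OF km]
   by (simp add: case_prod_unfold)
  then show ?thesis by (subst nn_integral_cmult) (auto simp: nn_integral_add)
 qed
 also have "\<dots> < \<infinity>" using JB Bfin by (simp add: ennreal_mult_less_top)
 finally have E2i: "integrable lborel E2" by (intro integrableI_nonneg E2m) (auto simp: E2_def)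
 define s2 where "s2 = R / 4"
 have s2: "0 < s2" "s2 <= R / 2" "s2 <= 1 / 2" using R by (auto simp: s2_def)
 obtain C2 where C2: "!!a U. a ~= 0 ==> cmod a <= rmin / 6 ==> isCont u a ==>
  ((\<forall>\<delta>. 0 < \<delta> \<and> \<delta> <= 1 / 2 --> potential h (s2\<^sup>2) a \<delta> <= U) --> 8 * pi * ln (cmod a) - U - C2 <= 2 * pi * u a) \<and>
  ((\<forall>\<delta>. 0 < \<delta> \<and> \<delta> <= 1 / 2 --> U <= potential h (s2\<^sup>2) a \<delta>) --> 2 * pi * u a <= 8 * pi * ln (cmod a) - U + C2)"
  using weak_bounds[OF wk u_props(1) hper \<rho>[OF s2(1,2)]] by blast
 \<comment> \<open>Half the integral of exp (2 u), and half of that of 4/|z - a|, which dominates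
   the squared kernel.\<close>
 define V where "V = 8 * pi * (1 / 2 * (LINT z|lborel. E2 z) + 2 * (2 * pi * s2))"
 have V0: "0 <= V" unfolding V_def using s2 by (intro mult_nonneg_nonneg add_nonneg_nonneg) (auto simp: E2_def)
 have bound: "\<bar>u a - 4 * ln (cmod a)\<bar> <= (V + \<bar>C2\<bar>) / (2 * pi)" if a: "a \<in> ball 0 s2 - {0}" for a
 proof -
  have a': "a ~= 0" "cmod a <= s2" "cmod a <= rmin / 6" "cmod a <= R / 2" using a R rmin_pos by (auto simp: s2_def)
  have "potential h (s2\<^sup>2) a \<delta> <= 0 \<and> - V <= potential h (s2\<^sup>2) a \<delta>" if \<delta>: "0 < \<delta>" "\<delta> <= 1 / 2" for \<delta>
  proof -
   define I where "I = (LINT z|lborel. (indicator (cball a s2) z *\<^sub>R exp (u z)) * l (s2\<^sup>2) a \<delta> z)"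
   have l0: "0 <= l (s2\<^sup>2) a \<delta> z" if "z \<in> cball a s2" for z
    unfolding l_def by (rule log_kernel_bounds(1)[OF that s2(3) \<delta>])
   have nn: "0 <= (indicator (cball a s2) z *\<^sub>R exp (u z)) * l (s2\<^sup>2) a \<delta> z" for z
    by (cases "z \<in> cball a s2") (auto intro!: mult_nonneg_nonneg l0)
   then have I0: "0 <= I" unfolding I_def by simp
   define D where "D z = indicator (cball a s2) z *\<^sub>R (1 / cmod (z - a))" for z
   have Di: "integrable lborel D" "(LINT z|lborel. D z) = 2 * pi * s2"
    using integral_inv_dist[of s2 a] s2 unfolding set_integrable_def set_lebesgue_integral_def D_def[abs_def] by auto
   have "I <= (LINT z|lborel. 1 / 2 * E2 z + 2 * D z)" unfolding I_def
   proof (rule integral_mono_AE)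
    show "integrable lborel (%z. (indicator (cball a s2) z *\<^sub>R exp (u z)) * l (s2\<^sup>2) a \<delta> z)"
     using eli[of s2 \<delta> a] s2 R \<delta> rmin_pos by auto
    show "integrable lborel (%z. 1 / 2 * E2 z + 2 * D z)" using E2i Di(1) by auto
    show "AE z in lborel. (indicator (cball a s2) z *\<^sub>R exp (u z)) * l (s2\<^sup>2) a \<delta> z <= 1 / 2 * E2 z + 2 * D z"
     using AE_lborel_singleton[of a]
    proof eventually_elim
     case (elim z)
     show ?case
     proof (cases "z \<in> cball a s2")
      case True
      have "cmod z <= R / 2" using True a' norm_triangle_sub[of z a] by (simp add: s2_def dist_norm norm_minus_commute)
      then have zB: "z \<in> B" by (simp add: B_def)
      have "0 <= (exp (u z) - l (s2\<^sup>2) a \<delta> z)\<^sup>2" by simp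
      then have "exp (u z) * l (s2\<^sup>2) a \<delta> z <= 1 / 2 * (exp (u z))\<^sup>2 + 1 / 2 * (l (s2\<^sup>2) a \<delta> z)\<^sup>2"
       by (simp add: power2_diff)
      also have "(exp (u z))\<^sup>2 = E2 z" using E2'[OF zB] by (simp add: power2_eq_square flip: exp_add)
      also have "(l (s2\<^sup>2) a \<delta> z)\<^sup>2 <= 4 * D z"
       using log_kernel_bounds(3)[OF True s2(3) \<delta> elim] True by (simp add: l_def D_def)
      finally show ?thesis using True by simp
     next
      case False
      then show ?thesis by (simp add: E2_def D_def)
     qed
    qed
   qed
   also have "\<dots> = 1 / 2 * (LINT z|lborel. E2 z) + 2 * (2 * pi * s2)"
    using E2i Di by (subst Bochner_Integration.integral_add) auto
   finally have "8 * pi * I <= V" unfolding V_def by (intro mult_left_mono) auto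
   then show ?thesis unfolding pot[OF s2(1)] I_def[symmetric] using I0 by simp
  qed
  with C2[OF a'(1,3) u_props(7)[OF nL[OF a'(1,4)]], of 0] C2[OF a'(1,3) u_props(7)[OF nL[OF a'(1,4)]], of "- V"]
  have "8 * pi * ln (cmod a) - C2 <= 2 * pi * u a" "2 * pi * u a <= 8 * pi * ln (cmod a) + V + C2" by auto
  then have "\<bar>2 * pi * (u a - 4 * ln (cmod a))\<bar> <= V + \<bar>C2\<bar>" using V0 by (auto simp: algebra_simps abs_le_iff)
  then have "2 * pi * \<bar>u a - 4 * ln (cmod a)\<bar> <= V + \<bar>C2\<bar>" by (simp add: abs_mult)
  then show ?thesis by (simp add: field_simps)
 qed
 show thesis by (rule that[OF s2(1) _ bound]) (use R rmin_pos in \<open>auto simp: s2_def\<close>)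
qed

end

section \<open>The Schwarzian of a solution\<close>

text \<open>The range t <= 1/4 is the disc of half the radius, where the cut-off has to stay away
  from 0.\<close>

lemma bump_lower: assumes "0 <= t" "t <= 1 / 4" shows "exp (- 1) <= bump t"
proof -
 have "t\<^sup>2 <= (1 / 4)\<^sup>2" using assms by (intro power_mono)
 then have t: "1 - t\<^sup>2 \<ge> 1 / 2" by (simp add: power2_eq_square)
 then have "1 / (1 - t\<^sup>2) <= 1 / (1 / 2)" by (intro divide_left_mono) auto
 then have "exp (- 1) <= exp (1 + - (1 / (1 - t\<^sup>2)))" by simp
 also have "\<dots> = bump t" using t unfolding exp_add bump_def flat_chain_def flat_def by simp
 finally show ?thesis .
qed

text \<open>\<open>bump\<close> falls from 1 at 0 to 0 at 1, so its derivative is -1 somewhere; it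
  is never positive for t >= 0.\<close>

lemma integral_bump1_neg: "0 < (LINT z|lborel. - bump1 ((cmod z)\<^sup>2))"
proof -
 obtain t where t: "0 < t" "t < 1" "bump 1 - bump 0 = (1 - 0) * bump1 t"
  using MVT2[of 0 1 bump bump1] bump_deriv by auto
 have c: "continuous_on UNIV (%z::complex. - bump1 ((cmod z)\<^sup>2))"
  by (intro continuous_intros continuous_on_compose2[OF DERIV_continuous_on[of UNIV bump1]])
   (use bump1_deriv has_field_derivative_at_within in auto)
 have z: "- bump1 ((cmod z)\<^sup>2) = 0" if "z \<notin> cball 0 1" for z :: complex
  using that bump_zero(2)[of "(cmod z)\<^sup>2"] by (simp add: abs_square_less_1 one_le_power)
 show ?thesis
 proof (rule integral_pos_continuous[OF c])
  show "integrable lborel (%z::complex. - bump1 ((cmod z)\<^sup>2))"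
   by (rule integrable_compact_support[of 0 1]) (use c z continuous_on_subset in blast)+
  show "0 < - bump1 ((cmod (of_real (sqrt t)))\<^sup>2)" using t by (simp add: bump_0 bump_zero(1))
 qed (use bump1_nonpos in auto)
qed

lemma integral_bound_cball:
 fixes F :: "complex => complex"
 assumes F: "integrable lborel F" "!!z. z \<notin> cball c s ==> F z = 0" "!!z. z \<in> cball c s ==> cmod (F z) <= g z + M"
  and g: "integrable lborel g" "!!z. 0 <= g z" and s: "0 <= s"
 shows "cmod (LINT z|lborel. F z) <= (LINT z|lborel. g z) + M * (pi * s\<^sup>2)"
proof -
 have ii: "integrable lborel (%z. indicator (cball c s) z *\<^sub>R M)" by (rule borel_integrable_compact) auto
 have "cmod (LINT z|lborel. F z) <= (LINT z|lborel. g z + indicator (cball c s) z *\<^sub>R M)"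
 proof (rule Bochner_Integration.integral_norm_bound_integral[OF F(1) Bochner_Integration.integrable_add[OF g(1) ii]])
  fix z show "norm (F z) <= g z + indicator (cball c s) z *\<^sub>R M"
   using F(2,3)[of z] g(2)[of z] by (cases "z \<in> cball c s") auto
 qed
 also have "\<dots> = (LINT z|lborel. g z) + (LINT z|lborel. indicator (cball c s) z *\<^sub>R M)"
  by (rule Bochner_Integration.integral_add[OF g(1) ii])
 also have "(LINT z|lborel. indicator (cball c s) z *\<^sub>R M) = M * (pi * s\<^sup>2)"
  using content_cball[OF s, of c] by (simp add: unit_ball_vol_2 mult.commute)
 finally show ?thesis .
qed

text \<open>Weighted mean values of \<open>q = f\<^sub>z - 3 f - f\<^sup>2 / 2\<close> with \<open>f = V\<^sub>z\<close>: the first two terms are controlled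
 by partial integration, the last by Caccioppoli's inequality for \<open>V\<close>.\<close>

lemma cylinder_estimate:
 fixes V :: "complex => real" and Z0 :: complex
 assumes Cb: "!!t. 0 <= t ==> \<bar>bump1 t\<bar> <= Cb" "!!t. 0 <= t ==> \<bar>bump2 t\<bar> <= Cb" and R: "0 < R"
 defines "U \<equiv> ball Z0 (3 * R)" and "\<kappa> \<equiv> (LINT z|lborel. - bump1 ((cmod z)\<^sup>2))"
 assumes V: "!!Z. Z \<in> U ==> has_wirt (%z. of_real (V z)) (f Z) (cnj (f Z)) Z"
  and f: "!!Z. Z \<in> U ==> has_wirt f (f1 Z) (f2 Z) Z" and fc: "continuous_on U f1" "continuous_on U f2"
  and VC: "!!Z. Z \<in> U ==> \<bar>V Z\<bar> <= C" and M: "!!Z. Z \<in> cball Z0 (2 * R) ==> cmod (f2 Z) <= M" "M * R\<^sup>2 <= M'"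
  and q: "q holomorphic_on U" "!!Z. Z \<in> U ==> q Z = f1 Z - 3 * f Z - (f Z)\<^sup>2 / 2"
 shows "cmod (q Z0) * \<kappa> * R\<^sup>2 <= Cb / 2 * (exp 1 * (pi * (C\<^sup>2 * Cb + 4 * C * M')) + pi) * (2 + 3 * R)"
proof -
 have Cb0: "0 <= Cb" using Cb(1)[of 0] by simp
 have Z0: "Z0 \<in> U" using R by (simp add: U_def)
 have C0: "0 <= C" using VC[OF Z0] by linarith
 have oU: "open U" and sub2: "cball Z0 (2 * R) \<subseteq> U" and sub1: "cball Z0 R \<subseteq> U" using R by (auto simp: U_def)
 have b1c: "continuous_on UNIV (%Z. bump1 ((cmod (Z - Z0))\<^sup>2 / \<rho>))" for \<rho>
  unfolding divide_inverse by (intro continuous_intros continuous_on_compose2[OF DERIV_continuous_on[of UNIV bump1]])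
   (use bump1_deriv has_field_derivative_at_within in auto)
 have b2c: "continuous_on UNIV (%Z. bump2 ((cmod (Z - Z0))\<^sup>2 / \<rho>))" for \<rho>
  unfolding divide_inverse by (intro continuous_on_compose2[OF bump2_cont[of UNIV]] continuous_intros) auto
 have b0c: "continuous_on UNIV (%Z. bump ((cmod (Z - Z0))\<^sup>2 / \<rho>))" for \<rho> using Ck_bump[of 0] by simp
 have off: "1 <= (cmod (Z - Z0))\<^sup>2 / s\<^sup>2" if "Z \<notin> cball Z0 s" "0 < s" for Z s
  using that power_mono[of s "cmod (Z - Z0)" 2] by (simp add: dist_norm norm_minus_commute)
 have Vc: "continuous_on U (%z. complex_of_real (V z))" by (rule wirt_imp_continuous_on, rule V)
 have fcont: "continuous_on U f" by (rule wirt_imp_continuous_on, rule f)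
 \<comment> \<open>The cut-off \<open>\<eta>\<close> lives on the disc of radius 2 R and is bounded
   below on the disc of radius R, which supports the weight \<open>w\<close>.\<close>
 define \<rho> where "\<rho> = (2 * R)\<^sup>2"
 have \<rho>: "\<rho> > 0" using R by (simp add: \<rho>_def)
 define \<eta> where "\<eta> Z = bump ((cmod (Z - Z0))\<^sup>2 / \<rho>)" for Z
 define \<eta>1 where "\<eta>1 Z = of_real (bump1 ((cmod (Z - Z0))\<^sup>2 / \<rho>) / \<rho>) * (Z - Z0)" for Z
 define \<eta>2 where "\<eta>2 Z = complex_of_real (bump1 ((cmod (Z - Z0))\<^sup>2 / \<rho>) / \<rho>) + of_real (bump2 ((cmod (Z - Z0))\<^sup>2 / \<rho>) / \<rho> / \<rho>) * (cnj (Z - Z0) * (Z - Z0))" for Z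
 have d1: "((%t. bump1 (t / \<rho>) / \<rho>) has_real_derivative bump2 (t / \<rho>) / \<rho> / \<rho>) (at t)" for t
  using DERIV_cdivide[OF bump_scaled_deriv(2)[of \<rho> t]] .
 have W0: "has_wirt (%Z. of_real (\<eta> Z)) (of_real (bump1 ((cmod (Z - Z0))\<^sup>2 / \<rho>) / \<rho>) * cnj (Z - Z0)) (\<eta>1 Z) Z" for Z
  unfolding \<eta>_def \<eta>1_def by (rule wirt_radial[OF bump_scaled_deriv(1)])
 have W1: "has_wirt \<eta>1 (\<eta>2 Z) (of_real (bump2 ((cmod (Z - Z0))\<^sup>2 / \<rho>) / \<rho> / \<rho>) * (Z - Z0) * (Z - Z0)) Z" for Z
 proof -
  have "((%z. z - Z0) has_field_derivative 1) (at Z)" by (auto intro!: derivative_eq_intros)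
  from wirt_mult[OF wirt_radial[OF d1] wirt_holo[OF this]] show ?thesis
   unfolding \<eta>1_def[abs_def] by (rule wirt_eq_rhs) (auto simp: \<eta>2_def)
 qed
 have \<eta>off: "\<eta> Z = 0" "\<eta>1 Z = 0" "\<eta>2 Z = 0" if "Z \<notin> cball Z0 (2 * R)" for Z
  using bump_zero[OF off[OF that]] R by (auto simp: \<eta>_def \<eta>1_def \<eta>2_def \<rho>_def)
 have \<eta>b: "0 <= \<eta> Z" "\<eta> Z <= 1" for Z using bump_bounds by (auto simp: \<eta>_def)
 define D where "D = (LINT Z|lborel. (cmod (f Z))\<^sup>2 * \<eta> Z)"
 have VfW: "has_wirt (%z. of_real (V z) * f z) (of_real (V Z) * f1 Z + f Z * f Z) (of_real (V Z) * f2 Z + cnj (f Z) * f Z) Z" if "Z \<in> U" for Z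
  by (intro wirt_mult V f that)
 have cc: "continuous_on U (%Z. cnj (f Z))" by (intro continuous_intros fcont)
 have ca1: "continuous_on U (%Z. of_real (V Z) * f1 Z + f Z * f Z)" and cb1: "continuous_on U (%Z. of_real (V Z) * f2 Z + cnj (f Z) * f Z)"
  by (intro continuous_intros Vc fc fcont)+
 have cf: "continuous_on UNIV (%Z. complex_of_real (bump1 ((cmod (Z - Z0))\<^sup>2 / \<rho>) / \<rho>))"
  "continuous_on UNIV (%Z. complex_of_real (bump2 ((cmod (Z - Z0))\<^sup>2 / \<rho>) / \<rho> / \<rho>))"
  using \<rho> by (intro continuous_intros b1c b2c; simp)+
 have c1: "continuous_on UNIV (%Z. of_real (bump1 ((cmod (Z - Z0))\<^sup>2 / \<rho>) / \<rho>) * cnj (Z - Z0))" "continuous_on UNIV \<eta>1" "continuous_on UNIV \<eta>2"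
  "continuous_on UNIV (%Z. of_real (bump2 ((cmod (Z - Z0))\<^sup>2 / \<rho>) / \<rho> / \<rho>) * (Z - Z0) * (Z - Z0))"
  unfolding \<eta>1_def[abs_def] \<eta>2_def[abs_def] by (intro continuous_intros cf)+
 have s1: "integrable lborel (%Z. (of_real (V Z) * f2 Z + cnj (f Z) * f Z) * of_real (\<eta> Z))"
  "(LINT Z|lborel. (of_real (V Z) * f Z) * \<eta>1 Z) = - (LINT Z|lborel. (of_real (V Z) * f2 Z + cnj (f Z) * f Z) * of_real (\<eta> Z))"
  by (rule stokes_product(2,6)[OF oU sub2 _ ca1 cb1 W0 c1(1,2)]; (erule VfW | simp add: \<eta>off))+
 have VVW: "has_wirt (%z. of_real (V z) * of_real (V z)) (of_real (V Z) * f Z + f Z * of_real (V Z)) (of_real (V Z) * cnj (f Z) + cnj (f Z) * of_real (V Z)) Z" if "Z \<in> U" for Z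
  by (intro wirt_mult V that)
 have ca2: "continuous_on U (%Z. of_real (V Z) * f Z + f Z * of_real (V Z))" and cb2: "continuous_on U (%Z. of_real (V Z) * cnj (f Z) + cnj (f Z) * of_real (V Z))"
  by (intro continuous_intros Vc fcont)+
 have s2: "integrable lborel (%Z. (of_real (V Z) * of_real (V Z)) * \<eta>2 Z)"
  "(LINT Z|lborel. (of_real (V Z) * of_real (V Z)) * \<eta>2 Z) = - (LINT Z|lborel. (of_real (V Z) * f Z + f Z * of_real (V Z)) * \<eta>1 Z)"
  by (rule stokes_product(3,5)[OF oU sub2 _ ca2 cb2 W1 c1(3,4)]; (erule VVW | simp add: \<eta>off))+
 have ni: "integrable lborel (%Z. (cmod (f Z))\<^sup>2 * \<eta> Z)"
 proof (rule integrable_compact_support[of Z0 "2 * R"])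
  show "continuous_on (cball Z0 (2 * R)) (%Z. (cmod (f Z))\<^sup>2 * \<eta> Z)" unfolding \<eta>_def
   by (intro continuous_intros continuous_on_subset[OF fcont sub2] continuous_on_subset[OF b0c subset_UNIV])
 qed (simp add: \<eta>off)
 have Vf2i: "integrable lborel (%Z. of_real (V Z) * f2 Z * of_real (\<eta> Z))"
 proof (rule integrable_compact_support[of Z0 "2 * R"])
  show "continuous_on (cball Z0 (2 * R)) (%Z. of_real (V Z) * f2 Z * of_real (\<eta> Z))" unfolding \<eta>_def
   by (intro continuous_intros continuous_on_subset[OF Vc sub2] continuous_on_subset[OF fc(2) sub2] continuous_on_subset[OF b0c subset_UNIV])
 qed (simp add: \<eta>off)
 \<comment> \<open>Caccioppoli: the integral of |V_Z|^2 \<eta> is half that of V^2 \<eta>_{Z Zbar}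
   minus that of V V_{Z Zbar} \<eta>, and neither contains a first derivative of
   \<open>V\<close>.\<close>
 have DV: "of_real D = (LINT Z|lborel. (of_real (V Z) * of_real (V Z)) * \<eta>2 Z) / 2 - (LINT Z|lborel. of_real (V Z) * f2 Z * of_real (\<eta> Z))"
 proof -
  have "(LINT Z|lborel. (of_real (V Z) * f Z + f Z * of_real (V Z)) * \<eta>1 Z) = 2 * (LINT Z|lborel. (of_real (V Z) * f Z) * \<eta>1 Z)"
   unfolding integral_mult_right_zero[symmetric] by (rule Bochner_Integration.integral_cong) (auto simp: algebra_simps)
  then have 1: "(LINT Z|lborel. (of_real (V Z) * of_real (V Z)) * \<eta>2 Z) / 2 = (LINT Z|lborel. (of_real (V Z) * f2 Z + cnj (f Z) * f Z) * of_real (\<eta> Z))"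
   unfolding s2(2) s1(2) by simp
  have "of_real D = (LINT Z|lborel. complex_of_real ((cmod (f Z))\<^sup>2 * \<eta> Z))" unfolding D_def by (rule integral_complex_of_real[symmetric])
  also have "\<dots> = (LINT Z|lborel. (of_real (V Z) * f2 Z + cnj (f Z) * f Z) * of_real (\<eta> Z) - of_real (V Z) * f2 Z * of_real (\<eta> Z))"
   by (rule Bochner_Integration.integral_cong) (auto simp: algebra_simps complex_norm_square simp del: of_real_power)
  also have "\<dots> = (LINT Z|lborel. (of_real (V Z) * f2 Z + cnj (f Z) * f Z) * of_real (\<eta> Z)) - (LINT Z|lborel. of_real (V Z) * f2 Z * of_real (\<eta> Z))"
   by (rule Bochner_Integration.integral_diff[OF s1(1) Vf2i])
  finally show ?thesis using 1 by simp
 qed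
 \<comment> \<open>The area of the disc cancels the R^(-2) in the second derivatives of
   \<open>\<eta>\<close>, and M R^2 <= M', so the bound does not depend on R.\<close>
 have D: "D <= pi * (C\<^sup>2 * Cb + 4 * C * M')"
 proof -
  have z0: "integrable lborel (%z::complex. 0::real)" by simp
  have "cmod (LINT Z|lborel. (of_real (V Z) * of_real (V Z)) * \<eta>2 Z) <= (LINT z::complex|lborel. 0) + (C\<^sup>2 * (2 * Cb / \<rho>)) * (pi * (2 * R)\<^sup>2)"
  proof (rule integral_bound_cball[where c = Z0, OF s2(1) _ _ z0])
   fix Z assume Z: "Z \<in> cball Z0 (2 * R)"
   have t: "(cmod (Z - Z0))\<^sup>2 <= \<rho>" unfolding \<rho>_def using Z by (intro power_mono) (auto simp: dist_norm norm_minus_commute)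
   have "cmod (\<eta>2 Z) <= \<bar>bump1 ((cmod (Z - Z0))\<^sup>2 / \<rho>)\<bar> / \<rho> + \<bar>bump2 ((cmod (Z - Z0))\<^sup>2 / \<rho>)\<bar> / \<rho> / \<rho> * (cmod (Z - Z0))\<^sup>2"
   proof -
    have n1: "cmod (complex_of_real (x / \<rho>)) = \<bar>x\<bar> / \<rho>" for x by (simp only: norm_of_real abs_divide abs_of_pos[OF \<rho>])
    have n2: "cmod (of_real (x / \<rho> / \<rho>) * (cnj y * y)) = \<bar>x\<bar> / \<rho> / \<rho> * (cmod y)\<^sup>2" for x y
     by (simp only: norm_mult norm_of_real abs_divide abs_of_pos[OF \<rho>] complex_mod_cnj power2_eq_square)
    show ?thesis unfolding \<eta>2_def by (rule norm_triangle_le) (simp only: n1 n2 order_refl)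
   qed
   also have "\<dots> <= Cb / \<rho> + Cb / \<rho> / \<rho> * \<rho>"
    using \<rho> Cb0 t by (intro add_mono mult_mono divide_right_mono Cb) auto
   also have "\<dots> = 2 * Cb / \<rho>" using \<rho> by simp
   finally have "cmod (\<eta>2 Z) <= 2 * Cb / \<rho>" .
   moreover have VZ: "\<bar>V Z\<bar> <= C" using VC sub2 Z by blast
   moreover have "\<bar>V Z\<bar> * \<bar>V Z\<bar> <= C * C" by (rule mult_mono[OF VZ VZ C0 abs_ge_zero])
   ultimately have "(\<bar>V Z\<bar> * \<bar>V Z\<bar>) * cmod (\<eta>2 Z) <= (C * C) * (2 * Cb / \<rho>)" using C0 by (intro mult_mono[of "\<bar>V Z\<bar> * \<bar>V Z\<bar>"]) auto
   then show "cmod ((of_real (V Z) * of_real (V Z)) * \<eta>2 Z) <= 0 + C\<^sup>2 * (2 * Cb / \<rho>)"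
    by (simp add: norm_mult power2_eq_square)
  qed (use \<eta>off R in auto)
  then have 1: "cmod (LINT Z|lborel. (of_real (V Z) * of_real (V Z)) * \<eta>2 Z) <= 2 * (C\<^sup>2 * Cb * pi)"
   using R by (simp add: \<rho>_def mult_ac)
  have "cmod (LINT Z|lborel. of_real (V Z) * f2 Z * of_real (\<eta> Z)) <= (LINT z::complex|lborel. 0) + (C * M) * (pi * (2 * R)\<^sup>2)"
  proof (rule integral_bound_cball[where c = Z0, OF Vf2i _ _ z0])
   fix Z assume Z: "Z \<in> cball Z0 (2 * R)"
   have "\<bar>V Z\<bar> * cmod (f2 Z) * \<eta> Z <= C * M * 1"
    using VC[of Z] sub2 Z C0 M(1)[OF Z] \<eta>b[of Z] by (intro mult_mono mult_nonneg_nonneg) (auto intro: order_trans[OF norm_ge_zero])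
   then show "cmod (of_real (V Z) * f2 Z * of_real (\<eta> Z)) <= 0 + C * M" using \<eta>b[of Z] by (simp add: norm_mult)
  qed (use \<eta>off R in auto)
  also have "\<dots> = 4 * pi * C * (M * R\<^sup>2)" by (simp add: power2_eq_square algebra_simps)
  also have "\<dots> <= 4 * pi * C * M'" using M(2) C0 by (intro mult_left_mono) auto
  finally have 2: "cmod (LINT Z|lborel. of_real (V Z) * f2 Z * of_real (\<eta> Z)) <= 4 * pi * C * M'" .
  have "D <= cmod (of_real D)" by simp
  also have "\<dots> <= cmod ((LINT Z|lborel. (of_real (V Z) * of_real (V Z)) * \<eta>2 Z) / 2) + cmod (LINT Z|lborel. of_real (V Z) * f2 Z * of_real (\<eta> Z))"
   unfolding DV by (rule norm_triangle_ineq4)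
  finally show ?thesis using 1 2 by (simp add: norm_divide algebra_simps)
 qed
 define w where "w Z = bump1 ((cmod (Z - Z0))\<^sup>2 / R\<^sup>2)" for Z
 define w1 where "w1 Z = of_real (bump2 ((cmod (Z - Z0))\<^sup>2 / R\<^sup>2) / R\<^sup>2) * cnj (Z - Z0)" for Z
 have Ww: "has_wirt (%Z. of_real (w Z)) (w1 Z) (of_real (bump2 ((cmod (Z - Z0))\<^sup>2 / R\<^sup>2) / R\<^sup>2) * (Z - Z0)) Z" for Z
  unfolding w_def w1_def by (rule wirt_radial[OF bump_scaled_deriv(2)])
 have woff: "w Z = 0" "w1 Z = 0" if "Z \<notin> cball Z0 R" for Z
  using bump_zero[OF off[OF that R]] by (auto simp: w_def w1_def)
 have wb: "\<bar>w Z\<bar> <= Cb" for Z unfolding w_def using R by (intro Cb) simp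
 have wc: "continuous_on UNIV w" unfolding w_def[abs_def] by (rule b1c)
 have ci: "integrable lborel (%Z. k Z * of_real (w Z))" if "continuous_on U k" for k :: "complex => complex"
  by (rule integrable_compact_support[of Z0 R])
   (auto simp: woff intro!: continuous_intros continuous_on_subset[OF that sub1] continuous_on_subset[OF wc subset_UNIV])
 \<comment> \<open>A mean value property with radial weight: q - q(Z0) is divisible by Z - Z0, and w
   (Z - Z0) is the Zbar-derivative of R^2 times the cut-off, so the holomorphic quotient integrates
   to 0 against it. The total weight is -R^2 \<kappa>.\<close>
 have mean: "(LINT Z|lborel. q Z * of_real (w Z)) = - (q Z0 * of_real (R\<^sup>2 * \<kappa>))"
 proof -
  define k where "k Z = (if Z = Z0 then deriv q Z0 else (q Z - q Z0) / (Z - Z0))" for Z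
  have kh: "k holomorphic_on U" unfolding k_def[abs_def]
   by (rule pole_lemma_open[OF q(1) oU])
  have kW: "has_wirt k (deriv k Z) 0 Z" if "Z \<in> U" for Z by (rule wirt_holo[OF holomorphic_derivI[OF kh oU that]])
  have dkc: "continuous_on U (deriv k)" by (intro holomorphic_on_imp_continuous_on holomorphic_deriv kh oU)
  have "has_wirt (%Z. of_real (R\<^sup>2 * bump ((cmod (Z - Z0))\<^sup>2 / R\<^sup>2))) (of_real (w Z) * cnj (Z - Z0)) (of_real (w Z) * (Z - Z0)) Z" for Z
   unfolding w_def by (rule wirt_radial) (use DERIV_cmult[OF bump_scaled_deriv(1)[of "R\<^sup>2"], of "R\<^sup>2"] R in simp)
  note W3 = this
  have c3: "continuous_on UNIV (%Z. of_real (w Z) * cnj (Z - Z0))" "continuous_on UNIV (%Z. of_real (w Z) * (Z - Z0))"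
   by (intro continuous_intros wc)+
  have "(LINT Z|lborel. k Z * (of_real (w Z) * (Z - Z0))) = - (LINT Z|lborel. 0 * of_real (R\<^sup>2 * bump ((cmod (Z - Z0))\<^sup>2 / R\<^sup>2)))"
   by (rule stokes_product(6)[OF oU sub1 _ dkc continuous_on_const W3 c3]) (erule kW, simp add: bump_zero(1)[OF off[OF _ R]])
  then have k0: "(LINT Z|lborel. k Z * (of_real (w Z) * (Z - Z0))) = 0" by simp
  have wi: "integrable lborel w"
   by (rule integrable_compact_support[of Z0 R]) (auto simp: woff intro!: continuous_on_subset[OF wc])
  have qi: "integrable lborel (%Z. k Z * (of_real (w Z) * (Z - Z0)))"
   by (rule integrable_compact_support[of Z0 R])
    (auto simp: woff intro!: continuous_intros continuous_on_subset[OF holomorphic_on_imp_continuous_on[OF kh] sub1] continuous_on_subset[OF wc subset_UNIV])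
  have "(LINT Z|lborel. q Z * of_real (w Z)) = (LINT Z|lborel. k Z * (of_real (w Z) * (Z - Z0)) + q Z0 * of_real (w Z))"
   by (rule Bochner_Integration.integral_cong) (auto simp: k_def field_simps)
  also have "\<dots> = q Z0 * of_real (LINT Z|lborel. w Z)"
   using qi wi by (subst Bochner_Integration.integral_add) (auto simp: k0 intro!: integrable_mult_right)
  also have "(LINT Z|lborel. w Z) = R\<^sup>2 * (LINT Z|lborel. w (Z0 + R *\<^sub>R Z))"
   by (rule lborel_integral_scale[OF _ R]) (use borel_measurable_integrable[OF wi] in simp)
  also have "(%Z. w (Z0 + R *\<^sub>R Z)) = (%Z. bump1 ((cmod Z)\<^sup>2))" using R by (auto simp: w_def power_mult_distrib)
  also have "q Z0 * of_real (R\<^sup>2 * (LINT Z|lborel. bump1 ((cmod Z)\<^sup>2))) = - (q Z0 * of_real (R\<^sup>2 * \<kappa>))" by (simp add: \<kappa>_def)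
  finally show ?thesis .
 qed
 have lowf: "(cmod (f Z))\<^sup>2 <= exp 1 * ((cmod (f Z))\<^sup>2 * \<eta> Z)" if Z: "Z \<in> cball Z0 R" for Z
 proof -
  have "(cmod (Z - Z0))\<^sup>2 <= R\<^sup>2" using Z by (intro power_mono) (auto simp: dist_norm norm_minus_commute)
  then have "(cmod (Z - Z0))\<^sup>2 / \<rho> <= 1 / 4" using R by (simp add: \<rho>_def power_mult_distrib divide_simps)
  then have "exp (- 1) <= \<eta> Z" unfolding \<eta>_def using \<rho> by (intro bump_lower) auto
  then have "exp 1 * exp (- 1) <= exp 1 * \<eta> Z" by (intro mult_left_mono) auto
  then have "1 <= exp 1 * \<eta> Z" by (simp flip: exp_add)
  from mult_left_mono[OF this, of "(cmod (f Z))\<^sup>2"] show ?thesis by (simp add: mult_ac)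
 qed
 \<comment> \<open>Trades |f| for |f|^2, which is under control, at a free scale s. Below s = R, so
   that both resulting contributions have the same order in R.\<close>
 have young: "cmod (f Z) <= 1 / 2 * (s * (exp 1 * ((cmod (f Z))\<^sup>2 * \<eta> Z)) + 1 / s)" if Z: "Z \<in> cball Z0 R" and s: "0 < s" for Z s
 proof -
  have "0 <= (s * cmod (f Z) - 1)\<^sup>2" by simp
  then have "2 * s * cmod (f Z) <= s * (s * (cmod (f Z))\<^sup>2) + 1" by (simp add: power2_eq_square algebra_simps)
  also have "\<dots> <= s * (s * (exp 1 * ((cmod (f Z))\<^sup>2 * \<eta> Z))) + 1" using lowf[OF Z] s by simp
  finally show ?thesis using s by (simp add: field_simps)
 qed
 define g where "g \<mu> Z = \<mu> * (exp 1 * ((cmod (f Z))\<^sup>2 * \<eta> Z))" for \<mu> Z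
 have g: "integrable lborel (g \<mu>)" "(LINT Z|lborel. g \<mu> Z) = \<mu> * (exp 1 * D)" "0 <= \<mu> ==> 0 <= g \<mu> Z" for \<mu> Z
  unfolding g_def[abs_def] D_def using ni \<eta>b by (auto intro!: mult_nonneg_nonneg)
 \<comment> \<open>The derivative of \<open>f\<close> is not controlled by the Dirichlet integral;
   it is moved to the weight.\<close>
 have i1: "(LINT Z|lborel. f Z * w1 Z) = - (LINT Z|lborel. f1 Z * of_real (w Z))" "integrable lborel (%Z. f Z * w1 Z)"
 proof -
  have cf': "continuous_on UNIV (%Z. complex_of_real (bump2 ((cmod (Z - Z0))\<^sup>2 / R\<^sup>2) / R\<^sup>2))"
   using R by (intro continuous_intros b2c) simp
  have c4: "continuous_on UNIV w1" "continuous_on UNIV (%Z. of_real (bump2 ((cmod (Z - Z0))\<^sup>2 / R\<^sup>2) / R\<^sup>2) * (Z - Z0))"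
   unfolding w1_def[abs_def] by (intro continuous_intros cf')+
  show "integrable lborel (%Z. f Z * w1 Z)"
   by (rule stokes_product(3)[OF oU sub1 _ fc Ww c4]) (erule f, simp add: woff)
  have "(LINT Z|lborel. f Z * w1 Z) = - (LINT Z|lborel. f1 Z * of_real (w Z))"
   by (rule stokes_product(5)[OF oU sub1 _ fc Ww c4]) (erule f, simp add: woff)
  then show "(LINT Z|lborel. f Z * w1 Z) = - (LINT Z|lborel. f1 Z * of_real (w Z))" .
 qed
 have e1: "cmod (LINT Z|lborel. f Z * w1 Z) <= (Cb / 2) * (exp 1 * D) + (Cb / 2 / R\<^sup>2) * (pi * R\<^sup>2)"
  unfolding g(2)[symmetric]
 proof (rule integral_bound_cball[where c = Z0, OF i1(2)])
  fix Z assume Z: "Z \<in> cball Z0 R"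
  have "cmod (w1 Z) = \<bar>bump2 ((cmod (Z - Z0))\<^sup>2 / R\<^sup>2)\<bar> / R\<^sup>2 * cmod (Z - Z0)"
   unfolding w1_def norm_mult complex_mod_cnj norm_of_real by (simp add: abs_divide)
  also have "\<dots> <= Cb / R\<^sup>2 * R" using Z R Cb0 by (intro mult_mono divide_right_mono Cb) (auto simp: dist_norm norm_minus_commute)
  finally have "cmod (w1 Z) <= Cb / R" using R by (simp add: power2_eq_square)
  then have "cmod (f Z) * cmod (w1 Z) <= (1 / 2 * (R * (exp 1 * ((cmod (f Z))\<^sup>2 * \<eta> Z)) + 1 / R)) * (Cb / R)"
   using young[OF Z R] R Cb0 by (intro mult_mono) (auto intro!: add_nonneg_nonneg mult_nonneg_nonneg \<eta>b)
  also have "\<dots> = g (Cb / 2) Z + Cb / 2 / R\<^sup>2" using R by (simp add: g_def field_simps power2_eq_square)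
  finally show "cmod (f Z * w1 Z) <= g (Cb / 2) Z + Cb / 2 / R\<^sup>2" by (simp add: norm_mult)
 qed (use g woff R Cb0 in auto)
 have e2: "cmod (LINT Z|lborel. f Z * of_real (w Z)) <= (Cb / 2 * R) * (exp 1 * D) + (Cb / 2 / R) * (pi * R\<^sup>2)"
  unfolding g(2)[symmetric]
 proof (rule integral_bound_cball[where c = Z0, OF ci[OF fcont]])
  fix Z assume Z: "Z \<in> cball Z0 R"
  have "cmod (f Z) * \<bar>w Z\<bar> <= (1 / 2 * (R * (exp 1 * ((cmod (f Z))\<^sup>2 * \<eta> Z)) + 1 / R)) * Cb"
   using young[OF Z R] wb R Cb0 by (intro mult_mono) (auto intro!: add_nonneg_nonneg mult_nonneg_nonneg \<eta>b)
  also have "\<dots> = g (Cb / 2 * R) Z + Cb / 2 / R" using R by (simp add: g_def field_simps)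
  finally show "cmod (f Z * of_real (w Z)) <= g (Cb / 2 * R) Z + Cb / 2 / R" by (simp add: norm_mult)
 qed (use g woff R Cb0 in auto)
 have f2c: "continuous_on U (%Z. (f Z)\<^sup>2 / 2)" by (intro continuous_intros fcont) auto
 have e3: "cmod (LINT Z|lborel. (f Z)\<^sup>2 / 2 * of_real (w Z)) <= (Cb / 2) * (exp 1 * D) + 0 * (pi * R\<^sup>2)"
  unfolding g(2)[symmetric]
 proof (rule integral_bound_cball[where c = Z0, OF ci[OF f2c]])
  fix Z assume Z: "Z \<in> cball Z0 R"
  have "(cmod (f Z))\<^sup>2 / 2 * \<bar>w Z\<bar> <= (exp 1 * ((cmod (f Z))\<^sup>2 * \<eta> Z)) / 2 * Cb"
   using lowf[OF Z] wb \<eta>b by (intro mult_mono) auto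
  then show "cmod ((f Z)\<^sup>2 / 2 * of_real (w Z)) <= g (Cb / 2) Z + 0" by (simp add: norm_mult norm_divide norm_power g_def mult_ac)
 qed (use g woff R Cb0 in auto)
 have "(LINT Z|lborel. q Z * of_real (w Z)) = (LINT Z|lborel. f1 Z * of_real (w Z) - 3 * (f Z * of_real (w Z)) - (f Z)\<^sup>2 / 2 * of_real (w Z))"
 proof (rule Bochner_Integration.integral_cong)
  fix Z show "q Z * of_real (w Z) = f1 Z * of_real (w Z) - 3 * (f Z * of_real (w Z)) - (f Z)\<^sup>2 / 2 * of_real (w Z)"
  proof (cases "Z \<in> cball Z0 R")
   case True
   then have "Z \<in> U" using sub1 by blast
   then show ?thesis unfolding q(2)[OF \<open>Z \<in> U\<close>] by (simp add: algebra_simps)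
  qed (simp add: woff)
 qed simp
 also have "\<dots> = - (LINT Z|lborel. f Z * w1 Z) - 3 * (LINT Z|lborel. f Z * of_real (w Z)) - (LINT Z|lborel. (f Z)\<^sup>2 / 2 * of_real (w Z))"
  using ci[OF fcont] ci[OF f2c] ci[OF fc(1)] i1(1)
  by (simp only: Bochner_Integration.integral_diff integrable_mult_right Bochner_Integration.integrable_diff integral_mult_right_zero minus_minus)
 finally have "cmod (q Z0 * of_real (R\<^sup>2 * \<kappa>)) = cmod (- (LINT Z|lborel. f Z * w1 Z) - 3 * (LINT Z|lborel. f Z * of_real (w Z)) - (LINT Z|lborel. (f Z)\<^sup>2 / 2 * of_real (w Z)))"
  unfolding mean by (metis norm_minus_cancel)
 also have "\<dots> <= cmod (- (LINT Z|lborel. f Z * w1 Z) - 3 * (LINT Z|lborel. f Z * of_real (w Z))) + cmod (LINT Z|lborel. (f Z)\<^sup>2 / 2 * of_real (w Z))"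
  by (rule norm_triangle_ineq4)
 also have "cmod (- (LINT Z|lborel. f Z * w1 Z) - 3 * (LINT Z|lborel. f Z * of_real (w Z))) <= cmod (LINT Z|lborel. f Z * w1 Z) + 3 * cmod (LINT Z|lborel. f Z * of_real (w Z))"
  by (rule order_trans[OF norm_triangle_ineq4]) (simp add: norm_mult)
 finally have tri: "cmod (q Z0 * of_real (R\<^sup>2 * \<kappa>)) <= cmod (LINT Z|lborel. f Z * w1 Z) + 3 * cmod (LINT Z|lborel. f Z * of_real (w Z)) + cmod (LINT Z|lborel. (f Z)\<^sup>2 / 2 * of_real (w Z))"
  by simp
 have "cmod (q Z0 * of_real (R\<^sup>2 * \<kappa>)) <= (Cb / 2 * (exp 1 * D) + Cb / 2 * pi) + 3 * (Cb / 2 * R * (exp 1 * D) + Cb / 2 * pi * R) + Cb / 2 * (exp 1 * D)"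
 proof -
  have r: "Cb / 2 / R\<^sup>2 * (pi * R\<^sup>2) = Cb / 2 * pi" "Cb / 2 / R * (pi * R\<^sup>2) = Cb / 2 * pi * R"
   using R by (simp_all add: power2_eq_square)
  have lin: "X <= a + 3 * b + c ==> a <= A1 + B1 ==> b <= A2 + B2 ==> c <= A1 + 0 * B3 ==> X <= A1 + B1 + 3 * (A2 + B2) + A1"
   for X a b c A1 A2 B1 B2 B3 :: real by simp
  show ?thesis
   by (rule lin[OF tri e1[unfolded r] e2[unfolded r] e3])
 qed
 also have "\<dots> <= Cb / 2 * (exp 1 * D + pi) * (2 + 3 * R)"
 proof -
  have eq: "(Cb / 2 * x + Cb / 2 * pi) + 3 * (Cb / 2 * R * x + Cb / 2 * pi * R) + Cb / 2 * x = Cb / 2 * (x + pi) * (2 + 3 * R) - Cb / 2 * pi" for x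
   by (simp add: field_simps)
  show ?thesis unfolding eq using Cb0 by simp
 qed
 also have "\<dots> <= Cb / 2 * (exp 1 * (pi * (C\<^sup>2 * Cb + 4 * C * M')) + pi) * (2 + 3 * R)"
  using D Cb0 R by (intro mult_right_mono mult_left_mono add_right_mono) auto
 finally have fin: "cmod (q Z0 * of_real (R\<^sup>2 * \<kappa>)) <= Cb / 2 * (exp 1 * (pi * (C\<^sup>2 * Cb + 4 * C * M')) + pi) * (2 + 3 * R)" .
 have "0 <= R\<^sup>2 * \<kappa>" using integral_bump1_neg by (simp add: \<kappa>_def del: Bochner_Integration.integral_minus)
 then have "cmod (q Z0 * of_real (R\<^sup>2 * \<kappa>)) = cmod (q Z0) * \<kappa> * R\<^sup>2"
  by (simp only: norm_mult norm_of_real abs_of_nonneg mult_ac)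
 then show ?thesis using fin by simp
qed

section \<open>Holomorphy and periodicity determine the Schwarzian\<close>

context mean_field
begin

lemma schwarzian:
 obtains ua u\<alpha> B where "!!z. z \<notin> \<Lambda> ==> has_wirt (%z. of_real (u z)) (ua z) (cnj (ua z)) z"
  "!!z. z \<notin> \<Lambda> ==> has_wirt ua (u\<alpha> z) (of_real (- (2 * pi) * exp (u z))) z"
  "!!z. z \<notin> \<Lambda> ==> u\<alpha> z - (ua z)\<^sup>2 / 2 = - 4 * wp z - 2 * B"
proof -
 have hc: "continuous_on (- \<Lambda>) (%z. - (8 * pi) * exp (u z))"
  by (intro continuous_intros) (auto intro!: continuous_at_imp_continuous_on u_props(7))
 obtain ua u\<alpha> where W0: "!!z. z \<notin> \<Lambda> ==> has_wirt (%z. of_real (u z)) (ua z) (cnj (ua z)) z"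
  and W1': "!!z. z \<notin> \<Lambda> ==> has_wirt ua (u\<alpha> z) (of_real (- (8 * pi) * exp (u z) / 4)) z" and \<alpha>c: "continuous_on (- \<Lambda>) u\<alpha>"
  by (rule weak_classical[OF u_props(3,1,4,2) hc]) (rule that)
 have W1: "has_wirt ua (u\<alpha> z) (of_real (- (2 * pi) * exp (u z))) z" if "z \<notin> \<Lambda>" for z
  using W1'[OF that] by (rule wirt_eq_rhs) simp_all
 have uac: "continuous_on (- \<Lambda>) ua" by (rule wirt_imp_continuous_on[of _ ua u\<alpha>]) (use W1 in auto)
 have uc: "continuous_on (- \<Lambda>) (%z. complex_of_real (u z))" by (rule wirt_imp_continuous_on[of _ _ ua]) (use W0 in auto)
 define Q where "Q z = u\<alpha> z - (ua z)\<^sup>2 / 2" for z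
 \<comment> \<open>\<open>u\<close> is only twice differentiable, so \<open>Q\<close> is not
   differentiated. By the equation the form (u_z^2 / 2) dz - 2 pi exp u dzbar is closed; subtracting
   a local primitive from u_z gives a holomorphic function whose derivative is
   \<open>Q\<close>.\<close>
 have Qh: "Q holomorphic_on - \<Lambda>"
 proof (rule holomorphic_onI)
  fix x assume "x \<in> - \<Lambda>"
  then obtain r where r: "r > 0" "ball x r \<subseteq> - \<Lambda>" using open_compl_lattice open_contains_ball by blast
  have nl: "z \<notin> \<Lambda>" if "z \<in> ball x r" for z using that r by auto
  have pW: "has_wirt (%z. (ua z)\<^sup>2 / 2) (ua z * u\<alpha> z) (ua z * of_real (- (2 * pi) * exp (u z))) z" if "z \<in> ball x r" for z
  proof -
   have e: "(%z. (ua z)\<^sup>2 / 2) = (%z. 1 / 2 * (ua z * ua z))" by (simp add: power2_eq_square)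
   show ?thesis unfolding e
    by (rule wirt_eq_rhs[OF wirt_cmult[OF wirt_mult[OF W1[OF nl[OF that]] W1[OF nl[OF that]]]]]) (simp_all add: field_simps)
  qed
  have qW: "has_wirt (%z. of_real (- (2 * pi) * exp (u z))) (ua z * of_real (- (2 * pi) * exp (u z))) (cnj (ua z) * of_real (- (2 * pi) * exp (u z))) z" if "z \<in> ball x r" for z
  proof -
   have "((%x. - (2 * pi) * exp x) has_real_derivative - (2 * pi) * exp (u z)) (at (u z))" by (auto intro!: derivative_eq_intros)
   from wirt_of_real_comp[OF W0[OF nl[OF that]] this] show ?thesis by (simp add: mult.commute)
  qed
  have ec: "continuous_on (ball x r) (%z. complex_of_real (- (2 * pi) * exp (u z)))"
   by (rule wirt_imp_continuous_on) (rule qW)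
  obtain \<nu> where \<nu>: "!!z. z \<in> ball x r ==> has_wirt \<nu> ((ua z)\<^sup>2 / 2) (of_real (- (2 * pi) * exp (u z))) z"
  proof (rule poincare_wirt[OF pW qW])
   show "continuous_on (ball x r) (%z. ua z * u\<alpha> z)" "continuous_on (ball x r) (%z. ua z * of_real (- (2 * pi) * exp (u z)))"
    "continuous_on (ball x r) (%z. cnj (ua z) * of_real (- (2 * pi) * exp (u z)))"
    by (intro continuous_intros ec continuous_on_subset[OF uac r(2)] continuous_on_subset[OF \<alpha>c r(2)])+
  qed (auto intro: that)
  have D: "((%z. ua z - \<nu> z) has_field_derivative Q z) (at z)" if "z \<in> ball x r" for z
   by (rule wirt_zero_imp_DERIV, rule wirt_eq_rhs[OF wirt_diff[OF W1[OF nl[OF that]] \<nu>[OF that]]]) (auto simp: Q_def)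
  then have "(%z. ua z - \<nu> z) holomorphic_on ball x r" unfolding holomorphic_on_open[OF open_ball] by blast
  then have "deriv (%z. ua z - \<nu> z) holomorphic_on ball x r" by (intro holomorphic_deriv) auto
  then have "Q holomorphic_on ball x r"
   by (rule holomorphic_transform) (use D DERIV_imp_deriv in blast)
  then have "Q field_differentiable at x" using r(1) holomorphic_on_imp_differentiable_at[of Q "ball x r" x] by simp
  then show "Q field_differentiable at x within - \<Lambda>" by (rule field_differentiable_at_within)
 qed
 obtain r C where r: "0 < r" "r <= rmin / 6" and rC: "!!z. z \<in> ball 0 r - {0} ==> \<bar>u z - 4 * ln (cmod z)\<bar> <= C"
  by (rule near_zero_bound) (rule that)
 have nl: "z \<notin> \<Lambda>" if "z \<in> ball 0 r - {0}" for z using small_ball[of z] that r by auto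
 have C0: "0 <= C"
 proof -
  have "of_real (r / 2) \<in> ball (0::complex) r - {0}" using r by simp
  from rC[OF this] show ?thesis by linarith
 qed
 obtain Cb where Cb: "!!t. 0 <= t ==> \<bar>bump1 t\<bar> <= Cb" "!!t. 0 <= t ==> \<bar>bump2 t\<bar> <= Cb"
  using bump_const by metis
 define \<kappa> where "\<kappa> = (LINT z::complex|lborel. - bump1 ((cmod z)\<^sup>2))"
 have \<kappa>: "\<kappa> > 0" unfolding \<kappa>_def by (rule integral_bump1_neg)
 define M' where "M' = 2 * pi * exp C * r ^ 6"
 define K where "K = Cb / 2 * (exp 1 * (pi * (C\<^sup>2 * Cb + 4 * C * M')) + pi) / \<kappa>"
 \<comment> \<open>A third of the distance from Ln z to the line Re Z = ln r, because
   \<open>cylinder_estimate\<close> at scale R needs a disc of radius 3 R.\<close>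
 define rr where "rr z = (ln r - ln (cmod z)) / 3" for z :: complex
 have est: "cmod (z0\<^sup>2 * Q z0 + 4) <= K * (2 * (1 / rr z0)\<^sup>2 + 3 * (1 / rr z0))" if z0: "z0 ~= 0" "cmod z0 < r" for z0
 proof -
  define R where "R = rr z0"
  have R: "R > 0" using z0 r(1) by (simp add: R_def rr_def)
  define Z0 where "Z0 = Ln z0"
  have ReZ0: "Re Z0 = ln r - 3 * R" using z0 by (simp add: Z0_def R_def rr_def diff_divide_distrib)
  have Reb: "Re Z <= Re Z0 + dist Z0 Z" for Z
   using complex_Re_le_cmod[of "Z - Z0"] by (simp add: dist_norm norm_minus_commute)
  have ex: "exp Z \<in> ball 0 r - {0}" if "Z \<in> ball Z0 (3 * R)" for Z
  proof -
   have "Re Z < ln r" using Reb[of Z] that by (simp add: ReZ0)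
   then have "exp (Re Z) < r" using r(1) by (metis exp_less_mono exp_ln)
   then show ?thesis by simp
  qed
  note exL = nl[OF ex]
  \<comment> \<open>With z = exp Z the function f = V_Z is z u_z - 2. Expanding (f + 2)^2 gives z^2
    Q + 4 = f_Z - 3 f - f^2 / 2, the combination that \<open>cylinder_estimate\<close>
    treats.\<close>
  define V where "V Z = u (exp Z) - 4 * Re Z" for Z
  define f where "f Z = exp Z * ua (exp Z) - 2" for Z
  define f1 where "f1 Z = exp Z * (u\<alpha> (exp Z) * exp Z) + exp Z * ua (exp Z)" for Z
  define f2 where "f2 Z = exp Z * (of_real (- (2 * pi) * exp (u (exp Z))) * cnj (exp Z))" for Z
  have "cmod ((%Z. (exp Z)\<^sup>2 * Q (exp Z) + 4) Z0) * (LINT z::complex|lborel. - bump1 ((cmod z)\<^sup>2)) * R\<^sup>2 <= Cb / 2 * (exp 1 * (pi * (C\<^sup>2 * Cb + 4 * C * M')) + pi) * (2 + 3 * R)"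
  proof (rule cylinder_estimate[OF Cb R, where V = V and f = f and ?f1.0 = f1 and ?f2.0 = f2 and M = "M' * exp (- 6 * R)" and q = "%Z. (exp Z)\<^sup>2 * Q (exp Z) + 4"])
   fix Z assume Z: "Z \<in> ball Z0 (3 * R)"
   have "has_wirt (%z. of_real (u (exp z)) - of_real (Re (4 * z))) (ua (exp Z) * exp Z - 4 / 2) (cnj (ua (exp Z)) * cnj (exp Z) - cnj (4 / 2)) Z"
    by (intro wirt_diff wirt_holo_comp[OF DERIV_exp W0[OF exL[OF Z]]] wirt_Re_holo) (auto intro!: derivative_eq_intros)
   then show "has_wirt (%z. of_real (V z)) (f Z) (cnj (f Z)) Z" by (simp add: V_def f_def mult.commute)
   have "has_wirt (%Z. exp Z * ua (exp Z) - 2) (exp Z * (u\<alpha> (exp Z) * exp Z) + exp Z * ua (exp Z) - 0)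
    (exp Z * (of_real (- (2 * pi) * exp (u (exp Z))) * cnj (exp Z)) + 0 * ua (exp Z) - 0) Z"
    by (intro wirt_diff wirt_mult wirt_const wirt_holo DERIV_exp wirt_holo_comp[OF DERIV_exp W1[OF exL[OF Z]]])
   then show "has_wirt f (f1 Z) (f2 Z) Z" by (simp add: f_def[abs_def] f1_def f2_def)
   show "\<bar>V Z\<bar> <= C" using rC[OF ex[OF Z]] by (simp add: V_def)
   show "(exp Z)\<^sup>2 * Q (exp Z) + 4 = f1 Z - 3 * f Z - (f Z)\<^sup>2 / 2"
    by (simp add: Q_def f1_def f_def power2_eq_square field_simps)
  next
   have sub: "exp ` ball Z0 (3 * R) \<subseteq> - \<Lambda>" using exL by auto
   have cp: "continuous_on (ball Z0 (3 * R)) (%Z. k (exp Z))" if "continuous_on (- \<Lambda>) k" for k :: "complex => complex"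
    by (rule continuous_on_compose2[OF that _ sub]) (intro continuous_intros)
   show "continuous_on (ball Z0 (3 * R)) f1" unfolding f1_def[abs_def] by (intro continuous_intros cp \<alpha>c uac)
   have uR: "continuous_on (- \<Lambda>) u" by (auto intro!: continuous_at_imp_continuous_on u_props(7))
   have ec: "continuous_on (- \<Lambda>) (%z. complex_of_real (- (2 * pi) * exp (u z)))" by (intro continuous_intros uR)
   show "continuous_on (ball Z0 (3 * R)) f2" unfolding f2_def[abs_def]
    by (intro continuous_on_mult continuous_on_exp continuous_on_id continuous_on_cnj cp[OF ec])
   show "(%Z. (exp Z)\<^sup>2 * Q (exp Z) + 4) holomorphic_on ball Z0 (3 * R)"
    by (intro holomorphic_intros holomorphic_on_compose_gen[OF _ Qh, unfolded o_def] sub)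
  next
   fix Z assume Z: "Z \<in> cball Z0 (2 * R)"
   have Z': "Z \<in> ball Z0 (3 * R)" using Z R by auto
   \<comment> \<open>The change of variable contributes |z|^2 and exp u at most exp C |z|^4. On the
     disc of radius 2 R one has |z| <= r exp (-R), whence the exponent 6.\<close>
   have "u (exp Z) <= 4 * Re Z + C" using rC[OF ex[OF Z']] by simp
   then have "exp (2 * Re Z) * exp (u (exp Z)) <= exp (2 * Re Z) * exp (4 * Re Z + C)" by simp
   also have "\<dots> = exp C * exp (6 * Re Z)" by (simp flip: exp_add)
   also have "exp (6 * Re Z) <= exp (6 * (ln r - R))" using Reb[of Z] Z by (simp add: ReZ0)
   also have "exp (6 * (ln r - R)) = r ^ 6 * exp (- 6 * R)"
    using r(1) by (simp add: right_diff_distrib exp_diff exp_minus divide_inverse exp_of_nat_mult[of 6, simplified])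
   finally have fin: "exp (2 * Re Z) * exp (u (exp Z)) <= exp C * (r ^ 6 * exp (- 6 * R))" by simp
   have e2: "exp (2 * Re Z) = exp (Re Z) * exp (Re Z)" by (simp flip: exp_add)
   from mult_left_mono[OF fin[unfolded e2], of "2 * pi"]
   show "cmod (f2 Z) <= M' * exp (- 6 * R)" by (simp add: f2_def norm_mult M'_def mult_ac)
  next
   have "R <= exp R" using exp_ge_add_one_self[of R] by linarith
   then have "R\<^sup>2 <= (exp R)\<^sup>2" using R by (intro power_mono) auto
   also have "\<dots> <= exp (6 * R)" using R by (simp add: power2_eq_square flip: exp_add)
   finally have "exp (- 6 * R) * R\<^sup>2 <= exp (- 6 * R) * exp (6 * R)" by (rule mult_left_mono) simp
   then have "exp (- 6 * R) * R\<^sup>2 <= 1" by (simp flip: exp_add)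
   then show "M' * exp (- 6 * R) * R\<^sup>2 <= M'"
    using mult_left_mono[of "exp (- 6 * R) * R\<^sup>2" 1 M'] r(1) by (simp add: M'_def mult.assoc)
  qed
  then have "cmod (z0\<^sup>2 * Q z0 + 4) * (\<kappa> * R\<^sup>2) <= K * \<kappa> * (2 + 3 * R)"
   using z0 \<kappa> by (simp add: Z0_def \<kappa>_def K_def mult.assoc)
  then have "cmod (z0\<^sup>2 * Q z0 + 4) <= K * \<kappa> * (2 + 3 * R) / (\<kappa> * R\<^sup>2)"
   using \<kappa> R by (simp add: pos_le_divide_eq)
  also have "\<dots> = K * (2 * (1 / R)\<^sup>2 + 3 * (1 / R))" using \<kappa> R by (simp add: field_simps power2_eq_square)
  finally show ?thesis by (simp add: R_def)
 qed
 have Qlim: "((%z. z\<^sup>2 * Q z + 4) \<longlongrightarrow> 0) (at 0)"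
 proof (rule Lim_null_comparison)
  show "\<forall>\<^sub>F z in at 0. cmod (z\<^sup>2 * Q z + 4) <= K * (2 * (1 / rr z)\<^sup>2 + 3 * (1 / rr z))"
   unfolding eventually_at by (intro exI[of _ r] conjI ballI impI r(1) est) (auto simp: dist_norm)
  have "filterlim (%z::complex. cmod z) (at_right 0) (at 0)"
   unfolding filterlim_at by (auto intro!: tendsto_norm_zero tendsto_ident_at simp: eventually_at_filter)
  from filterlim_compose[OF ln_at_0 this] have "filterlim (%z. - ln (cmod z)) at_top (at (0::complex))"
   by (simp add: filterlim_uminus_at_top)
  from filterlim_tendsto_add_at_top[OF tendsto_const[of "ln r"] this]
  have "filterlim (%z. ln r - ln (cmod z)) at_top (at (0::complex))" by simp
  from filterlim_tendsto_pos_mult_at_top[OF tendsto_const[of "1 / 3"] _ this]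
  have "filterlim rr at_top (at (0::complex))" by (simp add: rr_def[abs_def])
  then have "((%z. 1 / rr z) \<longlongrightarrow> 0) (at 0)" using tendsto_divide_0[OF tendsto_const filterlim_at_top_imp_at_infinity] by blast
  then have "((%z. K * (2 * (1 / rr z)\<^sup>2 + 3 * (1 / rr z))) \<longlongrightarrow> K * (2 * 0\<^sup>2 + 3 * 0)) (at 0)" by (intro tendsto_intros)
  then show "((%z. K * (2 * (1 / rr z)\<^sup>2 + 3 * (1 / rr z))) \<longlongrightarrow> 0) (at 0)" by simp
 qed
 define H where "H z = Q z + 4 * wp z" for z
 have Hh: "H holomorphic_on - \<Lambda>" unfolding H_def[abs_def] by (intro holomorphic_intros Qh wp_holo)
 \<comment> \<open>The double poles cancel, but z^2 H -> 0 still permits a simple pole;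
   \<open>s\<close> below is its residue.\<close>
 have Hlim: "((%z. (z - 0) * (z * H z)) \<longlongrightarrow> 0) (at 0)"
 proof -
  have "((%z. (z\<^sup>2 * Q z + 4) + 4 * ((z - 0)\<^sup>2 * wp z) - 4) \<longlongrightarrow> 0 + 4 * 1 - 4) (at 0)"
   by (intro tendsto_intros Qlim wp_lim) auto
  then show ?thesis by (simp add: H_def algebra_simps power2_eq_square)
 qed
 have "(%z. z * H z) holomorphic_on ball 0 r - {0}"
  by (intro holomorphic_intros holomorphic_on_subset[OF Hh]) (use nl in auto)
 with Hlim r(1) obtain g where g: "g holomorphic_on ball 0 r" "!!z. z \<in> ball 0 r - {0} ==> g z = z * H z"
  using holomorphic_on_extend_lim[of "%z. z * H z" "ball 0 r" 0] by auto
 have "(g \<longlongrightarrow> g 0) (at 0)"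
  using holomorphic_on_imp_continuous_on[OF g(1)] r(1) continuous_on_interior[of "ball 0 r" g 0] by (simp add: isCont_def)
 moreover have "\<forall>\<^sub>F z in at 0. g z = z * H z" using r(1) g(2) by (auto simp: eventually_at intro!: exI[of _ r])
 ultimately have zH: "((%z. z * H z) \<longlongrightarrow> g 0) (at 0)" by (rule Lim_transform_eventually)
 define s where "s = g 0"
 have uper: "periodic (%z. complex_of_real (u z))" using u_props(1) by (simp add: doubly_periodic_def)
 have uaper: "ua (z + w) = ua z" if "z \<notin> \<Lambda>" "w \<in> \<Lambda>" for z w
  by (rule wirt_periodic(1)[OF uper, of "- \<Lambda>" ua]) (use W0 that lattice_add_iff in auto)
 have u\<alpha>per: "u\<alpha> (z + w) = u\<alpha> z" if "z \<notin> \<Lambda>" "w \<in> \<Lambda>" for z w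
 proof -
  have zw: "z + w \<notin> \<Lambda>" using that lattice_add_iff by simp
  have "has_wirt (%z. ua (z + w)) (u\<alpha> (z + w) * 1) (of_real (- (2 * pi) * exp (u (z + w))) * cnj 1) z"
   by (rule wirt_holo_comp[where g = "%z. z + w", OF _ W1[OF zw]]) (auto intro!: derivative_eq_intros)
  then have "has_wirt ua (u\<alpha> (z + w) * 1) (of_real (- (2 * pi) * exp (u (z + w))) * cnj 1) z"
   by (rule wirt_transform[OF _ open_compl_lattice]) (use that uaper in auto)
  from wirt_unique(1)[OF this W1[OF that(1)]] show ?thesis by simp
 qed
 \<comment> \<open>Subtracting s zeta removes the pole and turns periodicity into quasi-periodicity
   with additive constants -s eta w.\<close>
 have "\<exists>c d. \<forall>z. z \<notin> \<Lambda> --> H z - s * zeta z = c * z + d"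
 proof (rule quasi_periodic_linear)
  show "(%z. H z - s * zeta z) holomorphic_on - \<Lambda>" by (intro holomorphic_intros Hh zeta_holo)
  show "H (z + w) - s * zeta (z + w) = H z - s * zeta z + - (s * eta w)" if "z \<notin> \<Lambda>" "w \<in> \<Lambda>" for z w
   unfolding H_def Q_def u\<alpha>per[OF that] uaper[OF that] zeta_shift[OF that(2,1)] periodic_lattice[OF wp_periodic that(2)]
   by (simp add: algebra_simps)
  have "((%z. z * H z - s * ((z - 0) * zeta z)) \<longlongrightarrow> g 0 - s * 1) (at 0)" by (intro tendsto_intros zH zeta_lim) auto
  then show "((%z. z * (H z - s * zeta z)) \<longlongrightarrow> 0) (at 0)" by (simp add: s_def algebra_simps)
 qed
 then obtain c d where cd: "!!z. z \<notin> \<Lambda> ==> H z - s * zeta z = c * z + d" by blast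
 have lin: "- (s * eta w) = c * w" if w: "w \<in> \<Lambda>" for w
 proof -
  have zw: "\<omega>\<^sub>1 / 2 + w \<notin> \<Lambda>" using half_not_lattice lattice_add_iff[OF w] by simp
  have "H (\<omega>\<^sub>1 / 2 + w) = H (\<omega>\<^sub>1 / 2)"
   unfolding H_def Q_def u\<alpha>per[OF half_not_lattice w] uaper[OF half_not_lattice w] periodic_lattice[OF wp_periodic w] ..
  with cd[OF zw] cd[OF half_not_lattice] have "c * w + s * eta w = 0"
   unfolding zeta_shift[OF w half_not_lattice] by (simp add: algebra_simps)
  then show ?thesis by (simp add: neg_eq_iff_add_eq_0 add.commute)
 qed
 \<comment> \<open>A nonzero residue would make the quasi-periods complex linear on the
   lattice.\<close>
 have s0: "s = 0"
 proof (rule ccontr)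
  assume "s ~= 0"
  have "eta w = (- c / s) * w" if "w \<in> \<Lambda>" for w
  proof -
   have "s * eta w = - (c * w)" using lin[OF that] by (simp only: minus_equation_iff)
   then show ?thesis using \<open>s ~= 0\<close> by (simp add: field_simps)
  qed
  then show False using eta_not_linear by blast
 qed
 have "c = 0" using s0 lin[OF lattice_basis(1)] omega_nz by simp
 have Hd: "u\<alpha> z - (ua z)\<^sup>2 / 2 = - 4 * wp z - 2 * (- d / 2)" if "z \<notin> \<Lambda>" for z
 proof -
  have "u\<alpha> z - (ua z)\<^sup>2 / 2 + 4 * wp z = d" using cd[OF that] s0 \<open>c = 0\<close> unfolding H_def Q_def by simp
  then have "u\<alpha> z - (ua z)\<^sup>2 / 2 = d - 4 * wp z" by (simp only: eq_diff_eq)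
  then show ?thesis by simp
 qed
 show thesis by (rule that[of ua u\<alpha> "- d / 2"]) (rule W0, assumption, rule W1, assumption, rule Hd, assumption)
qed

end

context torus_lattice
begin

section \<open>The Lame equation\<close>

text \<open>Let \<open>f\<close> be the left side minus wp (z + a) and wp z. It is elliptic, its
  limit at 0 is wp a by the expansions there, and it is symmetric under z -> -a - z, which settles
  -a as well. Half periods a are included, as the exclusion of half periods requires.\<close>

lemma zeta_addition:
 assumes a: "a \<notin> \<Lambda>" and z: "z \<notin> \<Lambda>" "z + a \<notin> \<Lambda>"
 shows "(zeta (z + a) - zeta z - zeta a)\<^sup>2 = wp (z + a) + wp z + wp a"
proof -
 define f where "f z = (zeta (z + a) - zeta z - zeta a)\<^sup>2 - wp (z + a) - wp z" for z
 have orb: "z \<notin> orbit {0, - a} \<longleftrightarrow> z \<notin> \<Lambda> \<and> z + a \<notin> \<Lambda>" for z by (auto simp: orbit_def)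
 have a': "- a \<notin> \<Lambda>" using a lattice_minus_iff by simp
 have lim0: "(f \<longlongrightarrow> wp a) (at 0)"
 proof -
  obtain r h h' where r: "r > 0" and h: "!!z. z \<in> ball 0 r ==> (h has_field_derivative - h' z) (at z)"
   and hz: "!!z. z \<in> ball 0 r - {0} ==> zeta z = 1 / (z - 0) + h z"
   and hw: "!!z. z \<in> ball 0 r - {0} ==> wp z = 1 / (z - 0)\<^sup>2 + h' z"
   by (rule zeta_wp_principal[OF lattice_0]) (rule that)
  have hh: "h holomorphic_on ball 0 r" using h unfolding holomorphic_on_open[OF open_ball] by blast
  have h'h: "(%z. - h' z) holomorphic_on ball 0 r"
   by (rule holomorphic_transform[OF holomorphic_deriv[OF hh open_ball]]) (use h DERIV_imp_deriv in blast)
  have cont0: "(k \<longlongrightarrow> k 0) (at 0)" if "k holomorphic_on ball 0 r" for k :: "complex => complex"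
   using holomorphic_on_imp_continuous_on[OF that] r continuous_on_interior[of "ball 0 r" k 0] by (simp add: isCont_def)
  have hl: "(h \<longlongrightarrow> h 0) (at 0)" by (rule cont0[OF hh])
  have "((%z. - (- h' z)) \<longlongrightarrow> - (- h' 0)) (at 0)" by (intro tendsto_minus cont0[OF h'h])
  then have h'l: "(h' \<longlongrightarrow> h' 0) (at 0)" by simp
  have h0: "h 0 = 0"
  proof -
   have "((%z. h (- z)) \<longlongrightarrow> h 0) (at 0)"
    by (rule filterlim_compose[OF hl]) (auto simp: filterlim_at eventually_at_filter intro!: tendsto_eq_intros)
   moreover have "\<forall>\<^sub>F z in at 0. h (- z) = - h z"
    unfolding eventually_at
   proof (intro exI[of _ r] conjI ballI impI r)
    fix z :: complex assume "z ~= 0 \<and> dist z 0 < r"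
    then have "z \<in> ball 0 r - {0}" "- z \<in> ball 0 r - {0}" by auto
    from hz[OF this(1)] hz[OF this(2)] show "h (- z) = - h z" by (simp add: zeta_odd algebra_simps)
   qed
   ultimately have "((%z. - h z) \<longlongrightarrow> h 0) (at 0)" by (rule Lim_transform_eventually)
   from LIM_unique[OF this tendsto_minus[OF hl]] show ?thesis by simp
  qed
  have h'0: "h' 0 = 0"
  proof -
   obtain r2 g where g: "r2 > 0" "g holomorphic_on ball 0 r2" "g 0 = 0"
    "!!z. z \<in> ball 0 r2 - {0} ==> wp z = 1 / z\<^sup>2 + g z" by (rule wp_at_0) (rule that)
   have "(g \<longlongrightarrow> g 0) (at 0)"
    using holomorphic_on_imp_continuous_on[OF g(2)] g(1) continuous_on_interior[of "ball 0 r2" g 0] by (simp add: isCont_def)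
   moreover have "\<forall>\<^sub>F z in at 0. g z = h' z"
    unfolding eventually_at
   proof (intro exI[of _ "min r r2"] conjI ballI impI)
    fix z :: complex assume "z ~= 0 \<and> dist z 0 < min r r2"
    then have "z \<in> ball 0 r - {0}" "z \<in> ball 0 r2 - {0}" by auto
    from hw[OF this(1)] g(4)[OF this(2)] show "g z = h' z" by simp
   qed (use r g(1) in simp)
   ultimately have "(h' \<longlongrightarrow> g 0) (at 0)" by (rule Lim_transform_eventually)
   from LIM_unique[OF this h'l] g(3) show ?thesis by simp
  qed
  \<comment> \<open>zeta (z + a) - zeta z - zeta a = e - 1/z with e/z -> - wp a. The cross term of
    the square tends to 2 wp a; the pole 1/z^2 cancels against wp z.\<close>
  define e where "e z = (zeta (z + a) - zeta (0 + a)) - (h z - h 0)" for z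
  have za: "((%z. zeta (z + a)) has_field_derivative - wp a) (at 0)"
   using zeta_deriv[OF a] DERIV_shift[of zeta "- wp a" 0 a] by simp
  have "(%z. zeta (z + a)) \<midarrow>0\<rightarrow> zeta (0 + a)" using DERIV_isCont[OF za] by (simp add: isCont_def)
  then have "(e \<longlongrightarrow> (zeta (0 + a) - zeta (0 + a)) - (h 0 - h 0)) (at 0)"
   unfolding e_def[abs_def] by (intro tendsto_intros hl)
  then have e0: "(e \<longlongrightarrow> 0) (at 0)" by simp
  have "h 0 = h 0 \<and> ((%z. (h z - h 0) / (z - 0)) \<longlongrightarrow> - h' 0) (at 0)" using DERIV_quotient_lim[OF h, of 0] r by simp
  then have "((%z. (zeta (z + a) - zeta (0 + a)) / (z - 0) - (h z - h 0) / (z - 0)) \<longlongrightarrow> - wp a - - h' 0) (at 0)"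
   by (intro tendsto_diff DERIV_quotient_lim[OF za]) blast
  then have e1: "((%z. e z / z) \<longlongrightarrow> - wp a) (at 0)" by (simp add: e_def diff_divide_distrib h'0)
  have wl: "((%z. wp (z + a)) \<longlongrightarrow> wp (0 + a)) (at 0)"
  proof -
   have "isCont (%z. wp (z + a)) 0" by (rule isCont_o2[where g = wp]) (use wp_isCont[OF a] in \<open>auto intro!: continuous_intros\<close>)
   then show ?thesis by (simp add: isCont_def)
  qed
  have "((%z. (e z)\<^sup>2 - 2 * (e z / z) - h' z - wp (z + a)) \<longlongrightarrow> 0\<^sup>2 - 2 * (- wp a) - h' 0 - wp (0 + a)) (at 0)"
   by (intro tendsto_intros e0 e1 h'l wl)
  then have "((%z. (e z)\<^sup>2 - 2 * (e z / z) - h' z - wp (z + a)) \<longlongrightarrow> wp a) (at 0)" by (simp add: h'0)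
  then show ?thesis
  proof (rule Lim_transform_eventually)
   show "\<forall>\<^sub>F z in at 0. (e z)\<^sup>2 - 2 * (e z / z) - h' z - wp (z + a) = f z"
    unfolding eventually_at
   proof (intro exI[of _ r] conjI ballI impI r)
    fix z :: complex assume "z ~= 0 \<and> dist z 0 < r"
    then have z: "z \<in> ball 0 r - {0}" by auto
    have ze: "zeta (z + a) - zeta z - zeta a = e z - 1 / z" using hz[OF z] by (simp add: e_def h0)
    show "(e z)\<^sup>2 - 2 * (e z / z) - h' z - wp (z + a) = f z"
     unfolding f_def ze hw[OF z] using z by (simp add: power2_eq_square field_simps)
   qed
  qed
 qed
 \<comment> \<open>Exchanges the two singular points, so the limit at -a is the limit at 0.\<close>
 have sym: "f (- a - w) = f w" for w
 proof -
  have "zeta (- a - w) = - zeta (w + a)" "wp (- a - w) = wp (w + a)"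
   using zeta_odd[of "w + a"] wp_even[of "w + a"] by (simp_all add: algebra_simps)
  then show ?thesis by (simp add: f_def zeta_odd wp_even power2_eq_square algebra_simps)
 qed
 have lima: "(f \<longlongrightarrow> wp a) (at (- a))"
 proof -
  have "filterlim (%w. - a - w) (at 0) (at (- a))"
   unfolding filterlim_at by (auto simp: eventually_at_filter intro!: tendsto_eq_intros)
  from filterlim_compose[OF lim0 this] show ?thesis by (simp add: sym)
 qed
 have "\<exists>k. \<forall>z. z \<notin> orbit {0, - a} --> f z = k"
 proof (rule elliptic_const)
  have o: "(%z. k (z + a)) holomorphic_on - orbit {0, - a}" if "k holomorphic_on - \<Lambda>" for k
   by (rule holomorphic_on_compose_gen[OF _ that, unfolded o_def]) (auto simp: orb intro!: holomorphic_intros)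
  show "f holomorphic_on - orbit {0, - a}" unfolding f_def[abs_def]
   by (intro holomorphic_intros o zeta_holo wp_holo holomorphic_on_subset[OF zeta_holo] holomorphic_on_subset[OF wp_holo]) (auto simp: orbit_def)
  fix z w assume z: "z \<notin> orbit {0, - a}" and w: "w \<in> \<Lambda>"
  have "zeta (z + w + a) = zeta (z + a) + eta w" "zeta (z + w) = zeta z + eta w" "wp (z + w + a) = wp (z + a)" "wp (z + w) = wp z"
   using zeta_shift[OF w, of "z + a"] zeta_shift[OF w, of z] periodic_lattice[OF wp_periodic w] z
   by (simp_all add: orb add_ac) (metis add.assoc add.commute)+
  then show "f (z + w) = f z" by (simp add: f_def)
 next
  fix c assume "c \<in> {0, - a}"
  then have "(f \<longlongrightarrow> wp a) (at c)" using lim0 lima by auto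
  then have "((%z. (z - c) * f z) \<longlongrightarrow> (c - c) * wp a) (at c)" by (intro tendsto_intros)
  then show "((%z. (z - c) * f z) \<longlongrightarrow> 0) (at c)" by simp
 qed simp
 then obtain k where k: "!!z. z \<notin> orbit {0, - a} ==> f z = k" by blast
 have "\<forall>\<^sub>F z in at 0. z \<notin> orbit {0, - a}" by (rule eventually_not_orbit) simp
 then have "\<forall>\<^sub>F z in at 0. k = f z" by (rule eventually_mono) (simp add: k)
 from Lim_transform_eventually[OF tendsto_const this] have "k = wp a" using LIM_unique lim0 by blast
 then show ?thesis using k[of z] z by (simp add: orb f_def algebra_simps)
qed

end

section \<open>From a solution to an extra critical point\<close>

context mean_field
begin

text \<open>For the Lame equation \<open>y'' = (2 \<wp> + \<wp>(a)) y\<close>, satisfied by \<open>exp (- u / 2)\<close>, the solution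
 \<open>Y (- a) / \<sigma>\<close> is quasi-periodic. The coefficients of \<open>exp (- u / 2)\<close> with respect to products of solutions and
 conjugate solutions are given by a sesquilinear Wronskian \<open>\<Phi>\<close>, whose periodicity fixes the multipliers.\<close>

lemma critical_point_exists: "\<exists>a. 2 * a \<notin> \<Lambda> \<and> Gz a = 0"
proof -
 obtain ua u\<alpha> B where W0: "!!z. z \<notin> \<Lambda> ==> has_wirt (%z. of_real (u z)) (ua z) (cnj (ua z)) z"
  and W1: "!!z. z \<notin> \<Lambda> ==> has_wirt ua (u\<alpha> z) (of_real (- (2 * pi) * exp (u z))) z"
  and QB: "!!z. z \<notin> \<Lambda> ==> u\<alpha> z - (ua z)\<^sup>2 / 2 = - 4 * wp z - 2 * B"
  by (rule schwarzian) (rule that)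
 \<comment> \<open>Writing the constant as wp a puts the equation into the form whose quasi-periodic
   solutions are explicit; so far nothing makes \<open>a\<close> critical.\<close>
 obtain a where a: "a \<notin> \<Lambda>" "wp a = B" by (rule wp_surj) (rule that)
 have a': "- a \<notin> \<Lambda>" using a lattice_minus_iff by simp
 define q where "q z = 2 * wp z + wp a" for z
 have u\<alpha>: "u\<alpha> z = (ua z)\<^sup>2 / 2 - 2 * q z" if "z \<notin> \<Lambda>" for z using QB[OF that] a(2) by (simp add: q_def algebra_simps)
 define E where "E z = complex_of_real (exp (- u z / 2))" for z
 define E1 where "E1 z = - (1 / 2) * (ua z * E z)" for z
 \<comment> \<open>\<open>L\<close> is E_{z zbar}; the mean field equation reads E E_{z zbar} = pi +
   |E_z|^2.\<close>
 define L where "L z = (of_real pi + E1 z * cnj (E1 z)) / E z" for z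
 have Enz: "E z ~= 0" for z by (simp add: E_def)
 have cE: "cnj (E z) = E z" for z by (simp add: E_def)
 have EE: "of_real (exp (u z)) * (E z * E z) = 1" for z by (simp add: E_def flip: of_real_mult exp_add)
 have cL: "cnj (L z) = L z" for z by (simp add: L_def cE mult.commute)
 have WE: "has_wirt E (E1 z) (cnj (E1 z)) z" if z: "z \<notin> \<Lambda>" for z
 proof -
  have "((%x. exp (- x / 2)) has_real_derivative - (1 / 2) * exp (- u z / 2)) (at (u z))" by (auto intro!: derivative_eq_intros)
  from wirt_of_real_comp[OF W0[OF z] this] show ?thesis unfolding E_def[abs_def]
   by (rule wirt_eq_rhs) (simp_all add: E1_def E_def)
 qed
 have WE1: "has_wirt E1 (q z * E z) (L z) z" if z: "z \<notin> \<Lambda>" for z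
 proof -
  have 1: "(of_real pi + E1 z * cnj (E1 z)) / E z = of_real pi * of_real (exp (u z)) * E z + 1 / 4 * (ua z * cnj (ua z)) * E z"
  proof -
   have "of_real pi = of_real pi * (of_real (exp (u z)) * (E z * E z))" by (simp add: EE)
   also have "\<dots> + E1 z * cnj (E1 z) = (of_real pi * of_real (exp (u z)) * E z + 1 / 4 * (ua z * cnj (ua z)) * E z) * E z"
    by (simp add: E1_def cE algebra_simps)
   finally show ?thesis using Enz by (simp add: field_simps)
  qed
  show ?thesis unfolding E1_def[abs_def]
   by (rule wirt_eq_rhs[OF wirt_cmult[OF wirt_mult[OF W1[OF z] WE[OF z]]]])
    (simp_all only: u\<alpha>[OF z] L_def 1, simp_all add: E1_def cE algebra_simps power2_eq_square)
 qed
 have WcE1: "has_wirt (%z. cnj (E1 z)) (L z) (cnj (q z) * E z) z" if z: "z \<notin> \<Lambda>" for z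
  using wirt_cnj[OF WE1[OF z]] by (simp add: cL cE)
 have WL: "has_wirt L (q z * cnj (E1 z)) (cnj (q z) * E1 z) z" if z: "z \<notin> \<Lambda>" for z
 proof -
  have l: "L z * E z = of_real pi + E1 z * cnj (E1 z)" using Enz by (simp add: L_def)
  have Lf: "L = (%z. (of_real pi + E1 z * cnj (E1 z)) / E z)" by (rule ext) (simp add: L_def)
  show ?thesis
   by (subst Lf, rule wirt_eq_rhs[OF wirt_divide[OF wirt_add[OF wirt_const wirt_mult[OF WE1[OF z] WcE1[OF z]]] WE[OF z] Enz]])
    (simp_all only: l[symmetric], use Enz[of z] in \<open>simp_all add: field_simps power2_eq_square\<close>)
 qed
 define U where "U = - orbit {0, - a}"
 have U_iff: "z \<in> U \<longleftrightarrow> z \<notin> \<Lambda> \<and> z + a \<notin> \<Lambda>" for z by (auto simp: U_def orbit_def)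
 have U: "open U" "connected U" using orbit_props(1,2)[of "{0, - a}"] by (auto simp: U_def intro: connected_compl_countable)
 have Uw: "z + w \<in> U" if "z \<in> U" "w \<in> \<Lambda>" for z w using that orbit_add[of w z "{0, - a}"] by (simp add: U_def)
 have "\<forall>\<^sub>F z in at 0. z \<notin> orbit {0, - a}" by (rule eventually_not_orbit) simp
 then obtain z0 where z0: "z0 \<in> U" using eventually_happens'[of "at (0::complex)"] by (auto simp: U_def)
 define \<Phi> where "\<Phi> f f1 g g1 z = L z * (f z * cnj (g z)) - E1 z * (f z * cnj (g1 z)) - cnj (E1 z) * (f1 z * cnj (g z)) + E z * (f1 z * cnj (g1 z))"
  for f f1 g g1 and z :: complex
 have \<Phi>_const: "\<Phi> f f1 g g1 x = \<Phi> f f1 g g1 y"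
  if f: "!!z. z \<in> U ==> (f has_field_derivative f1 z) (at z)" "!!z. z \<in> U ==> (f1 has_field_derivative q z * f z) (at z)"
   and g: "!!z. z \<in> U ==> (g has_field_derivative g1 z) (at z)" "!!z. z \<in> U ==> (g1 has_field_derivative q z * g z) (at z)"
   and xy: "x \<in> U" "y \<in> U" for f f1 g g1 x y
 proof (rule wirt_zero_const[OF U _ xy])
  fix z assume z: "z \<in> U"
  then have zL: "z \<notin> \<Lambda>" by (simp add: U_iff)
  note w = wirt_holo[OF f(1)[OF z]] wirt_holo[OF f(2)[OF z]] wirt_cnj[OF wirt_holo[OF g(1)[OF z]]] wirt_cnj[OF wirt_holo[OF g(2)[OF z]]]
  show "has_wirt (\<Phi> f f1 g g1) 0 0 z" unfolding \<Phi>_def[abs_def]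
   by (rule wirt_eq_rhs[OF wirt_add[OF wirt_diff[OF wirt_diff[OF wirt_mult[OF WL[OF zL] wirt_mult[OF w(1,3)]]
      wirt_mult[OF WE1[OF zL] wirt_mult[OF w(1,4)]]] wirt_mult[OF WcE1[OF zL] wirt_mult[OF w(2,3)]]] wirt_mult[OF WE[OF zL] wirt_mult[OF w(2,4)]]]])
    (simp_all add: algebra_simps)
 qed
 have Eper: "E (z + w) = E z" if "w \<in> \<Lambda>" for z w using periodic_lattice[OF u_props(1) that] by (simp add: E_def)
 have E1per: "E1 (z + w) = E1 z" if "z \<in> U" "w \<in> \<Lambda>" for z w
  by (rule wirt_periodic(1)[of E "- \<Lambda>" E1 "%z. cnj (E1 z)"])
   (use that WE lattice_add_iff U_iff in \<open>auto intro: periodicI simp: Eper\<close>)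
 have Lper: "L (z + w) = L z" if "z \<in> U" "w \<in> \<Lambda>" for z w using Eper E1per that by (simp add: L_def)
 define g where "g z = zeta (z + a) - zeta z - zeta a" for z
 have zad: "((%z. zeta (z + a)) has_field_derivative - wp (z + a)) (at z)" "((%z. wp (z + a)) has_field_derivative wp1 (z + a)) (at z)" if "z \<in> U" for z
  using that zeta_deriv[of "z + a"] wp_deriv[of "z + a"] DERIV_shift by (auto simp: U_iff)
 have g': "(g has_field_derivative wp z - wp (z + a)) (at z)" if "z \<in> U" for z
  unfolding g_def[abs_def] using that zad[OF that] zeta_deriv[of z] by (auto intro!: derivative_eq_intros simp: U_iff)
 have g2: "(g z)\<^sup>2 = wp (z + a) + wp z + wp a" if "z \<in> U" for z
  unfolding g_def using that a by (intro zeta_addition) (auto simp: U_iff)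
 define y where "y z = Y (- a) z / sigma z" for z
 define y1 where "y1 z = g z * y z" for z
 have ynz: "y z ~= 0" if "z \<in> U" for z using that a' by (auto simp: U_iff y_def Y_zero sigma_zero)
 have yd: "(y has_field_derivative y1 z) (at z)" if z: "z \<in> U" for z
 proof -
  have s: "sigma z ~= 0" using z by (simp add: U_iff sigma_zero)
  have l: "deriv (Y (- a)) z = (zeta (z + a) - zeta a) * Y (- a) z" "deriv sigma z = zeta z * sigma z"
   using Y_log_deriv[of z "- a"] sigma_zeta[of z] z by (auto simp: U_iff zeta_odd algebra_simps)
  have "(y has_field_derivative (deriv (Y (- a)) z * sigma z - Y (- a) z * deriv sigma z) / (sigma z * sigma z)) (at z)"
   unfolding y_def[abs_def] by (rule DERIV_divide[OF Y_deriv sigma_deriv s])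
  moreover have "(deriv (Y (- a)) z * sigma z - Y (- a) z * deriv sigma z) / (sigma z * sigma z) = y1 z"
   unfolding l y1_def y_def g_def using s by (simp add: field_simps)
  ultimately show ?thesis by simp
 qed
 have y1d: "(y1 has_field_derivative q z * y z) (at z)" if z: "z \<in> U" for z
 proof -
  have "(y1 has_field_derivative (wp z - wp (z + a)) * y z + y1 z * g z) (at z)"
   unfolding y1_def[abs_def] by (rule DERIV_mult[OF g'[OF z] yd[OF z, unfolded y1_def]])
  moreover have "y1 z * g z = (g z)\<^sup>2 * y z" by (simp add: y1_def power2_eq_square)
  ultimately show ?thesis unfolding g2[OF z] q_def by (simp add: algebra_simps)
 qed
 \<comment> \<open>Multiplication by E and completing the square give pi |y|^2 + |E_z y - E y'|^2,
   which is positive.\<close>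
 have \<Phi>nz: "\<Phi> y y1 y y1 z ~= 0" if z: "z \<in> U" for z
 proof
  assume 0: "\<Phi> y y1 y y1 z = 0"
  have "E z * \<Phi> y y1 y y1 z = (L z * E z) * (y z * cnj (y z)) - E z * (E1 z * (y z * cnj (y1 z))) - E z * (cnj (E1 z) * (y1 z * cnj (y z))) + E z * E z * (y1 z * cnj (y1 z))"
   by (simp add: \<Phi>_def algebra_simps)
  also have "L z * E z = of_real pi + E1 z * cnj (E1 z)" using Enz by (simp add: L_def)
  also have "(of_real pi + E1 z * cnj (E1 z)) * (y z * cnj (y z)) - E z * (E1 z * (y z * cnj (y1 z))) - E z * (cnj (E1 z) * (y1 z * cnj (y z))) + E z * E z * (y1 z * cnj (y1 z))
   = of_real pi * (y z * cnj (y z)) + (E1 z * y z - E z * y1 z) * cnj (E1 z * y z - E z * y1 z)"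
   by (simp add: cE algebra_simps)
  also have "\<dots> = of_real (pi * (cmod (y z))\<^sup>2 + (cmod (E1 z * y z - E z * y1 z))\<^sup>2)"
   by (simp only: complex_norm_square of_real_add of_real_mult)
  finally have "pi * (cmod (y z))\<^sup>2 + (cmod (E1 z * y z - E z * y1 z))\<^sup>2 = 0" unfolding 0 mult_zero_right
   by (metis of_real_eq_0_iff)
  moreover have "0 < pi * (cmod (y z))\<^sup>2" using ynz[OF z] by simp
  ultimately show False using zero_le_power2[of "cmod (E1 z * y z - E z * y1 z)"] by linarith
 qed
 define m where "m w = exp (- (zeta a * w - eta w * a))" for w
 have yq: "y (z + w) = m w * y z" "y1 (z + w) = m w * y1 z" if z: "z \<in> U" and w: "w \<in> \<Lambda>" for z w
 proof -
  obtain C where C: "C ~= 0" "!!a z. Y a (z + w) = exp (zeta a * w - eta w * a) * C * exp (eta w * z) * Y a z"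
   "!!z. sigma (z + w) = C * exp (eta w * z) * sigma z"
   by (rule Y_quasi[OF w]) (rule that)
  have e: "zeta (- a) * w - eta w * - a = - (zeta a * w - eta w * a)" by (simp add: zeta_odd)
  show 1: "y (z + w) = m w * y z" unfolding y_def C(2,3) e m_def using C(1) by simp
  have "zeta (z + w + a) = zeta (z + a) + eta w" using zeta_shift[OF w, of "z + a"] z by (simp add: U_iff add_ac)
  then have "g (z + w) = g z" using zeta_shift[OF w, of z] z by (simp add: U_iff g_def)
  then show "y1 (z + w) = m w * y1 z" by (simp add: y1_def 1)
 qed
 \<comment> \<open>\<open>\<Phi>\<close> is constant, yet translation by w multiplies it by |m
   w|^2.\<close>
 have mm: "m w * cnj (m w) = 1" if w: "w \<in> \<Lambda>" for w
 proof -
  have "\<Phi> y y1 y y1 (z0 + w) = (m w * cnj (m w)) * \<Phi> y y1 y y1 z0"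
   unfolding \<Phi>_def yq[OF z0 w] Eper[OF w] E1per[OF z0 w] Lper[OF z0 w] by (simp add: algebra_simps)
  moreover have "\<Phi> y y1 y y1 (z0 + w) = \<Phi> y y1 y y1 z0" by (rule \<Phi>_const[OF yd y1d yd y1d Uw[OF z0 w] z0])
  ultimately show ?thesis using \<Phi>nz[OF z0] by simp
 qed
 \<comment> \<open>The logarithm of the modulus of the multiplier is 4 pi Re (Gz a * w); as it
   vanishes on a real basis, Gz a = 0.\<close>
 have "Re (Gz a * w) = 0" if w: "w \<in> \<Lambda>" for w
 proof -
  have "(cmod (m w))\<^sup>2 = 1" using mm[OF w] by (metis complex_norm_square of_real_1 of_real_eq_iff of_real_power)
  then have "cmod (m w) = 1" by (simp add: power2_eq_1_iff) (use norm_ge_zero[of "m w"] in linarith)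
  then have 1: "Re (zeta a * w - eta w * a) = 0" by (simp add: m_def)
  have za: "zeta a = of_real (pi / A) * cnj a + 4 * of_real pi * gc * a - 4 * of_real pi * Gz a" by (simp add: Gz_def field_simps)
  have "zeta a * w - eta w * a = of_real (pi / A) * (cnj a * w - cnj (cnj a * w)) - of_real (4 * pi) * (Gz a * w)"
   unfolding eta_eq[OF w] za by (simp add: algebra_simps)
  then have "Re (zeta a * w - eta w * a) = - (4 * pi) * Re (Gz a * w)" by simp
  with 1 show ?thesis by simp
 qed
 then have Ga: "Gz a = 0" using complex_zero_from_basis lattice_basis by blast
 have "2 * a \<notin> \<Lambda>"
 proof
  assume 2: "2 * a \<in> \<Lambda>"
  obtain k where k: "!!z. z \<notin> orbit {0, a} ==> (wp z - wp a) * (wp (z + a) - wp a) = k"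
   by (rule wp_half[OF a(1) 2]) (rule that)
  have "z - a \<in> \<Lambda> \<longleftrightarrow> z + a \<in> \<Lambda>" for z using lattice_add_iff[OF 2, of "z - a"] by (simp add: algebra_simps mult_2)
  then have pk: "(wp z - wp a) * (wp (z + a) - wp a) = k" if "z \<in> U" for z
   using that by (intro k) (auto simp: U_iff orbit_def)
  \<comment> \<open>For x = X y, with X as below, D y is the defect in the Lame equation. D = 0 says
    that (wp (z + a) - wp a) y^2 is constant, so X' is a multiple of y^(-2): reduction of order for
    the second solution.\<close>
  define D where "D z = 2 * g z * (wp (z + a) - wp a) + wp1 (z + a)" for z
  have D\<phi>: "(wp z - wp (z + a)) * D z = 0" if z: "z \<in> U" for z
  proof -
   have zd: "(wp has_field_derivative wp1 z) (at z)" using z by (simp add: U_iff wp_deriv)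
   have "((%z. (wp z - wp a) * (wp (z + a) - wp a)) has_field_derivative (wp1 z - 0) * (wp (z + a) - wp a) + (wp1 (z + a) - 0) * (wp z - wp a)) (at z)"
    by (intro DERIV_mult DERIV_diff DERIV_const zd zad z)
   moreover have "((%z. (wp z - wp a) * (wp (z + a) - wp a)) has_field_derivative 0) (at z)"
    by (rule has_field_derivative_transform_within_open[OF DERIV_const U(1) z]) (simp add: pk)
   ultimately have 1: "wp1 z * (wp (z + a) - wp a) + wp1 (z + a) * (wp z - wp a) = 0" using DERIV_unique by fastforce
   have "((%z. g z * g z) has_field_derivative (wp z - wp (z + a)) * g z + (wp z - wp (z + a)) * g z) (at z)"
    by (intro DERIV_mult g' z)
   moreover have "((%z. g z * g z) has_field_derivative wp1 (z + a) + wp1 z + 0) (at z)"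
    by (rule has_field_derivative_transform_within_open[OF DERIV_add[OF DERIV_add[OF zad(2)[OF z] zd] DERIV_const[of "wp a"]] U(1) z])
     (simp add: g2[unfolded power2_eq_square])
   ultimately have 2: "(wp z - wp (z + a)) * g z + (wp z - wp (z + a)) * g z = wp1 (z + a) + wp1 z" using DERIV_unique by fastforce
   have "(wp z - wp (z + a)) * D z = ((wp z - wp (z + a)) * g z + (wp z - wp (z + a)) * g z) * (wp (z + a) - wp a) + (wp z - wp (z + a)) * wp1 (z + a)"
    by (simp add: D_def algebra_simps)
   also have "\<dots> = wp1 z * (wp (z + a) - wp a) + wp1 (z + a) * (wp z - wp a)" unfolding 2 by (simp add: algebra_simps)
   finally show ?thesis using 1 by simp
  qed
  have shift: "(%z. k (z + a)) holomorphic_on U" if "k holomorphic_on - \<Lambda>" for k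
   by (rule holomorphic_on_compose_gen[OF _ that, unfolded o_def]) (auto simp: U_iff intro!: holomorphic_intros)
  have gh: "g holomorphic_on U" using g' unfolding holomorphic_on_open[OF U(1)] by blast
  have Dh: "D holomorphic_on U" unfolding D_def[abs_def] by (intro holomorphic_intros gh shift wp_holo wp1_holo)
  have \<phi>h: "(%z. wp z - wp (z + a)) holomorphic_on U"
   by (intro holomorphic_intros shift wp_holo holomorphic_on_subset[OF wp_holo]) (auto simp: U_iff)
  \<comment> \<open>\<open>D\<close> vanishes where the factor wp z - wp (z + a) does not, a
    nonempty open set; the identity theorem extends this to \<open>U\<close>.\<close>
  define V where "V = {z \<in> U. wp z - wp (z + a) \<in> - {0}}"
  have oV: "open V" unfolding V_def
   by (rule continuous_open_preimage[OF holomorphic_on_imp_continuous_on[OF \<phi>h] U(1), unfolded vimage_def Int_def, simplified]) (rule open_Compl[OF closed_singleton])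
  have "V ~= {}"
  proof -
   have "isCont (%z. wp (z + a)) 0" by (rule isCont_o2[where g = wp]) (use wp_isCont[OF a(1)] in \<open>auto intro!: continuous_intros\<close>)
   then have "((%z. (z - 0)\<^sup>2 * wp z - (z - 0)\<^sup>2 * wp (z + a)) \<longlongrightarrow> 1 - (0 - 0)\<^sup>2 * wp (0 + a)) (at 0)"
    by (intro tendsto_intros wp_lim) (auto simp: isCont_def)
   then have "\<forall>\<^sub>F z in at 0. (z - 0)\<^sup>2 * wp z - (z - 0)\<^sup>2 * wp (z + a) ~= 0" by (rule tendsto_imp_eventually_ne) simp
   moreover have "\<forall>\<^sub>F z in at 0. z \<notin> orbit {0, - a}" by (rule eventually_not_orbit) simp
   ultimately have "\<forall>\<^sub>F z in at 0. z \<in> V" by eventually_elim (auto simp: V_def U_def)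
   then show ?thesis using eventually_happens'[of "at (0::complex)"] by auto
  qed
  then have D0: "D z = 0" if "z \<in> U" for z
   using analytic_continuation_open[OF oV U(1) _ U(2) _ Dh holomorphic_on_const[of 0] _ that] D\<phi> by (auto simp: V_def)
  define X where "X z = zeta (z + a) + wp a * z" for z
  have Xd: "(X has_field_derivative wp a - wp (z + a)) (at z)" if "z \<in> U" for z
   unfolding X_def[abs_def] using zad[OF that] by (auto intro!: derivative_eq_intros)
  define x where "x z = X z * y z" for z
  define x1 where "x1 z = (wp a - wp (z + a)) * y z + y1 z * X z" for z
  have xd: "(x has_field_derivative x1 z) (at z)" if "z \<in> U" for z
   unfolding x_def[abs_def] x1_def by (rule DERIV_mult[OF Xd[OF that] yd[OF that]])
  have x1d: "(x1 has_field_derivative q z * x z) (at z)" if z: "z \<in> U" for z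
  proof -
   have "(x1 has_field_derivative ((0 - wp1 (z + a)) * y z + y1 z * (wp a - wp (z + a))) + (q z * y z * X z + (wp a - wp (z + a)) * y1 z)) (at z)"
    unfolding x1_def[abs_def] by (intro DERIV_add DERIV_mult DERIV_diff DERIV_const zad yd y1d Xd z)
   moreover have "((0 - wp1 (z + a)) * y z + y1 z * (wp a - wp (z + a))) + (q z * y z * X z + (wp a - wp (z + a)) * y1 z) = q z * x z - D z * y z"
    by (simp add: D_def x_def y1_def algebra_simps)
   ultimately show ?thesis by (simp add: D0[OF z])
  qed
  have "eta w = - wp a * w" if w: "w \<in> \<Lambda>" for w
  proof -
   \<comment> \<open>Translation by w adds \<open>\<kappa>\<close> times the first solution to the
     second. Constancy of \<open>\<Phi> x x1 y y1\<close> then makes \<open>\<kappa>\<close> vanish,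
     so eta would be complex linear.\<close>
   define \<kappa> where "\<kappa> = eta w + wp a * w"
   have "zeta (z0 + w + a) = zeta (z0 + a) + eta w" "wp (z0 + w + a) = wp (z0 + a)"
    using zeta_shift[OF w, of "z0 + a"] periodic_lattice[OF wp_periodic w, of "z0 + a"] z0 by (simp_all add: U_iff add_ac)
   then have X: "X (z0 + w) = X z0 + \<kappa>" and pw: "wp (z0 + w + a) = wp (z0 + a)" by (simp_all add: X_def \<kappa>_def algebra_simps)
   have xw: "x (z0 + w) = m w * (x z0 + \<kappa> * y z0)" "x1 (z0 + w) = m w * (x1 z0 + \<kappa> * y1 z0)"
    unfolding x_def x1_def X pw yq[OF z0 w] by (simp_all add: algebra_simps)
   have "\<Phi> x x1 y y1 (z0 + w) = (m w * cnj (m w)) * (\<Phi> x x1 y y1 z0 + \<kappa> * \<Phi> y y1 y y1 z0)"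
    unfolding \<Phi>_def xw yq[OF z0 w] Eper[OF w] E1per[OF z0 w] Lper[OF z0 w] by (simp add: algebra_simps)
   moreover have "\<Phi> x x1 y y1 (z0 + w) = \<Phi> x x1 y y1 z0" by (rule \<Phi>_const[OF xd x1d yd y1d Uw[OF z0 w] z0])
   ultimately have "\<kappa> = 0" using mm[OF w] \<Phi>nz[OF z0] by simp
   then show ?thesis by (simp add: \<kappa>_def eq_neg_iff_add_eq_0)
  qed
  then show False using eta_not_linear[of "- wp a"] by blast
 qed
 with Ga show ?thesis by blast
qed

end

theorem theorem1p1:
 fixes \<omega>\<^sub>1 \<omega>\<^sub>2 :: complex and \<Gamma> :: "complex \<Rightarrow> complex \<Rightarrow> real"
 assumes "\<omega>\<^sub>1 \<noteq> \<omega>\<^sub>2" and "independent {\<omega>\<^sub>1, \<omega>\<^sub>2}"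
  and "green_function \<omega>\<^sub>1 \<omega>\<^sub>2 \<Gamma>"
 shows "((\<exists>u. mean_field_solution \<omega>\<^sub>1 \<omega>\<^sub>2 (8 * pi) u) \<longleftrightarrow>
      (\<exists>z. extra_critical_point \<omega>\<^sub>1 \<omega>\<^sub>2 (\<lambda>z. \<Gamma> z 0) z)) \<and>
    (\<forall>z\<^sub>0. extra_critical_point \<omega>\<^sub>1 \<omega>\<^sub>2 (\<lambda>z. \<Gamma> z 0) z\<^sub>0 \<longrightarrow>
      (\<exists>u. scaling_family \<omega>\<^sub>1 \<omega>\<^sub>2 (8 * pi) (developing_map \<omega>\<^sub>1 \<omega>\<^sub>2 z\<^sub>0) u \<and>
        scaling_family \<omega>\<^sub>1 \<omega>\<^sub>2 (8 * pi) (developing_map \<omega>\<^sub>1 \<omega>\<^sub>2 (- z\<^sub>0)) (\<lambda>l. u (- l))))"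
proof -
 interpret torus_green \<omega>\<^sub>1 \<omega>\<^sub>2 \<Gamma> by unfold_locales (rule assms)+
 have "\<exists>z. extra_critical_point \<omega>\<^sub>1 \<omega>\<^sub>2 (\<lambda>z. \<Gamma> z 0) z" if "mean_field_solution \<omega>\<^sub>1 \<omega>\<^sub>2 (8 * pi) u" for u
 proof -
  interpret mean_field \<omega>\<^sub>1 \<omega>\<^sub>2 \<Gamma> u by unfold_locales (rule that)
  show ?thesis using critical_point_exists by (auto simp: extra_iff)
 qed
 moreover have "\<exists>u. mean_field_solution \<omega>\<^sub>1 \<omega>\<^sub>2 (8 * pi) u" if "extra_critical_point \<omega>\<^sub>1 \<omega>\<^sub>2 (\<lambda>z. \<Gamma> z 0) z" for z
  using scaling_families[OF that] by (auto simp: scaling_family_def)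
 ultimately show ?thesis using scaling_families by blast
qed

end
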